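(* If $(\nu_n\vee p_n)/n\to0$ and (A1), (A2), (A3) of the context hold, then $$\|\hat{\boldsymbol\theta}_n-\boldsymbol\theta_0\|^2=O_{\mathbb P}\Big(\frac{\nu_n\vee p_n}{n}\Big).$$
   Context: Triangular array setting: for each $n$, $\mathbf Z_1,\dots,\mathbf Z_n\in\mathbb R^{m_n}$ are i.i.d. from a probability measure $\mathbb P$ (which may change with $n$), and $\mathcal F=\{f(\cdot,\cdot;\boldsymbol\theta):\boldsymbol\theta\in\Theta\subset\mathbb R^{p_n}\}$ is a class of real-valued, possibly asymmetric and possibly discontinuous functions on $\mathbb R^{m_n}\times\mathbb R^{m_n}$; $m_n,p_n,\nu_n$ may tend to infinity. $\mathcal F$ is a VC-subgraph class of VC-dimension $\nu_n$, uniformly bounded by an absolute constant (a constant not depending on $n$). Let $$\Gamma_n(\boldsymbol\theta)=\frac1{n(n-1)}\sum_{i\ne j}f(\mathbf Z_i,\mathbf Z_j;\boldsymbol\theta),\quad \hat{\boldsymbol\theta}_n=\arg\max_{\boldsymbol\theta\in\Theta}\Gamma_n(\boldsymbol\theta),\quad \Gamma(\boldsymbol\theta)=\mathbb E\Gamma_n(\boldsymbol\theta),\quad \boldsymbol\theta_0=\arg\max_{\boldsymbol\theta\in\Theta}\Gamma(\boldsymbol\theta).$$ It is assumed (without loss of generality) that $f(\mathbf z_1,\mathbf z_2;\boldsymbol\theta_0)=0$ for all $\mathbf z_1,\mathbf z_2$. $\mathbb E f(\mathbf z,\cdot;\boldsymbol\theta)$ and $\mathbb E f(\cdot,\mathbf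 z;\boldsymbol\theta)$ denote expectation over the free argument with law $\mathbb P$. Let $$\tau(\mathbf z;\boldsymbol\theta)=\mathbb E f(\mathbf z,\cdot;\boldsymbol\theta)+\mathbb E f(\cdot,\mathbf z;\boldsymbol\theta),\qquad \zeta(\mathbf z;\boldsymbol\theta)=\tau(\mathbf z;\boldsymbol\theta)-\mathbb E\tau(\cdot;\boldsymbol\theta).$$ $\|\cdot\|$ is the Euclidean norm for vectors and the spectral norm for matrices; $\mathcal B(\boldsymbol\theta_0,r)$ and $\overline{\mathcal B}(\boldsymbol\theta_0,r)$ are the open and closed balls $\{\boldsymbol\theta\in\Theta:\|\boldsymbol\theta-\boldsymbol\theta_0\|<r\}$, $\{\boldsymbol\theta\in\Theta:\|\boldsymbol\theta-\boldsymbol\theta_0\|\le r\}$; $\nabla_1,\nabla_2$ are gradient and Hessian in $\boldsymbol\theta$; $\mathbb S^{p-1}$ is the unit sphere of $\mathbb R^p$; $a\vee b=\max(a,b)$, $a\wedge b=\min(a,b)$. (A1) For each $p_n$, $\Theta$ is a compact subset of $\mathbb R^{p_n}$, and there is an absolute constant $r_0>0$ such that the Euclidean ball $\{\boldsymbol\theta\in\mathbb R^{p_n}:\|\boldsymbol\theta-\boldsymbol\theta_0\|<r_0\}$ is contained in $\Theta$ and, for any positive absolute constant $r<r_0$, there is an absolute constant $\xi_0>0$ depending on $r$ with $\Gamma(\boldsymbol\theta_0)-\max_{\boldsymbol\theta\in\Theta\setminus\mathcal B(\boldsymbol\theta_0,r)}\Gamma(\boldsymbol\theta)\ge\xi_0$.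 (A2) $\Gamma$ is continuous at every $\boldsymbol\theta\in\Theta$, and $f(\cdot,\cdot;\boldsymbol\theta)$ is almost everywhere continuous at $\boldsymbol\theta_0$ (for $\mathbb P\otimes\mathbb P$-almost every $(\mathbf z_1,\mathbf z_2)$, $\boldsymbol\theta\mapsto f(\mathbf z_1,\mathbf z_2;\boldsymbol\theta)$ is continuous at $\boldsymbol\theta_0$). (A3) For each $r\le r_0$: (i) for each $\mathbf z\in\mathbb R^{m_n}$ all mixed second partial derivatives of $\tau(\mathbf z;\boldsymbol\theta)$ in $\boldsymbol\theta$ exist on $\overline{\mathcal B}(\boldsymbol\theta_0,r)$; (ii) there are absolute constants with $0<c_{\min}\le\lambda_{\min}(-\mathbf V)\le\lambda_{\max}(-\mathbf V)\le c_{\max}$, where $2\mathbf V=\mathbb E\nabla_2\tau(\cdot;\boldsymbol\theta_0)$; (iii) there is a positive constant $\rho(r)<\frac{c_{\min}}{11c_{\max}}\wedge c\,p_n r$, for some absolute constant $c>0$, such that $\|\mathbf I_{p_n}-(-\mathbf V)^{-1/2}(-\mathbf V(\boldsymbol\theta))(-\mathbf V)^{-1/2}\|\le\rho(r)$ for all $\boldsymbol\theta\in\overline{\mathcal B}(\boldsymbol\theta_0,r)$, where $2\mathbf V(\boldsymbol\theta)=\mathbb E\nabla_2\tau(\cdot;\boldsymbol\theta)$; (iv) $0<d_{\min}\le\lambda_{\min}(\boldsymbol\Delta)\le\lambda_{\max}(\boldsymbol\Delta)\le d_{\max}$ for absolute constants $d_{\min},d_{\max}$, where $\boldsymbol\Delta=\mathbb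 E\nabla_1\tau(\cdot;\boldsymbol\theta_0)\{\nabla_1\tau(\cdot;\boldsymbol\theta_0)\}^\top$; (v) there are absolute constants $\nu_0>0,\ell_0>0$ such that for any $\boldsymbol\theta\in\overline{\mathcal B}(\boldsymbol\theta_0,r)$, $$\sup_{\boldsymbol\gamma_1,\boldsymbol\gamma_2\in\mathbb S^{p_n-1}}\log\mathbb E\exp\{\lambda\boldsymbol\gamma_1^\top\nabla_2\zeta(\cdot;\boldsymbol\theta)\boldsymbol\gamma_2\}\le\frac{\nu_0^2\lambda^2}{2}\quad\text{for all }|\lambda|\le\ell_0.$$
   Formalization: The formal theorem additionally assumes that f is jointly Borel measurable in both observations and the parameter, and that the estimator is a measurable maximizer; without joint measurability a bounded VC class can violate the claim (under the continuum hypothesis). *)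

theory Defs
  imports "HOL-Probability.Probability" "HOL-Library.Extended_Nat"
    "Jordan_Normal_Form.Spectral_Radius"
begin

text \<open>
  Since the dimensions vary with the sample size, points of \<open>\<real>\<^sup>d\<close> are the sequences that vanish
  from index \<open>d\<close> on, as in \<^const>\<open>Euclidean_space\<close>. On this set the product topology of
  \<open>nat \<Rightarrow> real\<close> (hence its continuity, compactness and Borel sets) is the usual one of \<open>\<real>\<^sup>d\<close>; its
  metric is not the Euclidean one, which is \<open>edist\<close> below.
\<close>

type_synonym point = "nat \<Rightarrow> real"

text \<open>\<open>f z\<^sub>1 z\<^sub>2 \<theta>\<close>\<close>
type_synonym kernel = "point \<Rightarrow> point \<Rightarrow> point \<Rightarrow> real"

abbreviation Rd :: "nat \<Rightarrow> point set" where
  "Rd d \<equiv> topspace (Euclidean_space d)"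

abbreviation Rd_borel :: "nat \<Rightarrow> point measure" where
  "Rd_borel d \<equiv> restrict_space borel (Rd d)"

definition edist :: "nat \<Rightarrow> point \<Rightarrow> point \<Rightarrow> real" where
  "edist d x y = L2_set (\<lambda>i. x i - y i) {..<d}"

definition open_ball :: "nat \<Rightarrow> point set \<Rightarrow> point \<Rightarrow> real \<Rightarrow> point set" where
  "open_ball d \<Theta> c r = {\<theta>\<in>\<Theta>. edist d \<theta> c < r}"

definition closed_ball :: "nat \<Rightarrow> point set \<Rightarrow> point \<Rightarrow> real \<Rightarrow> point set" where
  "closed_ball d \<Theta> c r = {\<theta>\<in>\<Theta>. edist d \<theta> c \<le> r}"

subsection \<open>Matrices\<close>

definition unit_sphere :: "nat \<Rightarrow> real vec set" where
  "unit_sphere d = {v \<in> carrier_vec d. sqrt (scalar_prod v v) = 1}"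

definition spectral_norm :: "real mat \<Rightarrow> real" where
  "spectral_norm A =
     (SUP v \<in> unit_sphere (dim_col A). sqrt (scalar_prod (A *\<^sub>v v) (A *\<^sub>v v)))"

text \<open>Used for symmetric matrices only, so that all eigenvalues are real.\<close>

definition lambda_min :: "real mat \<Rightarrow> real" where
  "lambda_min A = Min (spectrum A)"

definition lambda_max :: "real mat \<Rightarrow> real" where
  "lambda_max A = Max (spectrum A)"

definition symmetric_mat :: "real mat \<Rightarrow> bool" where
  "symmetric_mat A \<longleftrightarrow> square_mat A \<and> transpose_mat A = A"

definition pos_semidef :: "real mat \<Rightarrow> bool" where
  "pos_semidef A \<longleftrightarrow> symmetric_mat A \<and>
     (\<forall>v \<in> carrier_vec (dim_row A). 0 \<le> scalar_prod v (A *\<^sub>v v))"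

text \<open>\<open>A\<^sup>-\<^sup>1\<^sup>/\<^sup>2\<close> for a symmetric positive definite \<open>A\<close>: the positive semidefinite square root of the
  inverse.\<close>

definition inv_sqrt_mat :: "real mat \<Rightarrow> real mat" where
  "inv_sqrt_mat A = (THE B. B \<in> carrier_mat (dim_row A) (dim_row A) \<and> pos_semidef B \<and>
     inverts_mat A (B * B) \<and> inverts_mat (B * B) A)"

definition integrable_mat :: "nat \<Rightarrow> 'z measure \<Rightarrow> ('z \<Rightarrow> real mat) \<Rightarrow> bool" where
  "integrable_mat d P A \<longleftrightarrow> (\<forall>i<d. \<forall>j<d. integrable P (\<lambda>z. A z $$ (i, j)))"

definition mean_mat :: "nat \<Rightarrow> 'z measure \<Rightarrow> ('z \<Rightarrow> real mat) \<Rightarrow> real mat" where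
  "mean_mat d P A = mat d d (\<lambda>(i, j). \<integral>z. A z $$ (i, j) \<partial>P)"

subsection \<open>Partial derivatives\<close>

text \<open>Partial derivatives are two-sided, so at a boundary point of \<open>\<Theta>\<close> they also involve values of \<open>f\<close>
  for parameters outside \<open>\<Theta>\<close>. Since the open ball of radius \<open>r0\<close> lies in \<open>\<Theta>\<close>, below this can only
  concern the sphere of radius exactly \<open>r0\<close>.\<close>

definition partial_exists :: "nat \<Rightarrow> (point \<Rightarrow> real) \<Rightarrow> point \<Rightarrow> bool" where
  "partial_exists i g \<theta> \<longleftrightarrow> (\<lambda>t. g (\<theta>(i := t))) field_differentiable (at (\<theta> i))"

definition partial :: "nat \<Rightarrow> (point \<Rightarrow> real) \<Rightarrow> point \<Rightarrow> real" where
  "partial i g \<theta> = deriv (\<lambda>t. g (\<theta>(i := t))) (\<theta> i)"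

text \<open>For \<open>\<partial>\<^sub>i\<partial>\<^sub>jg\<close> to exist at \<open>\<theta>\<close>, \<open>\<partial>\<^sub>jg\<close> must exist near \<open>\<theta>\<close> on the line through \<open>\<theta>\<close> in direction
  \<open>i\<close>; without this clause \<^const>\<open>deriv\<close> would be applied to unspecified values.\<close>

definition second_partials_exist :: "nat \<Rightarrow> (point \<Rightarrow> real) \<Rightarrow> point \<Rightarrow> bool" where
  "second_partials_exist d g \<theta> \<longleftrightarrow> (\<forall>i<d. \<forall>j<d.
     (\<forall>\<^sub>F t in nhds (\<theta> i). partial_exists j g (\<theta>(i := t))) \<and>
     partial_exists i (partial j g) \<theta>)"

definition grad :: "nat \<Rightarrow> (point \<Rightarrow> real) \<Rightarrow> point \<Rightarrow> real vec" where
  "grad d g \<theta> = Matrix.vec d (\<lambda>i. partial i g \<theta>)"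

definition hess :: "nat \<Rightarrow> (point \<Rightarrow> real) \<Rightarrow> point \<Rightarrow> real mat" where
  "hess d g \<theta> = mat d d (\<lambda>(i, j). partial i (partial j g) \<theta>)"

subsection \<open>VC-subgraph classes\<close>

definition shatters :: "'x set set \<Rightarrow> 'x set \<Rightarrow> bool" where
  "shatters \<C> A \<longleftrightarrow> (\<lambda>C. C \<inter> A) ` \<C> = Pow A"

definition VC_dim :: "'x set set \<Rightarrow> enat" where
  "VC_dim \<C> = Sup {enat (card A) | A. finite A \<and> shatters \<C> A}"

definition subgraph :: "'x set \<Rightarrow> ('x \<Rightarrow> real) \<Rightarrow> ('x \<times> real) set" where
  "subgraph X g = {(x, t). x \<in> X \<and> t < g x}"

definition subgraph_VC_dim :: "nat \<Rightarrow> kernel \<Rightarrow> point set \<Rightarrow> enat" where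
  "subgraph_VC_dim m f \<Theta> =
     VC_dim ((\<lambda>\<theta>. subgraph (Rd m \<times> Rd m) (\<lambda>(z1, z2). f z1 z2 \<theta>)) ` \<Theta>)"

subsection \<open>Criterion functions\<close>

definition sample_crit :: "nat \<Rightarrow> kernel \<Rightarrow> (nat \<Rightarrow> point) \<Rightarrow> point \<Rightarrow> real" where
  "sample_crit n f z \<theta> =
     1 / (real n * (real n - 1)) * (\<Sum>i\<in>{1..n}. \<Sum>j\<in>{1..n} - {i}. f (z i) (z j) \<theta>)"

definition pop_crit ::
  "nat \<Rightarrow> kernel \<Rightarrow> 'w measure \<Rightarrow> (nat \<Rightarrow> 'w \<Rightarrow> point) \<Rightarrow> point \<Rightarrow> real" where
  "pop_crit n f M Z \<theta> = (\<integral>\<omega>. sample_crit n f (\<lambda>i. Z i \<omega>) \<theta> \<partial>M)"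

definition tau :: "point measure \<Rightarrow> kernel \<Rightarrow> point \<Rightarrow> point \<Rightarrow> real" where
  "tau P f z \<theta> = (\<integral>w. f z w \<theta> \<partial>P) + (\<integral>w. f w z \<theta> \<partial>P)"

definition zeta :: "point measure \<Rightarrow> kernel \<Rightarrow> point \<Rightarrow> point \<Rightarrow> real" where
  "zeta P f z \<theta> = tau P f z \<theta> - (\<integral>w. tau P f w \<theta> \<partial>P)"

definition V_mat :: "nat \<Rightarrow> point measure \<Rightarrow> kernel \<Rightarrow> point \<Rightarrow> real mat" where
  "V_mat d P f \<theta> = (1 / 2) \<cdot>\<^sub>m mean_mat d P (\<lambda>z. hess d (tau P f z) \<theta>)"

definition grad_outer :: "nat \<Rightarrow> point measure \<Rightarrow> kernel \<Rightarrow> point \<Rightarrow> point \<Rightarrow> real mat" where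
  "grad_outer d P f \<theta> z =
     mat d d (\<lambda>(i, j). vec_index (grad d (tau P f z) \<theta>) i * vec_index (grad d (tau P f z) \<theta>) j)"

definition Delta_mat :: "nat \<Rightarrow> point measure \<Rightarrow> kernel \<Rightarrow> point \<Rightarrow> real mat" where
  "Delta_mat d P f \<theta> = mean_mat d P (grad_outer d P f \<theta>)"

subsection \<open>Assumptions\<close>

text \<open>In what follows \<open>p\<close>, \<open>\<Theta>\<close>, \<open>\<theta>\<^sub>0\<close>, \<dots> are indexed by the sample size \<open>n\<close>. Absolute constants are
  those quantified before \<open>n\<close>; \<open>n \<ge> 2\<close> is what the U-statistic needs.\<close>

text \<open>The supremum is over a nonempty set when \<open>p n \<ge> 1\<close>, and is a maximum when \<open>\<Gamma> n\<close> is
  continuous.\<close>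

definition A1 ::
  "(nat \<Rightarrow> nat) \<Rightarrow> (nat \<Rightarrow> point set) \<Rightarrow> (nat \<Rightarrow> point) \<Rightarrow> (nat \<Rightarrow> point \<Rightarrow> real) \<Rightarrow> real \<Rightarrow> bool" where
  "A1 p \<Theta> \<theta>0 \<Gamma> r0 \<longleftrightarrow>
     (\<forall>n\<ge>2. compactin (Euclidean_space (p n)) (\<Theta> n)) \<and>
     r0 > 0 \<and>
     (\<forall>n\<ge>2. open_ball (p n) (Rd (p n)) (\<theta>0 n) r0 \<subseteq> \<Theta> n) \<and>
     (\<forall>r. 0 < r \<and> r < r0 \<longrightarrow> (\<exists>\<xi>0>0. \<forall>n\<ge>2.
        \<Gamma> n (\<theta>0 n) - (SUP \<theta> \<in> \<Theta> n - open_ball (p n) (\<Theta> n) (\<theta>0 n) r. \<Gamma> n \<theta>) \<ge> \<xi>0))"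

definition A2 ::
  "(nat \<Rightarrow> point set) \<Rightarrow> (nat \<Rightarrow> point) \<Rightarrow> (nat \<Rightarrow> point \<Rightarrow> real) \<Rightarrow>
   (nat \<Rightarrow> point measure) \<Rightarrow> (nat \<Rightarrow> kernel) \<Rightarrow> bool" where
  "A2 \<Theta> \<theta>0 \<Gamma> P f \<longleftrightarrow>
     (\<forall>n\<ge>2. continuous_on (\<Theta> n) (\<Gamma> n) \<and>
        (AE z in P n \<Otimes>\<^sub>M P n.
           continuous (at (\<theta>0 n) within \<Theta> n) (\<lambda>\<theta>. f n (fst z) (snd z) \<theta>)))"

text \<open>Clauses (i)--(v), in this order, for one sample size and one radius. Integrability and
  differentiability are spelled out wherever an expectation or a derivative is written, because the
  integral of a non-integrable function is 0 and \<^const>\<open>deriv\<close> of a non-differentiable function is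
  unspecified. Symmetry of \<open>-V\<close> is what gives its extreme eigenvalues and \<open>(-V)\<^sup>-\<^sup>1\<^sup>/\<^sup>2\<close> a
  meaning.\<close>

definition A3_at ::
  "nat \<Rightarrow> nat \<Rightarrow> point set \<Rightarrow> point \<Rightarrow> point measure \<Rightarrow> kernel \<Rightarrow>
   real \<Rightarrow> real \<Rightarrow> real \<Rightarrow> real \<Rightarrow> real \<Rightarrow> real \<Rightarrow> real \<Rightarrow> real \<Rightarrow> bool" where
  "A3_at m d \<Theta> \<theta>0 P f cmin cmax c dmin dmax \<nu>0 l0 r \<longleftrightarrow>
     (let B = closed_ball d \<Theta> \<theta>0 r; V = V_mat d P f \<theta>0; \<Delta> = Delta_mat d P f \<theta>0 in
       (\<forall>z\<in>Rd m. \<forall>\<theta>\<in>B. second_partials_exist d (tau P f z) \<theta>) \<and>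
       (integrable_mat d P (\<lambda>z. hess d (tau P f z) \<theta>0) \<and> symmetric_mat (- V) \<and>
        cmin \<le> lambda_min (- V) \<and> lambda_min (- V) \<le> lambda_max (- V) \<and>
        lambda_max (- V) \<le> cmax) \<and>
       (\<exists>\<rho>>0. \<rho> < min (cmin / (11 * cmax)) (c * real d * r) \<and>
         (\<forall>\<theta>\<in>B. integrable_mat d P (\<lambda>z. hess d (tau P f z) \<theta>) \<and>
           spectral_norm
             (1\<^sub>m d - inv_sqrt_mat (- V) * (- V_mat d P f \<theta>) * inv_sqrt_mat (- V)) \<le> \<rho>)) \<and>
       (integrable_mat d P (grad_outer d P f \<theta>0) \<and>
        dmin \<le> lambda_min \<Delta> \<and> lambda_min \<Delta> \<le> lambda_max \<Delta> \<and> lambda_max \<Delta> \<le> dmax) \<and>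
       (\<forall>\<theta>\<in>B. (\<forall>z\<in>Rd m. second_partials_exist d (zeta P f z) \<theta>) \<and>
         (\<forall>\<gamma>1\<in>unit_sphere d. \<forall>\<gamma>2\<in>unit_sphere d. \<forall>s. \<bar>s\<bar> \<le> l0 \<longrightarrow>
           integrable P (\<lambda>z. exp (s * scalar_prod \<gamma>1 (hess d (zeta P f z) \<theta> *\<^sub>v \<gamma>2))) \<and>
           ln (\<integral>z. exp (s * scalar_prod \<gamma>1 (hess d (zeta P f z) \<theta> *\<^sub>v \<gamma>2)) \<partial>P)
             \<le> \<nu>0\<^sup>2 * s\<^sup>2 / 2)))"

definition A3 ::
  "(nat \<Rightarrow> nat) \<Rightarrow> (nat \<Rightarrow> nat) \<Rightarrow> (nat \<Rightarrow> point set) \<Rightarrow> (nat \<Rightarrow> point) \<Rightarrow>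
   (nat \<Rightarrow> point measure) \<Rightarrow> (nat \<Rightarrow> kernel) \<Rightarrow> real \<Rightarrow> bool" where
  "A3 m p \<Theta> \<theta>0 P f r0 \<longleftrightarrow>
     (\<exists>cmin>0. \<exists>cmax. \<exists>c>0. \<exists>dmin>0. \<exists>dmax. \<exists>\<nu>0>0. \<exists>l0>0.
        \<forall>r. 0 < r \<and> r \<le> r0 \<longrightarrow>
          (\<forall>n\<ge>2. A3_at (m n) (p n) (\<Theta> n) (\<theta>0 n) (P n) (f n) cmin cmax c dmin dmax \<nu>0 l0 r))"

subsection \<open>Stochastic order\<close>

text \<open>\<open>X\<^sub>n = O\<^sub>P(a\<^sub>n)\<close>, where \<open>X\<^sub>n\<close> is a random variable on \<open>M n\<close>.\<close>

definition O_prob :: "(nat \<Rightarrow> 'w measure) \<Rightarrow> (nat \<Rightarrow> 'w \<Rightarrow> real) \<Rightarrow> (nat \<Rightarrow> real) \<Rightarrow> bool" where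
  "O_prob M X a \<longleftrightarrow>
     (\<forall>\<epsilon>>0. \<exists>C>0. \<exists>N. \<forall>n\<ge>N.
        measure (M n) {\<omega> \<in> space (M n). \<bar>X n \<omega>\<bar> > C * a n} \<le> \<epsilon>)"

end

(* The idea. By the Hoeffding decomposition, Gamma_n = Gamma + P_n zeta + U_n h with a degenerate kernel h.
   Here Gamma decreases quadratically at theta0 by (A1) and (A3), P_n zeta is a linear term P_n grad zeta(theta0)
   plus a remainder W, and inserting the maximizer gives
   c |t|^2 <= |t| |P_n grad zeta(theta0)| + |W(theta0 + t)| + |U_n h|, where t = thetahat - theta0.
   The linear term has variance O(p/n). The degenerate term is O(nu/n) in mean: symmetrize with a ghost sample, so
   that given the data only signs are random, and use chaining over the sign patterns that the VC class cuts out
   (Sauer, and packing numbers for separated families); random parameters are handled by replacing thetahat by a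
   measurable near-maximizing function of the signs. The increments of W are subgaussian with scale |s - t| rho
   on the ball of radius rho, so chaining over dyadic grids bounds W there by rho^2 sqrt(p/n) in mean, and peeling
   over the shells between sqrt(p/n) and r0 makes W negligible against |t|^2.
   Since only coordinatewise derivatives exist, directional increments are obtained from them by
   mollifying the parameter. *)

theory Submission
  imports Defs
begin

text \<open>The supremum over \<theta> need not be measurable, so in the empirical bounds the
  estimator is an arbitrary measurable function of the data, and finite maxima over sign-dependent
  choices stand in for suprema. The assumptions give second partial derivatives pointwise, with no
  continuity in \<theta> and no dominating function, so neither Taylor's formula nor differentiation
  under the expectation is at hand. Exponential moments of increments are therefore bounded by
  duality: an exponential weight turns the claim into one about a single deterministic function of
  \<theta>, and that one can be mollified. The Hessian of the mean equals the mean Hessian because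
  of (A3)(v): a logarithmic moment generating function below a parabola through 0 forces mean zero.
  A global bound of order sqrt((\<nu> + 1)/n) first brings the estimator within r0/2 of \<theta>0,
  where the local inequality applies. Peeling is affordable because each shell fails with
  probability of order sqrt(p/n), whatever its radius, while about (n/p)^(1/4) shells
  suffice.\<close>

section \<open>VC classes\<close>

text \<open>Shattering of A by F, stated by the one inclusion of \<open>shatters\<close> that is not
  automatic.\<close>

definition traced :: "'e set set => 'e set => bool" where
 "traced F A \<longleftrightarrow> (\<forall>B\<subseteq>A. \<exists>C\<in>F. C \<inter> A = B)"

text \<open>Pajor's form of Sauer's lemma. Removing x maps F onto \<open>F0\<close> and is
  two-to-one exactly over \<open>F1\<close>, so |F| = |F0| + |F1|. Both families live on E, and a
  set shattered by \<open>F1\<close> stays shattered by F after x is added, because F contains both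
  extensions. Sets with and without x cannot coincide, so the two counts add up.\<close>

lemma pajor:
 assumes "finite E" "F \<subseteq> Pow E"
 shows "card F <= card {A. A \<subseteq> E \<and> traced F A}"
 using assms
proof (induction E arbitrary: F rule: finite_induct)
 case empty
 then have "F = {} \<or> F = {{}}" by auto
 then show ?case
 proof
  assume "F = {{}}"
  then have "{A. A \<subseteq> {} \<and> traced F A} = {{}}" by (auto simp: traced_def)
  then show ?thesis using \<open>F = {{}}\<close> by simp
 qed simp
next
 case (insert x E)
 define F0 where "F0 = (%C. C - {x}) ` F"
 define F1 where "F1 = {C. C \<in> F \<and> x \<notin> C \<and> insert x C \<in> F}"
 have finF: "finite F" using insert by (meson finite_Pow_iff finite_insert finite_subset)
 have F0: "F0 \<subseteq> Pow E" "F1 \<subseteq> Pow E" using insert.prems by (auto simp: F0_def F1_def)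
 have cardF: "card F = card F0 + card F1"
 proof -
  let ?G = "{C\<in>F. x \<in> C \<and> C - {x} \<in> F}"
  have cF: "card F = card (F - ?G) + card ?G"
   using finF by (subst card_Un_disjoint[symmetric]) (auto intro: arg_cong[where f=card])
  have inj: "inj_on (%C. C - {x}) (F - ?G)"
  proof (rule inj_onI)
   fix C D assume CD: "C \<in> F - ?G" "D \<in> F - ?G" "C - {x} = D - {x}"
   show "C = D"
   proof (rule ccontr)
   assume "C ~= D"
   have *: False if "C \<in> F - ?G" "D \<in> F - ?G" "C - {x} = D - {x}" "x \<in> C" "x \<notin> D" for C D
   proof -
   have "D - {x} = D" using that(5) by simp
   then have "C - {x} \<in> F" using that(2,3) by simp
   then show False using that(1,4) by simp
   qed
   have "(x \<in> C \<and> x \<notin> D) \<or> (x \<in> D \<and> x \<notin> C)" using CD(3) \<open>C ~= D\<close> by blast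
   then show False using *[OF CD] *[OF CD(2,1) CD(3)[symmetric]] by blast
   qed
  qed
  have img: "(%C. C - {x}) ` (F - ?G) = F0"
  proof -
   have "C - {x} \<in> (%C. C - {x}) ` (F - ?G)" if "C \<in> F" for C
   proof (cases "C \<in> ?G")
   case True
   then have "C - {x} \<in> F - ?G" by auto
   moreover have "C - {x} = (C - {x}) - {x}" by auto
   ultimately show ?thesis by blast
   next
   case False
   then show ?thesis using that by auto
   qed
   then show ?thesis unfolding F0_def by auto
  qed
  have "card (F - ?G) = card F0" using card_image[OF inj] unfolding img by simp
  moreover have "card ?G = card F1"
   by (rule bij_betw_same_card[of "%C. C - {x}"], rule bij_betw_byWitness[of _ "insert x"])
   (auto simp: F1_def insert_absorb)
  ultimately show ?thesis using cF by simp
 qed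
 let ?SA = "{A. A \<subseteq> E \<and> traced F0 A}" and ?SB = "{A. A \<subseteq> E \<and> traced F1 A}"
  and ?S = "{A. A \<subseteq> insert x E \<and> traced F A}"
 have finS: "finite ?S" using insert.hyps by simp
 have fin1: "finite ?SB" using insert.hyps by simp
 have t0: "traced F A" if "A \<subseteq> E" "traced F0 A" for A
 proof -
  have "x \<notin> A" using that insert.hyps by auto
  then have "(C - {x}) \<inter> A = C \<inter> A" for C by auto
  then show ?thesis using that(2) unfolding traced_def F0_def by auto
 qed
 have t1: "traced F (insert x A)" if h: "A \<subseteq> E" "traced F1 A" for A
  unfolding traced_def
 proof (intro allI impI)
  fix B assume B: "B \<subseteq> insert x A"
  have xA: "x \<notin> A" using h insert.hyps by auto
  obtain C where C: "C \<in> F1" "C \<inter> A = B - {x}"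
   using h(2) B unfolding traced_def by (metis Diff_subset_conv insert_is_Un)
  show "\<exists>C\<in>F. C \<inter> insert x A = B"
  proof (cases "x \<in> B")
   case True
   then have "insert x C \<inter> insert x A = B" using C by auto
   then show ?thesis using C F1_def by blast
  next
   case False
   then have "C \<inter> insert x A = B" using C by (auto simp: F1_def)
   then show ?thesis using C F1_def by blast
  qed
 qed
 have sub: "?SA \<union> insert x ` ?SB \<subseteq> ?S" using t0 t1 by auto
 have disj: "?SA \<inter> insert x ` ?SB = {}" using insert.hyps by auto
 have inj: "inj_on (insert x) ?SB"
 proof (rule inj_onI)
  fix A B assume AB: "A \<in> ?SB" "B \<in> ?SB" "insert x A = insert x B"
  then have "x \<notin> A" "x \<notin> B" using insert.hyps by auto
  with AB(3) show "A = B" by (metis insert_ident)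
 qed
 have "card F <= card ?SA + card ?SB" unfolding cardF
  using insert.IH[OF F0(1)] insert.IH[OF F0(2)] by simp
 also have "... = card (?SA \<union> insert x ` ?SB)"
  using disj fin1 insert.hyps card_image[OF inj] by (subst card_Un_disjoint) auto
 also have "... <= card ?S" using sub finS card_mono by blast
 finally show ?case .
qed

lemma sum_Pow_power_card:
 assumes "finite S"
 shows "(\<Sum>A\<in>Pow S. (x::real) ^ card A) = (1 + x) ^ card S"
 using prod_add[OF assms, of "%_. x" "%_. 1"] by (simp add: add.commute)

text \<open>Exponential counting instead of binomial sums: for x <= 1 every shattered set has
  \<open>x ^ card A * (1/x) ^ d >= 1\<close>, and the weights \<open>x ^ card A\<close> over all
  subsets add up to (1 + x)^|S|. The free x is tuned later to the separation of the family.\<close>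

lemma sauer_bound:
 assumes "finite S" "F \<subseteq> Pow S" "!!A. A \<subseteq> S ==> traced F A ==> card A <= d" "0 < x" "x <= (1::real)"
 shows "real (card F) <= exp (x * real (card S)) * (1 / x) ^ d"
proof -
 have "real (card F) <= card {A. A \<subseteq> S \<and> traced F A}"
  using pajor[OF assms(1,2)] by simp
 also have "... = (\<Sum>A\<in>{A. A \<subseteq> S \<and> traced F A}. 1)" by simp
 also have "... <= (\<Sum>A\<in>{A. A \<subseteq> S \<and> traced F A}. x ^ card A * (1/x) ^ d)"
 proof (rule sum_mono)
  fix A assume "A \<in> {A. A \<subseteq> S \<and> traced F A}"
  then have "x ^ d <= x ^ card A" using assms by (intro power_decreasing) auto
  then show "1 <= x ^ card A * (1/x) ^ d" using assms by (simp add: power_one_over field_simps)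
 qed
 also have "... <= (\<Sum>A\<in>Pow S. x ^ card A * (1/x) ^ d)"
  using assms by (intro sum_mono2) auto
 also have "... = (1 + x) ^ card S * (1/x) ^ d"
  using sum_Pow_power_card[OF assms(1), of x] by (simp add: sum_distrib_right[symmetric])
 also have "... <= exp (x * real (card S)) * (1/x) ^ d"
 proof -
  have "(1 + x) ^ card S <= exp x ^ card S" using assms by (intro power_mono) (auto simp: add.commute)
  also have "... = exp (x * real (card S))" by (simp add: exp_of_nat2_mult)
  finally show ?thesis using assms by (intro mult_right_mono) auto
 qed
 finally show ?thesis .
qed

text \<open>Double counting: each pair is left together by at most (1 - dl)|E| points, so the
  average point leaves at most (1 - dl)|Q| pairs together, and some point does no worse than the
  average.\<close>

lemma best_separating_point:
 fixes Q :: "('e set \<times> 'e set) set"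
 assumes "finite E" "E ~= {}" "finite Q"
  and "!!A B. (A, B) \<in> Q ==> dl * real (card E) <= real (card {e\<in>E. e \<in> A \<longleftrightarrow> e \<notin> B})"
 shows "\<exists>e\<in>E. real (card {(A, B) \<in> Q. e \<in> A \<longleftrightarrow> e \<in> B}) <= (1 - dl) * real (card Q)"
proof (rule ccontr)
 assume "\<not> ?thesis"
 then have less: "(1 - dl) * real (card Q) < real (card {(A, B) \<in> Q. e \<in> A \<longleftrightarrow> e \<in> B})" if "e \<in> E" for e
  using that by force
 have "real (card E) * ((1 - dl) * real (card Q)) = (\<Sum>e\<in>E. (1 - dl) * real (card Q))" by simp
 also have "... < (\<Sum>e\<in>E. real (card {(A, B) \<in> Q. e \<in> A \<longleftrightarrow> e \<in> B}))"
  using assms less by (intro sum_strict_mono) auto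
 also have "... = (\<Sum>e\<in>E. \<Sum>q\<in>Q. if e \<in> fst q \<longleftrightarrow> e \<in> snd q then 1 else 0)"
  using assms by (intro sum.cong) (auto simp: sum.If_cases intro!: arg_cong[where f=card])
 also have "... = (\<Sum>q\<in>Q. \<Sum>e\<in>E. if e \<in> fst q \<longleftrightarrow> e \<in> snd q then 1 else 0)" by (rule sum.swap)
 also have "... <= (\<Sum>q\<in>Q. (1 - dl) * real (card E))"
 proof (rule sum_mono)
  fix q assume q: "q \<in> Q"
  have "(\<Sum>e\<in>E. if e \<in> fst q \<longleftrightarrow> e \<in> snd q then 1 else 0) + real (card {e\<in>E. e \<in> fst q \<longleftrightarrow> e \<notin> snd q})
   = (\<Sum>e\<in>E. if e \<in> fst q \<longleftrightarrow> e \<in> snd q then 1 else 0) + (\<Sum>e\<in>E. if e \<in> fst q \<longleftrightarrow> e \<in> snd q then 0 else 1)"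
  proof -
   have "{e\<in>E. e \<in> fst q \<longleftrightarrow> e \<notin> snd q} = E \<inter> - {e. e \<in> fst q \<longleftrightarrow> e \<in> snd q}" by auto
   then show ?thesis using assms by (simp add: sum.If_cases)
  qed
  also have "... = (\<Sum>e\<in>E. (if e \<in> fst q \<longleftrightarrow> e \<in> snd q then 1 else 0) + (if e \<in> fst q \<longleftrightarrow> e \<in> snd q then 0 else 1))"
   by (rule sum.distrib[symmetric])
  also have "... = (\<Sum>e\<in>E. 1)" by (rule sum.cong) auto
  finally show "(\<Sum>e\<in>E. if e \<in> fst q \<longleftrightarrow> e \<in> snd q then 1 else 0) <= (1 - dl) * real (card E)"
   using assms(4)[of "fst q" "snd q"] q by (simp add: algebra_simps)
 qed
 also have "... = real (card Q) * ((1 - dl) * real (card E))" by simp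
 finally show False by simp
qed

text \<open>Greedy choice: each new point leaves at most a fraction 1 - dl of the surviving pairs
  together.\<close>

lemma separating_set:
 fixes Q :: "('e set \<times> 'e set) set"
 assumes "finite E" "E ~= {}" "finite Q" "dl <= 1"
  and "!!A B. (A, B) \<in> Q ==> dl * real (card E) <= real (card {e\<in>E. e \<in> A \<longleftrightarrow> e \<notin> B})"
 shows "\<exists>S\<subseteq>E. card S <= s \<and> real (card {(A, B) \<in> Q. A \<inter> S = B \<inter> S}) <= (1 - dl) ^ s * real (card Q)"
proof (induction s)
 case 0
 then show ?case using assms(3) by (intro exI[of _ "{}"]) (auto intro: card_mono)
next
 case (Suc s)
 then obtain S where S: "S \<subseteq> E" "card S <= s"
  "real (card {(A, B) \<in> Q. A \<inter> S = B \<inter> S}) <= (1 - dl) ^ s * real (card Q)" by blast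
 let ?Q = "{(A, B) \<in> Q. A \<inter> S = B \<inter> S}"
 have finQ: "finite ?Q" using assms(3) by (rule rev_finite_subset) auto
 obtain e where e: "e \<in> E" "real (card {(A, B) \<in> ?Q. e \<in> A \<longleftrightarrow> e \<in> B}) <= (1 - dl) * real (card ?Q)"
  using best_separating_point[OF assms(1,2) finQ, of dl] assms(5) by force
 have "{(A, B) \<in> Q. A \<inter> insert e S = B \<inter> insert e S} = {(A, B) \<in> ?Q. e \<in> A \<longleftrightarrow> e \<in> B}"
  by auto
 then have "real (card {(A, B) \<in> Q. A \<inter> insert e S = B \<inter> insert e S}) <= (1 - dl) * real (card ?Q)"
  using e by simp
 also have "... <= (1 - dl) * ((1 - dl) ^ s * real (card Q))" using S assms by (intro mult_left_mono) auto
 finally have "real (card {(A, B) \<in> Q. A \<inter> insert e S = B \<inter> insert e S}) <= (1 - dl) ^ Suc s * real (card Q)"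
  by simp
 moreover have "card (insert e S) <= Suc s"
  using S(2) card_insert_le_m1 by (metis Suc_le_mono card.infinite card_insert_if finite_insert le_SucI order.trans)
 ultimately show ?case using S e by (intro exI[of _ "insert e S"]) auto
qed

text \<open>A packing bound in the manner of Haussler. Slightly more than 2 ln|F| / dl greedily
  chosen points separate all pairs, so F is faithfully represented by its traces on a set S of that
  size. Sauer's bound on S then contains ln|F| on both sides and can be solved for it.\<close>

lemma separated_family_card:
 assumes E: "finite E" and F: "F \<subseteq> Pow E" "F ~= {}"
  and vc: "!!A. A \<subseteq> E ==> traced F A ==> card A <= d"
  and dl: "0 < dl" "dl <= 1"
  and sep: "!!A B. A \<in> F ==> B \<in> F ==> A ~= B ==> dl * real (card E) <= real (card {e\<in>E. e \<in> A \<longleftrightarrow> e \<notin> B})"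
 shows "ln (real (card F)) <= 1 / 2 + 2 * real d * ln (4 / dl)"
proof (cases "card F = 1")
 case True
 have "ln (4 / dl) >= 0" using dl by simp
 then show ?thesis using True by (simp add: add_nonneg_nonneg)
next
 case False
 have finF: "finite F" using E F by (meson finite_Pow_iff finite_subset)
 then have N2: "card F >= 2" using False F by (metis One_nat_def Suc_1 Suc_leI card_gt_0_iff le_neq_implies_less)
 have Ene: "E ~= {}"
 proof
  assume "E = {}"
  then have "F \<subseteq> {{}}" using F by auto
  then have "card F <= 1" by (metis card_mono finite.emptyI finite_insert is_singletonI is_singleton_altdef)
  then show False using N2 by simp
 qed
 define N where "N = real (card F)"
 have N: "N >= 2" using N2 by (simp add: N_def)
 define L where "L = ln N"
 have L: "L >= 0" using N by (simp add: L_def)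
 \<comment> \<open>Just large enough for \<open>exp (- dl) ^ s * N ^ 2 < 1\<close>, so that no pair
   remains together.\<close>
 define s where "s = nat \<lfloor>2 * L / dl\<rfloor> + 1"
 have s: "real s > 2 * L / dl" "real s <= 2 * L / dl + 1"
 proof -
  have "0 <= 2 * L / dl" using L dl by simp
  then have "real (nat \<lfloor>2 * L / dl\<rfloor>) = of_int \<lfloor>2 * L / dl\<rfloor>" by simp
  then show "real s > 2 * L / dl" "real s <= 2 * L / dl + 1" unfolding s_def by linarith+
 qed
 define Q where "Q = {(A, B). A \<in> F \<and> B \<in> F \<and> A ~= B}"
 have Qsub: "Q \<subseteq> F \<times> F" by (auto simp: Q_def)
 have finQ: "finite Q" using Qsub finF by (meson finite_SigmaI finite_subset)
 have cQ: "real (card Q) <= N ^ 2"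
  using card_mono[OF _ Qsub] finF unfolding N_def
  by (simp add: card_cartesian_product power2_eq_square flip: of_nat_mult)
 obtain S where S: "S \<subseteq> E" "card S <= s"
  "real (card {(A, B) \<in> Q. A \<inter> S = B \<inter> S}) <= (1 - dl) ^ s * real (card Q)"
  using separating_set[OF E Ene finQ dl(2), of s] sep by (force simp: Q_def)
 have "(1 - dl) ^ s * real (card Q) <= exp (- dl) ^ s * N ^ 2"
  using dl cQ by (intro mult_mono power_mono) (use exp_ge_add_one_self[of "-dl"] in auto)
 also have "... = exp (2 * L - dl * real s)"
 proof -
  have "exp (2 * L) = N ^ 2" using N by (simp add: L_def exp_double)
  moreover have "exp (- dl) ^ s = exp (- (dl * real s))" by (simp add: exp_of_nat_mult[symmetric] mult.commute)
  ultimately show ?thesis by (simp add: exp_diff exp_minus field_simps)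
 qed
 also have "... < 1" using s(1) dl by (simp add: field_simps)
 finally have "card {(A, B) \<in> Q. A \<inter> S = B \<inter> S} = 0" using S(3) by simp
 moreover have "finite {(A, B) \<in> Q. A \<inter> S = B \<inter> S}" using finQ by (rule rev_finite_subset) auto
 ultimately have emp: "{(A, B) \<in> Q. A \<inter> S = B \<inter> S} = {}" by simp
 define G where "G = (%A. A \<inter> S) ` F"
 have inj: "inj_on (%A. A \<inter> S) F"
 proof (rule inj_onI)
  fix A B assume "A \<in> F" "B \<in> F" "A \<inter> S = B \<inter> S"
  then show "A = B" using emp unfolding Q_def by blast
 qed
 have finS: "finite S" using S E finite_subset by blast
 have tr: "card A <= d" if "A \<subseteq> S" "traced G A" for A
 proof (rule vc)
  show "A \<subseteq> E" using that S by auto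
  have "C \<inter> S \<inter> A = C \<inter> A" for C using that by auto
  then show "traced F A" using that(2) unfolding traced_def G_def by auto
 qed
 have "N = real (card G)" unfolding G_def N_def using card_image[OF inj] by simp
 \<comment> \<open>With the weight dl/4 the exponent dl/4 * |S| is at most L/2 + dl/4, which half of
   L absorbs.\<close>
 also have "... <= exp (dl/4 * real (card S)) * (1 / (dl/4)) ^ d"
  by (rule sauer_bound[OF finS _ tr]) (use dl in \<open>auto simp: G_def\<close>)
 finally have NN: "N <= exp (dl/4 * real (card S)) * (4 / dl) ^ d" by simp
 have "L <= ln (exp (dl/4 * real (card S)) * (4 / dl) ^ d)"
  unfolding L_def using NN N by (subst ln_le_cancel_iff) auto
 also have "... = dl/4 * real (card S) + real d * ln (4 / dl)"
  using dl by (simp add: ln_mult ln_realpow)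
 also have "dl/4 * real (card S) <= dl/4 * (2 * L / dl + 1)"
  using S(2) s(2) dl by (intro mult_left_mono) auto
 also have "dl/4 * (2 * L / dl + 1) = L/2 + dl/4" using dl by (simp add: field_simps)
 finally show ?thesis using dl unfolding L_def N_def by linarith
qed

section \<open>Chaining\<close>

context prob_space
begin

text \<open>From 1 + u <= exp u, a number y is at most (c + exp (\<beta> y - c)) / \<beta>. This is
  linear in the exponential, so the maximum is replaced by a sum pointwise and no logarithm of an
  integral is taken. The choice c = A + ln|I| makes the mean of the sum at most 1.\<close>

lemma nn_integral_Max_le:
 fixes Y :: "'i => 'a => real"
 assumes I: "finite I" "I ~= {}" and lam: "\<beta> > 0" and A: "A >= 0"
  and meas: "!!i. i \<in> I ==> Y i \<in> borel_measurable M"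
  and mgf: "!!i. i \<in> I ==> (\<integral>\<^sup>+om. ennreal (exp (\<beta> * \<bar>Y i om\<bar>)) \<partial>M) <= ennreal (exp A)"
 shows "(\<integral>\<^sup>+om. ennreal (Max ((%i. \<bar>Y i om\<bar>) ` I)) \<partial>M) <= ennreal ((A + ln (real (card I)) + 1) / \<beta>)"
proof -
 define c where "c = A + ln (real (card I))"
 have N: "real (card I) >= 1" using I by (simp add: Suc_le_eq card_gt_0_iff)
 have c: "c >= 0" unfolding c_def using A N by simp
 have pw: "Max ((%i. \<bar>Y i om\<bar>) ` I) <= (c + (\<Sum>i\<in>I. exp (-c) * exp (\<beta> * \<bar>Y i om\<bar>))) / \<beta>" for om
 proof -
  have "\<bar>Y i om\<bar> <= (c + (\<Sum>i\<in>I. exp (-c) * exp (\<beta> * \<bar>Y i om\<bar>))) / \<beta>" if i: "i \<in> I" for i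
  proof -
   have "\<beta> * \<bar>Y i om\<bar> - c <= exp (\<beta> * \<bar>Y i om\<bar> - c)"
   using exp_ge_add_one_self[of "\<beta> * \<bar>Y i om\<bar> - c"] by linarith
   also have "... = exp (-c) * exp (\<beta> * \<bar>Y i om\<bar>)" by (simp add: exp_diff exp_minus divide_inverse)
   also have "... <= (\<Sum>i\<in>I. exp (-c) * exp (\<beta> * \<bar>Y i om\<bar>))"
   using i I by (intro member_le_sum) auto
   finally show ?thesis using lam by (simp add: pos_le_divide_eq mult.commute)
  qed
  then show ?thesis using I by simp
 qed
 have "(\<integral>\<^sup>+om. ennreal (Max ((%i. \<bar>Y i om\<bar>) ` I)) \<partial>M)
   <= (\<integral>\<^sup>+om. ennreal ((c + (\<Sum>i\<in>I. exp (-c) * exp (\<beta> * \<bar>Y i om\<bar>))) / \<beta>) \<partial>M)"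
  by (intro nn_integral_mono ennreal_leI pw)
 also have "... = (\<integral>\<^sup>+om. ennreal (c / \<beta>) + (\<Sum>i\<in>I. ennreal (exp (-c) / \<beta>) * ennreal (exp (\<beta> * \<bar>Y i om\<bar>))) \<partial>M)"
  using c lam by (intro nn_integral_cong)
   (simp add: ennreal_plus[symmetric] ennreal_mult[symmetric] sum_nonneg add_divide_distrib sum_divide_distrib del: ennreal_plus)
 also have "... = ennreal (c / \<beta>) + (\<Sum>i\<in>I. ennreal (exp (-c) / \<beta>) * (\<integral>\<^sup>+om. ennreal (exp (\<beta> * \<bar>Y i om\<bar>)) \<partial>M))"
 proof -
  have m: "(%om. ennreal (exp (\<beta> * \<bar>Y i om\<bar>))) \<in> borel_measurable M" if "i \<in> I" for i
   using meas[OF that] by measurable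
  then show ?thesis
   by (subst nn_integral_add) (auto simp: nn_integral_sum nn_integral_cmult emeasure_space_1 intro!: borel_measurable_sum borel_measurable_times_ennreal sum.cong)
 qed
 also have "... <= ennreal (c / \<beta>) + (\<Sum>i\<in>I. ennreal (exp (-c) / \<beta>) * ennreal (exp A))"
  by (intro add_mono sum_mono mult_left_mono mgf) auto
 also have "... = ennreal (c / \<beta> + real (card I) * (exp (-c) / \<beta> * exp A))"
  using c lam by (simp add: ennreal_mult[symmetric] ennreal_plus[symmetric] ennreal_of_nat_eq_real_of_nat del: ennreal_plus)
 also have "c / \<beta> + real (card I) * (exp (-c) / \<beta> * exp A) = (c + 1) / \<beta>"
 proof -
  have "real (card I) * (exp (-c) * exp A) = 1"
  proof -
   have "exp (-c) * exp A = exp (- ln (real (card I)))" unfolding c_def by (simp flip: exp_add)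
   then show ?thesis using N by (simp add: exp_minus)
  qed
  then have "real (card I) * (exp (-c) / \<beta> * exp A) = 1 / \<beta>" by (metis times_divide_eq_left times_divide_eq_right)
  then show ?thesis by (simp add: add_divide_distrib)
 qed
 finally show ?thesis by (simp add: c_def)
qed

text \<open>The subtracted term is the exact tail, which lets the induction close; the limit 14
  enters the chaining constant.\<close>

lemma sum_geom_linear: "(\<Sum>k<K. (2 * real k + 5) / 2 ^ k) <= 14 - (4 * real K + 14) / 2 ^ K"
proof (induction K)
 case (Suc K)
 have "(\<Sum>k<Suc K. (2 * real k + 5) / 2 ^ k) <= 14 - (4 * real K + 14) / 2 ^ K + (2 * real K + 5) / 2 ^ K"
  using Suc by simp
 also have "... = 14 - (4 * real (Suc K) + 14) / 2 ^ Suc K" by (simp add: field_simps)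
 finally show ?case .
qed simp

text \<open>Scale D / 2^k against entropy A (k + 1): the links of level k number at most exp (A (2k
  + 3)), so their maximum costs (2k + 5) A D / (2^k \<beta>), and the base costs 3 A D / \<beta>.
  Hence 17 = 3 + 14. The index set is finite and \<open>\<pi> K\<close> is the identity on it, so
  every chain ends exactly at its target.\<close>

lemma nn_integral_chaining:
 fixes X :: "'t => 'a => real"
 assumes T: "finite T" "T ~= {}" and lam: "\<beta> > 0" and D: "D > 0" and A: "A >= 1"
  and top: "!!t. t \<in> T ==> \<pi> K t = t"
  and meas: "!!k t. k <= K ==> t \<in> T ==> X (\<pi> k t) \<in> borel_measurable M"
  and base: "!!t. t \<in> T ==> (\<integral>\<^sup>+om. ennreal (exp (\<beta> / D * \<bar>X (\<pi> 0 t) om\<bar>)) \<partial>M) <= ennreal (exp A)"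
  and link: "!!k t. k < K ==> t \<in> T ==>
   (\<integral>\<^sup>+om. ennreal (exp (\<beta> * 2 ^ k / D * \<bar>X (\<pi> (Suc k) t) om - X (\<pi> k t) om\<bar>)) \<partial>M) <= ennreal (exp A)"
  and card: "!!k. k <= K ==> ln (real (card (\<pi> k ` T))) <= A * (real k + 1)"
 shows "(\<integral>\<^sup>+om. ennreal (Max ((%t. \<bar>X t om\<bar>) ` T)) \<partial>M) <= ennreal (17 * A * D / \<beta>)"
proof -
 define L where "L k = (%t. (\<pi> k t, \<pi> (Suc k) t)) ` T" for k
 define Y where "Y q om = X (snd q) om - X (fst q) om" for q om
 have finL: "finite (L k)" "L k ~= {}" for k unfolding L_def using T by auto
 have c1: "card (\<pi> k ` T) >= 1" for k using T by (simp add: Suc_le_eq card_gt_0_iff)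
 have b0: "(\<integral>\<^sup>+om. ennreal (Max ((%s. \<bar>X s om\<bar>) ` (\<pi> 0 ` T))) \<partial>M) <= ennreal (3 * A * D / \<beta>)"
 proof -
  have "(\<integral>\<^sup>+om. ennreal (Max ((%s. \<bar>X s om\<bar>) ` (\<pi> 0 ` T))) \<partial>M) <= ennreal ((A + ln (real (card (\<pi> 0 ` T))) + 1) / (\<beta> / D))"
   by (rule nn_integral_Max_le) (use T lam D A meas base in auto)
  also have "... <= ennreal ((3 * A) / (\<beta> / D))"
   using card[of 0] A lam D by (intro ennreal_leI divide_right_mono) auto
  finally show ?thesis using lam D by simp
 qed
 have bk: "(\<integral>\<^sup>+om. ennreal (Max ((%q. \<bar>Y q om\<bar>) ` L k)) \<partial>M) <= ennreal ((2 * real k + 5) / 2 ^ k * (A * D / \<beta>))"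
  if k: "k < K" for k
 proof -
  have "card (L k) <= card (\<pi> k ` T \<times> \<pi> (Suc k) ` T)"
   unfolding L_def using T by (intro card_mono) auto
  then have "ln (real (card (L k))) <= ln (real (card (\<pi> k ` T) * card (\<pi> (Suc k) ` T)))"
   using finL[of k] by (subst ln_le_cancel_iff) (auto simp: card_gt_0_iff card_cartesian_product c1 T simp flip: of_nat_mult)
  also have "... = ln (real (card (\<pi> k ` T))) + ln (real (card (\<pi> (Suc k) ` T)))"
   using c1[of k] c1[of "Suc k"] by (simp add: ln_mult)
  also have "... <= A * (2 * real k + 3)"
   using card[of k] card[of "Suc k"] k by (simp add: algebra_simps)
  finally have lnL: "ln (real (card (L k))) <= A * (2 * real k + 3)" .
  have "(\<integral>\<^sup>+om. ennreal (Max ((%q. \<bar>Y q om\<bar>) ` L k)) \<partial>M) <= ennreal ((A + ln (real (card (L k))) + 1) / (\<beta> * 2 ^ k / D))"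
  proof (rule nn_integral_Max_le)
   show "Y q \<in> borel_measurable M" if "q \<in> L k" for q
   using that k meas unfolding L_def Y_def by (auto intro!: borel_measurable_diff)
   show "(\<integral>\<^sup>+ om. ennreal (exp (\<beta> * 2 ^ k / D * \<bar>Y q om\<bar>)) \<partial>M) <= ennreal (exp A)" if "q \<in> L k" for q
   using that link[OF k] unfolding L_def Y_def by auto
  qed (use finL lam D A in auto)
  also have "... <= ennreal ((A * (2 * real k + 5)) / (\<beta> * 2 ^ k / D))"
   using lnL A lam D by (intro ennreal_leI divide_right_mono) (auto simp: algebra_simps)
  also have "(A * (2 * real k + 5)) / (\<beta> * 2 ^ k / D) = (2 * real k + 5) / 2 ^ k * (A * D / \<beta>)"
   using lam D by (simp add: field_simps)
  finally show ?thesis .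
 qed
 have pw: "Max ((%t. \<bar>X t om\<bar>) ` T) <= Max ((%s. \<bar>X s om\<bar>) ` (\<pi> 0 ` T)) + (\<Sum>k<K. Max ((%q. \<bar>Y q om\<bar>) ` L k))" for om
 proof -
  have "\<bar>X t om\<bar> <= Max ((%s. \<bar>X s om\<bar>) ` (\<pi> 0 ` T)) + (\<Sum>k<K. Max ((%q. \<bar>Y q om\<bar>) ` L k))" if t: "t \<in> T" for t
  proof -
   have "X (\<pi> K t) om = X (\<pi> 0 t) om + (\<Sum>k<K. X (\<pi> (Suc k) t) om - X (\<pi> k t) om)"
   by (simp add: sum_lessThan_telescope[of "%k. X (\<pi> k t) om" K])
   then have "\<bar>X (\<pi> K t) om\<bar> <= \<bar>X (\<pi> 0 t) om\<bar> + (\<Sum>k<K. \<bar>X (\<pi> (Suc k) t) om - X (\<pi> k t) om\<bar>)"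
   using abs_triangle_ineq[of "X (\<pi> 0 t) om" "\<Sum>k<K. X (\<pi> (Suc k) t) om - X (\<pi> k t) om"]
   sum_abs[of "%k. X (\<pi> (Suc k) t) om - X (\<pi> k t) om" "{..<K}"] by linarith
   also have "... <= Max ((%s. \<bar>X s om\<bar>) ` (\<pi> 0 ` T)) + (\<Sum>k<K. Max ((%q. \<bar>Y q om\<bar>) ` L k))"
   proof (intro add_mono sum_mono)
   show "\<bar>X (\<pi> 0 t) om\<bar> <= Max ((%s. \<bar>X s om\<bar>) ` (\<pi> 0 ` T))"
   using T t by (intro Max_ge) auto
   show "\<bar>X (\<pi> (Suc k) t) om - X (\<pi> k t) om\<bar> <= Max ((%q. \<bar>Y q om\<bar>) ` L k)" for k
   using T t by (intro Max_ge) (auto simp: L_def Y_def image_iff)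
   qed
   finally show ?thesis by (simp add: top[OF t])
  qed
  then show ?thesis using T by simp
 qed
 have mMax: "(%om. Max ((%i. \<bar>F i om\<bar>) ` I)) \<in> borel_measurable M"
  if "finite I" "I ~= {}" "!!i. i \<in> I ==> F i \<in> borel_measurable M" for F :: "'i => 'a => real" and I
  using that by (intro borel_measurable_Max) auto
 have m0: "(%om. Max ((%s. \<bar>X s om\<bar>) ` (\<pi> 0 ` T))) \<in> borel_measurable M"
  using T meas by (intro mMax) auto
 have mk: "(%om. Max ((%q. \<bar>Y q om\<bar>) ` L k)) \<in> borel_measurable M" if "k < K" for k
 proof (intro mMax finL)
  show "Y q \<in> borel_measurable M" if "q \<in> L k" for q
   using that \<open>k < K\<close> meas unfolding L_def Y_def by (auto intro!: borel_measurable_diff)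
 qed
 have pos0: "0 <= Max ((%s. \<bar>X s om\<bar>) ` (\<pi> 0 ` T))" for om
  using T by (subst Max_ge_iff) auto
 have posk: "0 <= Max ((%q. \<bar>Y q om\<bar>) ` L k)" for k om
  using finL[of k] by (subst Max_ge_iff) auto
 have "(\<integral>\<^sup>+om. ennreal (Max ((%t. \<bar>X t om\<bar>) ` T)) \<partial>M)
   <= (\<integral>\<^sup>+om. ennreal (Max ((%s. \<bar>X s om\<bar>) ` (\<pi> 0 ` T))) + (\<Sum>k<K. ennreal (Max ((%q. \<bar>Y q om\<bar>) ` L k))) \<partial>M)"
  using pw pos0 posk by (intro nn_integral_mono) (simp add: sum_nonneg ennreal_plus[symmetric] ennreal_leI del: ennreal_plus)
 also have "... = (\<integral>\<^sup>+om. ennreal (Max ((%s. \<bar>X s om\<bar>) ` (\<pi> 0 ` T))) \<partial>M) + (\<Sum>k<K. \<integral>\<^sup>+om. ennreal (Max ((%q. \<bar>Y q om\<bar>) ` L k)) \<partial>M)"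
  using m0 mk by (subst nn_integral_add, simp, simp, subst nn_integral_sum) auto
 also have "... <= ennreal (3 * A * D / \<beta>) + (\<Sum>k<K. ennreal ((2 * real k + 5) / 2 ^ k * (A * D / \<beta>)))"
  using b0 bk by (intro add_mono sum_mono) auto
 also have "... = ennreal (3 * (A * D / \<beta>) + (\<Sum>k<K. (2 * real k + 5) / 2 ^ k) * (A * D / \<beta>))"
  using A D lam by (simp add: ennreal_plus[symmetric] sum_nonneg sum_distrib_right sum_divide_distrib mult.assoc del: ennreal_plus)
 also have "... <= ennreal (3 * (A * D / \<beta>) + 14 * (A * D / \<beta>))"
 proof (intro ennreal_leI add_left_mono mult_right_mono)
  show "(\<Sum>k<K. (2 * real k + 5) / 2 ^ k) <= 14"
   using sum_geom_linear[of K] by (rule order_trans) simp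
 qed (use A D lam in auto)
 also have "3 * (A * D / \<beta>) + 14 * (A * D / \<beta>) = 17 * A * D / \<beta>" by simp
 finally show ?thesis .
qed

end

section \<open>Rademacher chaos indexed by VC classes\<close>

text \<open>A Rademacher vector is encoded by the set of indices with sign -1, so that expectations
  over signs become averages over \<open>Pow J\<close>.\<close>

definition sg :: "'i set => 'i => real" where
 "sg si i = (if i \<in> si then -1 else 1)"

lemma sg_sq [simp]: "sg si i * sg si i = 1" "\<bar>sg si i\<bar> = 1" by (auto simp: sg_def)

text \<open>Independence of the signs, as the expansion of a product of two-term sums.\<close>

lemma sum_Pow_prod:
 assumes "finite J"
 shows "(\<Sum>si\<in>Pow J. \<Prod>i\<in>J. g i (i \<in> si)) = (\<Prod>i\<in>J. g i True + g i False :: 'a::comm_semiring_1)"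
proof -
 have "(\<Prod>i\<in>J. g i (i \<in> si)) = (\<Prod>i\<in>si. g i True) * (\<Prod>i\<in>J-si. g i False)" if "si \<in> Pow J" for si
 proof -
  have "(\<Prod>i\<in>J. g i (i \<in> si)) = (\<Prod>i\<in>J-si. g i (i \<in> si)) * (\<Prod>i\<in>si. g i (i \<in> si))"
   using assms that by (intro prod.subset_diff) auto
  then show ?thesis by (simp add: mult.commute)
 qed
 then show ?thesis using prod_add[OF assms, of "%i. g i True" "%i. g i False"] by simp
qed

lemma exp_sums_real: "(%k. (x::real) ^ k / fact k) sums exp x"
 using exp_converges[of x] by (simp only: real_scaleR_def divide_inverse_commute[of _ "fact _"])

text \<open>Comparison of the power series coefficient by coefficient, from 2^k k! <= (2k)!.\<close>

lemma cosh_le_exp_sq: "cosh (x::real) <= exp (x\<^sup>2 / 2)"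
proof -
 have "(%n. if even n then x ^ n /\<^sub>R fact n else 0) sums cosh x" by (rule cosh_converges)
 then have "(%k. (if even (2*k) then x ^ (2*k) /\<^sub>R fact (2*k) else 0)) sums cosh x"
  by (subst sums_mono_reindex[of "%k. 2 * k"]) (auto simp: strict_mono_def elim!: evenE)
 then have 1: "(%k. x ^ (2*k) / fact (2*k)) sums cosh x" by (simp add: divide_inverse mult.commute)
 have 2: "(%k. (x\<^sup>2 / 2) ^ k / fact k) sums exp (x\<^sup>2 / 2)" by (rule exp_sums_real)
 have "x ^ (2*k) / fact (2*k) <= (x\<^sup>2 / 2) ^ k / fact k" for k
 proof -
  have "2 ^ k * fact k <= (fact (2 * k) :: real)"
  proof (induction k)
   case (Suc k)
   have "2 ^ Suc k * fact (Suc k) = (2 * real k + 2) * (2 ^ k * fact k :: real)" by (simp add: algebra_simps)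
   also have "... <= (2 * real k + 2) * fact (2 * k)" using Suc by (intro mult_left_mono) auto
   also have "... <= (2 * real k + 2) * ((2 * real k + 1) * fact (2 * k))" by (intro mult_left_mono) (auto simp: mult_le_cancel_right1)
   also have "... = fact (2 * Suc k)" by (simp add: algebra_simps)
   finally show ?case .
  qed simp
  then have "x ^ (2*k) / fact (2*k) <= x ^ (2*k) / (2 ^ k * fact k)"
   by (intro divide_left_mono) (auto simp: power_mult)
  then show ?thesis by (simp add: power_mult power_divide)
 qed
 then show ?thesis using sums_le[OF _ 1 2] by blast
qed

lemma sum_exp_sg:
 assumes "finite J"
 shows "(\<Sum>si\<in>Pow J. exp (\<Sum>i\<in>J. sg si i * a i)) <= 2 ^ card J * exp ((\<Sum>i\<in>J. (a i)\<^sup>2) / 2)"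
proof -
 have "(\<Sum>si\<in>Pow J. exp (\<Sum>i\<in>J. sg si i * a i)) = (\<Sum>si\<in>Pow J. \<Prod>i\<in>J. (%b. exp (if b then - a i else a i)) (i \<in> si))"
  using assms by (intro sum.cong refl) (auto simp: exp_sum sg_def intro!: prod.cong)
 also have "... = (\<Prod>i\<in>J. exp (- a i) + exp (a i))"
  by (subst sum_Pow_prod[OF assms, where g = "%i b. exp (if b then - a i else a i)"]) simp
 also have "... = (\<Prod>i\<in>J. 2 * cosh (a i))" by (intro prod.cong refl) (simp add: cosh_field_def)
 also have "... <= (\<Prod>i\<in>J. 2 * exp ((a i)\<^sup>2 / 2))"
  by (intro prod_mono) (auto intro: cosh_le_exp_sq)
 also have "... = 2 ^ card J * exp ((\<Sum>i\<in>J. (a i)\<^sup>2) / 2)"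
  using assms by (simp add: prod.distrib exp_sum sum_divide_distrib)
 finally show ?thesis .
qed

text \<open>Comparing the term of degree \<open>2k\<close> in the cosh series at \<open>t\<^sup>2 = 2k\<close> bounds the moment of that order.\<close>

lemma sum_power_sg:
 assumes J: "finite J" and a: "(\<Sum>i\<in>J. (a i)\<^sup>2) <= 1"
 shows "(\<Sum>si\<in>Pow J. (\<Sum>i\<in>J. sg si i * a i) ^ (2 * k)) <= 2 ^ card J * (fact k * exp 1 ^ k)"
proof (cases "k = 0")
 case True
 then show ?thesis using J by (simp add: card_Pow)
next
 case False
 define t where "t = sqrt (2 * real k)"
 have t: "t > 0" "t\<^sup>2 = 2 * real k" using False by (auto simp: t_def)
 have trm: "(t * y) ^ (2 * k) / fact (2 * k) <= cosh (t * y)" for y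
 proof -
  have s: "(%n. if even n then (t * y) ^ n /\<^sub>R fact n else 0) sums cosh (t * y)" by (rule cosh_converges)
  have "(\<Sum>n\<in>{2*k}. if even n then (t * y) ^ n /\<^sub>R fact n else 0) <= (\<Sum>n. if even n then (t * y) ^ n /\<^sub>R fact n else 0)"
   using s by (intro sum_le_suminf) (auto simp: sums_iff zero_le_even_power)
  then show ?thesis using s by (simp add: sums_iff divide_inverse mult.commute)
 qed
 define Y where "Y si = (\<Sum>i\<in>J. sg si i * a i)" for si
 have Y: "t * Y si = (\<Sum>i\<in>J. sg si i * (t * a i))" "- (\<Sum>i\<in>J. sg si i * (t * a i)) = (\<Sum>i\<in>J. sg si i * (- t * a i))" for si
  unfolding Y_def by (simp_all add: sum_distrib_left mult_ac sum_negf)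
 have "t ^ (2*k) / fact (2*k) * (\<Sum>si\<in>Pow J. Y si ^ (2 * k)) = (\<Sum>si\<in>Pow J. (t * Y si) ^ (2 * k) / fact (2 * k))"
  by (simp add: sum_distrib_left power_mult_distrib)
 also have "... <= (\<Sum>si\<in>Pow J. cosh (t * Y si))" by (intro sum_mono trm)
 also have "... = ((\<Sum>si\<in>Pow J. exp (\<Sum>i\<in>J. sg si i * (t * a i))) + (\<Sum>si\<in>Pow J. exp (\<Sum>i\<in>J. sg si i * (- t * a i)))) / 2"
  unfolding cosh_field_def Y by (simp only: sum.distrib sum_divide_distrib[symmetric])
 also have "... <= (2 ^ card J * exp ((\<Sum>i\<in>J. (t * a i)\<^sup>2) / 2) + 2 ^ card J * exp ((\<Sum>i\<in>J. (- t * a i)\<^sup>2) / 2)) / 2"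
  by (intro divide_right_mono add_mono sum_exp_sg J) auto
 also have "... = 2 ^ card J * exp (t\<^sup>2 * (\<Sum>i\<in>J. (a i)\<^sup>2) / 2)"
  by (simp add: power_mult_distrib sum_distrib_left)
 also have "... <= 2 ^ card J * exp (t\<^sup>2 * 1 / 2)" using a by (intro mult_left_mono iffD2[OF exp_le_cancel_iff] divide_right_mono) auto
 also have "... = 2 ^ card J * exp 1 ^ k" by (simp add: t(2) exp_of_nat_mult flip: exp_of_nat2_mult)
 finally have "(\<Sum>si\<in>Pow J. Y si ^ (2 * k)) <= 2 ^ card J * exp 1 ^ k * (fact (2*k) / t ^ (2*k))"
  using t(1) by (simp add: field_simps)
 also have "fact (2*k) / t ^ (2*k) <= fact k"
 proof -
  have "fact (2*k) div fact (2*k - k) <= (2*k) ^ k" by (rule fact_div_fact_le_pow) simp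
  moreover have "(fact (2*k)::nat) = fact (2*k) div fact k * fact k"
   by (rule sym, rule dvd_div_mult_self, rule fact_dvd) simp
  ultimately have "(fact (2*k)::nat) <= (2*k) ^ k * fact k"
   by (metis mult_le_mono1 mult_2 add_diff_cancel_right')
  then have "(fact (2*k)::real) <= (2*real k) ^ k * fact k"
   by (metis (mono_tags) of_nat_fact of_nat_le_iff of_nat_mult of_nat_numeral of_nat_power)
  moreover have "t ^ (2*k) = (2*real k) ^ k" using t(2) by (simp add: power_mult)
  ultimately show ?thesis using False by (simp add: divide_le_eq mult.commute)
 qed
 finally show ?thesis by (simp add: Y_def mult_left_mono mult_ac)
qed

text \<open>The moments of \<open>sum_power_sg\<close>, divided by (2e)^k k!, are at most 2^(-k);
  summing the exponential series gives the factor 2.\<close>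

lemma sum_exp_sq_sg:
 assumes J: "finite J" and a: "(\<Sum>i\<in>J. (a i)\<^sup>2) <= 1"
 shows "(\<Sum>si\<in>Pow J. exp ((\<Sum>i\<in>J. sg si i * a i)\<^sup>2 / (2 * exp 1))) <= 2 * 2 ^ card J"
proof -
 define Y where "Y si = (\<Sum>i\<in>J. sg si i * a i)" for si
 have "(%k. ((Y si)\<^sup>2 / (2 * exp 1)) ^ k / fact k) sums exp ((Y si)\<^sup>2 / (2 * exp 1))" for si by (rule exp_sums_real)
 then have s1: "(%k. \<Sum>si\<in>Pow J. ((Y si)\<^sup>2 / (2 * exp 1)) ^ k / fact k) sums (\<Sum>si\<in>Pow J. exp ((Y si)\<^sup>2 / (2 * exp 1)))"
  by (intro sums_sum)
 have s2: "(%k. 2 ^ card J * (1 / 2 :: real) ^ k) sums (2 ^ card J * (1 / (1 - 1 / 2)))"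
  by (rule sums_mult[OF geometric_sums]) simp
 have "(\<Sum>si\<in>Pow J. ((Y si)\<^sup>2 / (2 * exp 1)) ^ k / fact k) <= 2 ^ card J * (1 / 2) ^ k" for k
 proof -
  have "(\<Sum>si\<in>Pow J. ((Y si)\<^sup>2 / (2 * exp 1)) ^ k / fact k) = (\<Sum>si\<in>Pow J. Y si ^ (2 * k)) / ((2 * exp 1) ^ k * fact k)"
   by (simp add: power_divide power_mult sum_divide_distrib)
  also have "... <= (2 ^ card J * (fact k * exp 1 ^ k)) / ((2 * exp 1) ^ k * fact k)"
   unfolding Y_def by (intro divide_right_mono sum_power_sg J a) auto
  also have "... = 2 ^ card J * (1 / 2) ^ k" by (simp add: power_mult_distrib power_divide)
  finally show ?thesis .
 qed
 then have "(\<Sum>si\<in>Pow J. exp ((Y si)\<^sup>2 / (2 * exp 1))) <= 2 ^ card J * (1 / (1 - 1 / 2))"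
  using sums_le[OF _ s1 s2] by blast
 then show ?thesis unfolding Y_def by simp
qed

section \<open>Exponential moments of quadratic forms in signs\<close>

lemma sum_Pow_split:
 assumes "finite J" "I \<subseteq> J"
 shows "(\<Sum>si\<in>Pow J. F (si \<inter> I) (si - I)) = (\<Sum>si1\<in>Pow I. \<Sum>si2\<in>Pow (J - I). F si1 si2 :: 'a::comm_monoid_add)"
proof -
 have "(\<Sum>si1\<in>Pow I. \<Sum>si2\<in>Pow (J - I). F si1 si2) = (\<Sum>q\<in>Pow I \<times> Pow (J - I). F (fst q) (snd q))"
  by (simp add: sum.cartesian_product case_prod_beta)
 also have "... = (\<Sum>si\<in>Pow J. F (si \<inter> I) (si - I))"
  by (rule sum.reindex_bij_witness[of _ "%si. (si \<inter> I, si - I)" "%q. fst q \<union> snd q"])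
   (use assms in \<open>auto intro!: arg_cong2[where f=F]\<close>)
 finally show ?thesis by simp
qed

text \<open>Conditionally on the signs in \<open>I\<close> the form is linear in the others; its conditional variance is a
 weighted average of squared linear forms, so Jensen's inequality reduces to the scalar case.\<close>

lemma sum_exp_decoupled:
 assumes J: "finite J" "I \<subseteq> J" and a: "(\<Sum>i\<in>I. \<Sum>j\<in>J-I. (a i j)\<^sup>2) <= 1 / exp 1"
 shows "(\<Sum>si\<in>Pow J. exp (\<Sum>i\<in>I. \<Sum>j\<in>J-I. sg si i * sg si j * a i j)) <= 2 * 2 ^ card J"
proof -
 have fin: "finite I" "finite (J - I)" using J by (auto dest: finite_subset)
 define b where "b si j = (\<Sum>i\<in>I. sg si i * a i j)" for si j
 define v where "v j = (\<Sum>i\<in>I. (a i j)\<^sup>2)" for j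
 \<comment> \<open>The factor e matches \<open>sum_exp_sq_sg\<close>: w j times (b / sqrt (v j))^2 /
   (2e) is exactly b^2 / 2.\<close>
 define w where "w j = exp 1 * v j" for j
 have v0: "v j >= 0" for j by (simp add: v_def sum_nonneg)
 have w0: "w j >= 0" for j by (simp add: w_def v0)
 have w1: "(\<Sum>j\<in>J-I. w j) <= 1"
 proof -
  have "(\<Sum>j\<in>J-I. w j) = exp 1 * (\<Sum>i\<in>I. \<Sum>j\<in>J-I. (a i j)\<^sup>2)"
   unfolding w_def v_def sum_distrib_left[symmetric] by (subst sum.swap) simp
  also have "... <= exp 1 * (1 / exp 1)" using a by (intro mult_left_mono) auto
  finally show ?thesis by simp
 qed
 have jensen: "exp ((\<Sum>j\<in>J-I. (b si j)\<^sup>2) / 2) <= (\<Sum>j\<in>J-I. w j * exp ((b si j / sqrt (v j))\<^sup>2 / (2 * exp 1))) + (1 - (\<Sum>j\<in>J-I. w j))" for si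
 proof -
  \<comment> \<open>The extra point \<open>None\<close>, with value 0, takes up the mass missing
    from the weights w, so that Jensen applies to a probability vector.\<close>
  define S where "S = insert None (Some ` (J - I))"
  define u where "u k = (case k of None => 1 - (\<Sum>j\<in>J-I. w j) | Some j => w j)" for k
  define y where "y k = (case k of None => 0 | Some j => (b si j / sqrt (v j))\<^sup>2 / (2 * exp 1))" for k
  have sumS: "(\<Sum>k\<in>S. g k) = g None + (\<Sum>j\<in>J-I. g (Some j))" for g :: "'a option => real"
   unfolding S_def using fin by (subst sum.insert) (auto simp: sum.reindex)
  have cvx: "exp (\<Sum>k\<in>S. u k *\<^sub>R y k) <= (\<Sum>k\<in>S. u k * exp (y k))"
   by (rule convex_on_sum[OF _ _ exp_convex]) (use fin w0 w1 in \<open>auto simp: S_def u_def sumS[unfolded S_def] split: option.splits\<close>)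
  have lhs: "(\<Sum>k\<in>S. u k *\<^sub>R y k) = (\<Sum>j\<in>J-I. (b si j)\<^sup>2) / 2"
   unfolding sumS u_def y_def sum_divide_distrib
  proof (simp, intro sum.cong refl)
   fix j assume "j \<in> J - I"
   show "w j * (b si j / sqrt (v j))\<^sup>2 / (2 * exp 1) = (b si j)\<^sup>2 / 2"
   proof (cases "v j = 0")
   \<comment> \<open>Here b vanishes together with v, and division by \<open>sqrt 0\<close> gives 0,
     so both sides are 0.\<close>
   case True
   then have "\<forall>i\<in>I. a i j = 0" using fin by (simp add: v_def sum_nonneg_eq_0_iff)
   then show ?thesis using True by (simp add: b_def)
   next
   case False
   then show ?thesis using v0[of j] by (simp add: w_def power_divide)
   qed
  qed
  show ?thesis using cvx unfolding lhs by (simp add: sumS u_def y_def)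
 qed
 have "(\<Sum>si\<in>Pow J. exp (\<Sum>i\<in>I. \<Sum>j\<in>J-I. sg si i * sg si j * a i j))
   = (\<Sum>si\<in>Pow J. (%s t. exp (\<Sum>j\<in>J-I. sg t j * b s j)) (si \<inter> I) (si - I))"
 proof (intro sum.cong refl)
  fix si assume "si \<in> Pow J"
  have "sg (si \<inter> I) i = sg si i" if "i \<in> I" for i using that by (simp add: sg_def)
  moreover have "sg (si - I) j = sg si j" if "j \<in> J - I" for j using that by (simp add: sg_def)
  ultimately show "exp (\<Sum>i\<in>I. \<Sum>j\<in>J-I. sg si i * sg si j * a i j) = (%s t. exp (\<Sum>j\<in>J-I. sg t j * b s j)) (si \<inter> I) (si - I)"
   unfolding b_def sum_distrib_left
   by (subst sum.swap) (simp, intro sum.cong refl, simp)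
 qed
 also have "... = (\<Sum>s\<in>Pow I. \<Sum>t\<in>Pow (J - I). exp (\<Sum>j\<in>J-I. sg t j * b s j))"
  by (rule sum_Pow_split[OF J])
 also have "... <= (\<Sum>s\<in>Pow I. 2 ^ card (J - I) * exp ((\<Sum>j\<in>J-I. (b s j)\<^sup>2) / 2))"
  by (intro sum_mono sum_exp_sg fin)
 also have "... <= (\<Sum>s\<in>Pow I. 2 ^ card (J - I) * ((\<Sum>j\<in>J-I. w j * exp ((b s j / sqrt (v j))\<^sup>2 / (2 * exp 1))) + (1 - (\<Sum>j\<in>J-I. w j))))"
  by (intro sum_mono mult_left_mono jensen) auto
 also have "... = 2 ^ card (J - I) * ((\<Sum>j\<in>J-I. w j * (\<Sum>s\<in>Pow I. exp ((b s j / sqrt (v j))\<^sup>2 / (2 * exp 1)))) + 2 ^ card I * (1 - (\<Sum>j\<in>J-I. w j)))"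
  using fin by (simp add: sum_distrib_left[symmetric] sum.distrib card_Pow, subst sum.swap, simp add: sum_distrib_left)
 also have "... <= 2 ^ card (J - I) * ((\<Sum>j\<in>J-I. w j * (2 * 2 ^ card I)) + 2 ^ card I * (1 - (\<Sum>j\<in>J-I. w j)))"
 proof (intro mult_left_mono add_mono sum_mono w0)
  fix j assume "j \<in> J - I"
  have "b s j / sqrt (v j) = (\<Sum>i\<in>I. sg s i * (a i j / sqrt (v j)))" for s by (simp add: b_def sum_divide_distrib)
  moreover have "(\<Sum>i\<in>I. (a i j / sqrt (v j))\<^sup>2) <= 1"
   using v0[of j] unfolding power_divide sum_divide_distrib[symmetric] v_def[symmetric] by simp
  ultimately show "(\<Sum>s\<in>Pow I. exp ((b s j / sqrt (v j))\<^sup>2 / (2 * exp 1))) <= 2 * 2 ^ card I"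
   using sum_exp_sq_sg[OF fin(1), of "%i. a i j / sqrt (v j)"] by simp
 qed auto
 also have "... = 2 ^ card (J - I) * 2 ^ card I * (1 + (\<Sum>j\<in>J-I. w j))"
  by (simp add: sum_distrib_right[symmetric] algebra_simps)
 also have "... <= 2 ^ card (J - I) * 2 ^ card I * 2" using w1 by (intro mult_left_mono) auto
 also have "(2::real) ^ card (J - I) * 2 ^ card I = 2 ^ card J"
  using J fin by (simp add: card_Diff_subset card_mono flip: power_add)
 finally show ?thesis by simp
qed

lemma sum_Pow_cut:
 assumes "finite J" "i \<in> J" "j \<in> J" "i ~= j"
 shows "(\<Sum>I\<in>Pow J. if i \<in> I \<and> j \<notin> I then 1 else 0) = (2 ^ card J / 4 :: real)"
proof -
 define g where "g k b = (if k = i then of_bool b else if k = j then of_bool (\<not> b) else (1::real))" for k b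
 have JJ: "J = insert i (insert j (J - {i, j}))" using assms by auto
 have pr: "(\<Prod>k\<in>J. h k) = h i * (h j * (\<Prod>k\<in>J - {i, j}. h k))" for h :: "'a => real"
  using assms by (subst JJ) simp
 have c: "card J = Suc (Suc (card (J - {i, j})))"
  using assms by (subst JJ) simp
 have "(\<Sum>I\<in>Pow J. if i \<in> I \<and> j \<notin> I then 1 else 0) = (\<Sum>I\<in>Pow J. \<Prod>k\<in>J. g k (k \<in> I))"
  unfolding pr using assms(4) by (intro sum.cong refl) (auto simp: g_def intro!: prod.neutral)
 also have "... = (\<Prod>k\<in>J. g k True + g k False)" by (rule sum_Pow_prod[OF assms(1)])
 also have "... = (\<Prod>k\<in>J - {i, j}. 2)" 
 proof -
  have "(\<Prod>k\<in>J - {i, j}. g k True + g k False) = (\<Prod>k\<in>J - {i, j}. 2)"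
   by (intro prod.cong) (auto simp: g_def)
  then show ?thesis unfolding pr using assms(4) by (simp add: g_def)
 qed
 also have "... = 2 ^ card J / 4" by (simp add: c)
 finally show ?thesis .
qed

text \<open>Half of the off-diagonal pairs in expectation are cut by a random \<open>I\<close>, one quarter in the order
 (in, out): hence the factor 4 in the decoupling.\<close>

lemma sum_exp_chaos:
 assumes J: "finite J" and a: "(\<Sum>i\<in>J. \<Sum>j\<in>J-{i}. (a i j)\<^sup>2) <= 1"
 shows "(\<Sum>si\<in>Pow J. exp (1/7 * (\<Sum>i\<in>J. \<Sum>j\<in>J-{i}. sg si i * sg si j * a i j))) <= 2 * 2 ^ card J"
proof -
 define N where "N = (2 ^ card J :: real)"
 have N: "N > 0" by (simp add: N_def)
 have cut: "(\<Sum>i\<in>J. \<Sum>j\<in>J-{i}. c i j) = (\<Sum>I\<in>Pow J. (1 / N) * (4 * (\<Sum>i\<in>I. \<Sum>j\<in>J-I. c i j)))" for c :: "'a => 'a => real"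
 proof -
  have "(\<Sum>i\<in>I. \<Sum>j\<in>J-I. c i j) = (\<Sum>i\<in>J. \<Sum>j\<in>J-{i}. if i \<in> I \<and> j \<notin> I then c i j else 0)" if I: "I \<in> Pow J" for I
  proof -
   have "(\<Sum>j\<in>J-{i}. if i \<in> I \<and> j \<notin> I then c i j else 0) = (if i \<in> I then \<Sum>j\<in>J-I. c i j else 0)" for i
   using J by (auto intro!: sum.mono_neutral_cong_right)
   then show ?thesis using I J by (simp add: sum.If_cases Int_absorb1)
  qed
  then have "(\<Sum>I\<in>Pow J. \<Sum>i\<in>I. \<Sum>j\<in>J-I. c i j) = (\<Sum>I\<in>Pow J. \<Sum>i\<in>J. \<Sum>j\<in>J-{i}. if i \<in> I \<and> j \<notin> I then c i j else 0)" by simp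
  also have "... = (\<Sum>i\<in>J. \<Sum>I\<in>Pow J. \<Sum>j\<in>J-{i}. if i \<in> I \<and> j \<notin> I then c i j else 0)" by (rule sum.swap)
  also have "... = (\<Sum>i\<in>J. \<Sum>j\<in>J-{i}. \<Sum>I\<in>Pow J. if i \<in> I \<and> j \<notin> I then c i j else 0)"
   by (intro sum.cong refl) (rule sum.swap)
  also have "... = (\<Sum>i\<in>J. \<Sum>j\<in>J-{i}. c i j * (N / 4))"
  proof (intro sum.cong refl)
   fix i j assume ij: "i \<in> J" "j \<in> J - {i}"
   have "(\<Sum>I\<in>Pow J. if i \<in> I \<and> j \<notin> I then c i j else 0) = c i j * (\<Sum>I\<in>Pow J. if i \<in> I \<and> j \<notin> I then 1 else 0)"
   unfolding sum_distrib_left by (intro sum.cong) auto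
   also have "... = c i j * (N / 4)" using sum_Pow_cut[OF J, of i j] ij by (auto simp: N_def)
   finally show "(\<Sum>I\<in>Pow J. if i \<in> I \<and> j \<notin> I then c i j else 0) = c i j * (N / 4)" .
  qed
  finally have "(\<Sum>I\<in>Pow J. \<Sum>i\<in>I. \<Sum>j\<in>J-I. c i j) = (\<Sum>i\<in>J. \<Sum>j\<in>J-{i}. c i j) * (N / 4)"
   unfolding sum_distrib_right .
  then show ?thesis using N
   unfolding sum_distrib_left[symmetric] by (simp add: field_simps)
 qed
 \<comment> \<open>The origin of 1/7: decoupling multiplies it by 4, and (4/7)^2 = 16/49 is below
   1/3 <= 1/e, the variance that \<open>sum_exp_decoupled\<close> allows.\<close>
 have sub: "(\<Sum>i\<in>I. \<Sum>j\<in>J-I. (4/7 * a i j)\<^sup>2) <= 1 / exp 1" if I: "I \<in> Pow J" for I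
 proof -
  have "(\<Sum>i\<in>I. \<Sum>j\<in>J-I. (a i j)\<^sup>2) <= (\<Sum>i\<in>J. \<Sum>j\<in>J-{i}. (a i j)\<^sup>2)"
  proof -
   have "(\<Sum>i\<in>I. \<Sum>j\<in>J-I. (a i j)\<^sup>2) <= (\<Sum>i\<in>I. \<Sum>j\<in>J-{i}. (a i j)\<^sup>2)"
   using I J by (intro sum_mono sum_mono2) auto
   also have "... <= (\<Sum>i\<in>J. \<Sum>j\<in>J-{i}. (a i j)\<^sup>2)"
   using I J by (intro sum_mono2) (auto intro: sum_nonneg)
   finally show ?thesis .
  qed
  then have "(\<Sum>i\<in>I. \<Sum>j\<in>J-I. (4/7 * a i j)\<^sup>2) <= 16 / 49"
   unfolding power_mult_distrib sum_distrib_left[symmetric] using a by (simp add: power2_eq_square)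
  also have "... <= 1 / exp 1" using exp_le by (simp add: field_simps)
  finally show ?thesis .
 qed
 have "exp (1/7 * (\<Sum>i\<in>J. \<Sum>j\<in>J-{i}. sg si i * sg si j * a i j))
   <= (\<Sum>I\<in>Pow J. 1 / N * exp (\<Sum>i\<in>I. \<Sum>j\<in>J-I. sg si i * sg si j * (4/7 * a i j)))" for si
 proof -
  have "1/7 * (\<Sum>i\<in>J. \<Sum>j\<in>J-{i}. sg si i * sg si j * a i j) = (\<Sum>I\<in>Pow J. (1 / N) *\<^sub>R (\<Sum>i\<in>I. \<Sum>j\<in>J-I. sg si i * sg si j * (4/7 * a i j)))"
   by (subst cut) (simp add: sum_distrib_left mult_ac)
  also have "exp ... <= (\<Sum>I\<in>Pow J. 1 / N * exp (\<Sum>i\<in>I. \<Sum>j\<in>J-I. sg si i * sg si j * (4/7 * a i j)))"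
   by (rule convex_on_sum[OF _ _ exp_convex]) (use J in \<open>auto simp: N_def card_Pow\<close>)
  finally show ?thesis .
 qed
 then have "(\<Sum>si\<in>Pow J. exp (1/7 * (\<Sum>i\<in>J. \<Sum>j\<in>J-{i}. sg si i * sg si j * a i j)))
   <= (\<Sum>si\<in>Pow J. \<Sum>I\<in>Pow J. 1 / N * exp (\<Sum>i\<in>I. \<Sum>j\<in>J-I. sg si i * sg si j * (4/7 * a i j)))"
  by (intro sum_mono)
 also have "... = (\<Sum>I\<in>Pow J. 1 / N * (\<Sum>si\<in>Pow J. exp (\<Sum>i\<in>I. \<Sum>j\<in>J-I. sg si i * sg si j * (4/7 * a i j))))"
  by (subst sum.swap) (simp add: sum_distrib_left)
 also have "... <= (\<Sum>I\<in>Pow J. 1 / N * (2 * 2 ^ card J))"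
  using N by (intro sum_mono mult_left_mono sum_exp_decoupled[OF J] sub) auto
 also have "... = 2 * 2 ^ card J" using J N by (simp add: card_Pow N_def)
 finally show ?thesis .
qed

section \<open>Suprema of signed sums over VC classes\<close>

lemma maximal_separated:
 assumes "finite F" "!!A B. sep A B \<longleftrightarrow> sep B A"
 shows "\<exists>S\<subseteq>F. (\<forall>A\<in>S. \<forall>B\<in>S. A ~= B --> sep A B) \<and> (\<forall>A\<in>F. \<exists>B\<in>S. A = B \<or> \<not> sep A B)"
 using assms(1)
proof (induction F rule: finite_induct)
 case (insert x F)
 then obtain S where S: "S \<subseteq> F" "\<forall>A\<in>S. \<forall>B\<in>S. A ~= B --> sep A B" "\<forall>A\<in>F. \<exists>B\<in>S. A = B \<or> \<not> sep A B"
  by blast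
 show ?case
 proof (cases "\<forall>B\<in>S. sep x B")
  case True
  then show ?thesis using S assms(2) by (intro exI[of _ "insert x S"]) blast
 next
  case False
  then have "\<forall>A\<in>insert x F. \<exists>B\<in>S. A = B \<or> \<not> sep A B" using S(3) by auto
  then show ?thesis using S(1,2) by (intro exI[of _ S] conjI) auto
 qed
qed blast

lemma traced_subset: "traced F A ==> F \<subseteq> G ==> traced G A"
 unfolding traced_def by (meson subsetD)

text \<open>The common frame of two processes: \<open>\<kappa> om e\<close> is a product of two
  signs for the degenerate part and a single sign for the linear part. What is kept of them is the
  exponential moment for coefficient vectors of Euclidean norm at most 1 and the bound by 1.\<close>

locale signed_process = prob_space +
 fixes E :: "'e set" and \<kappa> :: "'a => 'e => real" and \<beta> A :: real
 assumes E: "finite E" "E ~= {}" and \<beta>: "\<beta> > 0" and A: "A >= 1"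
  and \<kappa>_meas [measurable]: "!!e. e \<in> E ==> (%om. \<kappa> om e) \<in> borel_measurable M"
  and \<kappa>_le: "!!om e. e \<in> E ==> \<bar>\<kappa> om e\<bar> <= 1"
  and mgf: "!!b. (\<Sum>e\<in>E. (b e)\<^sup>2) <= 1 ==> (\<integral>\<^sup>+om. ennreal (exp (\<beta> * \<bar>\<Sum>e\<in>E. \<kappa> om e * b e\<bar>)) \<partial>M) <= ennreal (exp A)"
begin

definition m where "m = real (card E)"

lemma m: "m >= 1" using E by (simp add: m_def Suc_le_eq card_gt_0_iff)

text \<open>Chaining in the Euclidean distance of indicators, the square root of the size of the
  symmetric difference. Nets at resolution m 4^(-k) have logarithmic size at most 4 (d + 1)(k + 1)
  by the packing bound, and consecutive projections differ in at most 4 m 4^(-k) points. The scale D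
  = 2 sqrt m turns 17 into 34.\<close>

lemma nn_integral_Max_sets:
 assumes F: "F \<subseteq> Pow E" "F ~= {}"
  and vc: "!!B. B \<subseteq> E ==> traced F B ==> card B <= d" and Ad: "4 * (real d + 1) <= A"
 shows "(\<integral>\<^sup>+om. ennreal (Max ((%C. \<bar>\<Sum>e\<in>C. \<kappa> om e\<bar>) ` F)) \<partial>M) <= ennreal (34 * A * sqrt m / \<beta>)"
proof -
 define X where "X C om = (\<Sum>e\<in>C. \<kappa> om e)" for C om
 define Dl where "Dl B C = {e\<in>E. e \<in> B \<longleftrightarrow> e \<notin> C}" for B C
 have finF: "finite F" using F E by (meson finite_Pow_iff finite_subset)
 have finDl: "finite (Dl B C)" for B C using E by (simp add: Dl_def)
 have Dl_tri: "real (card (Dl B D)) <= real (card (Dl B C)) + real (card (Dl C D))" for B C D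
 proof -
  have "card (Dl B D) <= card (Dl B C \<union> Dl C D)" using finDl by (intro card_mono) (auto simp: Dl_def)
  also have "... <= card (Dl B C) + card (Dl C D)" by (rule card_Un_le)
  finally show ?thesis by simp
 qed
 have Dl_sym: "Dl B C = Dl C B" for B C by (auto simp: Dl_def)
 define sep where "sep k B C \<longleftrightarrow> (1/4) ^ k * m <= real (card (Dl B C))" for k B C
 \<comment> \<open>A maximal separated family is also a net: separation bounds its size through
   packing, and maximality puts a member within distance m 4^(-k) of every set.\<close>
 have "\<exists>S\<subseteq>F. (\<forall>B\<in>S. \<forall>C\<in>S. B ~= C --> sep k B C) \<and> (\<forall>B\<in>F. \<exists>C\<in>S. B = C \<or> \<not> sep k B C)" for k
  by (rule maximal_separated[OF finF]) (simp add: sep_def Dl_sym)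
 then obtain S where S: "!!k. S k \<subseteq> F" "!!k B C. B \<in> S k ==> C \<in> S k ==> B ~= C ==> sep k B C"
  "!!k B. B \<in> F ==> \<exists>C\<in>S k. B = C \<or> \<not> sep k B C"
  by metis
 define \<pi> where "\<pi> k B = (SOME C. C \<in> S k \<and> (B = C \<or> \<not> sep k B C))" for k B
 have \<pi>: "\<pi> k B \<in> S k \<and> (B = \<pi> k B \<or> \<not> sep k B (\<pi> k B))" if "B \<in> F" for k B
  unfolding \<pi>_def by (rule someI_ex) (use S(3)[OF that, of k] in blast)
 have near: "real (card (Dl B (\<pi> k B))) <= (1/4) ^ k * m" if "B \<in> F" for k B
 proof (cases "B = \<pi> k B")
  case True
  then have "Dl B (\<pi> k B) = {}" by (auto simp: Dl_def)
  then show ?thesis using m by simp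
 next
  case False
  then show ?thesis using \<pi>[OF that, of k] by (auto simp: sep_def)
 qed
 \<comment> \<open>Once 4^K > m, a difference of at most m / 4^K points is less than one point,
   hence empty.\<close>
 obtain K where K: "m < 4 ^ K" using real_arch_pow[of 4 m] by auto
 have top: "\<pi> K B = B" if "B \<in> F" for B
 proof -
  have "real (card (Dl B (\<pi> K B))) < 1"
  proof -
   have "(1/4) ^ K * m < 1" using K by (simp add: power_one_over field_simps)
   then show ?thesis using near[OF that, of K] by linarith
  qed
  then have "Dl B (\<pi> K B) = {}" using finDl by simp
  moreover have "B \<subseteq> E" "\<pi> K B \<subseteq> E" using \<pi>[OF that, of K] S(1)[of K] F that by auto
  ultimately show ?thesis unfolding Dl_def by blast
 qed
 have mgf': "(\<integral>\<^sup>+om. ennreal (exp (\<beta> * c * \<bar>\<Sum>e\<in>E. \<kappa> om e * b e\<bar>)) \<partial>M) <= ennreal (exp A)"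
  if "c >= 0" "c\<^sup>2 * (\<Sum>e\<in>E. (b e)\<^sup>2) <= 1" for c b
 proof -
  have "(\<integral>\<^sup>+om. ennreal (exp (\<beta> * \<bar>\<Sum>e\<in>E. \<kappa> om e * (c * b e)\<bar>)) \<partial>M) <= ennreal (exp A)"
   using that by (intro mgf) (simp add: power_mult_distrib sum_distrib_left)
  moreover have "\<bar>\<Sum>e\<in>E. \<kappa> om e * (c * b e)\<bar> = c * \<bar>\<Sum>e\<in>E. \<kappa> om e * b e\<bar>" for om
  proof -
   have "(\<Sum>e\<in>E. \<kappa> om e * (c * b e)) = c * (\<Sum>e\<in>E. \<kappa> om e * b e)"
   unfolding sum_distrib_left by (intro sum.cong refl) simp
   then show ?thesis using that(1) by (simp add: abs_mult)
  qed
  ultimately show ?thesis by (simp add: mult.assoc)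
 qed
 have Xd: "X B om = (\<Sum>e\<in>E. \<kappa> om e * of_bool (e \<in> B))" if "B \<subseteq> E" for B om
  using that E by (simp add: X_def sum.If_cases of_bool_def if_distrib Int_absorb1 cong: if_cong)
 have sub: "\<pi> k B \<subseteq> E" if "B \<in> F" for k B using \<pi>[OF that, of k] S(1)[of k] F by auto
 have meas: "X B \<in> borel_measurable M" if "B \<subseteq> E" for B
  unfolding X_def using that by (intro borel_measurable_sum) auto
 have "(\<integral>\<^sup>+om. ennreal (Max ((%C. \<bar>X C om\<bar>) ` F)) \<partial>M) <= ennreal (17 * A * (2 * sqrt m) / \<beta>)"
 proof (rule nn_integral_chaining[where \<pi> = \<pi> and K = K])
  show "2 * sqrt m > 0" using m by simp
  show "(\<integral>\<^sup>+om. ennreal (exp (\<beta> / (2 * sqrt m) * \<bar>X (\<pi> 0 t) om\<bar>)) \<partial>M) <= ennreal (exp A)" if "t \<in> F" for t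
  proof -
   have "(\<Sum>e\<in>E. (of_bool (e \<in> \<pi> 0 t) :: real)\<^sup>2) <= (\<Sum>e\<in>E. 1)" by (intro sum_mono) auto
   then have "(1 / (2 * sqrt m))\<^sup>2 * (\<Sum>e\<in>E. (of_bool (e \<in> \<pi> 0 t) :: real)\<^sup>2) <= (1 / (2 * sqrt m))\<^sup>2 * m"
   by (intro mult_left_mono) (auto simp: m_def)
   also have "... <= 1" using m by (simp add: power_divide power_mult_distrib)
   finally have "(1 / (2 * sqrt m))\<^sup>2 * (\<Sum>e\<in>E. (of_bool (e \<in> \<pi> 0 t) :: real)\<^sup>2) <= 1" .
   from mgf'[OF _ this] show ?thesis using m by (simp add: Xd[OF sub[OF that]])
  qed
  show "(\<integral>\<^sup>+om. ennreal (exp (\<beta> * 2 ^ k / (2 * sqrt m) * \<bar>X (\<pi> (Suc k) t) om - X (\<pi> k t) om\<bar>)) \<partial>M) <= ennreal (exp A)"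
   if "k < K" "t \<in> F" for k t
  proof -
   define b :: "'e => real" where "b e = of_bool (e \<in> \<pi> (Suc k) t) - of_bool (e \<in> \<pi> k t)" for e
   have "(\<Sum>e\<in>E. (b e)\<^sup>2) = (\<Sum>e\<in>E. if e \<in> Dl (\<pi> (Suc k) t) (\<pi> k t) then 1 else 0)"
   by (intro sum.cong) (auto simp: b_def Dl_def)
   also have "... = real (card (Dl (\<pi> (Suc k) t) (\<pi> k t)))"
   using E by (simp add: sum.If_cases Int_def) (simp add: Dl_def)
   also have "... <= (1/4) ^ Suc k * m + (1/4) ^ k * m"
   using Dl_tri[of "\<pi> (Suc k) t" "\<pi> k t" t] near[OF that(2), of k] near[OF that(2), of "Suc k"]
   unfolding Dl_sym[of "\<pi> (Suc k) t" t] by linarith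
   also have "... <= 4 * m * (1/4) ^ k" using m by (simp add: field_simps)
   finally have bb: "(\<Sum>e\<in>E. (b e)\<^sup>2) <= 4 * m * (1/4) ^ k" .
   have c2: "(2 ^ k / (2 * sqrt m))\<^sup>2 = 4 ^ k / (4 * m)"
   using m by (simp add: power_divide power_mult_distrib power2_eq_square flip: power_mult_distrib)
   have "(2 ^ k / (2 * sqrt m))\<^sup>2 * (\<Sum>e\<in>E. (b e)\<^sup>2) <= (2 ^ k / (2 * sqrt m))\<^sup>2 * (4 * m * (1/4) ^ k)"
   using bb by (intro mult_left_mono) auto
   also have "... = 1" unfolding c2 using m by (simp add: power_one_over)
   finally have "(2 ^ k / (2 * sqrt m))\<^sup>2 * (\<Sum>e\<in>E. (b e)\<^sup>2) <= 1" .
   from mgf'[OF _ this] have "(\<integral>\<^sup>+om. ennreal (exp (\<beta> * (2 ^ k / (2 * sqrt m)) * \<bar>\<Sum>e\<in>E. \<kappa> om e * b e\<bar>)) \<partial>M) <= ennreal (exp A)"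
   using m by simp
   moreover have "X (\<pi> (Suc k) t) om - X (\<pi> k t) om = (\<Sum>e\<in>E. \<kappa> om e * b e)" for om
   unfolding Xd[OF sub[OF that(2)]] b_def by (simp add: sum_subtractf right_diff_distrib)
   ultimately show ?thesis by simp
  qed
  show "ln (real (card (\<pi> k ` F))) <= A * (real k + 1)" if "k <= K" for k
  proof -
   have c: "\<pi> k ` F \<subseteq> S k" using \<pi> by auto
   have finS: "finite (S k)" using S(1)[of k] finF finite_subset by blast
   have ne: "S k ~= {}" using c F by auto
   have "ln (real (card (\<pi> k ` F))) <= ln (real (card (S k)))"
   using c finS F finF by (subst ln_le_cancel_iff) (auto simp: card_gt_0_iff intro: card_mono)
   also have "... <= 1 / 2 + 2 * real d * ln (4 / (1/4) ^ k)"
   proof (rule separated_family_card[OF E(1)])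
   show "S k \<subseteq> Pow E" using S(1)[of k] F by auto
   show "card B <= d" if "B \<subseteq> E" "traced (S k) B" for B
   using vc[OF that(1) traced_subset[OF that(2) S(1)]] .
   show "(1/4) ^ k * real (card E) <= real (card {e\<in>E. e \<in> B \<longleftrightarrow> e \<notin> C})" if "B \<in> S k" "C \<in> S k" "B ~= C" for B C
   using S(2)[OF that] by (simp add: sep_def Dl_def m_def)
   qed (use ne in \<open>auto simp: power_le_one\<close>)
   also have "4 / (1/4) ^ k = (4::real) ^ (k + 1)" by (simp add: power_one_over)
   also have "ln ((4::real) ^ (k + 1)) = (real k + 1) * ln 4" by (subst ln_realpow) (simp_all add: add.commute)
   also have "1 / 2 + 2 * real d * ((real k + 1) * ln 4) <= 4 * (real d + 1) * (real k + 1)"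
   proof -
   have "ln (4::real) <= 2"
   proof -
   have "ln (4::real) = ln (2 ^ 2)" by simp
   also have "... = 2 * ln 2" by (subst ln_realpow) simp_all
   finally show ?thesis using ln_le_minus_one[of "2::real"] by simp
   qed
   then have "2 * real d * ((real k + 1) * ln 4) <= 2 * real d * ((real k + 1) * 2)" by (intro mult_left_mono) auto
   then show ?thesis by (simp add: algebra_simps)
   qed
   also have "... <= A * (real k + 1)" using Ad by (intro mult_right_mono) auto
   finally show ?thesis .
  qed
  show "X (\<pi> k t) \<in> borel_measurable M" if "t \<in> F" for k t using sub[OF that] by (rule meas)
 qed (use finF F \<beta> A top in auto)
 then show ?thesis by (simp add: X_def mult.assoc)
qed

text \<open>A function with values in \<open>[-C, C]\<close> is, up to \<open>2C/N\<close>, the average of \<open>N\<close> indicators of its strict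
 superlevel sets.\<close>

lemma nn_integral_Max_functions:
 fixes f :: "'p => 'e => real"
 assumes T: "finite T" "T ~= {}" and C: "C > 0" and fC: "!!\<theta> e. \<theta> \<in> T ==> e \<in> E ==> \<bar>f \<theta> e\<bar> <= C"
  and vc: "!!t B. B \<subseteq> E ==> (!!D. D \<subseteq> B ==> \<exists>\<theta>\<in>T. {e\<in>B. t < f \<theta> e} = D) ==> card B <= d"
  and Ad: "4 * (real d + 1) <= A"
 shows "(\<integral>\<^sup>+om. ennreal (Max ((%\<theta>. \<bar>\<Sum>e\<in>E. \<kappa> om e * f \<theta> e\<bar>) ` T)) \<partial>M) <= ennreal (102 * A * C * sqrt m / \<beta>)"
proof (rule ennreal_le_epsilon)
 fix \<epsilon> :: real assume \<epsilon>: "\<epsilon> > 0"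
 define B0 where "B0 = 34 * A * sqrt m / \<beta>"
 have B0: "B0 >= 0" using A \<beta> m by (simp add: B0_def)
 obtain N :: nat where N: "N > 0" "2 * C * m / real N <= \<epsilon>"
 proof -
  obtain N :: nat where "2 * C * m / \<epsilon> < real N" using reals_Archimedean2 by blast
  then show ?thesis using that[of "Suc N"] \<epsilon> C m by (simp add: field_simps)
 qed
 define t where "t k = 2 * C * real k / real N - C" for k :: nat
 define F where "F k = (%\<theta>. {e\<in>E. t k < f \<theta> e}) ` T" for k
 define X where "X S om = (\<Sum>e\<in>S. \<kappa> om e)" for S om
 define MX where "MX k om = Max ((%S. \<bar>X S om\<bar>) ` F k)" for k om
 have FP: "F k \<subseteq> Pow E" "F k ~= {}" "finite (F k)" for k using T by (auto simp: F_def)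
 have layer: "\<bar>f \<theta> e - (- C + 2 * C / real N * (\<Sum>k\<in>{1..N}. of_bool (t k < f \<theta> e)))\<bar> <= 2 * C / real N"
  if "\<theta> \<in> T" "e \<in> E" for \<theta> e
 proof -
  define y where "y = real N * (f \<theta> e + C) / (2 * C)"
  have "0 <= f \<theta> e + C" "f \<theta> e + C <= 2 * C" using fC[OF that] by (auto simp: abs_le_iff)
  then have y: "0 <= y" "y <= real N" using C by (auto simp: y_def divide_le_eq mult_left_mono)
  have fy: "f \<theta> e = - C + 2 * C / real N * y" using C N by (simp add: y_def field_simps)
  have "t k < f \<theta> e \<longleftrightarrow> real k < y" for k using C N by (simp add: fy t_def field_simps)
  then have "(\<Sum>k\<in>{1..N}. of_bool (t k < f \<theta> e)) = (\<Sum>k\<in>{1..N}. if real k < y then 1 else (0::real))"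
   by (simp add: of_bool_def)
  also have "... = real (card {k\<in>{1..N}. real k < y})"
   by (simp add: sum.If_cases Int_def)
  also have "{k\<in>{1..N}. real k < y} = {1..<nat \<lceil>y\<rceil>}"
  proof -
   have "real k < y \<longleftrightarrow> k < nat \<lceil>y\<rceil>" for k
   using less_ceiling_iff[of "int k" y] by (simp add: zless_nat_eq_int_zless)
   moreover have "k <= N" if "real k < y" for k using that y(2) by simp
   ultimately show ?thesis by (auto simp: Suc_le_eq)
  qed
  finally have cnt: "(\<Sum>k\<in>{1..N}. of_bool (t k < f \<theta> e)) = real (nat \<lceil>y\<rceil> - 1)" by simp
  have "\<bar>y - real (nat \<lceil>y\<rceil> - 1)\<bar> <= 1"
  proof (cases "nat \<lceil>y\<rceil> = 0")
   case True then show ?thesis using y by simp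
  next
   case False
   then have "real (nat \<lceil>y\<rceil> - 1) = of_int \<lceil>y\<rceil> - 1" by linarith
   then show ?thesis using ceiling_correct[of y] by linarith
  qed
  then have "2 * C / real N * \<bar>y - real (nat \<lceil>y\<rceil> - 1)\<bar> <= 2 * C / real N * 1" using C by (intro mult_left_mono) auto
  also have "2 * C / real N * \<bar>y - real (nat \<lceil>y\<rceil> - 1)\<bar> = \<bar>2 * C / real N * (y - real (nat \<lceil>y\<rceil> - 1))\<bar>" using C by (simp add: abs_mult)
  finally show ?thesis unfolding cnt by (subst fy) (simp add: right_diff_distrib)
 qed
 have pw: "Max ((%\<theta>. \<bar>\<Sum>e\<in>E. \<kappa> om e * f \<theta> e\<bar>) ` T) <= C * Max ((%S. \<bar>X S om\<bar>) ` {E}) + (2 * C / real N * (\<Sum>k\<in>{1..N}. MX k om) + \<epsilon>)" for om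
 proof -
  have "\<bar>\<Sum>e\<in>E. \<kappa> om e * f \<theta> e\<bar> <= C * \<bar>X E om\<bar> + (2 * C / real N * (\<Sum>k\<in>{1..N}. MX k om) + \<epsilon>)" if \<theta>: "\<theta> \<in> T" for \<theta>
  proof -
   define g where "g e = - C + 2 * C / real N * (\<Sum>k\<in>{1..N}. of_bool (t k < f \<theta> e))" for e
   have "(\<Sum>e\<in>E. \<kappa> om e * f \<theta> e) = (\<Sum>e\<in>E. \<kappa> om e * g e) + (\<Sum>e\<in>E. \<kappa> om e * (f \<theta> e - g e))"
   by (simp add: sum.distrib[symmetric] algebra_simps)
   moreover have "\<bar>\<Sum>e\<in>E. \<kappa> om e * (f \<theta> e - g e)\<bar> <= \<epsilon>"
   proof -
   have "\<bar>\<Sum>e\<in>E. \<kappa> om e * (f \<theta> e - g e)\<bar> <= (\<Sum>e\<in>E. 1 * (2 * C / real N))"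
   proof (rule order_trans[OF sum_abs], rule sum_mono)
   fix e assume e: "e \<in> E"
   show "\<bar>\<kappa> om e * (f \<theta> e - g e)\<bar> <= 1 * (2 * C / real N)"
   unfolding abs_mult using \<kappa>_le[OF e] layer[OF \<theta> e] by (intro mult_mono) (auto simp: g_def)
   qed
   also have "... = 2 * C * m / real N" by (simp add: m_def)
   finally show ?thesis using N by linarith
   qed
   moreover have "(\<Sum>e\<in>E. \<kappa> om e * g e) = - C * X E om + 2 * C / real N * (\<Sum>k\<in>{1..N}. X {e\<in>E. t k < f \<theta> e} om)"
   proof -
   have XX: "(\<Sum>e\<in>E. \<kappa> om e * of_bool (t k < f \<theta> e)) = X {e\<in>E. t k < f \<theta> e} om" for k
   using E by (simp add: X_def of_bool_def if_distrib sum.If_cases Int_def cong: if_cong)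
   have "(\<Sum>e\<in>E. \<kappa> om e * g e) = - C * X E om + (\<Sum>e\<in>E. \<Sum>k\<in>{1..N}. 2 * C / real N * (\<kappa> om e * of_bool (t k < f \<theta> e)))"
   proof -
   have "\<kappa> om e * g e = - C * \<kappa> om e + (\<Sum>k\<in>{1..N}. 2 * C / real N * (\<kappa> om e * of_bool (t k < f \<theta> e)))" for e
   proof -
   have *: "\<kappa> om e * (- C + c * S) = - C * \<kappa> om e + c * (\<kappa> om e * S)" for c S :: real by (simp add: algebra_simps)
   show ?thesis unfolding g_def sum_distrib_left[symmetric] by (rule *)
   qed
   then show ?thesis unfolding X_def by (simp only: sum.distrib sum_distrib_left)
   qed
   also have "(\<Sum>e\<in>E. \<Sum>k\<in>{1..N}. 2 * C / real N * (\<kappa> om e * of_bool (t k < f \<theta> e))) = (\<Sum>k\<in>{1..N}. \<Sum>e\<in>E. 2 * C / real N * (\<kappa> om e * of_bool (t k < f \<theta> e)))"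
   by (rule sum.swap)
   also have "... = 2 * C / real N * (\<Sum>k\<in>{1..N}. \<Sum>e\<in>E. \<kappa> om e * of_bool (t k < f \<theta> e))"
   by (simp only: sum_distrib_left)
   finally show ?thesis by (simp only: XX)
   qed
   moreover have "\<bar>2 * C / real N * (\<Sum>k\<in>{1..N}. X {e\<in>E. t k < f \<theta> e} om)\<bar> <= 2 * C / real N * (\<Sum>k\<in>{1..N}. MX k om)"
   proof -
   have "\<bar>\<Sum>k\<in>{1..N}. X {e\<in>E. t k < f \<theta> e} om\<bar> <= (\<Sum>k\<in>{1..N}. MX k om)"
   unfolding MX_def using FP \<theta> by (intro order_trans[OF sum_abs] sum_mono Max_ge) (auto simp: F_def)
   then show ?thesis using C by (simp add: abs_mult mult_left_mono divide_right_mono)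
   qed
   moreover have "\<bar>- C * X E om\<bar> = C * \<bar>X E om\<bar>" using C by (simp add: abs_mult)
   ultimately show ?thesis by linarith
  qed
  then show ?thesis using T by simp
 qed
 have mX: "X S \<in> borel_measurable M" if "S \<subseteq> E" for S
  unfolding X_def using that by (intro borel_measurable_sum) auto
 have mMX: "MX k \<in> borel_measurable M" for k
  unfolding MX_def using FP[of k] by (intro borel_measurable_Max borel_measurable_abs mX) auto
 have MX0: "MX k om >= 0" for k om unfolding MX_def using FP[of k] by (subst Max_ge_iff) auto
 \<comment> \<open>The class {E} shatters only the empty set, so the bound for sets also covers the
   constant term.\<close>
 have bE: "(\<integral>\<^sup>+om. ennreal (Max ((%S. \<bar>X S om\<bar>) ` {E})) \<partial>M) <= ennreal B0"
  unfolding B0_def X_def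
 proof (rule nn_integral_Max_sets[OF _ _ _ Ad])
  fix B assume "B \<subseteq> E" "traced {E} B"
  then have "E \<inter> B = {}" unfolding traced_def by blast
  then have "B = {}" using \<open>B \<subseteq> E\<close> by auto
  then show "card B <= d" by simp
 qed auto
 have bF: "(\<integral>\<^sup>+om. ennreal (MX k om) \<partial>M) <= ennreal B0" for k
  unfolding B0_def X_def MX_def
 proof (rule nn_integral_Max_sets[OF FP(1,2) _ Ad])
  fix B assume B: "B \<subseteq> E" "traced (F k) B"
  show "card B <= d"
  proof (rule vc[OF B(1)])
   fix D assume "D \<subseteq> B"
   then obtain \<theta> where \<theta>: "\<theta> \<in> T" "{e\<in>E. t k < f \<theta> e} \<inter> B = D" using B(2) unfolding traced_def F_def by auto
   then have "{e\<in>B. t k < f \<theta> e} = D" using B(1) by auto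
   then show "\<exists>\<theta>\<in>T. {e\<in>B. t k < f \<theta> e} = D" using \<theta> by auto
  qed
 qed
 have "(\<integral>\<^sup>+om. ennreal (Max ((%\<theta>. \<bar>\<Sum>e\<in>E. \<kappa> om e * f \<theta> e\<bar>) ` T)) \<partial>M)
  <= (\<integral>\<^sup>+om. ennreal C * ennreal (Max ((%S. \<bar>X S om\<bar>) ` {E})) + (ennreal (2 * C / real N) * (\<Sum>k\<in>{1..N}. ennreal (MX k om)) + ennreal \<epsilon>) \<partial>M)"
 proof (intro nn_integral_mono)
  fix om
  have 1: "0 <= 2 * C / real N * (\<Sum>k\<in>{1..N}. MX k om)" using MX0 C by (intro mult_nonneg_nonneg sum_nonneg) auto
  have "ennreal (Max ((%\<theta>. \<bar>\<Sum>e\<in>E. \<kappa> om e * f \<theta> e\<bar>) ` T)) <= ennreal (C * Max ((%S. \<bar>X S om\<bar>) ` {E}) + (2 * C / real N * (\<Sum>k\<in>{1..N}. MX k om) + \<epsilon>))"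
   by (intro ennreal_leI pw)
  also have "... = ennreal (C * Max ((%S. \<bar>X S om\<bar>) ` {E})) + (ennreal (2 * C / real N * (\<Sum>k\<in>{1..N}. MX k om)) + ennreal \<epsilon>)"
   using 1 C \<epsilon> by (subst ennreal_plus, simp, simp, subst ennreal_plus) auto
  also have "... = ennreal C * ennreal (Max ((%S. \<bar>X S om\<bar>) ` {E})) + (ennreal (2 * C / real N) * (\<Sum>k\<in>{1..N}. ennreal (MX k om)) + ennreal \<epsilon>)"
   using C MX0 by (subst ennreal_mult, simp, simp, subst ennreal_mult) (auto intro!: sum_nonneg)
  finally show "ennreal (Max ((%\<theta>. \<bar>\<Sum>e\<in>E. \<kappa> om e * f \<theta> e\<bar>) ` T)) <= ennreal C * ennreal (Max ((%S. \<bar>X S om\<bar>) ` {E})) + (ennreal (2 * C / real N) * (\<Sum>k\<in>{1..N}. ennreal (MX k om)) + ennreal \<epsilon>)" .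
 qed
 also have "... = ennreal C * (\<integral>\<^sup>+om. ennreal (Max ((%S. \<bar>X S om\<bar>) ` {E})) \<partial>M) + (ennreal (2 * C / real N) * (\<Sum>k\<in>{1..N}. \<integral>\<^sup>+om. ennreal (MX k om) \<partial>M) + ennreal \<epsilon>)"
  using mX[of E] mMX by (simp add: nn_integral_add nn_integral_cmult nn_integral_sum emeasure_space_1)
 also have "... <= ennreal C * ennreal B0 + (ennreal (2 * C / real N) * (\<Sum>k\<in>{1..N}. ennreal B0) + ennreal \<epsilon>)"
  by (intro add_mono mult_left_mono sum_mono bE bF order_refl) auto
 also have "... = ennreal (C * B0 + 2 * C / real N * (real N * B0)) + ennreal \<epsilon>"
  using C B0 by (simp add: ennreal_mult[symmetric] ennreal_plus[symmetric] ennreal_of_nat_eq_real_of_nat add.assoc del: ennreal_plus)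
 \<comment> \<open>One share of C B0 for the lower end -C of the range and two for the layers: 102 =
   3 * 34.\<close>
 also have "C * B0 + 2 * C / real N * (real N * B0) = 102 * A * C * sqrt m / \<beta>" using N by (simp add: B0_def)
 finally show "(\<integral>\<^sup>+om. ennreal (Max ((%\<theta>. \<bar>\<Sum>e\<in>E. \<kappa> om e * f \<theta> e\<bar>) ` T)) \<partial>M) <= ennreal (102 * A * C * sqrt m / \<beta>) + ennreal \<epsilon>" .
qed

end

section \<open>Signed sums at a sign-dependent parameter\<close>

lemma nn_integral_uniform:
 assumes "finite S" "S ~= {}" "!!x. x \<in> S ==> g x >= (0::real)"
 shows "(\<integral>\<^sup>+x. ennreal (g x) \<partial>measure_pmf (pmf_of_set S)) = ennreal ((\<Sum>x\<in>S. g x) / real (card S))"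
proof -
 have c: "card S > 0" using assms by (simp add: card_gt_0_iff)
 have "(\<integral>\<^sup>+x. ennreal (g x) \<partial>measure_pmf (pmf_of_set S)) = (\<Sum>x\<in>S. ennreal (g x)) / ennreal (real (card S))"
  using assms(1,2) by (subst nn_integral_pmf_of_set) (auto simp: ennreal_of_nat_eq_real_of_nat)
 then show ?thesis using assms c by (simp add: divide_ennreal sum_nonneg)
qed

definition offdiag :: "'i set => ('i \<times> 'i) set" where
 "offdiag J = {(i, j). i \<in> J \<and> j \<in> J \<and> i ~= j}"

lemma sum_offdiag:
 assumes "finite J"
 shows "(\<Sum>e\<in>offdiag J. F (fst e) (snd e)) = (\<Sum>i\<in>J. \<Sum>j\<in>J-{i}. F i j :: 'a::comm_monoid_add)"
proof -
 have "offdiag J = Sigma J (%i. J - {i})" by (auto simp: offdiag_def)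
 then show ?thesis using assms by (simp add: sum.Sigma case_prod_beta)
qed

lemma card_offdiag: "finite J ==> finite (offdiag J) \<and> card (offdiag J) <= card J * card J"
proof -
 assume J: "finite J"
 have "offdiag J \<subseteq> J \<times> J" by (auto simp: offdiag_def)
 then show ?thesis using J card_mono[of "J \<times> J" "offdiag J"] by (auto simp: card_cartesian_product intro: finite_subset)
qed

lemma offdiag_ne: "2 <= card J ==> offdiag J ~= {}"
proof -
 assume "2 <= card J"
 then obtain i j where "i \<in> J" "j \<in> J" "i ~= j"
  by (metis card_le_Suc0_iff_eq card.infinite not_less_eq_eq numeral_2_eq_2 zero_le)
 then show ?thesis by (auto simp: offdiag_def)
qed

text \<open>The parameter may be an arbitrary function \<open>ch\<close> of the signs: its values
  form a finite set T, each term is at most the maximum over T, and T inherits the VC bound because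
  shattering by T is shattering by the whole class. This is what later accommodates an estimator
  that depends on the data. With A = 4 (d + 1) the constant becomes 408 = 4 * 102.\<close>

lemma sum_choice_le:
 fixes f :: "'p => 'i => 'i => real" and \<kappa> :: "'i set => 'i \<times> 'i => real"
 assumes J: "finite J" "2 <= card J" and C: "C > 0" and fC: "!!\<theta> i j. \<bar>f \<theta> i j\<bar> <= C"
  and vc: "!!t B. B \<subseteq> offdiag J ==> (!!D. D \<subseteq> B ==> \<exists>\<theta>. {e\<in>B. t < f \<theta> (fst e) (snd e)} = D) ==> card B <= d"
  and \<beta>: "\<beta> > 0" and \<kappa>: "!!si e. \<bar>\<kappa> si e\<bar> <= 1"
  and mgf: "!!b. (\<Sum>e\<in>offdiag J. (b e)\<^sup>2) <= 1 ==>
   (\<Sum>si\<in>Pow J. exp (\<beta> * (\<Sum>e\<in>offdiag J. \<kappa> si e * b e))) <= 2 ^ card J * (exp (4 * (real d + 1)) / 2)"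
 shows "(\<Sum>si\<in>Pow J. \<bar>\<Sum>e\<in>offdiag J. \<kappa> si e * f (ch si) (fst e) (snd e)\<bar>) <= 2 ^ card J * (408 * C * (real d + 1) * real (card J) / \<beta>)"
proof -
 define A where "A = 4 * (real d + 1)"
 have PJ: "finite (Pow J)" "Pow J ~= {}" "real (card (Pow J)) = 2 ^ card J" using J by (auto simp: card_Pow)
 interpret signed_process "measure_pmf (pmf_of_set (Pow J))" "offdiag J" \<kappa> \<beta> A
 proof (unfold_locales)
  fix b :: "'i \<times> 'i => real" assume b: "(\<Sum>e\<in>offdiag J. (b e)\<^sup>2) <= 1"
  define Y where "Y si = (\<Sum>e\<in>offdiag J. \<kappa> si e * b e)" for si
  \<comment> \<open>The factor 1/2 in \<open>mgf\<close> pays for the two signs of the absolute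
    value.\<close>
  have "(\<Sum>si\<in>Pow J. exp (\<beta> * \<bar>Y si\<bar>)) <= (\<Sum>si\<in>Pow J. exp (\<beta> * Y si) + exp (\<beta> * - Y si))"
   by (intro sum_mono) (auto simp: abs_if)
  also have "... <= 2 ^ card J * (exp A / 2) + 2 ^ card J * (exp A / 2)"
   unfolding sum.distrib
  proof (rule add_mono)
   show "(\<Sum>si\<in>Pow J. exp (\<beta> * Y si)) <= 2 ^ card J * (exp A / 2)"
   using mgf[OF b] by (simp add: Y_def A_def)
   have "(\<Sum>si\<in>Pow J. exp (\<beta> * (\<Sum>e\<in>offdiag J. \<kappa> si e * - b e))) <= 2 ^ card J * (exp A / 2)"
   unfolding A_def using b by (intro mgf) simp
   then show "(\<Sum>si\<in>Pow J. exp (\<beta> * - Y si)) <= 2 ^ card J * (exp A / 2)" by (simp add: Y_def sum_negf)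
  qed
  finally have "(\<Sum>si\<in>Pow J. exp (\<beta> * \<bar>Y si\<bar>)) / real (card (Pow J)) <= exp A"
   unfolding PJ by (simp add: divide_le_eq mult.commute)
  then have "(\<integral>\<^sup>+si. ennreal (exp (\<beta> * \<bar>Y si\<bar>)) \<partial>measure_pmf (pmf_of_set (Pow J))) <= ennreal (exp A)"
   by (subst nn_integral_uniform) (use PJ in \<open>auto intro: ennreal_leI\<close>)
  then show "(\<integral>\<^sup>+si. ennreal (exp (\<beta> * \<bar>\<Sum>e\<in>offdiag J. \<kappa> si e * b e\<bar>)) \<partial>measure_pmf (pmf_of_set (Pow J))) <= ennreal (exp A)"
   by (simp add: Y_def)
 qed (use card_offdiag[OF J(1)] offdiag_ne[OF J(2)] \<beta> \<kappa> in \<open>auto simp: A_def\<close>)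
 define T where "T = ch ` Pow J"
 have T: "finite T" "T ~= {}" using PJ by (auto simp: T_def)
 define g where "g si \<theta> = \<bar>\<Sum>e\<in>offdiag J. \<kappa> si e * f \<theta> (fst e) (snd e)\<bar>" for si \<theta>
 have "(\<integral>\<^sup>+si. ennreal (Max (g si ` T)) \<partial>measure_pmf (pmf_of_set (Pow J))) <= ennreal (102 * A * C * sqrt m / \<beta>)"
  unfolding g_def
 proof (rule nn_integral_Max_functions[OF T C])
  fix t B assume "B \<subseteq> offdiag J" "!!D. D \<subseteq> B ==> \<exists>\<theta>\<in>T. {e\<in>B. t < f \<theta> (fst e) (snd e)} = D"
  then show "card B <= d" by (intro vc[of B t]) blast+
 qed (use fC in \<open>auto simp: A_def\<close>)
 moreover have "ennreal ((\<Sum>si\<in>Pow J. g si (ch si)) / 2 ^ card J) <= (\<integral>\<^sup>+si. ennreal (Max (g si ` T)) \<partial>measure_pmf (pmf_of_set (Pow J)))"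
 proof -
  have ge: "g si (ch si) <= Max (g si ` T)" if "si \<in> Pow J" for si using T that by (intro Max_ge) (auto simp: T_def)
  have g0: "0 <= g si \<theta>" for si \<theta> by (simp add: g_def)
  have "(\<Sum>si\<in>Pow J. g si (ch si)) / 2 ^ card J <= (\<Sum>si\<in>Pow J. Max (g si ` T)) / real (card (Pow J))"
   unfolding PJ by (intro divide_right_mono sum_mono ge) auto
  then show ?thesis
   by (subst nn_integral_uniform) (use PJ g0 ge order_trans in \<open>auto intro!: ennreal_leI order_trans[OF g0 ge]\<close>)
 qed
 ultimately have "ennreal ((\<Sum>si\<in>Pow J. g si (ch si)) / 2 ^ card J) <= ennreal (102 * A * C * sqrt m / \<beta>)" by (rule order_trans[rotated])
 then have "(\<Sum>si\<in>Pow J. g si (ch si)) / 2 ^ card J <= 102 * A * C * sqrt m / \<beta>"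
  using \<beta> A C m by (subst (asm) ennreal_le_iff) auto
 also have "... <= 102 * A * C * real (card J) / \<beta>"
 proof -
  have "m <= real (card J) ^ 2" using card_offdiag[OF J(1)] unfolding m_def power2_eq_square by (metis of_nat_le_iff of_nat_mult)
  then have "sqrt m <= real (card J)" by (intro real_le_lsqrt) auto
  then show ?thesis using \<beta> A C by (intro divide_right_mono mult_left_mono) auto
 qed
 also have "... = 408 * C * (real d + 1) * real (card J) / \<beta>" by (simp add: A_def)
 finally show ?thesis unfolding g_def by (simp add: divide_le_eq mult.commute)
qed

lemma sum_chaos_choice_le:
 fixes f :: "'p => 'i => 'i => real"
 assumes J: "finite J" "2 <= card J" and C: "C > 0" and fC: "!!\<theta> i j. \<bar>f \<theta> i j\<bar> <= C"
  and vc: "!!t B. B \<subseteq> offdiag J ==> (!!D. D \<subseteq> B ==> \<exists>\<theta>. {e\<in>B. t < f \<theta> (fst e) (snd e)} = D) ==> card B <= d"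
 shows "(\<Sum>si\<in>Pow J. \<bar>\<Sum>i\<in>J. \<Sum>j\<in>J-{i}. sg si i * sg si j * f (ch si) i j\<bar>) <= 2 ^ card J * (2856 * C * (real d + 1) * real (card J))"
proof -
 \<comment> \<open>The exponent 1/7 of \<open>sum_exp_chaos\<close> turns 408 into 2856.\<close>
 have "(\<Sum>si\<in>Pow J. \<bar>\<Sum>e\<in>offdiag J. (sg si (fst e) * sg si (snd e)) * f (ch si) (fst e) (snd e)\<bar>) <= 2 ^ card J * (408 * C * (real d + 1) * real (card J) / (1/7))"
 proof (rule sum_choice_le[OF J C fC vc])
  fix b :: "'i \<times> 'i => real" assume b: "(\<Sum>e\<in>offdiag J. (b e)\<^sup>2) <= 1"
  have "(\<Sum>si\<in>Pow J. exp (1/7 * (\<Sum>i\<in>J. \<Sum>j\<in>J-{i}. sg si i * sg si j * b (i, j)))) <= 2 * 2 ^ card J"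
  proof (rule sum_exp_chaos[OF J(1)])
   show "(\<Sum>i\<in>J. \<Sum>j\<in>J-{i}. (b (i, j))\<^sup>2) <= 1"
   using b sum_offdiag[OF J(1), of "%i j. (b (i, j))\<^sup>2"] by simp
  qed
  then have "(\<Sum>si\<in>Pow J. exp (1/7 * (\<Sum>e\<in>offdiag J. (sg si (fst e) * sg si (snd e)) * b e))) <= 2 ^ card J * 2"
   using sum_offdiag[OF J(1), of "%i j. sg si i * sg si j * b (i, j)" for si] by (simp add: mult.commute)
  also have "... <= 2 ^ card J * (exp (4 * (real d + 1)) / 2)"
   using exp_ge_add_one_self[of "4 * (real d + 1)"] by (intro mult_left_mono) auto
  finally show "(\<Sum>si\<in>Pow J. exp (1/7 * (\<Sum>e\<in>offdiag J. (sg si (fst e) * sg si (snd e)) * b e))) <= 2 ^ card J * (exp (4 * (real d + 1)) / 2)" .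
 qed (auto simp: abs_mult)
 then show ?thesis
  using sum_offdiag[OF J(1), of "%i j. sg si i * sg si j * f (ch si) i j" for si] by simp
qed

text \<open>\<open>h\<close> selects one index of a pair, so up to n pairs share a sign, and by
  Cauchy-Schwarz a coefficient vector of norm 1 collapses to one of squared norm up to n. Taking
  \<beta>^2 = (d + 1) / n keeps the exponent of order d + 1; the price is a bound of order n sqrt
  ((d + 1) n) where the chaos has n (d + 1).\<close>

lemma sum_linear_choice_le:
 fixes f :: "'p => 'i => 'i => real"
 assumes J: "finite J" "2 <= card J" and C: "C > 0" and fC: "!!\<theta> i j. \<bar>f \<theta> i j\<bar> <= C"
  and vc: "!!t B. B \<subseteq> offdiag J ==> (!!D. D \<subseteq> B ==> \<exists>\<theta>. {e\<in>B. t < f \<theta> (fst e) (snd e)} = D) ==> card B <= d"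
  and h: "!!e. e \<in> offdiag J ==> h e \<in> J" and hc: "!!i. i \<in> J ==> card {e\<in>offdiag J. h e = i} <= card J"
 shows "(\<Sum>si\<in>Pow J. \<bar>\<Sum>e\<in>offdiag J. sg si (h e) * f (ch si) (fst e) (snd e)\<bar>) <= 2 ^ card J * (408 * C * real (card J) * sqrt ((real d + 1) * real (card J)))"
proof -
 define n where "n = real (card J)"
 have n: "n >= 2" using J by (simp add: n_def)
 define \<beta> where "\<beta> = sqrt ((real d + 1) / n)"
 have \<beta>: "\<beta> > 0" "\<beta>\<^sup>2 = (real d + 1) / n" using n by (auto simp: \<beta>_def)
 have finE: "finite (offdiag J)" using card_offdiag[OF J(1)] by simp
 have "(\<Sum>si\<in>Pow J. \<bar>\<Sum>e\<in>offdiag J. sg si (h e) * f (ch si) (fst e) (snd e)\<bar>) <= 2 ^ card J * (408 * C * (real d + 1) * real (card J) / \<beta>)"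
 proof (rule sum_choice_le[OF J C fC vc \<beta>(1)])
  fix b :: "'i \<times> 'i => real" assume b: "(\<Sum>e\<in>offdiag J. (b e)\<^sup>2) <= 1"
  define c where "c i = (\<Sum>e\<in>{e\<in>offdiag J. h e = i}. b e)" for i
  have Y: "(\<Sum>e\<in>offdiag J. sg si (h e) * b e) = (\<Sum>i\<in>J. sg si i * c i)" for si
  proof -
   have "(\<Sum>i\<in>J. sg si i * c i) = (\<Sum>i\<in>J. \<Sum>e\<in>{e\<in>offdiag J. h e = i}. sg si (h e) * b e)"
   unfolding c_def sum_distrib_left by (intro sum.cong refl) auto
   also have "... = (\<Sum>e\<in>offdiag J. sg si (h e) * b e)" using h by (intro sum.group finE J) auto
   finally show ?thesis by simp
  qed
  have "(\<Sum>i\<in>J. (c i)\<^sup>2) <= (\<Sum>i\<in>J. n * (\<Sum>e\<in>{e\<in>offdiag J. h e = i}. (b e)\<^sup>2))"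
  proof (rule sum_mono)
   fix i assume i: "i \<in> J"
   have "(c i)\<^sup>2 <= (\<Sum>e\<in>{e\<in>offdiag J. h e = i}. (b e)\<^sup>2) * real (card {e\<in>offdiag J. h e = i})"
   unfolding c_def by (rule sum_squared_le_sum_of_squares)
   also have "... <= (\<Sum>e\<in>{e\<in>offdiag J. h e = i}. (b e)\<^sup>2) * n"
   unfolding n_def using hc[OF i] by (intro mult_left_mono) (auto intro: sum_nonneg)
   finally show "(c i)\<^sup>2 <= n * (\<Sum>e\<in>{e\<in>offdiag J. h e = i}. (b e)\<^sup>2)" by (simp add: mult.commute)
  qed
  also have "... = n * (\<Sum>e\<in>offdiag J. (b e)\<^sup>2)"
   unfolding sum_distrib_left[symmetric] using h by (subst sum.group[OF finE J(1)]) auto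
  also have "... <= n * 1" using b n by (intro mult_left_mono) auto
  finally have c2: "(\<Sum>i\<in>J. (c i)\<^sup>2) <= n" by simp
  have "(\<Sum>si\<in>Pow J. exp (\<beta> * (\<Sum>e\<in>offdiag J. sg si (h e) * b e))) = (\<Sum>si\<in>Pow J. exp (\<Sum>i\<in>J. sg si i * (\<beta> * c i)))"
   unfolding Y by (simp add: sum_distrib_left mult_ac)
  also have "... <= 2 ^ card J * exp ((\<Sum>i\<in>J. (\<beta> * c i)\<^sup>2) / 2)" by (rule sum_exp_sg[OF J(1)])
  also have "(\<Sum>i\<in>J. (\<beta> * c i)\<^sup>2) = \<beta>\<^sup>2 * (\<Sum>i\<in>J. (c i)\<^sup>2)" by (simp add: power_mult_distrib sum_distrib_left)
  also have "2 ^ card J * exp (\<beta>\<^sup>2 * (\<Sum>i\<in>J. (c i)\<^sup>2) / 2) <= 2 ^ card J * exp (\<beta>\<^sup>2 * n / 2)"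
   using c2 by (intro mult_left_mono iffD2[OF exp_le_cancel_iff] divide_right_mono) auto
  also have "\<beta>\<^sup>2 * n / 2 = (real d + 1) / 2" using \<beta> n by simp
  also have "2 ^ card J * exp ((real d + 1) / 2) <= 2 ^ card J * (exp (4 * (real d + 1)) / 2)"
  proof (intro mult_left_mono)
   have "2 * exp ((real d + 1) / 2) <= exp 1 * exp ((real d + 1) / 2)"
   using exp_ge_add_one_self[of 1] by (intro mult_right_mono) auto
   also have "... <= exp (4 * (real d + 1))" unfolding exp_add[symmetric] exp_le_cancel_iff by simp
   finally show "exp ((real d + 1) / 2) <= exp (4 * (real d + 1)) / 2" by simp
  qed auto
  finally show "(\<Sum>si\<in>Pow J. exp (\<beta> * (\<Sum>e\<in>offdiag J. sg si (h e) * b e))) <= 2 ^ card J * (exp (4 * (real d + 1)) / 2)" .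
 qed auto
 also have "408 * C * (real d + 1) * real (card J) / \<beta> = 408 * C * real (card J) * sqrt ((real d + 1) * real (card J))"
 proof -
  have "\<beta> * sqrt ((real d + 1) * n) = real d + 1"
   unfolding \<beta>_def real_sqrt_mult[symmetric] using n by (simp add: power2_eq_square[symmetric])
  then have "(real d + 1) / \<beta> = sqrt ((real d + 1) * n)" using \<beta> by (simp add: field_simps)
  then have "408 * C * n * ((real d + 1) / \<beta>) = 408 * C * n * sqrt ((real d + 1) * n)" by (simp only:)
  then show ?thesis by (simp add: n_def mult_ac)
 qed
 finally show ?thesis .
qed

section \<open>Symmetrization\<close>

text \<open>Projections of compact sets are compact, so by inner regularity a supremum over the second coordinate
 has measurable minorants that are good enough for integration; the supremum itself need not be
 measurable.\<close>

lemma measurable_minorant: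
 fixes \<mu> :: "('a::polish_space \<times> 'b::polish_space) measure" and g :: "'a \<times> 'b => real"
 assumes P: "prob_space \<mu>" and sets: "sets \<mu> = sets borel" and g: "g \<in> borel_measurable borel"
  and g0: "!!q. 0 <= g q" and gC: "!!q. g q <= C" and \<epsilon>: "\<epsilon> > 0"
 shows "\<exists>F\<in>borel_measurable borel. (\<forall>x. 0 <= F x \<and> (\<exists>y. F x <= g (x, y))) \<and>
  (\<integral>\<^sup>+q. ennreal (g q) \<partial>\<mu>) <= (\<integral>\<^sup>+q. ennreal (F (fst q)) \<partial>\<mu>) + ennreal \<epsilon>"
proof -
 interpret prob_space \<mu> by fact
 define \<eta> where "\<eta> = \<epsilon> / 2"
 have \<eta>: "\<eta> > 0" using \<epsilon> by (simp add: \<eta>_def)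
 have C0: "C >= 0" using g0[of undefined] gC[of undefined] by linarith
 obtain N :: nat where N: "C < real N * \<eta>" using \<eta> ex_less_of_nat_mult[of \<eta> C] by blast
 have N0: "N > 0" using N C0 \<eta> by (cases N) auto
 define D where "D k = {q. real k * \<eta> <= g q \<and> g q < (real k + 1) * \<eta>}" for k :: nat
 have D: "D k \<in> sets borel" for k unfolding D_def using g by measurable
 \<comment> \<open>Each of the N slabs may lose mass dl when it is replaced by a compact subset, at
   a cost of at most C per unit of mass. The choice keeps C N dl below \<epsilon>/2; the slab height
   \<eta> takes the other half.\<close>
 define dl where "dl = \<epsilon> / (2 * real N * (C + 1))"
 have dl: "dl > 0" using \<epsilon> N0 C0 by (simp add: dl_def)
 have "\<exists>K. K \<subseteq> D k \<and> compact K \<and> emeasure \<mu> (D k) <= emeasure \<mu> K + ennreal dl" for k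
 proof (cases "measure \<mu> (D k) = 0")
  case True
  then show ?thesis by (intro exI[of _ "{}"]) (simp add: emeasure_eq_measure)
 next
  case False
  then have "ennreal (measure \<mu> (D k) - dl) < emeasure \<mu> (D k)"
   using dl unfolding emeasure_eq_measure by (intro ennreal_lessI) (auto simp: zero_less_measure_iff)
  also have "emeasure \<mu> (D k) = (SUP K \<in> {K. K \<subseteq> D k \<and> compact K}. emeasure \<mu> K)"
   using inner_regular[OF sets _ D] by (simp add: emeasure_space_1)
  finally obtain K where K: "K \<subseteq> D k" "compact K" "ennreal (measure \<mu> (D k) - dl) < emeasure \<mu> K"
   unfolding less_SUP_iff by auto
  then have "measure \<mu> (D k) - dl <= measure \<mu> K"
   by (cases "measure \<mu> (D k) <= dl") (auto simp: emeasure_eq_measure ennreal_less_iff intro: order_trans[OF _ measure_nonneg])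
  then have "emeasure \<mu> (D k) <= emeasure \<mu> K + ennreal dl"
   using dl by (simp add: emeasure_eq_measure ennreal_plus[symmetric] del: ennreal_plus)
  then show ?thesis using K by blast
 qed
 then obtain K where K: "!!k. K k \<subseteq> D k" "!!k. compact (K k)" "!!k. emeasure \<mu> (D k) <= emeasure \<mu> (K k) + ennreal dl"
  by metis
 have Kb: "K k \<in> sets borel" for k using K(2) by (simp add: compact_imp_closed)
 have fK: "fst ` K k \<in> sets borel" for k
  using K(2)[of k] by (intro borel_closed compact_imp_closed compact_continuous_image continuous_on_fst continuous_on_id)
 \<comment> \<open>A point x in the projection of \<open>K k\<close> has a partner y with g (x, y)
   >= k \<eta>, which makes F a minorant of the supremum; projections of compact sets are closed,
   which makes F Borel.\<close>
 define F where "F x = Max ((%k. real k * \<eta> * indicator (fst ` K k) x) ` {..<N})" for x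
 have Fm: "F \<in> borel_measurable borel"
  unfolding F_def using N0 fK by (intro borel_measurable_Max) auto
 have F0: "0 <= F x" for x
 proof -
  have "(%k. real k * \<eta> * indicator (fst ` K k) x) 0 <= F x"
   unfolding F_def using N0 by (intro Max_ge) auto
  then show ?thesis by simp
 qed
 have Fg: "\<exists>y. F x <= g (x, y)" for x
 proof -
  have "F x \<in> (%k. real k * \<eta> * indicator (fst ` K k) x) ` {..<N}"
   unfolding F_def using N0 by (intro Max_in) auto
  then obtain k where k: "F x = real k * \<eta> * indicator (fst ` K k) x" by auto
  show ?thesis
  proof (cases "x \<in> fst ` K k")
   case True
   then obtain y where "(x, y) \<in> K k" by auto
   then have "(x, y) \<in> D k" using K(1) by auto
   then show ?thesis using k True by (auto simp: D_def)
  next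
   case False
   then show ?thesis using k g0 by auto
  qed
 qed
 have pw: "g q <= \<eta> + F (fst q) + C * (\<Sum>k<N. indicator (D k - K k) q)" for q
 proof -
  define k where "k = nat \<lfloor>g q / \<eta>\<rfloor>"
  have kk: "real k = of_int \<lfloor>g q / \<eta>\<rfloor>" using g0[of q] \<eta> by (simp add: k_def)
  have k: "real k * \<eta> <= g q" "g q < (real k + 1) * \<eta>"
   using floor_divide_lower[OF \<eta>, of "g q"] floor_divide_upper[OF \<eta>, of "g q"] unfolding kk by auto
  then have qD: "q \<in> D k" by (simp add: D_def)
  have "real k * \<eta> < real N * \<eta>" using k(1) gC[of q] N by linarith
  then have kN: "k < N" using \<eta> by simp
  have s0: "0 <= C * (\<Sum>k<N. indicator (D k - K k) q)" using C0 by (intro mult_nonneg_nonneg sum_nonneg) auto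
  show ?thesis
  proof (cases "q \<in> K k")
   case True
   have "(%k. real k * \<eta> * indicator (fst ` K k) (fst q)) k <= F (fst q)"
   unfolding F_def using kN by (intro Max_ge) auto
   then have "real k * \<eta> <= F (fst q)" using True by simp
   then show ?thesis using k s0 \<eta> by (simp add: algebra_simps)
  next
   case False
   have "C * indicator (D k - K k) q <= C * (\<Sum>k<N. indicator (D k - K k) q)"
   using C0 kN by (intro mult_left_mono member_le_sum[of k "{..<N}" "%k. indicator (D k - K k) q"]) auto
   then have "C <= C * (\<Sum>k<N. indicator (D k - K k) q)" using qD False by simp
   then show ?thesis using gC[of q] F0[of "fst q"] \<eta> by linarith
  qed
 qed
 have mD: "D k - K k \<in> sets \<mu>" for k using D Kb sets by auto
 have small: "emeasure \<mu> (D k - K k) <= ennreal dl" for k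
 proof -
  have "emeasure \<mu> (D k - K k) = emeasure \<mu> (D k) - emeasure \<mu> (K k)"
   using K(1) D Kb sets by (intro emeasure_Diff) auto
  also have "... <= ennreal dl" using K(3)[of k] by (simp add: ennreal_minus_le_iff)
  finally show ?thesis .
 qed
 have mF: "(%q. F (fst q)) \<in> borel_measurable \<mu>"
 proof -
  have "(%q. F (fst q)) \<in> borel_measurable borel"
   by (intro measurable_compose[OF _ Fm] borel_measurable_continuous_onI continuous_on_fst continuous_on_id)
  then show ?thesis using measurable_cong_sets[OF sets refl] by blast
 qed
 have "(\<integral>\<^sup>+q. ennreal (g q) \<partial>\<mu>) <= (\<integral>\<^sup>+q. ennreal \<eta> + ennreal (F (fst q)) + ennreal C * (\<Sum>k<N. indicator (D k - K k) q) \<partial>\<mu>)"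
 proof (rule nn_integral_mono)
  fix q
  have "ennreal (g q) <= ennreal (\<eta> + F (fst q) + C * (\<Sum>k<N. indicator (D k - K k) q))" by (intro ennreal_leI pw)
  also have "... = ennreal \<eta> + ennreal (F (fst q)) + ennreal C * ennreal (\<Sum>k<N. indicator (D k - K k) q)"
   using \<eta> F0 C0 by (simp add: ennreal_plus ennreal_mult sum_nonneg)
  also have "ennreal (\<Sum>k<N. indicator (D k - K k) q) = (\<Sum>k<N. indicator (D k - K k) q)"
   by (subst sum_ennreal[symmetric]) (auto simp: ennreal_indicator)
  finally show "ennreal (g q) <= ennreal \<eta> + ennreal (F (fst q)) + ennreal C * (\<Sum>k<N. indicator (D k - K k) q)" .
 qed
 also have "... = ennreal \<eta> + (\<integral>\<^sup>+q. ennreal (F (fst q)) \<partial>\<mu>) + ennreal C * (\<Sum>k<N. emeasure \<mu> (D k - K k))"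
  using mD mF by (simp add: nn_integral_add nn_integral_cmult nn_integral_sum emeasure_space_1)
 also have "... <= ennreal \<eta> + (\<integral>\<^sup>+q. ennreal (F (fst q)) \<partial>\<mu>) + ennreal C * (\<Sum>k<N. ennreal dl)"
  by (intro add_left_mono mult_left_mono sum_mono small) auto
 also have "ennreal C * (\<Sum>k<N. ennreal dl) <= ennreal \<eta>"
 proof -
  have "ennreal C * (\<Sum>k<N. ennreal dl) = ennreal (C * (real N * dl))"
   using C0 dl by (simp add: ennreal_mult ennreal_of_nat_eq_real_of_nat)
  also have "... <= ennreal \<eta>"
  proof (rule ennreal_leI)
   have "real N * dl = \<eta> / (C + 1)" using N0 by (simp add: dl_def \<eta>_def)
   then have "C * (real N * dl) = C / (C + 1) * \<eta>" by simp
   also have "... <= 1 * \<eta>" using C0 \<eta> by (intro mult_right_mono) auto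
   finally show "C * (real N * dl) <= \<eta>" by simp
  qed
  finally show ?thesis .
 qed
 finally have "(\<integral>\<^sup>+q. ennreal (g q) \<partial>\<mu>) <= ennreal \<eta> + (\<integral>\<^sup>+q. ennreal (F (fst q)) \<partial>\<mu>) + ennreal \<eta>"
  by (simp add: add_left_mono)
 also have "... = (\<integral>\<^sup>+q. ennreal (F (fst q)) \<partial>\<mu>) + (ennreal \<eta> + ennreal \<eta>)" by (simp add: ac_simps)
 also have "ennreal \<eta> + ennreal \<eta> = ennreal \<epsilon>" using \<eta> by (simp add: \<eta>_def ennreal_plus[symmetric] del: ennreal_plus)
 finally show ?thesis using Fm F0 Fg by blast
qed

text \<open>Invariance holds for the law of W alone, not jointly with \<theta>, which may depend on
  W. A measurable minorant F of the supremum over the second argument removes \<theta> at a loss of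
  \<epsilon>. F is then averaged over the transformations, and at each transformed point some
  argument \<open>ch i\<close> reaches F, so the deterministic bound applies.\<close>

lemma (in prob_space) nn_integral_symmetrized_le:
 fixes W :: "'a => 'x::polish_space" and \<theta> :: "'a => 'b::polish_space" and G :: "'x \<times> 'b => real"
 assumes W: "W \<in> borel_measurable M" and \<theta>: "\<theta> \<in> borel_measurable M"
  and G: "G \<in> borel_measurable borel" and GC: "!!q. \<bar>G q\<bar> <= C"
  and I: "finite I" "I ~= {}" and s: "!!i. i \<in> I ==> s i \<in> borel_measurable borel"
  and inv: "!!i. i \<in> I ==> distr M borel (%om. s i (W om)) = distr M borel W"
  and B: "!!x ch. (\<Sum>i\<in>I. \<bar>G (s i x, ch i)\<bar>) <= real (card I) * B"
 shows "(\<integral>\<^sup>+om. ennreal \<bar>G (W om, \<theta> om)\<bar> \<partial>M) <= ennreal B"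
proof (rule ennreal_le_epsilon)
 fix \<epsilon> :: real assume \<epsilon>: "\<epsilon> > 0"
 have cI: "real (card I) > 0" using I by (simp add: card_gt_0_iff)
 have WT: "(%om. (W om, \<theta> om)) \<in> borel_measurable M" using W \<theta> by (rule borel_measurable_Pair)
 define \<mu> where "\<mu> = distr M borel (%om. (W om, \<theta> om))"
 have "prob_space \<mu>" unfolding \<mu>_def by (rule prob_space_distr[OF WT])
 then obtain F where F: "F \<in> borel_measurable borel" "!!x. 0 <= F x" "!!x. \<exists>y. F x <= \<bar>G (x, y)\<bar>"
  "(\<integral>\<^sup>+q. ennreal \<bar>G q\<bar> \<partial>\<mu>) <= (\<integral>\<^sup>+q. ennreal (F (fst q)) \<partial>\<mu>) + ennreal \<epsilon>"
  using measurable_minorant[of \<mu> "%q. \<bar>G q\<bar>" C \<epsilon>] G GC \<epsilon> by (force simp: \<mu>_def)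
 have Ff: "(%q. F (fst q)) \<in> borel_measurable borel"
  by (intro measurable_compose[OF _ F(1)] borel_measurable_continuous_onI continuous_on_fst continuous_on_id)
 have sym: "(\<integral>\<^sup>+om. ennreal (F (s i (W om))) \<partial>M) = (\<integral>\<^sup>+om. ennreal (F (W om)) \<partial>M)" if "i \<in> I" for i
 proof -
  have sW: "(%om. s i (W om)) \<in> borel_measurable M" using measurable_compose[OF W s[OF that]] .
  have "(\<integral>\<^sup>+om. ennreal (F (s i (W om))) \<partial>M) = (\<integral>\<^sup>+x. ennreal (F x) \<partial>distr M borel (%om. s i (W om)))"
   using F(1) sW by (subst nn_integral_distr) auto
  also have "... = (\<integral>\<^sup>+om. ennreal (F (W om)) \<partial>M)" unfolding inv[OF that] using F(1) W by (subst nn_integral_distr) auto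
  finally show ?thesis .
 qed
 have avg: "(1 / real (card I)) * (\<Sum>i\<in>I. F (s i x)) <= B" for x
 proof -
  have "\<forall>i. \<exists>y. F (s i x) <= \<bar>G (s i x, y)\<bar>" using F(3) by blast
  then obtain ch where "\<forall>i. F (s i x) <= \<bar>G (s i x, ch i)\<bar>" by (rule choice[THEN exE])
  then have "(\<Sum>i\<in>I. F (s i x)) <= (\<Sum>i\<in>I. \<bar>G (s i x, ch i)\<bar>)" by (intro sum_mono) blast
  also have "... <= real (card I) * B" by (rule B)
  finally show ?thesis using cI by (simp add: field_simps)
 qed
 have mFs: "(%om. ennreal (F (s i (W om)))) \<in> borel_measurable M" if "i \<in> I" for i
  using measurable_compose[OF measurable_compose[OF W s[OF that]] F(1)] by measurable
 have "(\<integral>\<^sup>+om. ennreal (F (W om)) \<partial>M) = ennreal (1 / real (card I)) * (\<Sum>i\<in>I. \<integral>\<^sup>+om. ennreal (F (W om)) \<partial>M)"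
  using cI by (simp add: ennreal_of_nat_eq_real_of_nat mult.assoc[symmetric] ennreal_mult[symmetric])
 also have "... = ennreal (1 / real (card I)) * (\<Sum>i\<in>I. \<integral>\<^sup>+om. ennreal (F (s i (W om))) \<partial>M)" by (simp add: sym)
 also have "... = (\<integral>\<^sup>+om. ennreal (1 / real (card I)) * (\<Sum>i\<in>I. ennreal (F (s i (W om)))) \<partial>M)"
  using mFs by (simp add: nn_integral_cmult nn_integral_sum)
 also have "... = (\<integral>\<^sup>+om. ennreal ((1 / real (card I)) * (\<Sum>i\<in>I. F (s i (W om)))) \<partial>M)"
  using F(2) by (simp add: ennreal_mult[symmetric] sum_nonneg sum_ennreal)
 also have "... <= (\<integral>\<^sup>+om. ennreal B \<partial>M)" by (intro nn_integral_mono ennreal_leI avg)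
 finally have FB: "(\<integral>\<^sup>+om. ennreal (F (W om)) \<partial>M) <= ennreal B" by (simp add: emeasure_space_1)
 have "(\<integral>\<^sup>+om. ennreal \<bar>G (W om, \<theta> om)\<bar> \<partial>M) = (\<integral>\<^sup>+q. ennreal \<bar>G q\<bar> \<partial>\<mu>)"
  unfolding \<mu>_def using G WT by (subst nn_integral_distr) auto
 also have "... <= (\<integral>\<^sup>+q. ennreal (F (fst q)) \<partial>\<mu>) + ennreal \<epsilon>" by (rule F(4))
 also have "(\<integral>\<^sup>+q. ennreal (F (fst q)) \<partial>\<mu>) = (\<integral>\<^sup>+om. ennreal (F (W om)) \<partial>M)"
  unfolding \<mu>_def using measurable_compose[OF Ff measurable_ennreal] WT by (subst nn_integral_distr) simp_all
 finally show "(\<integral>\<^sup>+om. ennreal \<bar>G (W om, \<theta> om)\<bar> \<partial>M) <= ennreal B + ennreal \<epsilon>"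
  using FB by (meson add_right_mono order_trans)
qed

section \<open>The ghost sample and its symmetries\<close>

lemma (in prob_space) indep_vars_pair_distr:
 assumes ind: "indep_vars (%_. N) Z I" and ab: "a \<in> I" "b \<in> I" "a ~= b"
  and d: "!!i. i \<in> I ==> distr M N (Z i) = P"
 shows "distr M (N \<Otimes>\<^sub>M N) (%om. (Z a om, Z b om)) = P \<Otimes>\<^sub>M P"
proof -
 have "indep_var (PiM {a} (%_. N)) (%om. restrict (%i. Z i om) {a}) (PiM {b} (%_. N)) (%om. restrict (%i. Z i om) {b})"
  using ab by (intro indep_var_restrict[OF ind]) auto
 then have "indep_var N ((%x. x a) \<circ> (%om. restrict (%i. Z i om) {a})) N ((%x. x b) \<circ> (%om. restrict (%i. Z i om) {b}))"
  by (rule indep_var_compose) (auto intro: measurable_component_singleton)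
 then have "indep_var N (Z a) N (Z b)" by (simp add: comp_def)
 then show ?thesis using d ab unfolding indep_var_distribution_eq by metis
qed

text \<open>The permutation that trades sample point k for its ghost n + k whenever k is in si. The
  test \<open>n < k\<close> guards the truncated subtraction.\<close>

definition swp :: "nat => nat set => nat => nat" where
 "swp n si k = (if k \<in> si then k + n else if n < k \<and> k - n \<in> si then k - n else k)"

lemma inj_swp:
 assumes "si \<subseteq> {1..n}"
 shows "inj_on (swp n si) {1..2*n}" "swp n si \<in> {1..2*n} \<rightarrow> {1..2*n}"
 using assms by (auto simp: swp_def inj_on_def subset_iff split: if_splits)

lemma swp_simps:
 assumes "si \<subseteq> {1..n}" "i \<in> {1..n}"
 shows "swp n si i = (if i \<in> si then n + i else i)" "swp n si (n + i) = (if i \<in> si then i else n + i)"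
 using assms by (auto simp: swp_def subset_iff)

text \<open>The estimator enters as an arbitrary measurable map \<theta>. Kernel and parameter are
  total on Polish types, so that inner regularity is available, and the VC condition is stated at a
  fixed level t, as chaining over superlevel sets asks for.\<close>

locale iid_sample = prob_space M for M :: "'w measure" +
 fixes n :: nat and Z :: "nat => 'w => 'a::polish_space" and P :: "'a measure"
  and f :: "'a => 'a => 'b::polish_space => real" and C :: real and d :: nat and \<theta> :: "'w => 'b"
 assumes n: "n >= 2" and P: "prob_space P" and sets_P: "sets P = sets borel"
  and indep: "indep_vars (%_. borel) Z {1..n}"
  and distr_Z: "!!i. i \<in> {1..n} ==> distr M borel (Z i) = P"
  and f_meas: "(%(x, y, t). f x y t) \<in> borel_measurable borel"
  and C: "C > 0" and fC: "!!x y t. \<bar>f x y t\<bar> <= C"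
  and vc: "!!t B. finite B ==> (!!D. D \<subseteq> B ==> \<exists>\<theta>. {q\<in>B. t < f (fst q) (snd q) \<theta>} = D) ==> card B <= d"
  and \<theta>_meas: "\<theta> \<in> borel_measurable M"
begin

interpretation P: prob_space P by (rule P)

lemma Z_meas: "i \<in> {1..n} ==> Z i \<in> borel_measurable M"
 using indep unfolding indep_vars_def by auto

lemma f_meas' [measurable (raw)]:
 assumes "u \<in> borel_measurable N" "v \<in> borel_measurable N" "w \<in> borel_measurable N"
 shows "(%x. f (u x) (v x) (w x)) \<in> borel_measurable N"
proof -
 have "(%x. (u x, v x, w x)) \<in> borel_measurable N" using assms by (intro borel_measurable_Pair)
 from measurable_compose[OF this f_meas] show ?thesis by simp
qed

definition PP where "PP = PiM {n+1..2*n} (%_. P)"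

definition W where "W q = merge {1..n} {n+1..2*n} (\<lambda>i\<in>{1..n}. Z i (fst q), snd q)" for q

lemma W_simps: "i \<in> {1..n} ==> W (om, z) i = Z i om" "i \<in> {1..n} ==> W (om, z) (n + i) = z (n + i)"
 by (auto simp: W_def merge_def)

lemma prob_PP: "prob_space PP" unfolding PP_def by (intro prob_space_PiM P)

lemma prob_MPP: "prob_space (M \<Otimes>\<^sub>M PP)"
 by (intro prob_space_pair prob_space_axioms prob_PP)

text \<open>Passage from the product over a finite index set, whose points are
  \<open>undefined\<close> elsewhere, to the Borel sets of the whole sequence space, which is
  Polish.\<close>

lemma id_PiM_borel: "finite I ==> (%y. y) \<in> PiM I (%_. P) \<rightarrow>\<^sub>M (borel :: (nat => 'a) measure)"
proof (rule measurable_coordinatewise_then_product)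
 fix i assume "finite I"
 show "(%y. y i) \<in> borel_measurable (PiM I (%_. P))"
 proof (cases "i \<in> I")
  case True
  then have "(%y. y i) \<in> PiM I (%_. P) \<rightarrow>\<^sub>M P" by measurable
  then show ?thesis using measurable_cong_sets[OF refl sets_P] by blast
 next
  case False
  then have "y i = undefined" if "y \<in> space (PiM I (%_. P))" for y using that by (auto simp: space_PiM PiE_def extensional_def)
  then show ?thesis by (subst measurable_cong[where g = "%_. undefined"]) auto
 qed
qed

lemma distr_W: "distr (M \<Otimes>\<^sub>M PP) (PiM {1..2*n} (%_. P)) W = PiM {1..2*n} (%_. P)"
 and W_PiM: "W \<in> M \<Otimes>\<^sub>M PP \<rightarrow>\<^sub>M PiM {1..2*n} (%_. P)"
proof -
 interpret ps: product_sigma_finite "%_::nat. P" by standard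
 have un: "{1..n} \<union> {n+1..2*n} = {1..2*n}" by auto
 have ZP: "(%om. \<lambda>i\<in>{1..n}. Z i om) \<in> M \<rightarrow>\<^sub>M PiM {1..n} (%_. P)"
  using Z_meas measurable_cong_sets[OF refl sets_P] by (intro measurable_restrict) blast
 have dZ: "distr M (PiM {1..n} (%_. P)) (%om. \<lambda>i\<in>{1..n}. Z i om) = PiM {1..n} (%_. P)"
 proof -
  have "distr M (PiM {1..n} (%_. borel)) (%om. \<lambda>i\<in>{1..n}. Z i om) = PiM {1..n} (%i. distr M borel (Z i))"
   using n indep Z_meas by (subst indep_vars_iff_distr_eq_PiM'[symmetric]) auto
  also have "... = PiM {1..n} (%_. P)" by (intro PiM_cong) (auto simp: distr_Z)
  also have "distr M (PiM {1..n} (%_. borel)) (%om. \<lambda>i\<in>{1..n}. Z i om) = distr M (PiM {1..n} (%_. P)) (%om. \<lambda>i\<in>{1..n}. Z i om)"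
   by (intro distr_cong refl sets_PiM_cong) (simp_all add: sets_P)
  finally show ?thesis .
 qed
 have mg: "merge {1..n} {n+1..2*n} \<in> PiM {1..n} (%_. P) \<Otimes>\<^sub>M PP \<rightarrow>\<^sub>M PiM {1..2*n} (%_. P)"
  unfolding PP_def un[symmetric] by (rule measurable_merge)
 have pr: "(%q. (\<lambda>i\<in>{1..n}. Z i (fst q), snd q)) \<in> M \<Otimes>\<^sub>M PP \<rightarrow>\<^sub>M PiM {1..n} (%_. P) \<Otimes>\<^sub>M PP"
  using measurable_compose[OF measurable_fst ZP] by (intro measurable_Pair measurable_snd) auto
 show "W \<in> M \<Otimes>\<^sub>M PP \<rightarrow>\<^sub>M PiM {1..2*n} (%_. P)" unfolding W_def using measurable_compose[OF pr mg] by simp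
 interpret PP: prob_space PP by (rule prob_PP)
 have dd: "distr (M \<Otimes>\<^sub>M PP) (PiM {1..n} (%_. P) \<Otimes>\<^sub>M PP) (%q. (\<lambda>i\<in>{1..n}. Z i (fst q), snd q)) = PiM {1..n} (%_. P) \<Otimes>\<^sub>M PP"
  using pair_measure_distr[OF ZP measurable_ident_sets[OF refl, of PP]] PP.sigma_finite_measure_axioms
  unfolding dZ distr_id case_prod_beta by simp
 have "PiM {1..2*n} (%_. P) = distr (distr (M \<Otimes>\<^sub>M PP) (PiM {1..n} (%_. P) \<Otimes>\<^sub>M PP) (%q. (\<lambda>i\<in>{1..n}. Z i (fst q), snd q))) (PiM {1..2*n} (%_. P)) (merge {1..n} {n+1..2*n})"
  unfolding dd using ps.distr_merge[of "{1..n}" "{n+1..2*n}"] unfolding PP_def un by simp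
 also have "... = distr (M \<Otimes>\<^sub>M PP) (PiM {1..2*n} (%_. P)) W"
  unfolding distr_distr[OF mg pr] unfolding W_def[abs_def] comp_def ..
 finally show "distr (M \<Otimes>\<^sub>M PP) (PiM {1..2*n} (%_. P)) W = PiM {1..2*n} (%_. P)" by simp
qed

lemma swap_meas: "(%y k. y (swp n si k)) \<in> borel_measurable (borel :: (nat => 'a) measure)"
 by (rule measurable_coordinatewise_then_product) simp

lemma W_borel: "W \<in> borel_measurable (M \<Otimes>\<^sub>M PP)"
 using measurable_compose[OF W_PiM id_PiM_borel] by simp

text \<open>The 2n coordinates are i.i.d. and a permutation of indices preserves their law;
  coordinates outside 1..2n are fixed by \<open>swp\<close> and keep the value
  \<open>undefined\<close>.\<close>

lemma distr_swap:
 assumes si: "si \<subseteq> {1..n}"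
 shows "distr (M \<Otimes>\<^sub>M PP) borel (%q. (%k. W q (swp n si k))) = distr (M \<Otimes>\<^sub>M PP) borel W"
proof -
 let ?\<Pi> = "PiM {1..2*n} (%_. P)"
 let ?r = "%y. \<lambda>k\<in>{1..2*n}. y (swp n si k) :: 'a"
 have r: "?r \<in> ?\<Pi> \<rightarrow>\<^sub>M ?\<Pi>"
  using inj_swp(2)[OF si] by (intro measurable_restrict measurable_component_singleton) auto
 have out: "y (swp n si k) = undefined" if "y \<in> space ?\<Pi>" "k \<notin> {1..2*n}" for y k
 proof -
  have "swp n si k = k" using that(2) si by (auto simp: swp_def subset_iff)
  then show ?thesis using that by (auto simp: space_PiM PiE_def extensional_def)
 qed
 have "distr (M \<Otimes>\<^sub>M PP) borel (%q. (%k. W q (swp n si k))) = distr (M \<Otimes>\<^sub>M PP) borel (%q. ?r (W q))"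
  using out measurable_space[OF W_PiM] by (intro distr_cong refl ext) auto
 also have "... = distr (distr (distr (M \<Otimes>\<^sub>M PP) ?\<Pi> W) ?\<Pi> ?r) borel (%y. y)"
  using W_PiM r id_PiM_borel[of "{1..2*n}"] by (simp add: distr_distr comp_def)
 also have "distr (distr (M \<Otimes>\<^sub>M PP) ?\<Pi> W) ?\<Pi> ?r = ?\<Pi>"
  unfolding distr_W using distr_PiM_reindex[of "{1..2*n}" "%_. P", OF _ inj_swp[OF si]] P by simp
 also have "distr ?\<Pi> borel (%y. y) = distr (distr (M \<Otimes>\<^sub>M PP) ?\<Pi> W) borel (%y. y)" by (simp only: distr_W)
 also have "... = distr (M \<Otimes>\<^sub>M PP) borel W"
  using W_PiM id_PiM_borel[of "{1..2*n}"] by (simp add: distr_distr comp_def)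
 finally show ?thesis .
qed

text \<open>The absolute value is moved inside the integral over the ghost sample, and the
  symmetrization inequality is applied to the joint sample under all 2^n exchanges. What remains to
  be bounded is an average over exchanges at fixed data.\<close>

lemma symmetrize:
 fixes G :: "(nat => 'a) \<times> 'b => real"
 assumes G: "G \<in> borel_measurable borel" and GC: "!!q. \<bar>G q\<bar> <= C'"
  and B: "!!y ch. (\<Sum>si\<in>Pow {1..n}. \<bar>G (%k. y (swp n si k), ch si)\<bar>) <= 2 ^ n * B"
 shows "(\<integral>\<^sup>+om. ennreal \<bar>\<integral>z. G (W (om, z), \<theta> om) \<partial>PP\<bar> \<partial>M) <= ennreal B"
proof -
 interpret MPP: prob_space "M \<Otimes>\<^sub>M PP" by (rule prob_MPP)
 interpret PP: prob_space PP by (rule prob_PP)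
 have mG: "(%q. G (W q, \<theta> (fst q))) \<in> borel_measurable (M \<Otimes>\<^sub>M PP)"
  by (intro measurable_compose[OF _ G] borel_measurable_Pair W_borel measurable_compose[OF measurable_fst \<theta>_meas])
 have "ennreal \<bar>\<integral>z. G (W (om, z), \<theta> om) \<partial>PP\<bar> <= (\<integral>\<^sup>+z. ennreal \<bar>G (W (om, z), \<theta> om)\<bar> \<partial>PP)" if om: "om \<in> space M" for om
 proof -
  have m: "(%z. G (W (om, z), \<theta> om)) \<in> borel_measurable PP"
   using measurable_compose[OF measurable_Pair1'[OF om] mG] by simp
  then have "integrable PP (%z. G (W (om, z), \<theta> om))" using GC by (intro PP.integrable_const_bound[where B = C']) auto
  then show ?thesis using integral_norm_bound_ennreal[of PP "%z. G (W (om, z), \<theta> om)"] by simp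
 qed
 then have "(\<integral>\<^sup>+om. ennreal \<bar>\<integral>z. G (W (om, z), \<theta> om) \<partial>PP\<bar> \<partial>M) <= (\<integral>\<^sup>+om. \<integral>\<^sup>+z. ennreal \<bar>G (W (om, z), \<theta> om)\<bar> \<partial>PP \<partial>M)"
  by (rule nn_integral_mono)
 also have "... = (\<integral>\<^sup>+q. ennreal \<bar>G (W q, \<theta> (fst q))\<bar> \<partial>(M \<Otimes>\<^sub>M PP))"
  using PP.nn_integral_fst[of "%q. ennreal \<bar>G (W q, \<theta> (fst q))\<bar>" M] mG by simp
 also have "... <= ennreal B"
 proof (rule MPP.nn_integral_symmetrized_le[where C = C' and I = "Pow {1..n}" and s = "%si y k. y (swp n si k)"])
  show "(\<Sum>si\<in>Pow {1..n}. \<bar>G (%k. x (swp n si k), ch si)\<bar>) <= real (card (Pow {1..n})) * B" for x ch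
   using B[of x ch] by (simp add: card_Pow)
 qed (use W_borel measurable_compose[OF measurable_fst \<theta>_meas] G GC swap_meas distr_swap in auto)
 finally show ?thesis .
qed

text \<open>Different index pairs may carry equal data points, which the VC hypothesis would count
  once. Shattering excludes this: picking out a single index pair separates its data from those of
  every other pair, so the data map is injective on B.\<close>

lemma vc_offdiag:
 assumes "B \<subseteq> offdiag {1..n}" and D: "!!D. D \<subseteq> B ==> \<exists>\<theta>. {e\<in>B. t < f (u (fst e)) (v (snd e)) \<theta>} = D"
 shows "card B <= d"
proof -
 let ?\<phi> = "%e. (u (fst e), v (snd e))"
 have finB: "finite B" using assms(1) card_offdiag[of "{1..n}"] finite_subset by blast
 have inj: "inj_on ?\<phi> B"
 proof (rule inj_onI)
  fix e e' assume e: "e \<in> B" "e' \<in> B" "?\<phi> e = ?\<phi> e'"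
  have "{e} \<subseteq> B" using e by simp
  from D[OF this] obtain \<theta> where eq: "{e\<in>B. t < f (u (fst e)) (v (snd e)) \<theta>} = {e}" by (rule exE)
  have "e \<in> {e\<in>B. t < f (u (fst e)) (v (snd e)) \<theta>}" by (subst eq) simp
  then have "e' \<in> {e\<in>B. t < f (u (fst e)) (v (snd e)) \<theta>}" using e by simp
  then have "e' \<in> {e}" by (subst (asm) eq)
  then show "e = e'" by simp
 qed
 have "card (?\<phi> ` B) <= d"
 proof (rule vc[where t = t])
  fix D' assume D': "D' \<subseteq> ?\<phi> ` B"
  have "{e\<in>B. ?\<phi> e \<in> D'} \<subseteq> B" by (rule Collect_subset)
  from D[OF this] obtain \<theta> where \<theta>: "{e\<in>B. t < f (u (fst e)) (v (snd e)) \<theta>} = {e\<in>B. ?\<phi> e \<in> D'}" by (rule exE)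
  have "t < f (u (fst e)) (v (snd e)) \<theta> \<longleftrightarrow> ?\<phi> e \<in> D'" if "e \<in> B" for e
  proof -
   have "(e \<in> {e\<in>B. t < f (u (fst e)) (v (snd e)) \<theta>}) = (e \<in> {e\<in>B. ?\<phi> e \<in> D'})" by (simp only: \<theta>)
   then show ?thesis using that by simp
  qed
  then have "{q\<in>?\<phi> ` B. t < f (fst q) (snd q) \<theta>} = D'" using D' by auto
  then show "\<exists>\<theta>. {q\<in>?\<phi> ` B. t < f (fst q) (snd q) \<theta>} = D'" ..
 qed (use finB in auto)
 then show ?thesis using card_image[OF inj] by simp
qed

lemma chaos_bound:
 "(\<Sum>si\<in>Pow {1..n}. \<bar>\<Sum>i\<in>{1..n}. \<Sum>j\<in>{1..n}-{i}. sg si i * sg si j * f (u i) (v j) (ch si)\<bar>) <= 2 ^ n * (2856 * C * (real d + 1) * real n)"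
proof -
 have "(\<Sum>si\<in>Pow {1..n}. \<bar>\<Sum>i\<in>{1..n}. \<Sum>j\<in>{1..n}-{i}. sg si i * sg si j * f (u i) (v j) (ch si)\<bar>) <= 2 ^ card {1..n} * (2856 * C * (real d + 1) * real (card {1..n}))"
 proof (rule sum_chaos_choice_le[where f = "%t i j. f (u i) (v j) t" and ch = ch])
  fix t B assume "B \<subseteq> offdiag {1..n}" "!!D. D \<subseteq> B ==> \<exists>\<theta>. {e\<in>B. t < f (u (fst e)) (v (snd e)) \<theta>} = D"
  then show "card B <= d" by (rule vc_offdiag)
 qed (use n C fC in auto)
 then show ?thesis by simp
qed

lemma linear_bound:
 "(\<Sum>si\<in>Pow {1..n}. \<bar>\<Sum>i\<in>{1..n}. \<Sum>j\<in>{1..n}-{i}. sg si i * f (u i) (v j) (ch si)\<bar>) <= 2 ^ n * (408 * C * real n * sqrt ((real d + 1) * real n))"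
 "(\<Sum>si\<in>Pow {1..n}. \<bar>\<Sum>i\<in>{1..n}. \<Sum>j\<in>{1..n}-{i}. sg si j * f (u i) (v j) (ch si)\<bar>) <= 2 ^ n * (408 * C * real n * sqrt ((real d + 1) * real n))"
proof -
 have c1: "card {e\<in>offdiag {1..n}. fst e = i} <= card {1..n}" for i :: nat
 proof -
  have "{e\<in>offdiag {1..n}. fst e = i} \<subseteq> Pair i ` {1..n}" by (auto simp: offdiag_def)
  then have "card {e\<in>offdiag {1..n}. fst e = i} <= card (Pair i ` {1..n})" by (intro card_mono) auto
  then show ?thesis using card_image_le[of "{1..n}" "Pair i"] by simp
 qed
 have c2: "card {e\<in>offdiag {1..n}. snd e = i} <= card {1..n}" for i :: nat
 proof -
  have "{e\<in>offdiag {1..n}. snd e = i} \<subseteq> (%j. (j, i)) ` {1..n}" by (auto simp: offdiag_def)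
  then have "card {e\<in>offdiag {1..n}. snd e = i} <= card ((%j. (j, i)) ` {1..n})" by (intro card_mono) auto
  then show ?thesis using card_image_le[of "{1..n}" "%j. (j, i)"] by simp
 qed
 have "(\<Sum>si\<in>Pow {1..n}. \<bar>\<Sum>e\<in>offdiag {1..n}. sg si (fst e) * f (u (fst e)) (v (snd e)) (ch si)\<bar>) <= 2 ^ card {1..n} * (408 * C * real (card {1..n}) * sqrt ((real d + 1) * real (card {1..n})))"
 proof (rule sum_linear_choice_le[where f = "%t i j. f (u i) (v j) t" and ch = ch])
  fix t B assume "B \<subseteq> offdiag {1..n}" "!!D. D \<subseteq> B ==> \<exists>\<theta>. {e\<in>B. t < f (u (fst e)) (v (snd e)) \<theta>} = D"
  then show "card B <= d" by (rule vc_offdiag)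
 qed (use n C fC c1 in \<open>auto simp: offdiag_def\<close>)
 then show "(\<Sum>si\<in>Pow {1..n}. \<bar>\<Sum>i\<in>{1..n}. \<Sum>j\<in>{1..n}-{i}. sg si i * f (u i) (v j) (ch si)\<bar>) <= 2 ^ n * (408 * C * real n * sqrt ((real d + 1) * real n))"
  using sum_offdiag[of "{1..n}" "%i j. sg si i * f (u i) (v j) (ch si)" for si] by simp
 have "(\<Sum>si\<in>Pow {1..n}. \<bar>\<Sum>e\<in>offdiag {1..n}. sg si (snd e) * f (u (fst e)) (v (snd e)) (ch si)\<bar>) <= 2 ^ card {1..n} * (408 * C * real (card {1..n}) * sqrt ((real d + 1) * real (card {1..n})))"
 proof (rule sum_linear_choice_le[where f = "%t i j. f (u i) (v j) t" and ch = ch])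
  fix t B assume "B \<subseteq> offdiag {1..n}" "!!D. D \<subseteq> B ==> \<exists>\<theta>. {e\<in>B. t < f (u (fst e)) (v (snd e)) \<theta>} = D"
  then show "card B <= d" by (rule vc_offdiag)
 qed (use n C fC c2 in \<open>auto simp: offdiag_def\<close>)
 then show "(\<Sum>si\<in>Pow {1..n}. \<bar>\<Sum>i\<in>{1..n}. \<Sum>j\<in>{1..n}-{i}. sg si j * f (u i) (v j) (ch si)\<bar>) <= 2 ^ n * (408 * C * real n * sqrt ((real d + 1) * real n))"
  using sum_offdiag[of "{1..n}" "%i j. sg si j * f (u i) (v j) (ch si)" for si] by simp
qed

end

lemma abs_le_half_sum:
 fixes g :: real
 assumes "2 * g = a1 + a2 - a3 - a4 + (b1 - b2 + b3 - b4)"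
 shows "\<bar>g\<bar> <= 1/2 * (\<bar>a1\<bar> + \<bar>a2\<bar> + \<bar>a3\<bar> + \<bar>a4\<bar> + (\<bar>b1\<bar> + \<bar>b2\<bar> + \<bar>b3\<bar> + \<bar>b4\<bar>))"
proof -
 have "\<bar>2 * g\<bar> <= \<bar>a1 + a2 - a3 - a4\<bar> + \<bar>b1 - b2 + b3 - b4\<bar>" unfolding assms by (rule abs_triangle_ineq)
 moreover have "\<bar>a1 + a2 - a3 - a4\<bar> <= \<bar>a1\<bar> + \<bar>a2\<bar> + \<bar>a3\<bar> + \<bar>a4\<bar>" by linarith
 moreover have "\<bar>b1 - b2 + b3 - b4\<bar> <= \<bar>b1\<bar> + \<bar>b2\<bar> + \<bar>b3\<bar> + \<bar>b4\<bar>" by linarith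
 ultimately show ?thesis by (simp add: abs_mult)
qed

lemma sum_half8:
 fixes r :: real
 assumes "(\<Sum>si\<in>S. a1 si) <= r" "(\<Sum>si\<in>S. a2 si) <= r" "(\<Sum>si\<in>S. a3 si) <= r" "(\<Sum>si\<in>S. a4 si) <= r"
  "(\<Sum>si\<in>S. b1 si) <= r" "(\<Sum>si\<in>S. b2 si) <= r" "(\<Sum>si\<in>S. b3 si) <= r" "(\<Sum>si\<in>S. b4 si) <= r"
 shows "(\<Sum>si\<in>S. 1/2 * (a1 si + a2 si + a3 si + a4 si + (b1 si + b2 si + b3 si + b4 si))) <= 4 * r"
proof -
 have "sum a1 S + sum a2 S + sum a3 S + sum a4 S + (sum b1 S + sum b2 S + sum b3 S + sum b4 S) <= r + r + r + r + (r + r + r + r)"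
  by (intro add_mono assms)
 then show ?thesis unfolding sum_distrib_left[symmetric] sum.distrib by (simp only: mult_2 field_simps) simp
qed

context iid_sample
begin

interpretation P: prob_space P by (rule P)

definition \<Gamma> where "\<Gamma> t = (\<integral>x. \<integral>y. f x y t \<partial>P \<partial>P)"

lemma f_P: "(%q. f (fst q) (snd q) t) \<in> borel_measurable (P \<Otimes>\<^sub>M P)"
proof -
 have "fst \<in> P \<Otimes>\<^sub>M P \<rightarrow>\<^sub>M borel" "snd \<in> P \<Otimes>\<^sub>M P \<rightarrow>\<^sub>M borel"
  using measurable_cong_sets[OF refl sets_P] measurable_fst[of P P] measurable_snd[of P P] by blast+
 then show ?thesis by (intro f_meas') auto
qed

lemma f_P_iterated: "(\<integral>q. f (fst q) (snd q) t \<partial>(P \<Otimes>\<^sub>M P)) = \<Gamma> t"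
proof -
 interpret PP: pair_prob_space P P by unfold_locales
 have "integrable (P \<Otimes>\<^sub>M P) (%q. f (fst q) (snd q) t)"
  using f_P fC by (intro PP.integrable_const_bound[where B = C]) auto
 then show ?thesis using PP.integral_fst'[of "%q. f (fst q) (snd q) t"] by (simp add: \<Gamma>_def)
qed

lemma integral_pair:
 assumes "prob_space N" "prob_space.indep_vars N (%_. borel) X I" "a \<in> I" "b \<in> I" "a ~= b"
  and "!!i. i \<in> I ==> distr N borel (X i) = P"
 shows "(\<integral>om. f (X a om) (X b om) t \<partial>N) = \<Gamma> t"
proof -
 interpret N: prob_space N by fact
 have m: "X a \<in> borel_measurable N" "X b \<in> borel_measurable N" using assms unfolding N.indep_vars_def by auto
 have "(\<integral>om. f (X a om) (X b om) t \<partial>N) = (\<integral>q. f (fst q) (snd q) t \<partial>distr N (borel \<Otimes>\<^sub>M borel) (%om. (X a om, X b om)))"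
  using m by (subst integral_distr) (auto intro!: f_meas')
 also have "... = \<Gamma> t" using N.indep_vars_pair_distr[OF assms(2-6)] f_P_iterated by simp
 finally show ?thesis .
qed

lemma indep_PP: "prob_space.indep_vars PP (%_. borel) (%i z. z i) {n+1..2*n}"
 and distr_PP: "i \<in> {n+1..2*n} ==> distr PP borel (%z. z i) = P"
 and PP_meas: "i \<in> {n+1..2*n} ==> (%z. z i) \<in> borel_measurable PP"
proof -
 interpret PP: prob_space PP by (rule prob_PP)
 have m: "(%z. z i) \<in> borel_measurable PP" if "i \<in> {n+1..2*n}" for i
 proof -
  have "(%z. z i) \<in> PP \<rightarrow>\<^sub>M P" unfolding PP_def using that by measurable
  then show ?thesis using measurable_cong_sets[OF refl sets_P] by blast
 qed
 have d: "distr PP borel (%z. z i) = P" if "i \<in> {n+1..2*n}" for i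
 proof -
  have "distr PP borel (%z. z i) = distr PP P (%z. z i)" by (intro distr_cong refl) (simp add: sets_P)
  then show ?thesis unfolding PP_def using that P distr_PiM_component[of "{n+1..2*n}" "%_. P" i] by simp
 qed
 show "i \<in> {n+1..2*n} ==> distr PP borel (%z. z i) = P" by (rule d)
 show "i \<in> {n+1..2*n} ==> (%z. z i) \<in> borel_measurable PP" by (rule m)
 have "distr PP (PiM {n+1..2*n} (%_. borel)) (%z. \<lambda>i\<in>{n+1..2*n}. z i) = distr PP PP (%z. z)"
  by (intro distr_cong refl) (auto simp: PP_def sets_P space_PiM PiE_def extensional_def restrict_def intro!: sets_PiM_cong ext)
 also have "... = PiM {n+1..2*n} (%i. distr PP borel (%z. z i))"
  unfolding distr_id by (subst PP_def) (intro PiM_cong refl d[symmetric], auto)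
 finally show "PP.indep_vars (%_. borel) (%i z. z i) {n+1..2*n}"
  using n m by (subst PP.indep_vars_iff_distr_eq_PiM') auto
qed

lemma f_PP_1: "j \<in> {1..n} ==> (\<integral>z. f x (z (n + j)) t \<partial>PP) = (\<integral>y. f x y t \<partial>P)"
 and f_PP_2: "j \<in> {1..n} ==> (\<integral>z. f (z (n + j)) x t \<partial>PP) = (\<integral>y. f y x t \<partial>P)"
proof -
 assume j: "j \<in> {1..n}"
 have 1: "f x (z (n + j)) t = (%y. f x y t) (z (n + j))" "f (z (n + j)) x t = (%y. f y x t) (z (n + j))" for z by auto
 have "(\<integral>y. f x y t \<partial>P) = (\<integral>y. f x y t \<partial>distr PP borel (%z. z (n + j)))" using distr_PP[of "n + j"] j by simp
 also have "... = (\<integral>z. f x (z (n + j)) t \<partial>PP)" using PP_meas[of "n + j"] j by (subst integral_distr) (auto intro!: f_meas')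
 finally show "(\<integral>z. f x (z (n + j)) t \<partial>PP) = (\<integral>y. f x y t \<partial>P)" by simp
 have "(\<integral>y. f y x t \<partial>P) = (\<integral>y. f y x t \<partial>distr PP borel (%z. z (n + j)))" using distr_PP[of "n + j"] j by simp
 also have "... = (\<integral>z. f (z (n + j)) x t \<partial>PP)" using PP_meas[of "n + j"] j by (subst integral_distr) (auto intro!: f_meas')
 finally show "(\<integral>z. f (z (n + j)) x t \<partial>PP) = (\<integral>y. f y x t \<partial>P)" by simp
qed

lemma f_PP_3: "i \<in> {1..n} ==> j \<in> {1..n} ==> i ~= j ==> (\<integral>z. f (z (n + i)) (z (n + j)) t \<partial>PP) = \<Gamma> t"
 using integral_pair[OF prob_PP indep_PP, of "n + i" "n + j" t] distr_PP by auto

lemma integrable_PP: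
 assumes "u \<in> borel_measurable PP" "v \<in> borel_measurable PP"
 shows "integrable PP (%z. f (u z) (v z) t)"
proof -
 interpret PP: prob_space PP by (rule prob_PP)
 show ?thesis using assms fC by (intro PP.integrable_const_bound[where B = C] f_meas') auto
qed

abbreviation pairsum :: "(nat => nat => real) => real" where
 "pairsum g \<equiv> \<Sum>i\<in>{1..n}. \<Sum>j\<in>{1..n}-{i}. g i j"

text \<open>The kernel h of the decomposition: its mean over either argument vanishes.\<close>

definition hoeff where
 "hoeff x y t = f x y t - (\<integral>w. f x w t \<partial>P) - (\<integral>w. f w y t \<partial>P) + \<Gamma> t"

lemma pairsum_abs_le:
 assumes "!!i j. \<bar>g i j\<bar> <= K" shows "\<bar>pairsum g\<bar> <= real n * (real n * K)"
proof -
 have K: "K >= 0" using assms[of 0 0] by linarith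
 have "\<bar>pairsum g\<bar> <= (\<Sum>i\<in>{1..n}. \<Sum>j\<in>{1..n}-{i}. K)"
  using assms by (intro order_trans[OF sum_abs] sum_mono order_trans[OF sum_abs]) auto
 also have "... <= (\<Sum>i\<in>{1..n}. \<Sum>j\<in>{1..n}. K)" using K by (intro sum_mono sum_mono2) auto
 finally show ?thesis by simp
qed

lemma pair_f_meas:
 "(%q. f (fst q i) (fst q j) (snd q)) \<in> borel_measurable (borel :: ((nat => 'a) \<times> 'b) measure)"
proof -
 have "(%q::(nat => 'a) \<times> 'b. fst q i) \<in> borel_measurable borel" for i
 proof -
  have "(%y::nat => 'a. y i) \<in> borel_measurable borel" by simp
  from measurable_compose[OF borel_measurable_continuous_onI[OF continuous_on_fst[OF continuous_on_id]] this]
  show ?thesis by simp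
 qed
 then show ?thesis
  by (intro f_meas' borel_measurable_continuous_onI[of snd] continuous_on_snd continuous_on_id)
qed

lemma swap_f:
 assumes "si \<subseteq> {1..n}" "i \<in> {1..n}"
 shows "y (swp n si i) = (if i \<in> si then y (n + i) else y i)" "y (swp n si (n + i)) = (if i \<in> si then y i else y (n + i))"
 using swp_simps[OF assms] by auto

text \<open>H is the second difference of f between sample and ghost. Integrating out the ghost
  gives \<open>hoeff\<close>, and exchanging i or j with its ghost reverses the sign of H, so
  exchanges multiply it by a product of two signs. Its four terms give 11424 = 4 * 2856.\<close>

lemma degenerate_bound:
 "(\<integral>\<^sup>+om. ennreal \<bar>pairsum (%i j. hoeff (Z i om) (Z j om) (\<theta> om))\<bar> \<partial>M) <= ennreal (11424 * C * (real d + 1) * real n)"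
proof -
 interpret PP: prob_space PP by (rule prob_PP)
 define H where "H y t i j = f (y i) (y j) t - f (y i) (y (n + j)) t - f (y (n + i)) (y j) t + f (y (n + i)) (y (n + j)) t"
  for y :: "nat => 'a" and t and i j :: nat
 define G where "G q = pairsum (H (fst q) (snd q))" for q
 have HC: "\<bar>H y t i j\<bar> <= 4 * C" for y t i j
  using fC[of "y i" "y j" t] fC[of "y i" "y (n + j)" t] fC[of "y (n + i)" "y j" t] fC[of "y (n + i)" "y (n + j)" t]
  unfolding H_def by linarith
 have "(\<integral>\<^sup>+om. ennreal \<bar>\<integral>z. G (W (om, z), \<theta> om) \<partial>PP\<bar> \<partial>M) <= ennreal (11424 * C * (real d + 1) * real n)"
 proof (rule symmetrize)
  show "G \<in> borel_measurable borel" unfolding G_def H_def by (intro borel_measurable_sum borel_measurable_add borel_measurable_diff pair_f_meas)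
  show "\<bar>G q\<bar> <= real n * (real n * (4 * C))" for q unfolding G_def by (rule pairsum_abs_le[OF HC])
  fix y :: "nat => 'a" and ch :: "nat set => 'b"
  let ?T = "%u v si. \<bar>pairsum (%i j. sg si i * sg si j * f (u i) (v j) (ch si))\<bar>"
  let ?y' = "%i. y (n + i)"
  have "\<bar>G (%k. y (swp n si k), ch si)\<bar> <= ?T y y si + ?T y ?y' si + ?T ?y' y si + ?T ?y' ?y' si" if "si \<in> Pow {1..n}" for si
  proof -
   have "G (%k. y (swp n si k), ch si) = pairsum (%i j. sg si i * sg si j * f (y i) (y j) (ch si)
   - sg si i * sg si j * f (y i) (?y' j) (ch si) - sg si i * sg si j * f (?y' i) (y j) (ch si) + sg si i * sg si j * f (?y' i) (?y' j) (ch si))"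
   unfolding G_def fst_conv snd_conv H_def using that
   by (intro sum.cong refl) (auto simp: swap_f sg_def)
   then show ?thesis by (simp only: sum.distrib sum_subtractf)
  qed
  then have "(\<Sum>si\<in>Pow {1..n}. \<bar>G (%k. y (swp n si k), ch si)\<bar>) <= (\<Sum>si\<in>Pow {1..n}. ?T y y si + ?T y ?y' si + ?T ?y' y si + ?T ?y' ?y' si)"
   by (rule sum_mono)
  also have "... <= 2 ^ n * (11424 * C * (real d + 1) * real n)"
   using chaos_bound[of y y ch] chaos_bound[of y ?y' ch] chaos_bound[of ?y' y ch] chaos_bound[of ?y' ?y' ch]
   by (simp only: sum.distrib)
  finally show "(\<Sum>si\<in>Pow {1..n}. \<bar>G (%k. y (swp n si k), ch si)\<bar>) <= 2 ^ n * (11424 * C * (real d + 1) * real n)" .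
 qed
 moreover have "(\<integral>z. G (W (om, z), \<theta> om) \<partial>PP) = pairsum (%i j. hoeff (Z i om) (Z j om) (\<theta> om))" for om
 proof -
  define t where "t = \<theta> om"
  have "(\<integral>z. G (W (om, z), t) \<partial>PP) = (\<integral>z. pairsum (%i j. f (Z i om) (Z j om) t - f (Z i om) (z (n + j)) t - f (z (n + i)) (Z j om) t + f (z (n + i)) (z (n + j)) t) \<partial>PP)"
   unfolding G_def H_def fst_conv snd_conv by (intro Bochner_Integration.integral_cong sum.cong refl) (auto simp: W_simps)
  also have "... = pairsum (%i j. \<integral>z. (f (Z i om) (Z j om) t - f (Z i om) (z (n + j)) t - f (z (n + i)) (Z j om) t + f (z (n + i)) (z (n + j)) t) \<partial>PP)"
   by (subst Bochner_Integration.integral_sum, (intro Bochner_Integration.integrable_sum Bochner_Integration.integrable_add Bochner_Integration.integrable_diff integrable_PP PP_meas; auto),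
   intro sum.cong refl, subst Bochner_Integration.integral_sum, (intro Bochner_Integration.integrable_add Bochner_Integration.integrable_diff integrable_PP PP_meas; auto), simp)
  also have "... = pairsum (%i j. hoeff (Z i om) (Z j om) t)"
  proof (intro sum.cong refl)
   fix i j assume ij: "i \<in> {1..n}" "j \<in> {1..n} - {i}"
   have I: "integrable PP (%z. f (Z i om) (Z j om) t)" "integrable PP (%z. f (Z i om) (z (n + j)) t)"
   "integrable PP (%z. f (z (n + i)) (Z j om) t)" "integrable PP (%z. f (z (n + i)) (z (n + j)) t)"
   using ij by (auto intro!: integrable_PP PP_meas)
   show "(\<integral>z. (f (Z i om) (Z j om) t - f (Z i om) (z (n + j)) t - f (z (n + i)) (Z j om) t + f (z (n + i)) (z (n + j)) t) \<partial>PP) = hoeff (Z i om) (Z j om) t"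
   using I ij by (simp add: f_PP_1 f_PP_2 f_PP_3 hoeff_def PP.prob_space)
  qed
  finally show ?thesis unfolding t_def .
 qed
 ultimately show ?thesis by simp
qed

text \<open>The plain difference between sample and ghost has no product structure, but twice it
  splits into a part odd in i and even in j and a part even in i and odd in j. Eight linear signed
  sums with weight 1/2 give 1632 = 4 * 408. After division by n (n - 1) the order is sqrt ((d + 1) /
  n), too crude for the rate but enough for consistency.\<close>

lemma uniform_bound:
 "(\<integral>\<^sup>+om. ennreal \<bar>pairsum (%i j. f (Z i om) (Z j om) (\<theta> om) - \<Gamma> (\<theta> om))\<bar> \<partial>M) <= ennreal (1632 * C * real n * sqrt ((real d + 1) * real n))"
proof -
 interpret PP: prob_space PP by (rule prob_PP)
 define H where "H y t i j = f (y i) (y j) t - f (y (n + i)) (y (n + j)) t"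
  for y :: "nat => 'a" and t and i j :: nat
 define G where "G q = pairsum (H (fst q) (snd q))" for q
 define R where "R = 408 * C * real n * sqrt ((real d + 1) * real n)"
 have HC: "\<bar>H y t i j\<bar> <= 2 * C" for y t i j
  using fC[of "y i" "y j" t] fC[of "y (n + i)" "y (n + j)" t] unfolding H_def by linarith
 have "(\<integral>\<^sup>+om. ennreal \<bar>\<integral>z. G (W (om, z), \<theta> om) \<partial>PP\<bar> \<partial>M) <= ennreal (4 * R)"
 proof (rule symmetrize)
  show "G \<in> borel_measurable borel" unfolding G_def H_def by (intro borel_measurable_sum borel_measurable_add borel_measurable_diff pair_f_meas)
  show "\<bar>G q\<bar> <= real n * (real n * (2 * C))" for q unfolding G_def by (rule pairsum_abs_le[OF HC])
  fix y :: "nat => 'a" and ch :: "nat set => 'b"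
  let ?S = "%u v si. pairsum (%i j. sg si i * f (u i) (v j) (ch si))"
  let ?T = "%u v si. pairsum (%i j. sg si j * f (u i) (v j) (ch si))"
  let ?y' = "%i. y (n + i)"
  have "\<bar>G (%k. y (swp n si k), ch si)\<bar> <= 1/2 * (\<bar>?S y y si\<bar> + \<bar>?S y ?y' si\<bar> + \<bar>?S ?y' y si\<bar> + \<bar>?S ?y' ?y' si\<bar>
   + (\<bar>?T y y si\<bar> + \<bar>?T y ?y' si\<bar> + \<bar>?T ?y' y si\<bar> + \<bar>?T ?y' ?y' si\<bar>))" if "si \<in> Pow {1..n}" for si
  proof -
   have "2 * G (%k. y (swp n si k), ch si) = pairsum (%i j. (sg si i * f (y i) (y j) (ch si)
   + sg si i * f (y i) (?y' j) (ch si) - sg si i * f (?y' i) (y j) (ch si) - sg si i * f (?y' i) (?y' j) (ch si))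
   + (sg si j * f (y i) (y j) (ch si)
   - sg si j * f (y i) (?y' j) (ch si) + sg si j * f (?y' i) (y j) (ch si) - sg si j * f (?y' i) (?y' j) (ch si)))"
   unfolding G_def fst_conv snd_conv H_def sum_distrib_left using that
   by (intro sum.cong refl) (auto simp: swap_f sg_def)
   then show ?thesis unfolding sum.distrib sum_subtractf by (rule abs_le_half_sum)
  qed
  then have "(\<Sum>si\<in>Pow {1..n}. \<bar>G (%k. y (swp n si k), ch si)\<bar>) <= (\<Sum>si\<in>Pow {1..n}. 1/2 * (\<bar>?S y y si\<bar> + \<bar>?S y ?y' si\<bar> + \<bar>?S ?y' y si\<bar> + \<bar>?S ?y' ?y' si\<bar>
   + (\<bar>?T y y si\<bar> + \<bar>?T y ?y' si\<bar> + \<bar>?T ?y' y si\<bar> + \<bar>?T ?y' ?y' si\<bar>)))"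
   by (rule sum_mono)
  also have "... <= 2 ^ n * (4 * R)"
  proof -
   note lb = linear_bound[where ch = ch, folded R_def]
   have "(\<Sum>si\<in>Pow {1..n}. 1/2 * (\<bar>?S y y si\<bar> + \<bar>?S y ?y' si\<bar> + \<bar>?S ?y' y si\<bar> + \<bar>?S ?y' ?y' si\<bar>
   + (\<bar>?T y y si\<bar> + \<bar>?T y ?y' si\<bar> + \<bar>?T ?y' y si\<bar> + \<bar>?T ?y' ?y' si\<bar>))) <= 4 * (2 ^ n * R)"
   by (rule sum_half8[OF lb(1)[of y y] lb(1)[of y ?y'] lb(1)[of ?y' y] lb(1)[of ?y' ?y'] lb(2)[of y y] lb(2)[of y ?y'] lb(2)[of ?y' y] lb(2)[of ?y' ?y']])
   then show ?thesis by (simp only: mult.left_commute)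
  qed
  finally show "(\<Sum>si\<in>Pow {1..n}. \<bar>G (%k. y (swp n si k), ch si)\<bar>) <= 2 ^ n * (4 * R)" .
 qed
 moreover have "(\<integral>z. G (W (om, z), \<theta> om) \<partial>PP) = pairsum (%i j. f (Z i om) (Z j om) (\<theta> om) - \<Gamma> (\<theta> om))" for om
 proof -
  define t where "t = \<theta> om"
  have "(\<integral>z. G (W (om, z), t) \<partial>PP) = (\<integral>z. pairsum (%i j. f (Z i om) (Z j om) t - f (z (n + i)) (z (n + j)) t) \<partial>PP)"
   unfolding G_def H_def fst_conv snd_conv by (intro Bochner_Integration.integral_cong sum.cong refl) (auto simp: W_simps)
  also have "... = pairsum (%i j. \<integral>z. (f (Z i om) (Z j om) t - f (z (n + i)) (z (n + j)) t) \<partial>PP)"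
   by (subst Bochner_Integration.integral_sum, (intro Bochner_Integration.integrable_sum Bochner_Integration.integrable_add Bochner_Integration.integrable_diff integrable_PP PP_meas; auto),
   intro sum.cong refl, subst Bochner_Integration.integral_sum, (intro Bochner_Integration.integrable_add Bochner_Integration.integrable_diff integrable_PP PP_meas; auto), simp)
  also have "... = pairsum (%i j. f (Z i om) (Z j om) t - \<Gamma> t)"
  proof (intro sum.cong refl)
   fix i j assume ij: "i \<in> {1..n}" "j \<in> {1..n} - {i}"
   have I: "integrable PP (%z. f (Z i om) (Z j om) t)" "integrable PP (%z. f (z (n + i)) (z (n + j)) t)"
   using ij by (auto intro!: integrable_PP PP_meas)
   show "(\<integral>z. (f (Z i om) (Z j om) t - f (z (n + i)) (z (n + j)) t) \<partial>PP) = f (Z i om) (Z j om) t - \<Gamma> t"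
   using I ij by (simp add: f_PP_3 PP.prob_space)
  qed
  finally show ?thesis unfolding t_def .
 qed
 ultimately show ?thesis by (simp add: R_def mult.assoc)
qed

end

section \<open>Symmetric matrices\<close>

text \<open>Vectors are total sequences of which the first n entries count, so that points,
  eigenvectors and matrix rows are treated alike.\<close>

definition ip :: "nat => (nat => real) => (nat => real) => real" where
 "ip n x y = (\<Sum>i<n. x i * y i)"

definition mv :: "nat => (nat => nat => real) => (nat => real) => nat => real" where
 "mv n a x i = (\<Sum>j<n. a i j * x j)"

lemma ip_commute: "ip n x y = ip n y x" by (simp add: ip_def mult.commute)

lemma ip_lin:
 "ip n (%i. x i + y i) z = ip n x z + ip n y z" "ip n (%i. x i - y i) z = ip n x z - ip n y z" "ip n (%i. c * x i) z = c * ip n x z"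
 "ip n z (%i. x i + y i) = ip n z x + ip n z y" "ip n z (%i. x i - y i) = ip n z x - ip n z y" "ip n z (%i. c * x i) = c * ip n z x"
 by (simp_all add: ip_def sum.distrib sum_subtractf algebra_simps sum_distrib_left)

lemma mv_lin:
 "mv n a (%i. x i + y i) = (%i. mv n a x i + mv n a y i)" "mv n a (%i. x i - y i) = (%i. mv n a x i - mv n a y i)" "mv n a (%i. c * x i) = (%i. c * mv n a x i)"
 by (auto simp: mv_def sum.distrib sum_subtractf algebra_simps sum_distrib_left)

lemma ip_pos: "ip n x x >= 0" by (simp add: ip_def sum_nonneg)

lemma ip_eq_0: "ip n x x = 0 ==> i < n ==> x i = 0"
 by (simp add: ip_def sum_nonneg_eq_0_iff)

lemma ip_sum: "ip n (%i. \<Sum>k\<in>K. f k i) z = (\<Sum>k\<in>K. ip n (f k) z)" "ip n z (%i. \<Sum>k\<in>K. f k i) = (\<Sum>k\<in>K. ip n z (f k))"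
 unfolding ip_def by (simp_all add: sum_distrib_right sum_distrib_left) (rule sum.swap)+

lemma ip_mv_sym:
 assumes "!!i j. i < n ==> j < n ==> a i j = a j i"
 shows "ip n x (mv n a y) = ip n (mv n a x) y"
proof -
 have "ip n x (mv n a y) = (\<Sum>i<n. \<Sum>j<n. a i j * x i * y j)" by (simp add: ip_def mv_def sum_distrib_left mult_ac)
 also have "... = (\<Sum>j<n. \<Sum>i<n. a i j * x i * y j)" by (rule sum.swap)
 also have "... = (\<Sum>j<n. \<Sum>i<n. a j i * x i * y j)" using assms by (intro sum.cong refl) auto
 also have "... = ip n (mv n a x) y" by (simp only: ip_def mv_def sum_distrib_right)
 finally show ?thesis .
qed

text \<open>The first-order condition at a minimum. For K > c and K > 0 the point t = - b / K gives
  a negative value unless b = 0.\<close>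

lemma nonneg_quadratic_imp_zero:
 fixes b c :: real
 assumes "!!t. 0 <= 2 * t * b + t\<^sup>2 * c" shows "b = 0"
proof (rule ccontr)
 assume b: "b ~= 0"
 define K where "K = \<bar>c\<bar> + 1"
 have K: "K > 0" "c < K" by (auto simp: K_def)
 have "2 * (- b / K) * b + (- b / K)\<^sup>2 * c = b\<^sup>2 / K * (c / K - 2)" using K by (simp add: field_simps power2_eq_square)
 also have "... < 0" using b K by (intro mult_pos_neg) (auto simp: field_simps)
 finally show False using assms[of "- b / K"] by linarith
qed

definition orthonormal :: "nat => nat => (nat => nat => real) => bool" where
 "orthonormal n m v \<longleftrightarrow> (\<forall>k<m. \<forall>l<m. ip n (v k) (v l) = (if k = l then 1 else 0))"

text \<open>The j-th unit vector minus its orthogonal projection onto the span of the vectors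
  \<open>v k\<close>, k < m.\<close>

definition resid :: "nat => (nat => nat => real) => nat => nat => real" where
 "resid m v j i = of_bool (i = j) - (\<Sum>k<m. v k j * v k i)"

lemma ip_unit: "j < n ==> ip n (%i. of_bool (i = j)) x = x j" "j < n ==> ip n x (%i. of_bool (i = j)) = x j"
 by (simp_all add: ip_def of_bool_def if_distrib if_distribR sum.delta cong: if_cong)

lemma resid_orth:
 assumes "orthonormal n m v" "j < n" "k < m" shows "ip n (resid m v j) (v k) = 0"
proof -
 have "ip n (resid m v j) (v k) = v k j - (\<Sum>l<m. v l j * ip n (v l) (v k))"
  unfolding resid_def[abs_def] using assms by (simp add: ip_lin ip_sum ip_unit)
 also have "(\<Sum>l<m. v l j * ip n (v l) (v k)) = (\<Sum>l<m. if l = k then v k j else 0)"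
  using assms by (intro sum.cong) (auto simp: orthonormal_def)
 finally show ?thesis using assms by simp
qed

text \<open>The residuals are the columns of an orthogonal projection of rank n - m, and the sum is
  its trace. It yields a vector outside the span when m < n and completeness when m = n.\<close>

lemma sum_resid:
 assumes "orthonormal n m v" shows "(\<Sum>j<n. ip n (resid m v j) (resid m v j)) = real n - real m"
proof -
 have "ip n (resid m v j) (resid m v j) = 1 - (\<Sum>k<m. v k j * v k j)" if j: "j < n" for j
 proof -
  have "ip n (resid m v j) (resid m v j) = ip n (resid m v j) (%i. of_bool (i = j)) - (\<Sum>k<m. v k j * ip n (resid m v j) (v k))"
   by (subst (2) resid_def[abs_def]) (simp add: ip_lin ip_sum)
  also have "... = resid m v j j" using resid_orth[OF assms j] j by (simp add: ip_unit)
  finally show ?thesis by (simp add: resid_def)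
 qed
 then have "(\<Sum>j<n. ip n (resid m v j) (resid m v j)) = real n - (\<Sum>j<n. \<Sum>k<m. v k j * v k j)" by (simp add: sum_subtractf)
 also have "(\<Sum>j<n. \<Sum>k<m. v k j * v k j) = (\<Sum>k<m. ip n (v k) (v k))" unfolding ip_def by (rule sum.swap)
 also have "... = real m" using assms by (simp add: orthonormal_def)
 finally show ?thesis .
qed

lemma compact_unit_vectors: "compact {x::nat => real. (\<forall>i\<ge>n. x i = 0) \<and> ip n x x = 1 \<and> (\<forall>k<m. ip n x (v k) = 0)}"
proof -
 have "compactin (product_topology (%i. euclidean) UNIV) (PiE UNIV (%i::nat. {-1..1::real}))"
  by (subst compactin_PiE) auto
 then have c: "compact (PiE UNIV (%i::nat. {-1..1::real}))" by (simp add: euclidean_product_topology)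
 have cc: "continuous_on UNIV (%x::nat => real. x i)" for i by (simp add: continuous_on_product_coordinates)
 have "closed ((\<Inter>i\<in>{n..}. {x::nat => real. x i = 0}) \<inter> {x. ip n x x = 1} \<inter> (\<Inter>k\<in>{..<m}. {x. ip n x (v k) = 0}))"
  unfolding ip_def by (intro closed_Int closed_INT ballI closed_Collect_eq continuous_intros cc)
 moreover have "((\<Inter>i\<in>{n..}. {x::nat => real. x i = 0}) \<inter> {x. ip n x x = 1} \<inter> (\<Inter>k\<in>{..<m}. {x. ip n x (v k) = 0})) = {x. (\<forall>i\<ge>n. x i = 0) \<and> ip n x x = 1 \<and> (\<forall>k<m. ip n x (v k) = 0)}" by auto
 ultimately have cl: "closed {x::nat => real. (\<forall>i\<ge>n. x i = 0) \<and> ip n x x = 1 \<and> (\<forall>k<m. ip n x (v k) = 0)}" by simp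
 have "{x::nat => real. (\<forall>i\<ge>n. x i = 0) \<and> ip n x x = 1 \<and> (\<forall>k<m. ip n x (v k) = 0)} \<subseteq> PiE UNIV (%i. {-1..1})"
 proof
  fix x assume x: "x \<in> {x::nat => real. (\<forall>i\<ge>n. x i = 0) \<and> ip n x x = 1 \<and> (\<forall>k<m. ip n x (v k) = 0)}"
  have "\<bar>x i\<bar> <= 1" for i
  proof (cases "i < n")
   case True
   have "x i * x i <= ip n x x" unfolding ip_def using True by (intro member_le_sum) auto
   then have "(x i)\<^sup>2 <= 1" using x by (simp add: power2_eq_square)
   then show ?thesis by (simp add: abs_square_le_1)
  qed (use x in auto)
  then show "x \<in> PiE UNIV (%i. {-1..1})" by (auto simp: abs_le_iff)
 qed
 then show ?thesis using compact_Int_closed[OF c cl] by (simp only: Int_absorb1)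
qed

text \<open>u minimizes the quadratic form over the unit vectors orthogonal to the eigenvectors
  found so far. The defect z = a u - \<mu>u u is orthogonal to them as well, by symmetry, so it is
  an admissible direction, and the first-order condition along z says that z has norm 0.\<close>

lemma spectral_step:
 assumes sym: "!!i j. i < n ==> j < n ==> a i j = a j i" and v: "orthonormal n m v" "m < n"
  and ev: "!!k i. k < m ==> i < n ==> mv n a (v k) i = \<mu> k * v k i"
 shows "\<exists>u \<mu>u. ip n u u = 1 \<and> (\<forall>k<m. ip n u (v k) = 0) \<and> (\<forall>i<n. mv n a u i = \<mu>u * u i)"
proof -
 let ?S = "{x::nat => real. (\<forall>i\<ge>n. x i = 0) \<and> ip n x x = 1 \<and> (\<forall>k<m. ip n x (v k) = 0)}"
 define q where "q x = ip n x (mv n a x)" for x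
 have ne: "?S ~= {}"
 proof -
  have "\<exists>j<n. ip n (resid m v j) (resid m v j) > 0"
  proof (rule ccontr)
   assume "\<not> ?thesis"
   then have "(\<Sum>j<n. ip n (resid m v j) (resid m v j)) <= 0" by (intro sum_nonpos) (meson lessThan_iff not_le)
   then show False using sum_resid[OF v(1)] v(2) by simp
  qed
  then obtain j where j: "j < n" "ip n (resid m v j) (resid m v j) > 0" by blast
  define r where "r i = (if i < n then resid m v j i / sqrt (ip n (resid m v j) (resid m v j)) else 0)" for i
  have r: "ip n r y = 1 / sqrt (ip n (resid m v j) (resid m v j)) * ip n (resid m v j) y" for y
   unfolding ip_lin(3)[symmetric] by (auto simp: ip_def r_def intro!: sum.cong)
  have "ip n r r = 1 / sqrt (ip n (resid m v j) (resid m v j)) * (1 / sqrt (ip n (resid m v j) (resid m v j)) * ip n (resid m v j) (resid m v j))"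
   unfolding r by (subst ip_commute) (simp only: r)
  also have "... = 1" using j(2) by (simp add: real_sqrt_mult[symmetric] divide_simps)
  finally have "r \<in> ?S" using resid_orth[OF v(1) j(1)] by (auto simp: r) (auto simp: r_def)
  then show ?thesis by blast
 qed
 have cont: "continuous_on ?S q"
  unfolding q_def ip_def mv_def
  by (intro continuous_intros continuous_on_subset[OF continuous_on_product_coordinates]) auto
 from continuous_attains_inf[OF compact_unit_vectors ne cont]
 obtain u where uS: "u \<in> ?S" and umin: "\<forall>x\<in>?S. q u <= q x" by (elim bexE)
 note u = uS umin[rule_format]
 define \<mu>u where "\<mu>u = q u"
 have hom: "\<mu>u * ip n x x <= q x" if x: "!!k. k < m ==> ip n x (v k) = 0" for x
 proof (cases "ip n x x = 0")
  case True
  then have "!!i. i < n ==> x i = 0" using ip_eq_0 by blast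
  then show ?thesis using True by (simp add: q_def ip_def)
 next
  case False
  then have p: "ip n x x > 0" using ip_pos[of n x] by linarith
  define c where "c = 1 / sqrt (ip n x x)"
  define y where "y i = (if i < n then c * x i else 0)" for i
  have yy: "ip n y z = c * ip n x z" for z unfolding ip_lin(3)[symmetric] by (auto simp: ip_def y_def intro!: sum.cong)
  have mvy: "mv n a y = (%i. c * mv n a x i)" unfolding mv_lin(3)[symmetric] by (auto simp: mv_def y_def intro!: sum.cong)
  have "ip n y y = c * (c * ip n x x)" unfolding yy by (subst ip_commute) (simp only: yy)
  then have "y \<in> ?S" using x p by (auto simp: yy c_def divide_simps) (auto simp: y_def)
  then have "\<mu>u <= q y" using u(2) by (simp add: \<mu>u_def)
  also have "q y = c * (c * q x)" unfolding q_def yy mvy ip_lin by simp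
  also have "... = q x / ip n x x" using p by (simp add: c_def)
  finally show ?thesis using p by (simp add: field_simps)
 qed
 define z where "z i = mv n a u i - \<mu>u * u i" for i
 have zv: "ip n z (v k) = 0" if k: "k < m" for k
 proof -
  have "ip n z (v k) = ip n u (mv n a (v k)) - \<mu>u * ip n u (v k)"
   unfolding z_def[abs_def] ip_lin by (simp add: ip_mv_sym[OF sym])
  also have "ip n u (mv n a (v k)) = \<mu> k * ip n u (v k)"
   unfolding ip_lin(6)[symmetric] using ev[OF k] by (auto simp: ip_def intro!: sum.cong)
  finally show ?thesis using u(1) k by simp
 qed
 have "0 <= 2 * t * ip n z z + t\<^sup>2 * (q z - \<mu>u * ip n z z)" for t
 proof -
  have "\<mu>u * ip n (%i. u i + t * z i) (%i. u i + t * z i) <= q (%i. u i + t * z i)"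
   by (rule hom) (use zv u(1) in \<open>simp add: ip_lin\<close>)
  moreover have "q (%i. u i + t * z i) = q u + 2 * t * ip n z (mv n a u) + t\<^sup>2 * q z"
   unfolding q_def mv_lin ip_lin using ip_mv_sym[where n = n and a = a and x = u and y = z, OF sym] ip_commute[of n "mv n a u" z]
   by (simp add: algebra_simps power2_eq_square)
  moreover have "ip n z (mv n a u) = ip n z z + \<mu>u * ip n z u"
   unfolding ip_lin(4)[symmetric] ip_lin(6)[symmetric] by (simp add: z_def)
  ultimately show ?thesis using u(1) by (simp add: ip_lin ip_commute[of n u z] \<mu>u_def[symmetric] algebra_simps power2_eq_square)
 qed
 then have "ip n z z = 0" by (rule nonneg_quadratic_imp_zero)
 then have "\<forall>i<n. mv n a u i = \<mu>u * u i" using ip_eq_0[of n z] by (auto simp: z_def)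
 then show ?thesis using u(1) by blast
qed

lemma spectral_theorem:
 assumes sym: "!!i j. i < n ==> j < n ==> a i j = a j i"
 obtains v \<mu> where "orthonormal n n v" "!!k i. k < n ==> i < n ==> mv n a (v k) i = \<mu> k * v k i"
proof -
 have "m <= n ==> \<exists>v \<mu>. orthonormal n m v \<and> (\<forall>k<m. \<forall>i<n. mv n a (v k) i = \<mu> k * v k i)" for m
 proof (induction m)
  case 0 then show ?case by (auto simp: orthonormal_def)
 next
  case (Suc m)
  then obtain v \<mu> where v: "orthonormal n m v" "!!k i. k < m ==> i < n ==> mv n a (v k) i = \<mu> k * v k i" by auto
  obtain u \<mu>u where u: "ip n u u = 1" "\<forall>k<m. ip n u (v k) = 0" "\<forall>i<n. mv n a u i = \<mu>u * u i"
   using spectral_step[OF sym v(1) _ v(2)] Suc by auto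
  have "orthonormal n (Suc m) (v(m := u))"
  proof -
   have u4: "\<forall>k<m. ip n (v k) u = 0" using u(2) by (metis ip_commute)
   have "ip n ((v(m := u)) k) ((v(m := u)) l) = (if k = l then 1 else 0)" if "k < Suc m" "l < Suc m" for k l
   proof (cases "k = m")
   case True
   then show ?thesis using u(1,2) that by (cases "l = m") auto
   next
   case False
   then show ?thesis using v(1) u4 that by (cases "l = m") (auto simp: orthonormal_def)
   qed
   then show ?thesis by (simp add: orthonormal_def)
  qed
  moreover have "\<forall>k<Suc m. \<forall>i<n. mv n a ((v(m := u)) k) i = (\<mu>(m := \<mu>u)) k * (v(m := u)) k i"
   using v(2) u by (auto simp: less_Suc_eq)
  ultimately show ?case by blast
 qed
 from this[of n] that show ?thesis by auto
qed

lemma orthonormal_complete: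
 assumes "orthonormal n n v" "i < n" "j < n"
 shows "(\<Sum>k<n. v k i * v k j) = of_bool (i = j)"
proof -
 have "(\<Sum>j<n. ip n (resid n v j) (resid n v j)) = 0" using sum_resid[OF assms(1)] by simp
 then have "ip n (resid n v j) (resid n v j) = 0" using assms(3) ip_pos by (simp add: sum_nonneg_eq_0_iff)
 then have "resid n v j i = 0" using ip_eq_0 assms(2) by blast
 then show ?thesis by (simp add: resid_def mult.commute)
qed

text \<open>Functional calculus: the matrix with eigenvectors \<open>v k\<close> and eigenvalues
  \<open>\<phi> k\<close>. Inverse, square root and identity are instances, and products of such
  matrices multiply \<phi> pointwise.\<close>

definition fcalc :: "nat => (nat => nat => real) => (nat => real) => nat => nat => real" where
 "fcalc n v \<phi> i j = (\<Sum>k<n. \<phi> k * (v k i * v k j))"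

lemma fcalc_sym: "fcalc n v \<phi> i j = fcalc n v \<phi> j i" by (simp add: fcalc_def mult.commute)

lemma fcalc_mv: "mv n (fcalc n v \<phi>) x i = (\<Sum>k<n. \<phi> k * ip n (v k) x * v k i)"
 unfolding mv_def fcalc_def ip_def sum_distrib_right sum_distrib_left
 by (subst sum.swap) (simp add: mult_ac)

lemma fcalc_ip: "ip n x (mv n (fcalc n v \<phi>) y) = (\<Sum>k<n. \<phi> k * ip n (v k) x * ip n (v k) y)"
proof -
 have "ip n x (mv n (fcalc n v \<phi>) y) = ip n x (%i. \<Sum>k<n. (\<phi> k * ip n (v k) y) * v k i)" by (simp add: fcalc_mv[abs_def])
 also have "... = (\<Sum>k<n. \<phi> k * ip n (v k) y * ip n x (v k))" unfolding ip_sum ip_lin by simp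
 finally show ?thesis by (simp add: ip_commute[of n x] mult_ac)
qed

lemma fcalc_mult:
 assumes "orthonormal n n v"
 shows "(\<Sum>l<n. fcalc n v \<phi> i l * fcalc n v \<psi> l j) = fcalc n v (%k. \<phi> k * \<psi> k) i j"
proof -
 have "(\<Sum>l<n. fcalc n v \<phi> i l * fcalc n v \<psi> l j) = mv n (fcalc n v \<phi>) (%l. fcalc n v \<psi> l j) i" by (simp add: mv_def)
 also have "... = (\<Sum>k<n. \<phi> k * ip n (v k) (%l. fcalc n v \<psi> l j) * v k i)" by (rule fcalc_mv)
 also have "... = (\<Sum>k<n. \<phi> k * (\<psi> k * v k j) * v k i)"
 proof (intro sum.cong refl)
  fix k assume k: "k \<in> {..<n}"
  have "ip n (v k) (%l. fcalc n v \<psi> l j) = (\<Sum>m<n. ip n (v k) (%l. (\<psi> m * v m j) * v m l))"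
   unfolding fcalc_def ip_sum[symmetric] by (simp add: mult_ac)
  also have "... = (\<Sum>m<n. if m = k then \<psi> k * v k j else 0)"
   unfolding ip_lin using assms k by (intro sum.cong) (auto simp: orthonormal_def)
  finally show "\<phi> k * ip n (v k) (%l. fcalc n v \<psi> l j) * v k i = \<phi> k * (\<psi> k * v k j) * v k i" using k by simp
 qed
 finally show ?thesis by (simp add: fcalc_def mult_ac)
qed

lemma fcalc_1: "orthonormal n n v ==> i < n ==> j < n ==> fcalc n v (%_. 1) i j = of_bool (i = j)"
 using orthonormal_complete[of n v i j] by (simp add: fcalc_def)

lemma fcalc_eq:
 assumes v: "orthonormal n n v" and ev: "!!k i. k < n ==> i < n ==> mv n a (v k) i = \<mu> k * v k i" and ij: "i < n" "j < n"
 shows "a i j = fcalc n v \<mu> i j"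
proof -
 have "a i j = (\<Sum>l<n. a i l * of_bool (l = j))" using ij by (simp add: of_bool_def if_distrib cong: if_cong)
 also have "... = (\<Sum>l<n. \<Sum>k<n. a i l * (v k l * v k j))"
  using orthonormal_complete[OF v _ ij(2)] by (intro sum.cong refl) (simp add: sum_distrib_left[symmetric])
 also have "... = (\<Sum>k<n. mv n a (v k) i * v k j)" unfolding mv_def sum_distrib_right by (subst sum.swap) (simp add: mult_ac)
 also have "... = (\<Sum>k<n. \<mu> k * v k i * v k j)" using ev ij by (intro sum.cong) auto
 finally show ?thesis by (simp add: fcalc_def mult_ac)
qed

lemma parseval: "orthonormal n n v ==> (\<Sum>k<n. ip n (v k) x * ip n (v k) y) = ip n x y"
proof -
 assume v: "orthonormal n n v"
 have "mv n (fcalc n v (%_. 1)) y i = y i" if "i < n" for i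
 proof -
  have "mv n (fcalc n v (%_. 1)) y i = (\<Sum>j<n. of_bool (i = j) * y j)"
   unfolding mv_def using fcalc_1[OF v that] by (intro sum.cong) auto
  also have "... = y i" using that by (simp add: of_bool_def if_distrib if_distribR cong: if_cong)
  finally show ?thesis .
 qed
 then have "ip n x (mv n (fcalc n v (%_. 1)) y) = ip n x y" by (simp add: ip_def)
 then show ?thesis unfolding fcalc_ip by simp
qed

section \<open>Passage to matrices, spectra and the inverse square root\<close>

lemma scalar_prod_ip: "x \<in> carrier_vec n ==> y \<in> carrier_vec n ==> scalar_prod x y = ip n (%i. x $ i) (%i. y $ i)"
 by (simp add: scalar_prod_def ip_def atLeast0LessThan)

lemma mult_mat_vec_mv: "A \<in> carrier_mat n n ==> x \<in> carrier_vec n ==> i < n ==> (A *\<^sub>v x) $ i = mv n (%i j. A $$ (i, j)) (%i. x $ i) i"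
 by (simp add: mv_def scalar_prod_def atLeast0LessThan)

lemma scalar_prod_mult_mat_vec:
 assumes A: "A \<in> carrier_mat n n" and x: "x \<in> carrier_vec n" and y: "y \<in> carrier_vec n"
 shows "scalar_prod x (A *\<^sub>v y) = ip n (%i. x $ i) (mv n (%i j. A $$ (i, j)) (%i. y $ i))"
  and "scalar_prod (A *\<^sub>v x) (A *\<^sub>v y) = ip n (mv n (%i j. A $$ (i, j)) (%i. x $ i)) (mv n (%i j. A $$ (i, j)) (%i. y $ i))"
proof -
 have c: "A *\<^sub>v x \<in> carrier_vec n" "A *\<^sub>v y \<in> carrier_vec n" using A x y by auto
 show "scalar_prod x (A *\<^sub>v y) = ip n (%i. x $ i) (mv n (%i j. A $$ (i, j)) (%i. y $ i))"
  unfolding scalar_prod_ip[OF x c(2)] ip_def by (intro sum.cong refl arg_cong2[where f = "(*)"] mult_mat_vec_mv[OF A y]) simp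
 show "scalar_prod (A *\<^sub>v x) (A *\<^sub>v y) = ip n (mv n (%i j. A $$ (i, j)) (%i. x $ i)) (mv n (%i j. A $$ (i, j)) (%i. y $ i))"
  unfolding scalar_prod_ip[OF c] ip_def by (intro sum.cong refl arg_cong2[where f = "(*)"] mult_mat_vec_mv[OF A x] mult_mat_vec_mv[OF A y]) simp_all
qed

lemma index_mult_mat_sum: "A \<in> carrier_mat n n ==> B \<in> carrier_mat n n ==> i < n ==> j < n ==>
  (A * B) $$ (i, j) = (\<Sum>l<n. A $$ (i, l) * B $$ (l, j))"
 by (simp add: scalar_prod_def atLeast0LessThan)

locale sym_mat =
 fixes n :: nat and A :: "real mat" and v :: "nat => nat => real" and \<mu> :: "nat => real"
 assumes A: "A \<in> carrier_mat n n" and v: "orthonormal n n v"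
  and ev: "!!k i. k < n ==> i < n ==> mv n (%i j. A $$ (i, j)) (v k) i = \<mu> k * v k i"
begin

lemma A_fcalc: "i < n ==> j < n ==> A $$ (i, j) = fcalc n v \<mu> i j"
 using fcalc_eq[OF v, of "%i j. A $$ (i, j)" \<mu>] ev by blast

lemma mv_A: "i < n ==> mv n (%i j. A $$ (i, j)) x i = mv n (fcalc n v \<mu>) x i"
 unfolding mv_def by (intro sum.cong) (auto simp: A_fcalc)

lemma \<mu>_spectrum: "k < n ==> \<mu> k \<in> spectrum A"
proof -
 assume k: "k < n"
 have "Matrix.vec n (v k) ~= 0\<^sub>v n"
 proof
  assume "Matrix.vec n (v k) = 0\<^sub>v n"
  then have "v k i = 0" if "i < n" for i using that by (metis index_vec index_zero_vec(1))
  then have "ip n (v k) (v k) = 0" by (simp add: ip_def)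
  then show False using v k by (simp add: orthonormal_def)
 qed
 moreover have "A *\<^sub>v Matrix.vec n (v k) = \<mu> k \<cdot>\<^sub>v Matrix.vec n (v k)"
 proof (rule eq_vecI)
  fix i assume "i < dim_vec (\<mu> k \<cdot>\<^sub>v Matrix.vec n (v k))"
  then have i: "i < n" by simp
  have "(A *\<^sub>v Matrix.vec n (v k)) $ i = mv n (%i j. A $$ (i, j)) (v k) i"
   unfolding mult_mat_vec_mv[OF A vec_carrier i] mv_def by (intro sum.cong) auto
  then show "(A *\<^sub>v Matrix.vec n (v k)) $ i = (\<mu> k \<cdot>\<^sub>v Matrix.vec n (v k)) $ i" using ev[OF k i] i by simp
 qed (use A in auto)
 ultimately have "eigenvector A (Matrix.vec n (v k)) (\<mu> k)" using A unfolding eigenvector_def by auto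
 then show ?thesis unfolding spectrum_def eigenvalue_def by auto
qed

lemma \<mu>_bounds: "k < n ==> lambda_min A <= \<mu> k" "k < n ==> \<mu> k <= lambda_max A"
 using card_finite_spectrum(1)[OF A] \<mu>_spectrum unfolding lambda_min_def lambda_max_def by auto

lemma rayleigh: "lambda_min A * ip n x x <= ip n x (mv n (%i j. A $$ (i, j)) x)" "ip n x (mv n (%i j. A $$ (i, j)) x) <= lambda_max A * ip n x x"
proof -
 have e: "ip n x (mv n (%i j. A $$ (i, j)) x) = (\<Sum>k<n. \<mu> k * (ip n (v k) x * ip n (v k) x))"
  using fcalc_ip[of n x v \<mu> x] by (simp add: ip_def mv_A mult_ac)
 have "(\<Sum>k<n. lambda_min A * (ip n (v k) x * ip n (v k) x)) <= (\<Sum>k<n. \<mu> k * (ip n (v k) x * ip n (v k) x))"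
  using \<mu>_bounds(1) by (intro sum_mono mult_right_mono) auto
 then show "lambda_min A * ip n x x <= ip n x (mv n (%i j. A $$ (i, j)) x)"
  unfolding e sum_distrib_left[symmetric] parseval[OF v] .
 have "(\<Sum>k<n. \<mu> k * (ip n (v k) x * ip n (v k) x)) <= (\<Sum>k<n. lambda_max A * (ip n (v k) x * ip n (v k) x))"
  using \<mu>_bounds(2) by (intro sum_mono mult_right_mono) auto
 then show "ip n x (mv n (%i j. A $$ (i, j)) x) <= lambda_max A * ip n x x"
  unfolding e sum_distrib_left[symmetric] parseval[OF v] .
qed

end

lemma sym_mat_exists:
 assumes "A \<in> carrier_mat n n" "symmetric_mat A" obtains v \<mu> where "sym_mat n A v \<mu>"
proof -
 have "A $$ (i, j) = A $$ (j, i)" if "i < n" "j < n" for i j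
  using assms that index_transpose_mat(1)[of i A j] unfolding symmetric_mat_def by auto
 then obtain v \<mu> where "orthonormal n n v" "!!k i. k < n ==> i < n ==> mv n (%i j. A $$ (i, j)) (v k) i = \<mu> k * v k i"
  using spectral_theorem[of n "%i j. A $$ (i, j)"] by blast
 then have "sym_mat n A v \<mu>" using assms(1) by unfold_locales
 then show ?thesis by (rule that)
qed

locale pd_mat = sym_mat +
 assumes pos: "!!k. k < n ==> \<mu> k > 0"
begin

definition \<beta> where "\<beta> k = 1 / sqrt (\<mu> k)"
definition B where "B = mat n n (%(i, j). fcalc n v \<beta> i j)"

lemma B: "B \<in> carrier_mat n n" "i < n ==> j < n ==> B $$ (i, j) = fcalc n v \<beta> i j"
 by (auto simp: B_def)

lemma \<beta>: "k < n ==> \<beta> k > 0" "k < n ==> \<beta> k * \<beta> k = 1 / \<mu> k"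
 using pos[of k] by (simp_all add: \<beta>_def)

lemma fcalc_cong: "(!!k. k < n ==> \<phi> k = \<psi> k) ==> fcalc n v \<phi> i j = fcalc n v \<psi> i j"
 by (simp add: fcalc_def)

lemma BB: "i < n ==> j < n ==> (B * B) $$ (i, j) = fcalc n v (%k. 1 / \<mu> k) i j"
proof -
 assume ij: "i < n" "j < n"
 have "(B * B) $$ (i, j) = (\<Sum>l<n. fcalc n v \<beta> i l * fcalc n v \<beta> l j)"
  unfolding index_mult_mat_sum[OF B(1) B(1) ij] using B(2) ij by (intro sum.cong) auto
 then show ?thesis unfolding fcalc_mult[OF v] using fcalc_cong[of "%k. \<beta> k * \<beta> k" "%k. 1 / \<mu> k"] \<beta> by simp
qed

lemma A_BB: "A * (B * B) = 1\<^sub>m n" "(B * B) * A = 1\<^sub>m n"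
proof -
 have BBc: "B * B \<in> carrier_mat n n" using B(1) by simp
 show "A * (B * B) = 1\<^sub>m n"
 proof (rule eq_matI)
  fix i j assume "i < dim_row (1\<^sub>m n :: real mat)" "j < dim_col (1\<^sub>m n :: real mat)"
  then have ij: "i < n" "j < n" by auto
  have "(A * (B * B)) $$ (i, j) = (\<Sum>l<n. fcalc n v \<mu> i l * fcalc n v (%k. 1 / \<mu> k) l j)"
   unfolding index_mult_mat_sum[OF A BBc ij] using BB A_fcalc ij by (intro sum.cong) auto
  also have "... = fcalc n v (%_. 1) i j" unfolding fcalc_mult[OF v] using pos by (intro fcalc_cong) (auto simp: less_imp_neq[symmetric])
  finally show "(A * (B * B)) $$ (i, j) = 1\<^sub>m n $$ (i, j)" using fcalc_1[OF v ij] ij by simp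
 qed (use A B(1) in auto)
 show "(B * B) * A = 1\<^sub>m n"
 proof (rule eq_matI)
  fix i j assume "i < dim_row (1\<^sub>m n :: real mat)" "j < dim_col (1\<^sub>m n :: real mat)"
  then have ij: "i < n" "j < n" by auto
  have "((B * B) * A) $$ (i, j) = (\<Sum>l<n. fcalc n v (%k. 1 / \<mu> k) i l * fcalc n v \<mu> l j)"
   unfolding index_mult_mat_sum[OF BBc A ij] using BB A_fcalc ij by (intro sum.cong) auto
  also have "... = fcalc n v (%_. 1) i j" unfolding fcalc_mult[OF v] using pos by (intro fcalc_cong) (auto simp: less_imp_neq[symmetric])
  finally show "((B * B) * A) $$ (i, j) = 1\<^sub>m n $$ (i, j)" using fcalc_1[OF v ij] ij by simp
 qed (use A B(1) in auto)
qed

lemma mv_mult: "X \<in> carrier_mat n n ==> Y \<in> carrier_mat n n ==> i < n ==>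
 mv n (%i j. (X * Y) $$ (i, j)) x i = mv n (%i j. X $$ (i, j)) (mv n (%i j. Y $$ (i, j)) x) i"
proof -
 assume X: "X \<in> carrier_mat n n" "Y \<in> carrier_mat n n" "i < n"
 have "mv n (%i j. (X * Y) $$ (i, j)) x i = (\<Sum>j<n. \<Sum>l<n. X $$ (i, l) * Y $$ (l, j) * x j)"
  unfolding mv_def using index_mult_mat_sum[OF X] by (intro sum.cong) (auto simp: sum_distrib_right)
 also have "... = (\<Sum>l<n. \<Sum>j<n. X $$ (i, l) * Y $$ (l, j) * x j)" by (rule sum.swap)
 finally show ?thesis by (simp add: mv_def sum_distrib_left mult.assoc)
qed

text \<open>If \<open>C\<close> is another positive semidefinite square root of the inverse, then \<open>w = C v - \<beta> v\<close> satisfies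
 \<open>C w = - \<beta> w\<close> for every eigenvector \<open>v\<close>, which forces \<open>w = 0\<close>.\<close>

lemma inv_sqrt_unique:
 assumes C: "C \<in> carrier_mat n n" "pos_semidef C" "inverts_mat (C * C) A"
 shows "C = B"
proof -
 let ?c = "%i j. C $$ (i, j)"
 have CCc: "C * C \<in> carrier_mat n n" and BBc: "B * B \<in> carrier_mat n n" using C(1) B(1) by auto
 have "C * C = (C * C) * (A * (B * B))" unfolding A_BB(1) right_mult_one_mat[OF CCc] ..
 also have "... = ((C * C) * A) * (B * B)" by (rule assoc_mult_mat[symmetric, OF CCc A BBc])
 also have "C * C * A = 1\<^sub>m n" using C(1,3) unfolding inverts_mat_def by simp
 also have "1\<^sub>m n * (B * B) = B * B" by (rule left_mult_one_mat[OF BBc])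
 finally have CC: "C * C = B * B" .
 have psd: "0 <= ip n x (mv n ?c x)" for x
 proof -
  have "0 <= scalar_prod (Matrix.vec n x) (C *\<^sub>v Matrix.vec n x)" using C(1,2) unfolding pos_semidef_def by auto
  also have "... = ip n (%i. Matrix.vec n x $ i) (%i. (C *\<^sub>v Matrix.vec n x) $ i)" using C(1) by (intro scalar_prod_ip) auto
  also have "... = ip n x (mv n ?c x)"
   unfolding ip_def using mult_mat_vec_mv[OF C(1) vec_carrier] by (intro sum.cong refl) (auto simp: mv_def)
  finally show ?thesis .
 qed
 have Cv: "mv n ?c (v k) i = \<beta> k * v k i" if k: "k < n" and i: "i < n" for k i
 proof -
  define w where "w i = mv n ?c (v k) i - \<beta> k * v k i" for i
  have cc: "mv n ?c (mv n ?c (v k)) i = \<beta> k * \<beta> k * v k i" if i: "i < n" for i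
  proof -
   have "mv n ?c (mv n ?c (v k)) i = mv n (%i j. (B * B) $$ (i, j)) (v k) i" using mv_mult[OF C(1) C(1) i] CC by simp
   also have "... = mv n (fcalc n v (%k. 1 / \<mu> k)) (v k) i" unfolding mv_def using BB i by (intro sum.cong) auto
   also have "... = (\<Sum>l<n. if l = k then 1 / \<mu> k * v k i else 0)" unfolding fcalc_mv using v k by (intro sum.cong) (auto simp: orthonormal_def)
   finally show ?thesis using k \<beta>(2)[OF k] by simp
  qed
  have "mv n ?c w i = - \<beta> k * w i" if "i < n" for i
   unfolding w_def[abs_def] mv_lin using cc[OF that] by (simp add: algebra_simps)
  then have "ip n w (mv n ?c w) = - \<beta> k * ip n w w"
   unfolding ip_lin(6)[symmetric] by (auto simp: ip_def intro!: sum.cong)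
  then have "\<beta> k * ip n w w <= 0" using psd[of w] by simp
  then have "ip n w w <= 0" using \<beta>(1)[OF k] by (simp add: mult_le_0_iff)
  then have "ip n w w = 0" using ip_pos[of n w] by linarith
  then show ?thesis using ip_eq_0 i by (fastforce simp: w_def)
 qed
 show ?thesis
 proof (rule eq_matI)
  fix i j assume "i < dim_row B" "j < dim_col B"
  then have ij: "i < n" "j < n" using B(1) by auto
  then show "C $$ (i, j) = B $$ (i, j)" using fcalc_eq[OF v Cv ij] B(2) by simp
 qed (use C(1) B(1) in auto)
qed

text \<open>Existence and uniqueness together evaluate the definite description in
  \<open>inv_sqrt_mat\<close>.\<close>

lemma inv_sqrt_mat_eq: "inv_sqrt_mat A = B"
proof -
 have "pos_semidef B"
 proof -
  have "transpose_mat B = B" using B fcalc_sym by (intro eq_matI) (auto simp: B_def)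
  moreover have "0 <= scalar_prod x (B *\<^sub>v x)" if x: "x \<in> carrier_vec n" for x
  proof -
   have "scalar_prod x (B *\<^sub>v x) = ip n (%i. x $ i) (mv n (fcalc n v \<beta>) (%i. x $ i))"
   unfolding scalar_prod_mult_mat_vec(1)[OF B(1) x x] ip_def mv_def using B(2) by (intro sum.cong refl) auto
   also have "... >= 0" unfolding fcalc_ip using \<beta>(1) by (intro sum_nonneg) (auto simp: mult.assoc less_imp_le)
   finally show ?thesis .
  qed
  ultimately show ?thesis using B(1) unfolding pos_semidef_def symmetric_mat_def by auto
 qed
 then have *: "B \<in> carrier_mat (dim_row A) (dim_row A) \<and> pos_semidef B \<and> inverts_mat A (B * B) \<and> inverts_mat (B * B) A"
  using A B(1) A_BB unfolding inverts_mat_def by auto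
 show ?thesis unfolding inv_sqrt_mat_def
 proof (rule the_equality)
  show "B \<in> carrier_mat (dim_row A) (dim_row A) \<and> pos_semidef B \<and> inverts_mat A (B * B) \<and> inverts_mat (B * B) A" by (rule *)
  show "X = B" if "X \<in> carrier_mat (dim_row A) (dim_row A) \<and> pos_semidef X \<and> inverts_mat A (X * X) \<and> inverts_mat (X * X) A" for X
   using that A by (intro inv_sqrt_unique) auto
 qed
qed

end

lemma ip_CS: "\<bar>ip n x y\<bar> <= sqrt (ip n x x) * sqrt (ip n y y)"
proof -
 have "(ip n x y)\<^sup>2 <= ip n x x * ip n y y"
  using Cauchy_Schwarz_ineq_sum[of x y "{..<n}"] by (simp add: ip_def power2_eq_square)
 then have "sqrt ((ip n x y)\<^sup>2) <= sqrt (ip n x x * ip n y y)" by (rule real_sqrt_le_mono)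
 then show ?thesis by (simp add: real_sqrt_mult)
qed

lemma spectral_norm_bound:
 assumes E: "E \<in> carrier_mat n n" and \<rho>: "spectral_norm E <= \<rho>"
 shows "sqrt (ip n (mv n (%i j. E $$ (i, j)) y) (mv n (%i j. E $$ (i, j)) y)) <= \<rho> * sqrt (ip n y y)"
proof (cases "ip n y y = 0")
 case True
 then have "!!i. i < n ==> y i = 0" using ip_eq_0 by blast
 then show ?thesis using True by (simp add: ip_def mv_def)
next
 case False
 let ?e = "%i j. E $$ (i, j)"
 define c where "c = sqrt (ip n y y)"
 have c: "c > 0" "c * c = ip n y y" using False ip_pos[of n y] by (auto simp: c_def)
 have sp: "scalar_prod (E *\<^sub>v u) (E *\<^sub>v u) = ip n (mv n ?e (%i. u $ i)) (mv n ?e (%i. u $ i))" if "u \<in> carrier_vec n" for u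
  by (rule scalar_prod_mult_mat_vec(2)[OF E that that])
 \<comment> \<open>A real supremum dominates its members only if the set is bounded; here the
   Frobenius norm is an upper bound.\<close>
 have bdd: "bdd_above ((%u. sqrt (scalar_prod (E *\<^sub>v u) (E *\<^sub>v u))) ` unit_sphere (dim_col E))"
 proof (rule bdd_aboveI2)
  fix u assume "u \<in> unit_sphere (dim_col E)"
  then have u: "u \<in> carrier_vec n" "ip n (%i. u $ i) (%i. u $ i) = 1"
   using E scalar_prod_ip[of u n u] by (auto simp: unit_sphere_def)
  have "(mv n ?e (%i. u $ i) i)\<^sup>2 <= ip n (?e i) (?e i)" for i
   using Cauchy_Schwarz_ineq_sum[of "?e i" "%i. u $ i" "{..<n}"] u(2) by (simp add: mv_def ip_def power2_eq_square)
  then have "ip n (mv n ?e (%i. u $ i)) (mv n ?e (%i. u $ i)) <= (\<Sum>i<n. ip n (?e i) (?e i))"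
   unfolding ip_def[of n "mv n ?e (%i. u $ i)"] by (intro sum_mono) (simp add: power2_eq_square)
  then show "sqrt (scalar_prod (E *\<^sub>v u) (E *\<^sub>v u)) <= sqrt (\<Sum>i<n. ip n (?e i) (?e i))" unfolding sp[OF u(1)] by simp
 qed
 define u where "u = Matrix.vec n (%i. 1 / c * y i)"
 have uip: "ip n (%i. u $ i) z = 1 / c * ip n y z" for z
  unfolding ip_lin(3)[symmetric] by (auto simp: ip_def u_def intro!: sum.cong)
 have "ip n (%i. u $ i) (%i. u $ i) = 1 / c * (1 / c * ip n y y)" unfolding uip by (subst ip_commute) (simp only: uip)
 then have u1: "ip n (%i. u $ i) (%i. u $ i) = 1" unfolding c(2)[symmetric] using c(1) by simp
 have uc: "u \<in> carrier_vec n" by (simp add: u_def)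
 then have uS: "u \<in> unit_sphere (dim_col E)" using E u1 scalar_prod_ip[OF uc uc] by (simp add: unit_sphere_def)
 have "sqrt (scalar_prod (E *\<^sub>v u) (E *\<^sub>v u)) <= \<rho>"
  using cSUP_upper[OF uS bdd] \<rho> unfolding spectral_norm_def by linarith
 moreover have "mv n ?e (%i. u $ i) = (%i. 1 / c * mv n ?e y i)"
  unfolding mv_lin(3)[symmetric] by (auto simp: mv_def u_def intro!: sum.cong)
 ultimately have "sqrt (1 / c * (1 / c * ip n (mv n ?e y) (mv n ?e y))) <= \<rho>" unfolding sp[OF uc] by (simp only: ip_lin)
 moreover have "sqrt (1 / c * (1 / c * ip n (mv n ?e y) (mv n ?e y))) = sqrt (ip n (mv n ?e y) (mv n ?e y)) / c"
  using c(1) by (simp add: real_sqrt_mult real_sqrt_divide)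
 ultimately show ?thesis using c(1) by (simp add: divide_le_eq c_def)
qed

text \<open>With E = I - A^(-1/2) C A^(-1/2) one has A - C = A^(1/2) E A^(1/2). The form of A - C at
  x, y is therefore the form of E at \<open>rt x\<close>, \<open>rt y\<close>, and each square root
  costs a factor sqrt (lambda_max A).\<close>

lemma (in pd_mat) inv_sqrt_perturbation:
 assumes C: "C \<in> carrier_mat n n"
  and \<rho>: "spectral_norm (1\<^sub>m n - inv_sqrt_mat A * C * inv_sqrt_mat A) <= \<rho>" and \<rho>0: "\<rho> >= 0" and lmax: "0 <= lambda_max A"
 shows "\<bar>ip n x (mv n (%i j. A $$ (i, j) - C $$ (i, j)) y)\<bar> <= \<rho> * lambda_max A * (sqrt (ip n x x) * sqrt (ip n y y))"
proof -
 let ?a = "%i j. A $$ (i, j)" and ?c = "%i j. C $$ (i, j)" and ?b = "%i j. B $$ (i, j)"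
 define E where "E = 1\<^sub>m n - B * C * B"
 let ?e = "%i j. E $$ (i, j)"
 have E: "E \<in> carrier_mat n n" unfolding E_def by (intro minus_carrier_mat mult_carrier_mat[where n = n] B(1) C)
 have BC: "B * C \<in> carrier_mat n n" using B(1) C by simp
 define rt where "rt z = mv n (fcalc n v (%k. sqrt (\<mu> k))) z" for z
 have Brt: "mv n ?b (rt z) i = z i" if i: "i < n" for z i
 proof -
  have "mv n ?b (rt z) i = mv n (fcalc n v \<beta>) (rt z) i" unfolding mv_def using B(2) i by (intro sum.cong) auto
  also have "... = mv n (%i j. \<Sum>l<n. fcalc n v \<beta> i l * fcalc n v (%k. sqrt (\<mu> k)) l j) z i"
   unfolding mv_def rt_def sum_distrib_left sum_distrib_right by (subst sum.swap) (simp add: mult.assoc)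
  also have "... = mv n (fcalc n v (%_. 1)) z i"
   unfolding fcalc_mult[OF v] using pos by (intro arg_cong2[where f = "%a i. mv n a z i"] ext fcalc_cong) (auto simp: \<beta>_def less_imp_neq[symmetric])
  also have "... = (\<Sum>j<n. of_bool (i = j) * z j)" unfolding mv_def using fcalc_1[OF v i] by (intro sum.cong) auto
  also have "... = z i" using i by (simp add: of_bool_def if_distrib if_distribR cong: if_cong)
  finally show ?thesis .
 qed
 have rtn: "ip n (rt z) (rt z) = ip n z (mv n ?a z)" for z
 proof -
  have "ip n (rt z) (rt z) = ip n z (mv n (fcalc n v (%k. sqrt (\<mu> k))) (rt z))"
   unfolding rt_def by (subst ip_mv_sym[where a = "fcalc n v (%k. sqrt (\<mu> k))"]) (auto simp: fcalc_sym)
  also have "mv n (fcalc n v (%k. sqrt (\<mu> k))) (rt z) = mv n (%i j. \<Sum>l<n. fcalc n v (%k. sqrt (\<mu> k)) i l * fcalc n v (%k. sqrt (\<mu> k)) l j) z"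
   unfolding mv_def rt_def sum_distrib_left sum_distrib_right by (subst sum.swap) (simp add: mult.assoc)
  also have "... = mv n (fcalc n v \<mu>) z"
   unfolding fcalc_mult[OF v] using pos by (intro arg_cong2[where f = "%a z. mv n a z"] ext fcalc_cong refl) (auto simp: less_imp_le)
  also have "ip n z ... = ip n z (mv n ?a z)" by (simp add: ip_def mv_A)
  finally show ?thesis .
 qed
 have "mv n ?e u i = u i - mv n ?b (mv n ?c (mv n ?b u)) i" if i: "i < n" for u i
 proof -
  have "mv n ?e u i = (\<Sum>j<n. of_bool (i = j) * u j) - mv n (%i j. (B * C * B) $$ (i, j)) u i"
   unfolding mv_def sum_subtractf[symmetric] using i B(1) C by (intro sum.cong refl) (auto simp: E_def left_diff_distrib)
  also have "(\<Sum>j<n. of_bool (i = j) * u j) = u i" using i by (simp add: of_bool_def if_distrib if_distribR cong: if_cong)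
  also have "mv n (%i j. (B * C * B) $$ (i, j)) u i = mv n (%i j. (B * C) $$ (i, j)) (mv n ?b u) i" by (rule mv_mult[OF BC B(1) i])
  also have "... = mv n ?b (mv n ?c (mv n ?b u)) i" by (rule mv_mult[OF B(1) C i])
  finally show ?thesis .
 qed
 then have "ip n (rt x) (mv n ?e (rt y)) = ip n (rt x) (%i. rt y i - mv n ?b (mv n ?c (mv n ?b (rt y))) i)"
  by (simp add: ip_def)
 also have "... = ip n (rt x) (rt y) - ip n (rt x) (mv n ?b (mv n ?c (mv n ?b (rt y))))" by (rule ip_lin)
 also have "ip n (rt x) (mv n ?b (mv n ?c (mv n ?b (rt y)))) = ip n (mv n ?b (rt x)) (mv n ?c (mv n ?b (rt y)))"
 proof (rule ip_mv_sym)
  fix i j assume ij: "i < n" "j < n"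
  show "B $$ (i, j) = B $$ (j, i)" using B(2)[OF ij] B(2)[OF ij(2,1)] fcalc_sym[of n v \<beta> i j] by simp
 qed
 also have "... = ip n x (mv n ?c y)"
 proof -
  have "mv n ?c (mv n ?b (rt y)) i = mv n ?c y i" for i
   unfolding mv_def[of n ?c] using Brt by (intro sum.cong refl) auto
  then show ?thesis unfolding ip_def using Brt by (intro sum.cong) auto
 qed
 also have "ip n (rt x) (rt y) = ip n x (mv n ?a y)"
 proof -
  \<comment> \<open>Polarization of the norm identity \<open>rtn\<close>.\<close>
  have "4 * ip n (rt x) (rt y) = ip n (rt (%i. x i + y i)) (rt (%i. x i + y i)) - ip n (rt (%i. x i - y i)) (rt (%i. x i - y i))"
   unfolding rt_def mv_lin ip_lin using ip_commute[of n "mv n (fcalc n v (%k. sqrt (\<mu> k))) x" "mv n (fcalc n v (%k. sqrt (\<mu> k))) y"] by simp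
  also have "... = 2 * ip n x (mv n ?a y) + 2 * ip n y (mv n ?a x)" unfolding rtn mv_lin ip_lin by simp
  also have "ip n y (mv n ?a x) = ip n x (mv n ?a y)"
  proof -
   have "A $$ (i, j) = A $$ (j, i)" if "i < n" "j < n" for i j
   using A_fcalc[OF that] A_fcalc[OF that(2,1)] fcalc_sym[of n v \<mu> i j] by simp
   then have "ip n y (mv n ?a x) = ip n (mv n ?a y) x" by (rule ip_mv_sym)
   then show ?thesis by (simp only: ip_commute[of n "mv n ?a y" x])
  qed
  finally show ?thesis by simp
 qed
 finally have main: "ip n (rt x) (mv n ?e (rt y)) = ip n x (mv n (%i j. ?a i j - ?c i j) y)"
  by (simp add: ip_def mv_def left_diff_distrib sum_subtractf right_diff_distrib)
 have rtb: "sqrt (ip n (rt z) (rt z)) <= sqrt (lambda_max A) * sqrt (ip n z z)" for z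
  using rayleigh(2)[of z] unfolding rtn real_sqrt_mult[symmetric] by simp
 have "\<bar>ip n (rt x) (mv n ?e (rt y))\<bar> <= sqrt (ip n (rt x) (rt x)) * sqrt (ip n (mv n ?e (rt y)) (mv n ?e (rt y)))" by (rule ip_CS)
 also have "... <= sqrt (ip n (rt x) (rt x)) * (\<rho> * sqrt (ip n (rt y) (rt y)))"
  using \<rho> unfolding inv_sqrt_mat_eq E_def[symmetric] by (intro mult_left_mono spectral_norm_bound E) (auto simp: ip_pos)
 also have "... = \<rho> * (sqrt (ip n (rt x) (rt x)) * sqrt (ip n (rt y) (rt y)))" by simp
 also have "... <= \<rho> * ((sqrt (lambda_max A) * sqrt (ip n x x)) * (sqrt (lambda_max A) * sqrt (ip n y y)))"
  using \<rho>0 lmax by (intro mult_left_mono mult_mono rtb) (auto simp: ip_pos)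
 also have "... = \<rho> * lambda_max A * (sqrt (ip n x x) * sqrt (ip n y y))"
 proof -
  have "(sqrt (lambda_max A) * a) * (sqrt (lambda_max A) * b) = lambda_max A * (a * b)" for a b
   using real_sqrt_mult_self[of "lambda_max A"] lmax by (simp add: mult_ac)
  then show ?thesis by (simp only: mult.assoc)
 qed
 finally show ?thesis unfolding main .
qed

section \<open>Mollification\<close>

lemma PiM_lborel_shift:
 fixes t :: "nat => real"
 assumes I: "finite I"
 shows "distr (PiM I (%_. lborel)) (PiM I (%_. lborel)) (%v. \<lambda>i\<in>I. v i + t i) = PiM I (%_. lborel)"
proof -
 interpret product_sigma_finite "%_::nat. lborel :: real measure" ..
 have m: "(%v. \<lambda>i\<in>I. v i + t i) \<in> PiM I (%_. lborel) \<rightarrow>\<^sub>M PiM I (%_. lborel)" by measurable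
 show ?thesis
 proof (rule PiM_eqI[OF I])
  fix A :: "nat => real set" assume A: "!!i. i \<in> I ==> A i \<in> sets lborel"
  have pre: "(%v. \<lambda>i\<in>I. v i + t i) -` PiE I A \<inter> space (PiM I (%_. lborel)) = PiE I (%i. (+) (t i) -` A i)"
   by (auto simp: space_PiM PiE_iff add.commute)
  have "emeasure (distr (PiM I (%_. lborel)) (PiM I (%_. lborel)) (%v. \<lambda>i\<in>I. v i + t i)) (PiE I A)
   = emeasure (PiM I (%_. lborel)) (PiE I (%i. (+) (t i) -` A i))"
   unfolding pre[symmetric] using A I by (intro emeasure_distr m sets_PiM_I_finite) auto
  also have "... = (\<Prod>i\<in>I. emeasure lborel ((+) (t i) -` A i))"
   using A I by (intro emeasure_PiM) (auto intro: measurable_sets_borel[of _ borel])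
  also have "... = (\<Prod>i\<in>I. emeasure lborel (A i))"
  proof (rule prod.cong[OF refl])
   fix i assume i: "i \<in> I"
   have "emeasure lborel (A i) = emeasure (distr lborel borel ((+) (t i))) (A i)" by (simp add: lborel_distr_plus)
   also have "... = emeasure lborel ((+) (t i) -` A i)" using A[OF i] by (subst emeasure_distr) auto
   finally show "emeasure lborel ((+) (t i) -` A i) = emeasure lborel (A i)" by simp
  qed
  finally show "emeasure (distr (PiM I (%_. lborel)) (PiM I (%_. lborel)) (%v. \<lambda>i\<in>I. v i + t i)) (PiE I A) = (\<Prod>i\<in>I. emeasure lborel (A i))" .
 qed simp
qed

definition U01 :: "real measure" where "U01 = restrict_space lborel {0..1}"

lemma prob_U01: "prob_space U01"
 by (rule prob_spaceI) (simp add: U01_def emeasure_restrict_space)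

lemma U01_meas: "(%u. u) \<in> borel_measurable U01" unfolding U01_def by (rule measurable_restrict_space1) simp

lemma space_U01: "space U01 = {0..1}" by (simp add: U01_def)

text \<open>The derivative need not be continuous: the gauge integral integrates every derivative,
  and integrability identifies the value with the Lebesgue integral.\<close>

lemma FTC_U01:
 fixes F f :: "real => real"
 assumes der: "!!u. 0 <= u ==> u <= 1 ==> (F has_field_derivative f u) (at u)" and int: "integrable U01 f"
 shows "F 1 - F 0 = (\<integral>u. f u \<partial>U01)"
proof -
 have sint: "set_integrable lborel {0..1} f" using int unfolding U01_def by (subst (asm) integrable_restrict_space) (auto simp: set_integrable_def)
 have "(f has_integral F 1 - F 0) {0..1}"
 proof (rule fundamental_theorem_of_calculus)
  show "(F has_vector_derivative f u) (at u within {0..1})" if "u \<in> {0..1}" for u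
   using der[of u] that unfolding has_real_derivative_iff_has_vector_derivative by (auto intro: has_vector_derivative_at_within)
 qed simp
 moreover have "(f has_integral (LINT u:{0..1}|lborel. f u)) {0..1}"
  unfolding set_borel_integral_eq_integral(2)[OF sint] by (rule integrable_integral[OF set_borel_integral_eq_integral(1)[OF sint]])
 ultimately have "F 1 - F 0 = (LINT u:{0..1}|lborel. f u)" by (rule has_integral_unique)
 then show ?thesis unfolding U01_def by (subst integral_restrict_space) (auto simp: set_lebesgue_integral_def)
qed

text \<open>Zero padding: points of the product measure \<open>Lam d\<close> are
  \<open>undefined\<close> beyond d, whereas points of \<open>Rd d\<close> are zero there.\<close>

definition pt :: "nat => (nat => real) => point" where "pt d v = (%i. if i < d then v i else 0)"

abbreviation Lam :: "nat => (nat => real) measure" where "Lam d \<equiv> PiM {..<d} (%_. lborel)"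

lemma pt_meas [measurable (raw)]:
 assumes "!!i. i < d ==> (%w. f w i) \<in> borel_measurable N"
 shows "(%w. pt d (f w)) \<in> borel_measurable N"
proof (rule measurable_coordinatewise_then_product)
 show "(%w. pt d (f w) i) \<in> borel_measurable N" for i using assms[of i] by (cases "i < d") (simp_all add: pt_def)
qed

lemma Lam_comp [measurable]: "i < d ==> (%v. v i) \<in> borel_measurable (Lam d)"
 by (rule measurable_compose[OF measurable_component_singleton]) auto

definition tent :: "real => real => real" where "tent dl x = max 0 (1 - \<bar>x\<bar> / dl)"

lemma tent: "dl > 0 ==> 0 <= tent dl x" "dl > 0 ==> tent dl x <= 1" "dl > 0 ==> dl <= \<bar>x\<bar> ==> tent dl x = 0"
 "dl > 0 ==> \<bar>tent dl x - tent dl y\<bar> <= \<bar>x - y\<bar> / dl"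
proof -
 assume dl: "dl > 0"
 show "0 <= tent dl x" "tent dl x <= 1" "dl <= \<bar>x\<bar> ==> tent dl x = 0" using dl by (auto simp: tent_def)
 have "\<bar>(1 - \<bar>x\<bar> / dl) - (1 - \<bar>y\<bar> / dl)\<bar> = \<bar>\<bar>y\<bar> - \<bar>x\<bar>\<bar> / dl" using dl by (simp add: diff_divide_distrib[symmetric])
 also have "... <= \<bar>x - y\<bar> / dl" using dl by (intro divide_right_mono) auto
 finally show "\<bar>tent dl x - tent dl y\<bar> <= \<bar>x - y\<bar> / dl" unfolding tent_def by linarith
qed

lemma tent_meas [measurable]: "tent dl \<in> borel_measurable borel" unfolding tent_def[abs_def] by measurable

text \<open>The kernel is a normalized product of tents, supported in a box of half-width dl. Being
  Lipschitz, it makes the averages of bounded measurable functions Lipschitz on bounded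
  sets.\<close>

locale mollifier =
 fixes d :: nat and dl :: real
 assumes dl: "dl > 0"
begin

interpretation L: product_sigma_finite "%_::nat. lborel :: real measure" ..
interpretation LF: finite_product_sigma_finite "%_::nat. lborel :: real measure" "{..<d}" by standard simp

definition Z where "Z = (\<integral>\<^sup>+v. ennreal (\<Prod>i<d. tent dl (v i)) \<partial>Lam d)"

lemma Z: "0 < Z" "Z < \<top>"
proof -
 have "Z = (\<integral>\<^sup>+v. (\<Prod>i<d. ennreal (tent dl (v i))) \<partial>Lam d)" unfolding Z_def using tent dl by (simp add: prod_ennreal)
 also have "... = (\<Prod>i<d. \<integral>\<^sup>+x. ennreal (tent dl x) \<partial>lborel)" by (rule L.product_nn_integral_prod) auto
 finally have Zp: "Z = (\<Prod>i<d. \<integral>\<^sup>+x. ennreal (tent dl x) \<partial>lborel)" .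
 have "(\<integral>\<^sup>+x. ennreal (tent dl x) \<partial>lborel) <= (\<integral>\<^sup>+x. indicator {-dl..dl} x \<partial>lborel)"
 proof (rule nn_integral_mono)
  fix x :: real
  show "ennreal (tent dl x) <= indicator {-dl..dl} x"
   using tent(2,3)[OF dl, of x] by (cases "x \<in> {-dl..dl}") (auto simp: ennreal_le_1)
 qed
 also have "... < \<top>" using dl by simp
 finally have fin: "(\<integral>\<^sup>+x. ennreal (tent dl x) \<partial>lborel) < \<top>" .
 have "(\<integral>\<^sup>+x. ennreal (1/2) * indicator {-(dl/2)..dl/2} x \<partial>lborel) <= (\<integral>\<^sup>+x. ennreal (tent dl x) \<partial>lborel)"
 proof (rule nn_integral_mono)
  fix x :: real
  show "ennreal (1/2) * indicator {-(dl/2)..dl/2} x <= ennreal (tent dl x)"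
  proof (cases "x \<in> {-(dl/2)..dl/2}")
   case True
   then have "\<bar>x\<bar> <= dl / 2" by auto
   then have "\<bar>x\<bar> / dl <= 1 / 2" using dl by (simp add: field_simps)
   then have "1 / 2 <= tent dl x" unfolding tent_def by linarith
   then have "ennreal (1 / 2) <= ennreal (tent dl x)" by (rule ennreal_leI)
   then show ?thesis unfolding indicator_simps(1)[OF True] mult_1_right .
  qed simp
 qed
 moreover have "0 < (\<integral>\<^sup>+x. ennreal (1/2) * indicator {-(dl/2)..dl/2} x \<partial>lborel)"
 proof -
  have "(\<integral>\<^sup>+x. ennreal (1/2) * indicator {-(dl/2)..dl/2} x \<partial>lborel) = ennreal (1/2) * ennreal dl"
   using dl by (subst nn_integral_cmult_indicator) auto
  also have "... = ennreal (1/2 * dl)" using dl by (intro ennreal_mult[symmetric]) auto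
  also have "0 < ..." using dl by simp
  finally show ?thesis by simp
 qed
 ultimately have pos: "0 < (\<integral>\<^sup>+x. ennreal (tent dl x) \<partial>lborel)" by (rule less_le_trans[rotated])
 show "Z < \<top>" unfolding Zp prod_constant using fin by (simp add: power_less_top_ennreal)
 show "0 < Z" unfolding Zp prod_constant using pos unfolding zero_less_iff_neq_zero by (rule power_not_zero)
qed

definition q where "q v = (\<Prod>i<d. tent dl (v i)) / enn2real Z"

lemma q_meas [measurable (raw)]:
 assumes "!!i. i < d ==> (%w. f w i) \<in> borel_measurable N"
 shows "(%w. q (f w)) \<in> borel_measurable N"
 unfolding q_def by (intro borel_measurable_divide borel_measurable_prod measurable_compose[OF assms tent_meas] borel_measurable_const) auto

lemma Zr: "enn2real Z > 0" using Z by (simp add: enn2real_positive_iff)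

lemma q0: "q v >= 0" unfolding q_def using Zr tent(1)[OF dl] by (intro divide_nonneg_nonneg prod_nonneg) auto

lemma q_supp: "i < d ==> dl <= \<bar>v i\<bar> ==> q v = 0"
 unfolding q_def using tent(3)[OF dl] by (auto simp: prod_zero_iff)

lemma q_int: "(\<integral>\<^sup>+v. ennreal (q v) \<partial>Lam d) = 1"
proof -
 have "(\<integral>\<^sup>+v. ennreal (q v) \<partial>Lam d) = (\<integral>\<^sup>+v. ennreal (\<Prod>i<d. tent dl (v i)) / ennreal (enn2real Z) \<partial>Lam d)"
  unfolding q_def using Zr tent(1)[OF dl] by (intro nn_integral_cong divide_ennreal[symmetric] prod_nonneg) auto
 also have "... = Z / ennreal (enn2real Z)"
  unfolding Z_def[symmetric] by (subst nn_integral_divide) (auto simp: Z_def intro!: measurable_compose[OF _ measurable_ennreal] borel_measurable_prod measurable_compose[OF Lam_comp tent_meas])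
 also have "... = 1" using Z by (simp add: ennreal_divide_self less_imp_neq[symmetric] zero_less_iff_neq_zero)
 finally show ?thesis .
qed

definition Q where "Q = density (Lam d) (%v. ennreal (q v))"

lemma q_meas' [measurable]: "q \<in> borel_measurable (Lam d)" by (rule q_meas) simp

lemma prob_Q: "prob_space Q"
 by (rule prob_spaceI) (simp add: Q_def emeasure_density q_int cong: nn_integral_cong_simp)

lemma sets_Q [measurable_cong]: "sets Q = sets (Lam d)" by (simp add: Q_def)

lemma AE_Q: "AE v in Q. \<forall>i<d. \<bar>v i\<bar> < dl"
proof -
 have "\<forall>i<d. \<bar>v i\<bar> < dl" if "0 < ennreal (q v)" for v
 proof (rule ccontr)
  assume "\<not> (\<forall>i<d. \<bar>v i\<bar> < dl)"
  then obtain i where "i < d" "dl <= \<bar>v i\<bar>" by (auto simp: not_less)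
  then have "q v = 0" by (rule q_supp)
  then show False using that by simp
 qed
 then have "AE v in Lam d. 0 < ennreal (q v) --> (\<forall>i<d. \<bar>v i\<bar> < dl)" by (intro AE_I2) blast
 moreover have "(%v. ennreal (q v)) \<in> borel_measurable (Lam d)" by measurable
 ultimately show ?thesis unfolding Q_def using AE_density by blast
qed

lemma q_lipschitz: "\<bar>q v - q w\<bar> <= (\<Sum>i<d. \<bar>v i - w i\<bar>) / (dl * enn2real Z)"
proof -
 have "\<bar>(\<Prod>i<d. tent dl (v i)) - (\<Prod>i<d. tent dl (w i))\<bar> <= (\<Sum>i<d. \<bar>tent dl (v i) - tent dl (w i)\<bar>)"
  using norm_prod_diff[of "{..<d}" "%i. tent dl (v i)" "%i. tent dl (w i)"] tent(1,2)[OF dl] by simp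
 also have "... <= (\<Sum>i<d. \<bar>v i - w i\<bar> / dl)" by (intro sum_mono tent(4)[OF dl])
 finally have "\<bar>(\<Prod>i<d. tent dl (v i)) - (\<Prod>i<d. tent dl (w i))\<bar> <= (\<Sum>i<d. \<bar>v i - w i\<bar>) / dl" by (simp add: sum_divide_distrib)
 then have "\<bar>(\<Prod>i<d. tent dl (v i)) - (\<Prod>i<d. tent dl (w i))\<bar> / enn2real Z <= (\<Sum>i<d. \<bar>v i - w i\<bar>) / dl / enn2real Z"
  using Zr by (intro divide_right_mono) auto
 then show ?thesis using Zr by (simp add: q_def diff_divide_distrib[symmetric])
qed

definition Lc where "Lc R = (2 * (R + dl)) ^ d / (dl * enn2real Z)"

lemma Lc0: "R >= 0 ==> Lc R >= 0" unfolding Lc_def using dl Zr by simp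

text \<open>Both shifted kernels vanish outside a box of half-width R + dl, and inside they differ
  by at most the Lipschitz bound; \<open>Lc\<close> is the Lipschitz constant of q times the volume
  of that box.\<close>

lemma q_shift_L1:
 assumes y: "!!i. i < d ==> \<bar>y i\<bar> <= R" "!!i. i < d ==> \<bar>y' i\<bar> <= R" and R: "R >= 0"
 shows "(\<integral>\<^sup>+v. ennreal \<bar>q (%i. v i - y i) - q (%i. v i - y' i)\<bar> \<partial>Lam d) <= ennreal (Lc R * (\<Sum>i<d. \<bar>y i - y' i\<bar>))"
proof -
 define S where "S = (\<Sum>i<d. \<bar>y i - y' i\<bar>) / (dl * enn2real Z)"
 define Bx where "Bx = PiE {..<d} (%_. {-(R + dl)..R + dl})"
 have S0: "S >= 0" unfolding S_def using dl Zr by (simp add: sum_nonneg)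
 have "\<bar>q (%i. v i - y i) - q (%i. v i - y' i)\<bar> <= S * indicator Bx v" if v: "v \<in> space (Lam d)" for v
 proof (cases "v \<in> Bx")
  case True
  have "(\<Sum>i<d. \<bar>(v i - y i) - (v i - y' i)\<bar>) = (\<Sum>i<d. \<bar>y i - y' i\<bar>)" by (intro sum.cong refl) linarith
  then show ?thesis using q_lipschitz[of "%i. v i - y i" "%i. v i - y' i"] True by (simp add: S_def)
 next
  case False
  then obtain i where i: "i < d" "\<not> (-(R + dl) <= v i \<and> v i <= R + dl)" using v by (auto simp: Bx_def space_PiM PiE_iff)
  then have "dl <= \<bar>v i - y i\<bar>" "dl <= \<bar>v i - y' i\<bar>" using y(1)[OF i(1)] y(2)[OF i(1)] by linarith+
  then show ?thesis using q_supp[OF i(1), of "%i. v i - y i"] q_supp[OF i(1), of "%i. v i - y' i"] S0 by simp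
 qed
 then have "(\<integral>\<^sup>+v. ennreal \<bar>q (%i. v i - y i) - q (%i. v i - y' i)\<bar> \<partial>Lam d) <= (\<integral>\<^sup>+v. ennreal S * indicator Bx v \<partial>Lam d)"
  using S0 by (intro nn_integral_mono) (auto simp: ennreal_mult[symmetric] ennreal_indicator[symmetric] intro!: ennreal_leI simp del: ennreal_indicator)
 also have "... = ennreal S * emeasure (Lam d) Bx"
  unfolding Bx_def by (intro nn_integral_cmult_indicator sets_PiM_I_finite) auto
 also have "emeasure (Lam d) Bx = (\<Prod>i<d. ennreal (2 * (R + dl)))"
  unfolding Bx_def using R dl by (subst L.emeasure_PiM) (auto intro!: prod.cong arg_cong[where f = ennreal])
 also have "... = ennreal ((2 * (R + dl)) ^ d)" using R dl ennreal_power[of "2 * (R + dl)" d] by (simp only: prod_constant card_lessThan) simp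
 also have "ennreal S * ... = ennreal (Lc R * (\<Sum>i<d. \<bar>y i - y' i\<bar>))"
  using S0 R dl by (simp add: ennreal_mult[symmetric] S_def Lc_def mult.commute)
 finally show ?thesis .
qed

text \<open>The shift is moved from F, which is only measurable, to the kernel; all regularity in y
  then comes from q.\<close>

lemma Lam_shift:
 fixes F :: "point => real"
 assumes F: "F \<in> borel_measurable borel"
 shows "(\<integral>v. F (pt d (%i. y i + v i)) \<partial>Q) = (\<integral>v. q (%i. v i - y i) * F (pt d v) \<partial>Lam d)" (is ?A)
  and "integrable Q (%v. F (pt d (%i. y i + v i))) \<longleftrightarrow> integrable (Lam d) (%v. q (%i. v i - y i) * F (pt d v))" (is ?B)
proof -
 have r: "(%v. \<lambda>i\<in>{..<d}. v i + y i) \<in> Lam d \<rightarrow>\<^sub>M Lam d" by measurable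
 have mF: "(%v. F (pt d (%i. y i + v i))) \<in> borel_measurable (Lam d)"
  by (intro measurable_compose[OF pt_meas F]) auto
 have m: "(%v. q (%i. v i - y i) * F (pt d v)) \<in> borel_measurable (Lam d)"
  by (intro borel_measurable_times measurable_compose[OF pt_meas F] q_meas) auto
 have e: "q (%i. (\<lambda>i\<in>{..<d}. v i + y i) i - y i) * F (pt d (\<lambda>i\<in>{..<d}. v i + y i)) = q v * F (pt d (%i. y i + v i))" for v
  by (intro arg_cong2[where f = "(*)"] arg_cong[where f = F]) (auto simp: pt_def q_def add.commute intro!: prod.cong)
 show ?A
 proof -
  have "(\<integral>v. q (%i. v i - y i) * F (pt d v) \<partial>Lam d) = (\<integral>v. q (%i. v i - y i) * F (pt d v) \<partial>distr (Lam d) (Lam d) (%v. \<lambda>i\<in>{..<d}. v i + y i))"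
   by (simp only: PiM_lborel_shift[OF finite_lessThan])
  also have "... = (\<integral>v. q v * F (pt d (%i. y i + v i)) \<partial>Lam d)"
   using m r by (subst integral_distr) (simp_all only: e)
  also have "... = (\<integral>v. F (pt d (%i. y i + v i)) \<partial>Q)" unfolding Q_def using mF q0 by (subst integral_density) auto
  finally show ?thesis by simp
 qed
 show ?B
 proof -
  have "integrable (Lam d) (%v. q (%i. v i - y i) * F (pt d v)) \<longleftrightarrow> integrable (distr (Lam d) (Lam d) (%v. \<lambda>i\<in>{..<d}. v i + y i)) (%v. q (%i. v i - y i) * F (pt d v))"
   by (simp only: PiM_lborel_shift[OF finite_lessThan])
  also have "... \<longleftrightarrow> integrable (Lam d) (%v. q v * F (pt d (%i. y i + v i)))"
   using m r by (subst integrable_distr_eq) (simp_all only: e)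
  also have "... \<longleftrightarrow> integrable Q (%v. F (pt d (%i. y i + v i)))" unfolding Q_def using mF q0 by (subst integrable_density) auto
  finally show ?thesis by simp
 qed
qed

sublocale Q: prob_space Q by (rule prob_Q)

definition avg :: "(point => real) => point => real" where
 "avg F y = (\<integral>v. F (pt d (%i. y i + v i)) \<partial>Q)"

lemma F_meas_Q: "F \<in> borel_measurable borel ==> (%v. F (pt d (%i. y i + v i))) \<in> borel_measurable Q"
 by (subst measurable_cong_sets[OF sets_Q refl]) (intro measurable_compose[OF pt_meas], auto)

lemma F_int_Q:
 fixes F :: "point => real"
 shows "F \<in> borel_measurable borel ==> (!!x. \<bar>F x\<bar> <= b) ==> integrable Q (%v. F (pt d (%i. y i + v i)))"
 by (rule Q.integrable_const_bound[of _ b]) (auto intro: F_meas_Q)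

lemma avg_lipschitz:
 assumes F: "F \<in> borel_measurable borel" "!!x. \<bar>F x\<bar> <= b"
  and y: "!!i. i < d ==> \<bar>y i\<bar> <= R" "!!i. i < d ==> \<bar>y' i\<bar> <= R" and R: "R >= 0"
 shows "\<bar>avg F y - avg F y'\<bar> <= b * Lc R * (\<Sum>i<d. \<bar>y i - y' i\<bar>)"
proof -
 have b: "0 <= b" using F(2)[of undefined] by linarith
 let ?k = "%v. q (%i. v i - y i) - q (%i. v i - y' i)"
 have i1: "integrable (Lam d) (%v. q (%i. v i - y i) * F (pt d v))" for y
  using F_int_Q[OF F, of y] unfolding Lam_shift(2)[OF F(1)] .
 have km: "?k \<in> borel_measurable (Lam d)" by (intro borel_measurable_diff q_meas) auto
 have "avg F y - avg F y' = (\<integral>v. ?k v * F (pt d v) \<partial>Lam d)"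
  unfolding avg_def Lam_shift(1)[OF F(1)] left_diff_distrib by (rule Bochner_Integration.integral_diff[OF i1 i1, symmetric])
 then have "ennreal \<bar>avg F y - avg F y'\<bar> <= (\<integral>\<^sup>+v. ennreal \<bar>?k v * F (pt d v)\<bar> \<partial>Lam d)"
  using i1[of y] i1[of y'] integral_norm_bound_ennreal[of "Lam d" "%v. ?k v * F (pt d v)"] by (simp add: left_diff_distrib)
 also have "... <= (\<integral>\<^sup>+v. ennreal b * ennreal \<bar>?k v\<bar> \<partial>Lam d)"
 proof (rule nn_integral_mono)
  fix v
  have "\<bar>?k v * F (pt d v)\<bar> <= b * \<bar>?k v\<bar>" unfolding abs_mult mult.commute[of b] by (intro mult_left_mono F(2)) simp
  then show "ennreal \<bar>?k v * F (pt d v)\<bar> <= ennreal b * ennreal \<bar>?k v\<bar>" using b by (simp add: ennreal_mult[symmetric] ennreal_leI)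
 qed
 also have "... = ennreal b * (\<integral>\<^sup>+v. ennreal \<bar>?k v\<bar> \<partial>Lam d)" using km by (intro nn_integral_cmult) measurable
 also have "... <= ennreal b * ennreal (Lc R * (\<Sum>i<d. \<bar>y i - y' i\<bar>))" by (intro mult_left_mono q_shift_L1 y R) auto
 also have "... = ennreal (b * Lc R * (\<Sum>i<d. \<bar>y i - y' i\<bar>))"
  using b Lc0[OF R] by (simp add: ennreal_mult[symmetric] sum_nonneg mult.assoc)
 finally show ?thesis using b Lc0[OF R] by (simp add: ennreal_le_iff sum_nonneg)
qed

end

lemma DERIV_quadratic_remainder:
 fixes F :: "real => real"
 assumes \<eta>: "\<eta> > 0" and le: "!!h. \<bar>h\<bar> < \<eta> ==> \<bar>F (x + h) - F x - h * D\<bar> <= K * h\<^sup>2"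
 shows "(F has_real_derivative D) (at x)"
proof -
 have "((%h. (F (x + h) - F x) / h - D) \<longlongrightarrow> 0) (at 0)"
 proof (rule Lim_null_comparison)
  show "((%h. K * \<bar>h\<bar>) \<longlongrightarrow> 0) (at 0)" by (auto intro!: tendsto_eq_intros)
  have "\<forall>\<^sub>F h in at (0::real). \<bar>h\<bar> < \<eta>" using \<eta> by (auto simp: eventually_at dist_real_def)
  moreover have "\<forall>\<^sub>F h in at (0::real). h ~= 0" by (simp add: eventually_at_filter)
  ultimately show "\<forall>\<^sub>F h in at 0. norm ((F (x + h) - F x) / h - D) <= K * \<bar>h\<bar>"
  proof eventually_elim
   case (elim h)
   have "\<bar>F (x + h) - F x - h * D\<bar> / \<bar>h\<bar> <= K * h\<^sup>2 / \<bar>h\<bar>" by (rule divide_right_mono[OF le[OF elim(1)]]) simp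
   moreover have "(F (x + h) - F x) / h - D = (F (x + h) - F x - h * D) / h" using elim(2) by (simp add: diff_divide_distrib)
   moreover have "K * h\<^sup>2 / \<bar>h\<bar> = K * \<bar>h\<bar>" using elim(2) by (simp add: power2_eq_square abs_mult_self_eq[symmetric, of h] del: abs_mult_self_eq)
   ultimately show ?case unfolding real_norm_def by (simp only: abs_divide)
  qed
 qed
 then show ?thesis unfolding DERIV_def LIM_zero_iff .
qed

text \<open>The increment is taken one coordinate at a time. On each leg the mean value inequality
  is applied to \<psi> minus its linear part, whose derivative is small by the Lipschitz bound, so
  the total error is quadratic in u.\<close>

lemma partials_imp_directional:
 fixes \<psi> :: "point => real"
 assumes \<eta>: "\<eta> > 0" and Dl: "!!i. i >= d ==> Dl i = 0"
  and der: "!!x i. i < d ==> (!!j. \<bar>x j - y j\<bar> < \<eta>) ==> (!!j. j >= d ==> x j = y j) ==>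
   ((%t. \<psi> (x(i := t))) has_real_derivative k i x) (at (x i))"
  and lip: "!!x i. i < d ==> (!!j. \<bar>x j - y j\<bar> < \<eta>) ==> (!!j. j >= d ==> x j = y j) ==>
   \<bar>k i x - k i y\<bar> <= L * (\<Sum>j<d. \<bar>x j - y j\<bar>)"
  and L: "L >= 0"
 shows "((%u. \<psi> (%i. y i + u * Dl i)) has_real_derivative (\<Sum>i<d. Dl i * k i y)) (at 0)"
proof -
 define S where "S = (\<Sum>j<d. \<bar>Dl j\<bar>)"
 have S0: "S >= 0" by (simp add: S_def sum_nonneg)
 have DlS: "\<bar>Dl j\<bar> <= S" for j
  using member_le_sum[of j "{..<d}" "%j. \<bar>Dl j\<bar>"] Dl[of j] S0 by (cases "j < d") (auto simp: S_def)
 have step: "\<bar>\<psi> (%i. y i + u * Dl i) - \<psi> y - u * (\<Sum>i<d. Dl i * k i y)\<bar> <= L * S * S * u\<^sup>2" if u: "\<bar>u\<bar> * S < \<eta>" for u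
 proof -
  define st where "st m = (%i. if i < m then y i + u * Dl i else y i)" for m
  have one: "\<bar>\<psi> (st (Suc m)) - \<psi> (st m) - u * (Dl m * k m y)\<bar> <= L * (\<bar>u\<bar> * S) * (\<bar>u\<bar> * \<bar>Dl m\<bar>)" if m: "m < d" for m
  proof -
   let ?a = "y m" and ?b = "y m + u * Dl m"
   let ?G = "%t. \<psi> ((st m)(m := t)) - k m y * t"
   have D: "(?G has_field_derivative (k m ((st m)(m := t)) - k m y)) (at t within closed_segment ?a ?b)
   \<and> norm (k m ((st m)(m := t)) - k m y) <= L * (\<bar>u\<bar> * S)" if t: "t \<in> closed_segment ?a ?b" for t
   proof -
   let ?x = "(st m)(m := t)"
   have tm: "\<bar>t - y m\<bar> <= \<bar>u\<bar> * \<bar>Dl m\<bar>"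
   using t unfolding closed_segment_eq_real_ivl abs_mult[symmetric] by (auto split: if_splits)
   have xj: "\<bar>?x j - y j\<bar> <= \<bar>u\<bar> * \<bar>Dl j\<bar>" for j using tm by (auto simp: st_def abs_mult)
   have "\<bar>u\<bar> * \<bar>Dl j\<bar> <= \<bar>u\<bar> * S" for j by (intro mult_left_mono DlS) simp
   then have bx: "\<bar>?x j - y j\<bar> < \<eta>" for j using xj[of j] u by (meson le_less_trans order_trans)
   have hi: "?x j = y j" if "j >= d" for j using that m by (simp add: st_def)
   have "(\<Sum>j<d. \<bar>?x j - y j\<bar>) <= (\<Sum>j<d. \<bar>u\<bar> * \<bar>Dl j\<bar>)" by (intro sum_mono xj)
   then have "L * (\<Sum>j<d. \<bar>?x j - y j\<bar>) <= L * (\<bar>u\<bar> * S)" using L by (intro mult_left_mono) (simp_all add: S_def sum_distrib_left)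
   from order_trans[OF lip[OF m bx hi] this] have lipx: "norm (k m ?x - k m y) <= L * (\<bar>u\<bar> * S)" by (simp only: real_norm_def)
   have d1: "((%t. \<psi> ((st m)(m := t))) has_real_derivative k m ?x) (at t)"
   using der[OF m bx hi] unfolding fun_upd_same fun_upd_upd .
   have d2: "((*) (k m y) has_real_derivative k m y) (at t)" by (rule DERIV_cmult_Id)
   show ?thesis by (rule conjI[OF has_field_derivative_at_within[OF DERIV_diff[OF d1 d2]] lipx])
   qed
   have "norm (?G ?b - ?G ?a) <= L * (\<bar>u\<bar> * S) * norm (?b - ?a)"
   proof (rule field_differentiable_bound[OF convex_closed_segment])
   show "(?G has_field_derivative (k m ((st m)(m := t)) - k m y)) (at t within closed_segment ?a ?b)" if "t \<in> closed_segment ?a ?b" for t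
   using D[OF that] by (rule conjunct1)
   show "norm (k m ((st m)(m := t)) - k m y) <= L * (\<bar>u\<bar> * S)" if "t \<in> closed_segment ?a ?b" for t
   using D[OF that] by (rule conjunct2)
   qed (rule ends_in_segment)+
   moreover have "(st m)(m := ?b) = st (Suc m)" "(st m)(m := ?a) = st m" by (auto simp: st_def fun_eq_iff less_Suc_eq)
   ultimately show ?thesis by (simp only: real_norm_def) (simp add: abs_mult algebra_simps)
  qed
  have e: "\<psi> (%i. y i + u * Dl i) - \<psi> y = (\<Sum>m<d. \<psi> (st (Suc m)) - \<psi> (st m))"
  proof -
   have "st d = (%i. y i + u * Dl i)" "st 0 = y" using Dl by (auto simp: st_def fun_eq_iff)
   then show ?thesis using sum_lessThan_telescope[of "%m. \<psi> (st m)" d] by simp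
  qed
  have "\<bar>\<psi> (%i. y i + u * Dl i) - \<psi> y - u * (\<Sum>i<d. Dl i * k i y)\<bar> = \<bar>\<Sum>m<d. \<psi> (st (Suc m)) - \<psi> (st m) - u * (Dl m * k m y)\<bar>"
   unfolding e by (simp add: sum_subtractf sum_distrib_left)
  also have "... <= (\<Sum>m<d. L * (\<bar>u\<bar> * S) * (\<bar>u\<bar> * \<bar>Dl m\<bar>))" by (rule order_trans[OF sum_abs sum_mono]) (use one in auto)
  also have "... = L * S * S * u\<^sup>2"
   unfolding sum_distrib_left[symmetric] S_def[symmetric] by (simp add: power2_eq_square abs_mult_self_eq algebra_simps)
  finally show ?thesis .
 qed
 let ?F = "%u. \<psi> (%i. y i + u * Dl i)" and ?D = "\<Sum>i<d. Dl i * k i y"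
 show ?thesis
 proof (rule DERIV_quadratic_remainder)
  show "\<eta> / (S + 1) > 0" using \<eta> S0 by simp
  show "\<bar>?F (0 + h) - ?F 0 - h * ?D\<bar> <= L * S * S * h\<^sup>2" if "\<bar>h\<bar> < \<eta> / (S + 1)" for h
  proof -
   have "\<bar>h\<bar> * (S + 1) < \<eta>" using that S0 by (simp add: pos_less_divide_eq)
   then have "\<bar>h\<bar> * S < \<eta>" using abs_ge_zero[of h] unfolding distrib_left by linarith
   from step[OF this] show ?thesis by simp
  qed
 qed
qed

lemma (in prob_space) abs_expectation_le:
 fixes X :: "'a => real"
 assumes "!!x. \<bar>X x\<bar> <= C" "C >= 0"
 shows "\<bar>expectation X\<bar> <= C"
proof (cases "integrable M X")
 case True
 have "\<bar>expectation X\<bar> <= expectation (%x. \<bar>X x\<bar>)" by (rule integral_abs_bound)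
 also have "... <= expectation (%_. C)" using True assms(1) by (intro integral_mono) auto
 finally show ?thesis by (simp add: prob_space)
qed (simp add: not_integrable_integral_eq assms(2))

text \<open>\<phi> is controlled along coordinate lines only and may lack a directional derivative.
  Its box average has the Lipschitz partial derivatives \<open>avg (\<kappa> i)\<close>, hence a
  directional derivative, which is an average of the sums in \<open>le\<close> and so at most B. The
  mean value theorem bounds the increment of the average, and averaging changes \<phi> by
  O(dl).\<close>

lemma increment_le:
 fixes \<phi> :: "point => real" and \<kappa> :: "nat => point => real"
 assumes \<phi>m: "\<phi> \<in> borel_measurable borel" and \<kappa>m: "!!i. i < d ==> \<kappa> i \<in> borel_measurable borel"
  and \<phi>b: "!!x. \<bar>\<phi> x\<bar> <= b" and \<kappa>b: "!!i x. i < d ==> \<bar>\<kappa> i x\<bar> <= C" and C: "C >= 0"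
  and rel: "!!x i h. i < d ==> (!!u. 0 <= u ==> u <= 1 ==> x(i := x i + u * h) \<in> U) ==>
   \<phi> (x(i := x i + h)) - \<phi> x = h * (\<integral>u. \<kappa> i (x(i := x i + u * h)) \<partial>U01)"
  and \<theta>: "!!i. i >= d ==> \<theta> i = 0" and Dl: "!!i. i >= d ==> Dl i = 0" and dl0: "dl0 > 0"
  and nbhd: "!!x u. 0 <= u ==> u <= 1 ==> (!!i. i < d ==> \<bar>x i - (\<theta> i + u * Dl i)\<bar> < dl0) ==>
   (!!i. i >= d ==> x i = 0) ==> x \<in> U"
  and le: "!!x. x \<in> U ==> (\<Sum>i<d. Dl i * \<kappa> i x) <= B"
 shows "\<phi> (%i. \<theta> i + Dl i) - \<phi> \<theta> <= B"
proof -
 interpret U: prob_space U01 by (rule prob_U01)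
 define R where "R = (\<Sum>i<d. \<bar>\<theta> i\<bar> + \<bar>Dl i\<bar>) + dl0"
 have R0: "R >= 0" using dl0 by (simp add: R_def sum_nonneg)
 have p_R: "\<bar>\<theta> i + u * Dl i\<bar> <= R - dl0" if "0 <= u" "u <= 1" "i < d" for u i
 proof -
  have "\<bar>u * Dl i\<bar> <= \<bar>Dl i\<bar>" using that(1,2) by (simp add: abs_mult mult_left_le_one_le)
  moreover have "\<bar>\<theta> i\<bar> + \<bar>Dl i\<bar> <= (\<Sum>i<d. \<bar>\<theta> i\<bar> + \<bar>Dl i\<bar>)" by (rule member_le_sum) (use that(3) in auto)
  ultimately show ?thesis unfolding R_def by linarith
 qed
 have near_R: "\<bar>x i\<bar> <= R" if "0 <= u" "u <= 1" "\<bar>x i - (\<theta> i + u * Dl i)\<bar> < dl0" "i < d" for x u i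
  using p_R[OF that(1,2,4)] that(3) by linarith
 have main: "\<phi> (%i. \<theta> i + Dl i) - \<phi> \<theta> <= B + 2 * (C * real d * dl)" if dd: "0 < dl" "dl < dl0 / 4" for dl
 proof -
  interpret mollifier d dl by standard (rule dd)
  \<comment> \<open>A point of the box is reached from y in d coordinate moves, each shorter than dl
    and with slope at most C.\<close>
  have close: "\<bar>avg \<phi> y - \<phi> y\<bar> <= C * real d * dl" if y: "y = (%i. \<theta> i + u * Dl i)" and u: "0 <= u" "u <= 1" for y u
  proof -
   have pw: "\<bar>\<phi> (pt d (%i. y i + v i)) - \<phi> y\<bar> <= C * real d * dl" if v: "\<forall>i<d. \<bar>v i\<bar> < dl" for v
   proof -
   define st where "st m = (%i. if i < m \<and> i < d then y i + v i else y i)" for m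
   have "\<bar>\<phi> (st (Suc m)) - \<phi> (st m)\<bar> <= dl * C" if m: "m < d" for m
   proof -
   have e: "st (Suc m) = (st m)(m := st m m + v m)" using m by (auto simp: st_def less_Suc_eq)
   have "(st m)(m := st m m + w * v m) \<in> U" if w: "0 <= w" "w <= 1" for w
   proof (rule nbhd[OF u])
   have wv: "\<bar>w * v m\<bar> <= \<bar>v m\<bar>" using w by (simp add: abs_mult mult_left_le_one_le)
   show "\<bar>((st m)(m := st m m + w * v m)) i - (\<theta> i + u * Dl i)\<bar> < dl0" if "i < d" for i
   proof (cases "i = m")
   case True
   then show ?thesis using v[rule_format, OF m] wv dd by (simp add: st_def y)
   next
   case False
   then show ?thesis using v[rule_format, OF that] dd by (auto simp: st_def y)
   qed
   qed (use \<theta> Dl m in \<open>auto simp: st_def y\<close>)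
   then have "\<phi> (st (Suc m)) - \<phi> (st m) = v m * (\<integral>w. \<kappa> m ((st m)(m := st m m + w * v m)) \<partial>U01)" unfolding e by (rule rel[OF m])
   moreover have "\<bar>\<integral>w. \<kappa> m ((st m)(m := st m m + w * v m)) \<partial>U01\<bar> <= C"
   using \<kappa>b[OF m] C by (rule U.abs_expectation_le)
   ultimately show ?thesis
   using mult_mono[OF less_imp_le[OF v[rule_format, OF m]], of _ C] dd by (simp only: abs_mult)
   qed
   then have "\<bar>\<Sum>m<d. \<phi> (st (Suc m)) - \<phi> (st m)\<bar> <= (\<Sum>m<d. dl * C)" by (intro order_trans[OF sum_abs sum_mono]) auto
   moreover have "(\<Sum>m<d. \<phi> (st (Suc m)) - \<phi> (st m)) = \<phi> (st d) - \<phi> (st 0)" by (rule sum_lessThan_telescope)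
   moreover have "st d = pt d (%i. y i + v i)" "st 0 = y" using \<theta> Dl by (auto simp: st_def pt_def y)
   ultimately show ?thesis by (simp add: mult_ac)
   qed
   have "avg \<phi> y - \<phi> y = (\<integral>v. \<phi> (pt d (%i. y i + v i)) - \<phi> y \<partial>Q)"
   unfolding avg_def by (subst Bochner_Integration.integral_diff) (auto intro: F_int_Q \<phi>m \<phi>b simp: Q.prob_space)
   also have "\<bar>...\<bar> <= C * real d * dl"
   proof -
   have "\<bar>\<integral>v. \<phi> (pt d (%i. y i + v i)) - \<phi> y \<partial>Q\<bar> <= (\<integral>v. \<bar>\<phi> (pt d (%i. y i + v i)) - \<phi> y\<bar> \<partial>Q)" by (rule integral_abs_bound)
   also have "... <= (\<integral>v. C * real d * dl \<partial>Q)"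
   proof (rule integral_mono_AE)
   show "AE v in Q. \<bar>\<phi> (pt d (%i. y i + v i)) - \<phi> y\<bar> <= C * real d * dl" using AE_Q by eventually_elim (rule pw)
   show "integrable Q (%v. \<bar>\<phi> (pt d (%i. y i + v i)) - \<phi> y\<bar>)"
   by (intro integrable_abs Bochner_Integration.integrable_diff F_int_Q[OF \<phi>m \<phi>b]) simp
   qed simp
   finally show ?thesis by (simp add: Q.prob_space)
   qed
   finally show ?thesis .
  qed
  \<comment> \<open>By Fubini \<open>rel\<close> passes to the averages: a coordinate increment of
    \<open>avg \<phi>\<close> is an integral of \<open>avg (\<kappa> i)\<close>, and the Lipschitz
    bound for the latter leaves a quadratic remainder.\<close>
  have part: "((%t. avg \<phi> (x(i := t))) has_real_derivative avg (\<kappa> i) x) (at (x i))"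
   if i: "i < d" and u: "0 <= u" "u <= 1" and x: "!!j. \<bar>x j - (\<theta> j + u * Dl j)\<bar> < dl0 / 4" "!!j. j >= d ==> x j = 0" for x i u
  proof (rule DERIV_quadratic_remainder)
   show "dl0 / 4 > 0" using dl0 by simp
   fix h :: real assume h: "\<bar>h\<bar> < dl0 / 4"
   let ?x = "%w. x(i := x i + w * h)"
   let ?G = "%w v. \<kappa> i (pt d (%j. ?x w j + v j))"
   have xu: "\<bar>?x w j - (\<theta> j + u * Dl j)\<bar> < dl0 / 2" if w: "0 <= w" "w <= 1" for w j
   proof -
   have "\<bar>w * h\<bar> <= \<bar>h\<bar>" using w by (simp add: abs_mult mult_left_le_one_le)
   then have "\<bar>w * h\<bar> < dl0 / 4" using h by simp
   then show ?thesis using x(1)[of j] dl0 unfolding abs_less_iff by (cases "j = i") auto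
   qed
   interpret UQ: pair_sigma_finite U01 Q by standard
   have Qc: "j < d ==> (%v. v j) \<in> borel_measurable Q" for j by (subst measurable_cong_sets[OF sets_Q refl]) (rule Lam_comp)
   have "(%p. pt d (%j. ?x (fst p) j + snd p j)) \<in> borel_measurable (U01 \<Otimes>\<^sub>M Q)"
   proof (rule pt_meas)
   fix j assume j: "j < d"
   have "(%p. snd p j) \<in> borel_measurable (U01 \<Otimes>\<^sub>M Q)" by (rule measurable_compose[OF measurable_snd Qc[OF j]])
   moreover have "(%p. fst p) \<in> borel_measurable (U01 \<Otimes>\<^sub>M Q)" by (rule measurable_compose[OF measurable_fst U01_meas])
   ultimately show "(%p. ?x (fst p) j + snd p j) \<in> borel_measurable (U01 \<Otimes>\<^sub>M Q)" by (cases "j = i") auto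
   qed
   then have Gm: "(%p. ?G (fst p) (snd p)) \<in> borel_measurable (U01 \<Otimes>\<^sub>M Q)" by (rule measurable_compose[OF _ \<kappa>m[OF i]])
   interpret UQp: prob_space "U01 \<Otimes>\<^sub>M Q" by (intro prob_space_pair prob_U01 prob_Q)
   have Gi: "integrable (U01 \<Otimes>\<^sub>M Q) (%(w, v). ?G w v)"
   unfolding case_prod_beta' by (rule UQp.integrable_const_bound[of _ C]) (use \<kappa>b[OF i] Gm in auto)
   have pw: "\<phi> (pt d (%j. ?x 1 j + v j)) - \<phi> (pt d (%j. x j + v j)) = h * (\<integral>w. ?G w v \<partial>U01)" if v: "\<forall>j<d. \<bar>v j\<bar> < dl" for v
   proof -
   define X where "X = pt d (%j. x j + v j)"
   have Xe: "X(i := X i + w * h) = pt d (%j. ?x w j + v j)" for w using i by (auto simp: X_def pt_def)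
   have "X(i := X i + w * h) \<in> U" if w: "0 <= w" "w <= 1" for w
   unfolding Xe
   proof (rule nbhd[OF u])
   fix j assume j: "j < d"
   have "pt d (%j. ?x w j + v j) j = ?x w j + v j" using j by (simp add: pt_def del: fun_upd_apply)
   then show "\<bar>pt d (%j. ?x w j + v j) j - (\<theta> j + u * Dl j)\<bar> < dl0"
   using xu[OF w, of j] v[rule_format, OF j] dd unfolding abs_less_iff by (simp only:) linarith
   qed (simp add: pt_def)
   note r = rel[OF i this]
   have e1: "X(i := X i + h) = pt d (%j. ?x 1 j + v j)" using Xe[of 1] by (simp only: mult_1)
   show ?thesis using r unfolding e1 Xe unfolding X_def .
   qed
   have "avg \<phi> (?x 1) - avg \<phi> x = (\<integral>v. \<phi> (pt d (%j. ?x 1 j + v j)) - \<phi> (pt d (%j. x j + v j)) \<partial>Q)"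
   unfolding avg_def by (rule Bochner_Integration.integral_diff[symmetric]) (rule F_int_Q[OF \<phi>m \<phi>b])+
   also have "... = (\<integral>v. h * (\<integral>w. ?G w v \<partial>U01) \<partial>Q)"
   proof (rule integral_cong_AE)
   show "AE v in Q. \<phi> (pt d (%j. ?x 1 j + v j)) - \<phi> (pt d (%j. x j + v j)) = h * (\<integral>w. ?G w v \<partial>U01)" using AE_Q by eventually_elim (rule pw)
   show "(%v. \<phi> (pt d (%j. ?x 1 j + v j)) - \<phi> (pt d (%j. x j + v j))) \<in> borel_measurable Q" by (intro borel_measurable_diff F_meas_Q \<phi>m)
   have "integrable Q (%v. \<integral>w. ?G w v \<partial>U01)" by (rule UQ.integrable_snd[OF Gi])
   then show "(%v. h * (\<integral>w. ?G w v \<partial>U01)) \<in> borel_measurable Q" by auto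
   qed
   also have "... = h * (\<integral>w. avg (\<kappa> i) (?x w) \<partial>U01)" unfolding avg_def using UQ.Fubini_integral[OF Gi] by simp
   finally have "avg \<phi> (?x 1) - avg \<phi> x - h * avg (\<kappa> i) x = h * (\<integral>w. avg (\<kappa> i) (?x w) - avg (\<kappa> i) x \<partial>U01)"
   using UQ.integrable_fst[OF Gi] by (subst Bochner_Integration.integral_diff) (auto simp: avg_def U.prob_space right_diff_distrib)
   moreover have "\<bar>\<integral>w. avg (\<kappa> i) (?x w) - avg (\<kappa> i) x \<partial>U01\<bar> <= C * Lc R * \<bar>h\<bar>"
   proof -
   have L: "C * Lc R >= 0" using C Lc0[OF R0] by simp
   have "\<bar>avg (\<kappa> i) (?x w) - avg (\<kappa> i) x\<bar> <= C * Lc R * \<bar>h\<bar>" if w: "w \<in> space U01" for w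
   proof -
   have w: "0 <= w" "w <= 1" using w by (auto simp: space_U01)
   have "\<bar>avg (\<kappa> i) (?x w) - avg (\<kappa> i) x\<bar> <= C * Lc R * (\<Sum>j<d. \<bar>?x w j - x j\<bar>)"
   proof (rule avg_lipschitz[OF \<kappa>m[OF i] \<kappa>b[OF i] _ _ R0])
   show "\<bar>?x w j\<bar> <= R" if "j < d" for j using xu[OF w, of j] dl0 by (intro near_R[OF u _ that]) linarith
   show "\<bar>x j\<bar> <= R" if "j < d" for j using x(1)[of j] dl0 by (intro near_R[OF u _ that]) linarith
   qed
   moreover have "(\<Sum>j<d. \<bar>?x w j - x j\<bar>) <= \<bar>h\<bar>"
   proof -
   have "(\<Sum>j<d. \<bar>?x w j - x j\<bar>) = (\<Sum>j<d. if j = i then \<bar>w * h\<bar> else 0)" by (intro sum.cong) auto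
   also have "... = \<bar>w * h\<bar>" using i by simp
   also have "... <= \<bar>h\<bar>" using w by (simp add: abs_mult mult_left_le_one_le)
   finally show ?thesis .
   qed
   ultimately show ?thesis by (rule order_trans[OF _ mult_left_mono[OF _ L]])
   qed
   then have "\<bar>\<integral>w. avg (\<kappa> i) (?x w) - avg (\<kappa> i) x \<partial>U01\<bar> <= (\<integral>w. C * Lc R * \<bar>h\<bar> \<partial>U01)"
   using UQ.integrable_fst[OF Gi] by (intro order_trans[OF integral_abs_bound] integral_mono) (auto simp: avg_def)
   then show ?thesis by (simp add: U.prob_space)
   qed
   ultimately have "\<bar>avg \<phi> (?x 1) - avg \<phi> x - h * avg (\<kappa> i) x\<bar> <= \<bar>h\<bar> * (C * Lc R * \<bar>h\<bar>)"
   by (simp add: abs_mult mult_left_mono)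
   then show "\<bar>avg \<phi> (x(i := x i + h)) - avg \<phi> (x(i := x i)) - h * avg (\<kappa> i) x\<bar> <= C * Lc R * h\<^sup>2"
   by (simp add: power2_eq_square mult_ac abs_mult_self_eq)
  qed
  let ?p = "%u i. \<theta> i + u * Dl i"
  have D: "((%u. avg \<phi> (?p u)) has_real_derivative (\<Sum>i<d. Dl i * avg (\<kappa> i) (?p u))) (at u)" if u: "0 <= u" "u <= 1" for u
  proof -
   have "((%s. avg \<phi> (%i. ?p u i + s * Dl i)) has_real_derivative (\<Sum>i<d. Dl i * avg (\<kappa> i) (?p u))) (at 0)"
   proof (rule partials_imp_directional[where \<eta> = "dl0 / 4" and L = "C * Lc R" and k = "%i. avg (\<kappa> i)"])
   fix x :: point and i assume x: "i < d" "!!j. \<bar>x j - ?p u j\<bar> < dl0 / 4" "!!j. j >= d ==> x j = ?p u j"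
   then have x0: "j >= d ==> x j = 0" for j using \<theta> Dl by simp
   show "((%t. avg \<phi> (x(i := t))) has_real_derivative avg (\<kappa> i) x) (at (x i))" by (rule part[OF x(1) u x(2) x0])
   show "\<bar>avg (\<kappa> i) x - avg (\<kappa> i) (?p u)\<bar> <= C * Lc R * (\<Sum>j<d. \<bar>x j - ?p u j\<bar>)"
   proof (rule avg_lipschitz[OF \<kappa>m[OF x(1)] \<kappa>b[OF x(1)] _ _ R0])
   show "\<bar>x j\<bar> <= R" if "j < d" for j using x(2)[of j] dl0 by (intro near_R[OF u _ that]) linarith
   show "\<bar>?p u j\<bar> <= R" if "j < d" for j using p_R[OF u that] dl0 by linarith
   qed
   qed (use dl0 Dl C Lc0[OF R0] in auto)
   moreover have "(%s. avg \<phi> (%i. ?p u i + s * Dl i)) = (%s. avg \<phi> (?p (s + u)))" by (simp add: algebra_simps)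
   ultimately show ?thesis using DERIV_shift[of "%u. avg \<phi> (?p u)" "(\<Sum>i<d. Dl i * avg (\<kappa> i) (?p u))" 0 u] by simp
  qed
  obtain z where z: "0 < z" "z < 1" "avg \<phi> (?p 1) - avg \<phi> (?p 0) = (1 - 0) * (\<Sum>i<d. Dl i * avg (\<kappa> i) (?p z))"
   using MVT2[of 0 1 "%u. avg \<phi> (?p u)" "%u. \<Sum>i<d. Dl i * avg (\<kappa> i) (?p u)"] D by fastforce
  have ki: "integrable Q (%v. Dl i * \<kappa> i (pt d (%j. ?p z j + v j)))" if "i < d" for i
   using F_int_Q[OF \<kappa>m[OF that] \<kappa>b[OF that]] by (rule integrable_mult_right)
  have "(\<Sum>i<d. Dl i * avg (\<kappa> i) (?p z)) = (\<integral>v. (\<Sum>i<d. Dl i * \<kappa> i (pt d (%j. ?p z j + v j))) \<partial>Q)"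
   using ki by (subst Bochner_Integration.integral_sum) (auto simp: avg_def)
  also have "... <= (\<integral>v. B \<partial>Q)"
  proof (rule integral_mono_AE)
   show "AE v in Q. (\<Sum>i<d. Dl i * \<kappa> i (pt d (%j. ?p z j + v j))) <= B"
   using AE_Q
   proof eventually_elim
   case (elim v)
   have "\<bar>pt d (%j. ?p z j + v j) i - ?p z i\<bar> < dl0" if "i < d" for i
   using elim[rule_format, OF that] dd that by (simp add: pt_def)
   then show ?case using z by (intro le nbhd[of z]) (auto simp: pt_def)
   qed
  qed (use ki in auto)
  finally have "avg \<phi> (?p 1) - avg \<phi> (?p 0) <= B" using z(3) by (simp add: Q.prob_space)
  then show ?thesis using close[OF refl, of 1] close[OF refl, of 0] by simp
 qed
 show ?thesis
 proof (rule field_le_epsilon)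
  fix e :: real assume e: "e > 0"
  \<comment> \<open>The first entry keeps the box inside the tube of \<open>nbhd\<close>, the second
    makes the error 2 C d dl at most e.\<close>
  define dl where "dl = min (dl0 / 8) (e / (2 * C * real d + 1))"
  have pos: "2 * C * real d + 1 > 0" using C by (simp add: add_nonneg_pos)
  have dl: "0 < dl" "dl < dl0 / 4" using dl0 e pos by (auto simp: dl_def)
  have "dl * (2 * C * real d + 1) <= e" using pos by (simp add: dl_def pos_le_divide_eq[symmetric])
  then have "2 * (C * real d * dl) <= e" using dl(1) by (simp add: algebra_simps)
  then show "\<phi> (%i. \<theta> i + Dl i) - \<phi> \<theta> <= B + e" using main[OF dl] by linarith
 qed
qed

section \<open>Calculus in the mean\<close>

text \<open>The partial derivatives K are bounded in L1(P) uniformly over U, which is weaker than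
  domination by one integrable function. Results hold in mean, or for almost every z along one given
  segment.\<close>

locale l1_calculus = prob_space P for P :: "'z measure" +
 fixes d :: nat and U :: "point set" and D :: "'z => point => real" and K :: "nat => 'z => point => real" and C :: real
 assumes D_meas: "(%(z, x). D z x) \<in> borel_measurable (P \<Otimes>\<^sub>M borel)"
  and K_meas: "!!i. i < d ==> (%(z, x). K i z x) \<in> borel_measurable (P \<Otimes>\<^sub>M borel)"
  and U: "U \<in> sets borel" and C0: "C >= 0"
  and deriv: "!!z x i. z \<in> space P ==> x \<in> U ==> i < d ==> ((%t. D z (x(i := t))) has_real_derivative K i z x) (at (x i))"
  and K_bound: "!!x i. x \<in> U ==> i < d ==> (\<integral>\<^sup>+z. ennreal \<bar>K i z x\<bar> \<partial>P) <= ennreal C"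
begin

lemma D_meas1 [measurable]: "D' = (%z. D z x) ==> D' \<in> borel_measurable P"
 using measurable_compose[OF measurable_Pair2'[of x borel P] D_meas] by simp

lemma K_meas1: "i < d ==> (%z. K i z x) \<in> borel_measurable P"
 using measurable_compose[OF measurable_Pair2'[of x borel P] K_meas] by simp

lemma K_path_meas: "i < d ==> (%p. K i (snd p) (x(i := x i + fst p * h))) \<in> borel_measurable (U01 \<Otimes>\<^sub>M P)"
proof -
 assume i: "i < d"
 have "(%p. x(i := x i + fst p * h)) \<in> borel_measurable (U01 \<Otimes>\<^sub>M P)"
 proof (rule measurable_coordinatewise_then_product)
  fix j
  have "(%p. fst p) \<in> borel_measurable (U01 \<Otimes>\<^sub>M P)" by (rule measurable_compose[OF measurable_fst U01_meas])
  then show "(%p. (x(i := x i + fst p * h)) j) \<in> borel_measurable (U01 \<Otimes>\<^sub>M P)" by (cases "j = i") auto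
 qed
 then have "(%p. (snd p, x(i := x i + fst p * h))) \<in> U01 \<Otimes>\<^sub>M P \<rightarrow>\<^sub>M P \<Otimes>\<^sub>M borel" by (intro measurable_Pair measurable_snd)
 from measurable_compose[OF this K_meas[OF i]] show ?thesis by simp
qed

lemma K_path_int:
 assumes i: "i < d" and x: "!!u. 0 <= u ==> u <= 1 ==> x(i := x i + u * h) \<in> U"
 shows "(\<integral>\<^sup>+p. ennreal \<bar>K i (snd p) (x(i := x i + fst p * h))\<bar> \<partial>(U01 \<Otimes>\<^sub>M P)) <= ennreal C"
proof -
 interpret U: prob_space U01 by (rule prob_U01)
 have "(\<integral>\<^sup>+p. ennreal \<bar>K i (snd p) (x(i := x i + fst p * h))\<bar> \<partial>(U01 \<Otimes>\<^sub>M P))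
  = (\<integral>\<^sup>+u. \<integral>\<^sup>+z. ennreal \<bar>K i z (x(i := x i + u * h))\<bar> \<partial>P \<partial>U01)"
  using K_path_meas[OF i, of x h] by (subst nn_integral_fst[symmetric]) (auto simp del: fun_upd_apply)
 also have "... <= (\<integral>\<^sup>+u. ennreal C \<partial>U01)" by (intro nn_integral_mono K_bound x i) (auto simp: space_U01)
 finally show ?thesis by (simp add: U.emeasure_space_1)
qed

text \<open>By Fubini the derivative is integrable along the given segment for almost every z, and
  for those z the fundamental theorem applies. The exceptional null set depends on the
  segment.\<close>

lemma segment_AE:
 assumes i: "i < d" and x: "!!u. 0 <= u ==> u <= 1 ==> x(i := x i + u * h) \<in> U"
 shows "AE z in P. D z (x(i := x i + h)) - D z x = h * (\<integral>u. K i z (x(i := x i + u * h)) \<partial>U01)"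
proof -
 interpret U: prob_space U01 by (rule prob_U01)
 interpret UP: pair_sigma_finite U01 P by standard
 have "integrable (U01 \<Otimes>\<^sub>M P) (%p. K i (snd p) (x(i := x i + fst p * h)))"
  using K_path_int[OF i x] K_path_meas[OF i] by (intro integrableI_bounded) (auto simp del: fun_upd_apply intro: le_less_trans)
 then have "integrable (U01 \<Otimes>\<^sub>M P) (%(u, z). K i z (x(i := x i + u * h)))" by (simp add: case_prod_beta' del: fun_upd_apply)
 from UP.AE_integrable_snd[OF this] have "AE z in P. integrable U01 (%u. K i z (x(i := x i + u * h)))" .
 then show ?thesis using AE_space
 proof eventually_elim
  case (elim z)
  have "D z (x(i := x i + 1 * h)) - D z (x(i := x i + 0 * h)) = (\<integral>u. K i z (x(i := x i + u * h)) * h \<partial>U01)"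
  proof (rule FTC_U01)
   fix u :: real assume u: "0 <= u" "u <= 1"
   let ?X = "x(i := x i + u * h)"
   have "((%t. D z (?X(i := t))) has_real_derivative K i z ?X) (at (?X i))" by (rule deriv[OF elim(2) x[OF u] i])
   then have "((%t. D z (x(i := t))) has_real_derivative K i z ?X) (at (x i + u * h))" unfolding fun_upd_upd fun_upd_same .
   moreover have "((%u. x i + u * h) has_real_derivative h) (at u)" by (auto intro!: derivative_eq_intros)
   ultimately show "((%u. D z (x(i := x i + u * h))) has_real_derivative K i z ?X * h) (at u)" by (rule DERIV_chain2)
  qed (use elim(1) in \<open>rule integrable_mult_left\<close>)
  then show ?case by (simp add: mult.commute del: fun_upd_apply)
 qed
qed

lemma step_bound:
 assumes i: "i < d" and x: "!!u. 0 <= u ==> u <= 1 ==> x(i := x i + u * h) \<in> U"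
 shows "(\<integral>\<^sup>+z. ennreal \<bar>D z (x(i := x i + h)) - D z x\<bar> \<partial>P) <= ennreal (C * \<bar>h\<bar>)"
proof -
 interpret U: prob_space U01 by (rule prob_U01)
 interpret UP: pair_sigma_finite U01 P by standard
 have m: "(%p. ennreal \<bar>K i (snd p) (x(i := x i + fst p * h))\<bar>) \<in> borel_measurable (U01 \<Otimes>\<^sub>M P)"
  using K_path_meas[OF i, of x h] by (intro measurable_compose[OF _ measurable_ennreal] borel_measurable_abs)
 have "(\<integral>\<^sup>+z. ennreal \<bar>D z (x(i := x i + h)) - D z x\<bar> \<partial>P) <= (\<integral>\<^sup>+z. ennreal \<bar>h\<bar> * (\<integral>\<^sup>+u. ennreal \<bar>K i z (x(i := x i + u * h))\<bar> \<partial>U01) \<partial>P)"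
 proof (rule nn_integral_mono_AE)
  have "AE z in P. D z (x(i := x i + h)) - D z x = h * (\<integral>u. K i z (x(i := x i + u * h)) \<partial>U01)" by (rule segment_AE[OF i]) (rule x)
  then show "AE z in P. ennreal \<bar>D z (x(i := x i + h)) - D z x\<bar> <= ennreal \<bar>h\<bar> * (\<integral>\<^sup>+u. ennreal \<bar>K i z (x(i := x i + u * h))\<bar> \<partial>U01)"
  proof eventually_elim
  case (elim z)
  have "ennreal \<bar>D z (x(i := x i + h)) - D z x\<bar> = ennreal \<bar>h\<bar> * ennreal \<bar>\<integral>u. K i z (x(i := x i + u * h)) \<partial>U01\<bar>"
   unfolding elim by (simp add: abs_mult ennreal_mult)
  also have "... <= ennreal \<bar>h\<bar> * (\<integral>\<^sup>+u. ennreal \<bar>K i z (x(i := x i + u * h))\<bar> \<partial>U01)"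
  proof (cases "integrable U01 (%u. K i z (x(i := x i + u * h)))")
   case True
   then show ?thesis using integral_norm_bound_ennreal[OF True] by (intro mult_left_mono) auto
  qed (simp add: not_integrable_integral_eq)
  finally show ?case .
  qed
 qed
 also have "... = ennreal \<bar>h\<bar> * (\<integral>\<^sup>+z. \<integral>\<^sup>+u. ennreal \<bar>K i z (x(i := x i + u * h))\<bar> \<partial>U01 \<partial>P)"
  using U.borel_measurable_nn_integral_fst[of "%p. ennreal \<bar>K i (fst p) (x(i := x i + snd p * h))\<bar>" P]
   measurable_compose[OF measurable_pair_swap'[of P U01] m] by (intro nn_integral_cmult) (simp add: case_prod_beta' del: fun_upd_apply)
 also have "(\<integral>\<^sup>+z. \<integral>\<^sup>+u. ennreal \<bar>K i z (x(i := x i + u * h))\<bar> \<partial>U01 \<partial>P) = (\<integral>\<^sup>+u. \<integral>\<^sup>+z. ennreal \<bar>K i z (x(i := x i + u * h))\<bar> \<partial>P \<partial>U01)"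
  using m by (intro UP.Fubini') (simp add: case_prod_beta' del: fun_upd_apply)
 also have "... <= (\<integral>\<^sup>+u. ennreal C \<partial>U01)" by (intro nn_integral_mono K_bound x i) (auto simp: space_U01)
 also have "... = ennreal C" by (simp add: U.emeasure_space_1)
 also have "ennreal \<bar>h\<bar> * ennreal C = ennreal (C * \<bar>h\<bar>)" using C0 by (simp add: ennreal_mult[symmetric] mult.commute)
 finally show ?thesis by (simp add: mult_left_mono del: fun_upd_apply)
qed

lemma L1_staircase:
 assumes U: "!!w. (!!i. i < d ==> w i \<in> closed_segment (y i) (x i)) ==> (!!i. i >= d ==> w i = y i) ==> w \<in> U"
  and hi: "!!i. i >= d ==> x i = y i"
 shows "(\<integral>\<^sup>+z. ennreal \<bar>D z x - D z y\<bar> \<partial>P) <= ennreal (C * (\<Sum>i<d. \<bar>x i - y i\<bar>))"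
proof -
 define st where "st m = (%i. if i < m then x i else y i)" for m
 have st: "st d = x" "st 0 = y" using hi by (auto simp: st_def fun_eq_iff)
 have "ennreal \<bar>D z x - D z y\<bar> <= (\<Sum>m<d. ennreal \<bar>D z (st (Suc m)) - D z (st m)\<bar>)" for z
  using sum_abs[of "%m. D z (st (Suc m)) - D z (st m)" "{..<d}"] sum_lessThan_telescope[of "%m. D z (st m)" d] unfolding st by (simp add: sum_ennreal ennreal_leI)
 then have "(\<integral>\<^sup>+z. ennreal \<bar>D z x - D z y\<bar> \<partial>P) <= (\<integral>\<^sup>+z. (\<Sum>m<d. ennreal \<bar>D z (st (Suc m)) - D z (st m)\<bar>) \<partial>P)" by (intro nn_integral_mono)
 also have "... = (\<Sum>m<d. \<integral>\<^sup>+z. ennreal \<bar>D z (st (Suc m)) - D z (st m)\<bar> \<partial>P)"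
  by (intro nn_integral_sum measurable_compose[OF _ measurable_ennreal] borel_measurable_abs borel_measurable_diff D_meas1[OF refl])
 also have "... <= (\<Sum>m<d. ennreal (C * \<bar>x m - y m\<bar>))"
 proof (rule sum_mono)
  fix m assume "m \<in> {..<d}"
  then have m: "m < d" by simp
  have e: "st (Suc m) = (st m)(m := st m m + (x m - y m))" by (auto simp: st_def less_Suc_eq)
  show "(\<integral>\<^sup>+z. ennreal \<bar>D z (st (Suc m)) - D z (st m)\<bar> \<partial>P) <= ennreal (C * \<bar>x m - y m\<bar>)"
   unfolding e
  proof (rule step_bound[OF m], rule U)
   fix u :: real and i assume u: "0 <= u" "u <= 1"
   show "((st m)(m := st m m + u * (x m - y m))) i \<in> closed_segment (y i) (x i)"
   proof (cases "i = m")
   case True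
   have "(1 - u) *\<^sub>R y m + u *\<^sub>R x m \<in> closed_segment (y m) (x m)" using u by (auto simp: closed_segment_def)
   then show ?thesis using True by (simp add: st_def algebra_simps)
   qed (auto simp: st_def)
  next
   fix u :: real and i assume "d <= i"
   then show "((st m)(m := st m m + u * (x m - y m))) i = y i" using m hi by (simp add: st_def)
  qed
 qed
 also have "... = ennreal (C * (\<Sum>i<d. \<bar>x i - y i\<bar>))" using C0 by (simp add: sum_ennreal sum_distrib_left)
 finally show ?thesis .
qed

text \<open>The weight \<open>w = e\<^sup>X\<close> on \<open>{\<bar>X\<bar> <= m}\<close>, with \<open>X\<close> the exponent of the conclusion, is the extremal one
 in the Gibbs variational inequality; it turns the claim into a statement about
 the single real function \<open>x \<mapsto> E w D(x)\<close>.\<close>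

theorem exp_increment_le:
 assumes Y0: "Y0 \<in> borel_measurable P"
  and \<theta>: "!!i. i >= d ==> \<theta> i = 0" and Dl: "!!i. i >= d ==> Dl i = 0" and dl0: "dl0 > 0"
  and nbhd: "!!x u. 0 <= u ==> u <= 1 ==> (!!i. i < d ==> \<bar>x i - (\<theta> i + u * Dl i)\<bar> < dl0) ==>
   (!!i. i >= d ==> x i = 0) ==> x \<in> U"
  and D_bound: "!!x. x \<in> U ==> (\<integral>\<^sup>+z. ennreal \<bar>D z x - D z \<theta>\<bar> \<partial>P) <= ennreal C2"
  and mgf: "!!x. x \<in> U ==> (\<integral>\<^sup>+z. ennreal (exp ((\<Sum>i<d. Dl i * K i z x) + Y0 z)) \<partial>P) <= ennreal c" and c: "c > 0"
 shows "(\<integral>\<^sup>+z. ennreal (exp (D z (%i. \<theta> i + Dl i) - D z \<theta> + Y0 z)) \<partial>P) <= ennreal c"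
proof -
 let ?\<theta> = "%i. \<theta> i + Dl i"
 define X where "X z = D z ?\<theta> - D z \<theta> + Y0 z" for z
 have Xm [measurable]: "X \<in> borel_measurable P" unfolding X_def[abs_def] by (intro borel_measurable_add borel_measurable_diff D_meas1[OF refl] Y0)
 have in_U: "\<theta> \<in> U" "?\<theta> \<in> U" using nbhd[of 0 \<theta>] nbhd[of 1 ?\<theta>] dl0 \<theta> Dl by auto
 have "\<bar>C2\<bar> >= 0" by simp
 have D_bound': "(\<integral>\<^sup>+z. ennreal \<bar>D z x - D z \<theta>\<bar> \<partial>P) <= ennreal \<bar>C2\<bar>" if "x \<in> U" for x
  using D_bound[OF that] by (rule order_trans) (simp add: ennreal_leI)
 \<comment> \<open>Truncation keeps w bounded, so that weighted means of L1 functions exist; Fatou's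
   lemma removes it at the end.\<close>
 define w where "w m z = (if \<bar>X z\<bar> <= real m then exp (X z) else 0)" for m z
 have wm [measurable]: "w m \<in> borel_measurable P" for m unfolding w_def[abs_def] by measurable
 have w0: "0 <= w m z" for m z by (simp add: w_def)
 have wW: "w m z <= exp (real m)" for m z by (auto simp: w_def abs_le_iff)
 have trunc: "expectation (w m) <= c" for m
 proof (rule ccontr)
  define Zm where "Zm = expectation (w m)"
  assume "\<not> expectation (w m) <= c"
  then have Zc: "Zm > c" by (simp add: Zm_def)
  then have Z0: "Zm > 0" using c by simp
  let ?W = "exp (real m)"
  have w_nn: "(\<integral>\<^sup>+z. ennreal \<bar>w m z * F z\<bar> \<partial>P) <= ennreal (?W * b)" if F: "F \<in> borel_measurable P" "(\<integral>\<^sup>+z. ennreal \<bar>F z\<bar> \<partial>P) <= ennreal b" "b >= 0" for F b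
  proof -
   have "(\<integral>\<^sup>+z. ennreal \<bar>w m z * F z\<bar> \<partial>P) <= (\<integral>\<^sup>+z. ennreal ?W * ennreal \<bar>F z\<bar> \<partial>P)"
   using w0 wW by (intro nn_integral_mono) (auto simp: abs_mult ennreal_mult[symmetric] intro!: ennreal_leI mult_right_mono)
   also have "... = ennreal ?W * (\<integral>\<^sup>+z. ennreal \<bar>F z\<bar> \<partial>P)" by (intro nn_integral_cmult measurable_compose[OF _ measurable_ennreal] borel_measurable_abs F(1))
   also have "... <= ennreal ?W * ennreal b" by (intro mult_left_mono F(2)) simp
   finally show ?thesis using F(3) by (simp add: ennreal_mult)
  qed
  have w_int: "integrable P (%z. w m z * F z) \<and> \<bar>\<integral>z. w m z * F z \<partial>P\<bar> <= ?W * b"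
   if F: "F \<in> borel_measurable P" "(\<integral>\<^sup>+z. ennreal \<bar>F z\<bar> \<partial>P) <= ennreal b" "b >= 0" for F b
  proof
   show i: "integrable P (%z. w m z * F z)" using w_nn[OF F] F(1) by (intro integrableI_bounded) (auto intro: le_less_trans)
   have "ennreal \<bar>\<integral>z. w m z * F z \<partial>P\<bar> <= ennreal (?W * b)" using order_trans[OF integral_norm_bound_ennreal[OF i]] w_nn[OF F] by simp
   then show "\<bar>\<integral>z. w m z * F z \<partial>P\<bar> <= ?W * b" using F(3) by (simp add: ennreal_le_iff)
  qed
  have wD: "integrable P (%z. w m z * (D z x - D z \<theta>))" "\<bar>\<integral>z. w m z * (D z x - D z \<theta>) \<partial>P\<bar> <= ?W * \<bar>C2\<bar>" if "x \<in> U" for x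
   using w_int[OF _ D_bound'[OF that]] by (auto intro: borel_measurable_diff D_meas1[OF refl])
  have wK: "integrable P (%z. w m z * K i z x)" "\<bar>\<integral>z. w m z * K i z x \<partial>P\<bar> <= ?W * C" if "i < d" "x \<in> U" for x i
   using w_int[OF K_meas1[OF that(1)] K_bound[OF that(2,1)] C0] by auto
  define \<phi> where "\<phi> x = (if x \<in> U then \<integral>z. w m z * (D z x - D z \<theta>) \<partial>P else 0)" for x
  define \<kappa> where "\<kappa> i x = (if x \<in> U then \<integral>z. w m z * K i z x \<partial>P else 0)" for i x
  have swap: "(%(x, z). F z x) \<in> borel_measurable (borel \<Otimes>\<^sub>M P)" if "(%(z, x). F z x) \<in> borel_measurable (P \<Otimes>\<^sub>M borel)" for F :: "'z => point => real"
   using measurable_compose[OF measurable_pair_swap'[of borel P] that] by (simp add: case_prod_beta')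
  have w2: "(%(x, z). w m z) \<in> borel_measurable (borel \<Otimes>\<^sub>M P)" for m by measurable
  have \<phi>m: "\<phi> \<in> borel_measurable borel"
  proof -
   have "(%(x, z). w m z * (D z x - D z \<theta>)) \<in> borel_measurable (borel \<Otimes>\<^sub>M P)"
   proof -
   have "(%(x :: point, z). D z \<theta>) \<in> borel_measurable (borel \<Otimes>\<^sub>M P)"
   using measurable_compose[OF measurable_snd D_meas1[OF refl, of \<theta>], of borel] by (simp add: case_prod_beta')
   then show ?thesis using swap[OF D_meas] w2[of m] by (simp add: case_prod_beta')
   qed
   then have "(%x. \<integral>z. w m z * (D z x - D z \<theta>) \<partial>P) \<in> borel_measurable borel" by (rule borel_measurable_lebesgue_integral)
   then show ?thesis unfolding \<phi>_def[abs_def] using U by (intro measurable_If_set) auto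
  qed
  have \<kappa>m: "\<kappa> i \<in> borel_measurable borel" if i: "i < d" for i
  proof -
   have "(%(x, z). w m z * K i z x) \<in> borel_measurable (borel \<Otimes>\<^sub>M P)"
   using swap[OF K_meas[OF i]] w2[of m] by (simp add: case_prod_beta')
   then have "(%x. \<integral>z. w m z * K i z x \<partial>P) \<in> borel_measurable borel" by (rule borel_measurable_lebesgue_integral)
   then show ?thesis unfolding \<kappa>_def[abs_def] using U by (intro measurable_If_set) auto
  qed
  \<comment> \<open>The bound is chosen so that the value at the far end cancels: since \<phi>
    vanishes at \<theta>, it leaves 0 <= Zm ln (c / Zm), contrary to Zm > c.\<close>
  have "\<phi> ?\<theta> - \<phi> \<theta> <= \<phi> ?\<theta> + Zm * ln (c / Zm)"
  proof (rule increment_le[OF \<phi>m \<kappa>m _ _ _ _ \<theta> Dl dl0 nbhd])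
   show "\<bar>\<phi> x\<bar> <= ?W * \<bar>C2\<bar>" for x using wD(2)[of x] by (simp add: \<phi>_def)
   show "\<bar>\<kappa> i x\<bar> <= ?W * C" if "i < d" for i x using wK(2)[OF that, of x] C0 by (simp add: \<kappa>_def)
   show "?W * C >= 0" using C0 by simp
   show "\<phi> (x(i := x i + h)) - \<phi> x = h * (\<integral>u. \<kappa> i (x(i := x i + u * h)) \<partial>U01)"
   if i: "i < d" and x: "!!u. 0 <= u ==> u <= 1 ==> x(i := x i + u * h) \<in> U" for x i h
   proof -
   interpret U: prob_space U01 by (rule prob_U01)
   interpret UP: pair_sigma_finite U01 P by standard
   have xU: "x(i := x i + h) \<in> U" "x \<in> U" using x[of 1] x[of 0] by auto
   have pm: "(%p. w m (snd p) * K i (snd p) (x(i := x i + fst p * h))) \<in> borel_measurable (U01 \<Otimes>\<^sub>M P)"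
   by (intro borel_measurable_times K_path_meas i measurable_compose[OF measurable_snd wm])
   have "(\<integral>\<^sup>+p. ennreal \<bar>w m (snd p) * K i (snd p) (x(i := x i + fst p * h))\<bar> \<partial>(U01 \<Otimes>\<^sub>M P))
   <= (\<integral>\<^sup>+p. ennreal ?W * ennreal \<bar>K i (snd p) (x(i := x i + fst p * h))\<bar> \<partial>(U01 \<Otimes>\<^sub>M P))"
   using w0 wW by (intro nn_integral_mono) (auto simp: abs_mult ennreal_mult[symmetric] simp del: fun_upd_apply intro!: ennreal_leI mult_right_mono)
   also have "... = ennreal ?W * (\<integral>\<^sup>+p. ennreal \<bar>K i (snd p) (x(i := x i + fst p * h))\<bar> \<partial>(U01 \<Otimes>\<^sub>M P))"
   using K_path_meas[OF i, of x h] by (intro nn_integral_cmult measurable_compose[OF _ measurable_ennreal] borel_measurable_abs)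
   also have "... <= ennreal ?W * ennreal C" by (intro mult_left_mono K_path_int i x) auto
   also have "... < \<infinity>" by (simp add: ennreal_mult[symmetric] C0 less_top[symmetric])
   finally have "integrable (U01 \<Otimes>\<^sub>M P) (%p. w m (snd p) * K i (snd p) (x(i := x i + fst p * h)))" using pm by (intro integrableI_bounded) auto
   then have int: "integrable (U01 \<Otimes>\<^sub>M P) (%(u, z). w m z * K i z (x(i := x i + u * h)))" by (simp add: case_prod_beta' del: fun_upd_apply)
   have "\<phi> (x(i := x i + h)) - \<phi> x = (\<integral>z. w m z * (D z (x(i := x i + h)) - D z \<theta>) - w m z * (D z x - D z \<theta>) \<partial>P)"
   unfolding \<phi>_def using xU wD(1) by (simp del: fun_upd_apply)
   also have "... = (\<integral>z. h * (\<integral>u. w m z * K i z (x(i := x i + u * h)) \<partial>U01) \<partial>P)"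
   proof (rule integral_cong_AE)
   show "AE z in P. w m z * (D z (x(i := x i + h)) - D z \<theta>) - w m z * (D z x - D z \<theta>) = h * (\<integral>u. w m z * K i z (x(i := x i + u * h)) \<partial>U01)"
   proof -
   have "AE z in P. D z (x(i := x i + h)) - D z x = h * (\<integral>u. K i z (x(i := x i + u * h)) \<partial>U01)" by (rule segment_AE[OF i]) (rule x)
   then show ?thesis
   proof eventually_elim
   case (elim z)
   have "w m z * (D z (x(i := x i + h)) - D z \<theta>) - w m z * (D z x - D z \<theta>) = w m z * (D z (x(i := x i + h)) - D z x)"
   by (simp only: right_diff_distrib)
   then show ?case unfolding elim by (simp del: fun_upd_apply)
   qed
   qed
   show "(%z. w m z * (D z (x(i := x i + h)) - D z \<theta>) - w m z * (D z x - D z \<theta>)) \<in> borel_measurable P"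
   using wD(1)[OF xU(1)] wD(1)[OF xU(2)] by (intro borel_measurable_diff borel_measurable_integrable)
   have "integrable P (%z. \<integral>u. w m z * K i z (x(i := x i + u * h)) \<partial>U01)" by (rule UP.integrable_snd[OF int])
   then show "(%z. h * (\<integral>u. w m z * K i z (x(i := x i + u * h)) \<partial>U01)) \<in> borel_measurable P" by (intro borel_measurable_integrable integrable_mult_right)
   qed
   also have "... = h * (\<integral>u. \<integral>z. w m z * K i z (x(i := x i + u * h)) \<partial>P \<partial>U01)" using UP.Fubini_integral[OF int] by (simp del: fun_upd_apply)
   also have "(\<integral>u. \<integral>z. w m z * K i z (x(i := x i + u * h)) \<partial>P \<partial>U01) = (\<integral>u. \<kappa> i (x(i := x i + u * h)) \<partial>U01)"
   by (intro Bochner_Integration.integral_cong refl) (simp add: \<kappa>_def x space_U01 del: fun_upd_apply)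
   finally show ?thesis .
   qed
   show "(\<Sum>i<d. Dl i * \<kappa> i x) <= \<phi> ?\<theta> + Zm * ln (c / Zm)" if xU: "x \<in> U" for x
   proof -
   define T where "T z = (\<Sum>i<d. Dl i * K i z x) - (D z ?\<theta> - D z \<theta>)" for z
   define Y where "Y z = (\<Sum>i<d. Dl i * K i z x) + Y0 z" for z
   have Ym: "Y \<in> borel_measurable P" unfolding Y_def[abs_def] by (intro borel_measurable_add borel_measurable_sum borel_measurable_times borel_measurable_const K_meas1 Y0) auto
   have eY: "integrable P (%z. exp (Y z))"
   using le_less_trans[OF mgf[OF xU] ennreal_less_top] measurable_compose[OF Ym borel_measurable_exp] by (intro integrableI_nonneg) (auto simp: Y_def intro: le_less_trans)
   have "ennreal (expectation (%z. exp (Y z))) <= ennreal c"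
   using mgf[OF xU] nn_integral_eq_integral[OF eY] by (simp add: Y_def)
   then have EY: "expectation (%z. exp (Y z)) <= c" using c by (simp add: ennreal_le_iff)
   have wi: "integrable P (w m)" by (rule integrable_const_bound[of _ ?W]) (use w0 wW in auto)
   have s: "integrable P (%z. \<Sum>i<d. Dl i * (w m z * K i z x))" using wK(1)[OF _ xU] by (intro Bochner_Integration.integrable_sum integrable_mult_right) auto
   have wTe: "w m z * T z = (\<Sum>i<d. Dl i * (w m z * K i z x)) - w m z * (D z ?\<theta> - D z \<theta>)" for z
   by (simp add: T_def right_diff_distrib sum_distrib_left mult_ac)
   have wT: "integrable P (%z. w m z * T z)" unfolding wTe by (intro Bochner_Integration.integrable_diff s wD(1) in_U)
   have wTi: "expectation (%z. w m z * T z) = (\<Sum>i<d. Dl i * \<kappa> i x) - \<phi> ?\<theta>"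
   unfolding wTe using s wD(1)[OF in_U(2)] wK(1)[OF _ xU] xU in_U by (simp add: \<kappa>_def \<phi>_def)
   \<comment> \<open>Gibbs' inequality in pointwise form: exp X (t + 1) <= exp (X + t) with t = T -
     ln (c / Zm), where X + T = Y.\<close>
   have pw: "w m z * T z - w m z * ln (c / Zm) <= Zm / c * exp (Y z) - w m z" for z
   proof (cases "\<bar>X z\<bar> <= real m")
   case True
   define t where "t = T z - ln (c / Zm)"
   have "exp (X z) * (t + 1) <= exp (X z) * exp t" using exp_ge_add_one_self[of t] by (intro mult_left_mono) (auto simp: add.commute)
   also have "... = exp (X z + T z) / exp (ln (c / Zm))" by (simp add: t_def exp_add exp_diff)
   also have "X z + T z = Y z" by (simp add: X_def T_def Y_def)
   finally show ?thesis using True c Z0 by (simp add: w_def t_def algebra_simps)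
   next
   case False
   then show ?thesis using c Z0 by (simp add: w_def)
   qed
   have "expectation (%z. w m z * T z - w m z * ln (c / Zm)) <= expectation (%z. Zm / c * exp (Y z) - w m z)"
   by (intro integral_mono Bochner_Integration.integrable_diff integrable_mult_left integrable_mult_right wT wi eY pw)
   then have "expectation (%z. w m z * T z) - Zm * ln (c / Zm) <= Zm / c * expectation (%z. exp (Y z)) - Zm"
   using wT wi eY by (simp add: Zm_def)
   also have "Zm / c * expectation (%z. exp (Y z)) <= Zm / c * c" using c Z0 by (intro mult_left_mono EY) auto
   finally show ?thesis using c unfolding wTi by simp
   qed
  qed
  moreover have "\<phi> \<theta> = 0" using in_U by (simp add: \<phi>_def)
  ultimately have "0 <= Zm * ln (c / Zm)" by simp
  moreover have "ln (c / Zm) < 0" using Zc Z0 c by (intro ln_less_zero) auto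
  ultimately show False using Z0 by (simp add: zero_le_mult_iff)
 qed
 have "(\<integral>\<^sup>+z. ennreal (exp (X z)) \<partial>P) = (\<integral>\<^sup>+z. liminf (%m. ennreal (w m z)) \<partial>P)"
 proof (rule nn_integral_cong)
  fix z
  obtain k :: nat where k: "\<bar>X z\<bar> <= real k" using real_arch_simple by blast
  have "\<forall>\<^sub>F m in sequentially. ennreal (w m z) = ennreal (exp (X z))"
   using eventually_ge_at_top[of k] by eventually_elim (use k in \<open>simp add: w_def\<close>)
  then have "(%m. ennreal (w m z)) \<longlonglongrightarrow> ennreal (exp (X z))" by (rule tendsto_eventually)
  from lim_imp_Liminf[OF _ this] show "ennreal (exp (X z)) = liminf (%m. ennreal (w m z))" by simp
 qed
 also have "... <= liminf (%m. \<integral>\<^sup>+z. ennreal (w m z) \<partial>P)" by (intro nn_integral_liminf) auto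
 also have "... <= liminf (%m::nat. ennreal c)"
 proof (intro Liminf_mono always_eventually allI)
  fix m
  have "integrable P (w m)" by (rule integrable_const_bound[of _ "exp (real m)"]) (use w0 wW in auto)
  then show "(\<integral>\<^sup>+z. ennreal (w m z) \<partial>P) <= ennreal c" using trunc[of m] w0 by (subst nn_integral_eq_integral) (auto intro: ennreal_leI)
 qed
 finally show ?thesis by (simp add: Liminf_const X_def)
qed

end

section \<open>Second order expansions\<close>

lemma Rd_iff: "x \<in> Rd d \<longleftrightarrow> (\<forall>i\<ge>d. x i = 0)" by (auto simp: topspace_Euclidean_space)

abbreviation eball :: "nat => point => real => point set" where "eball d \<equiv> open_ball d (Rd d)"

lemma eball_iff: "x \<in> eball d c r \<longleftrightarrow> (\<forall>i\<ge>d. x i = 0) \<and> edist d x c < r"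
 unfolding open_ball_def Rd_iff[abs_def, symmetric] by simp

lemma edist_ip: "edist d x y = sqrt (ip d (%i. x i - y i) (%i. x i - y i))"
 by (simp add: edist_def L2_set_def ip_def power2_eq_square)

lemma edist_mono: "(!!i. i < d ==> \<bar>x i - c i\<bar> <= \<bar>y i - b i\<bar>) ==> edist d x c <= edist d y b"
 unfolding edist_def L2_set_def by (intro real_sqrt_le_mono sum_mono) (auto simp: abs_le_square_iff)

lemma edist_triangle: "edist d x z <= edist d x y + edist d y z"
 unfolding edist_def using L2_set_triangle_ineq[of "%i. x i - y i" "%i. y i - z i" "{..<d}"] by simp

lemma edist_pos: "0 <= edist d x y" by (simp add: edist_def L2_set_def sum_nonneg)

lemma edist_same [simp]: "edist d x x = 0" by (simp add: edist_def L2_set_def)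

lemma edist_le_sum: "edist d x y <= (\<Sum>i<d. \<bar>x i - y i\<bar>)"
 unfolding edist_def by (rule L2_set_le_sum_abs)

lemma component_le_edist: "i < d ==> \<bar>x i - y i\<bar> <= edist d x y"
 unfolding edist_def using member_le_L2_set[of "{..<d}" i "%i. \<bar>x i - y i\<bar>"] by (simp add: L2_set_def)

lemma edist_scale: "u >= 0 ==> edist d (%i. c i + u * Dl i) c = u * edist d (%i. c i + Dl i) c"
 unfolding edist_def by (simp add: L2_set_right_distrib)

text \<open>By convexity the segment stays within the larger end distance m of the centre; the slack
  r - m is spread over the d coordinates, since the Euclidean distance is at most the sum of the
  coordinate distances.\<close>

lemma eball_nbhd:
 assumes x: "\<theta> \<in> eball d c r" "(%i. \<theta> i + Dl i) \<in> eball d c r"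
 obtains \<eta> where "\<eta> > 0" "!!x u. 0 <= u ==> u <= 1 ==> (!!i. i < d ==> \<bar>x i - (\<theta> i + u * Dl i)\<bar> < \<eta>) ==>
   (!!i. i >= d ==> x i = 0) ==> x \<in> eball d c r"
proof -
 let ?\<theta> = "%i. \<theta> i + Dl i"
 define m where "m = max (edist d \<theta> c) (edist d ?\<theta> c)"
 define \<eta> where "\<eta> = (r - m) / (real d + 1)"
 have m: "m < r" using x by (simp add: m_def eball_iff)
 show thesis
 proof (rule that)
  show "\<eta> > 0" using m by (simp add: \<eta>_def)
  fix x u assume u: "0 <= u" "u <= 1" and near: "!!i. i < d ==> \<bar>x i - (\<theta> i + u * Dl i)\<bar> < \<eta>" and hi: "!!i. i >= d ==> x i = 0"
  let ?p = "%i. \<theta> i + u * Dl i"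
  have "edist d x ?p <= (\<Sum>i<d. \<eta>)" by (rule order_trans[OF edist_le_sum sum_mono]) (use near in \<open>auto intro: less_imp_le\<close>)
  also have "... = real d * \<eta>" by simp
  also have "... < r - m"
  proof -
   have "(real d + 1) * \<eta> = r - m" unfolding \<eta>_def by (simp add: add_nonneg_pos)
   moreover have "\<eta> > 0" using m by (simp add: \<eta>_def)
   ultimately show ?thesis by (simp add: distrib_right)
  qed
  finally have 1: "edist d x ?p < r - m" .
  have "edist d ?p c = L2_set (%i. (1 - u) * (\<theta> i - c i) + u * (?\<theta> i - c i)) {..<d}"
   unfolding edist_def by (rule L2_set_cong) (auto simp: algebra_simps)
  also have "... <= L2_set (%i. (1 - u) * (\<theta> i - c i)) {..<d} + L2_set (%i. u * (?\<theta> i - c i)) {..<d}" by (rule L2_set_triangle_ineq)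
  also have "... = (1 - u) * edist d \<theta> c + u * edist d ?\<theta> c" using u by (simp add: edist_def L2_set_right_distrib)
  also have "... <= (1 - u) * m + u * m" using u by (intro add_mono mult_left_mono) (auto simp: m_def)
  finally have "edist d ?p c <= m" by (simp add: algebra_simps)
  then have "edist d x c < r" using edist_triangle[of d x c ?p] 1 by linarith
  then show "x \<in> eball d c r" using hi by (simp add: eball_iff)
 qed
qed

lemma eball_coord:
 assumes "x \<in> eball d c r" "i < d"
 shows "\<forall>\<^sub>F t in nhds (x i). x(i := t) \<in> eball d c r"
proof -
 obtain \<eta> where e: "\<eta> > 0" "!!y u. 0 <= u ==> u <= 1 ==> (!!i. i < d ==> \<bar>y i - (x i + u * 0)\<bar> < \<eta>) ==>
   (!!i. i >= d ==> y i = 0) ==> y \<in> eball d c r"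
  using eball_nbhd[of x d c r "%_. 0"] assms(1) by auto
 have "x(i := t) \<in> eball d c r" if "dist t (x i) < \<eta>" for t
  using assms e(1) that by (intro e(2)[of 0]) (auto simp: eball_iff dist_real_def)
 then show ?thesis unfolding eventually_nhds_metric using e(1) by blast
qed

lemma edist_meas [measurable]: "(%x. edist d x c) \<in> borel_measurable borel"
 unfolding edist_def L2_set_def
 by (intro measurable_compose[OF _ borel_measurable_sqrt] borel_measurable_sum borel_measurable_power borel_measurable_diff measurable_product_coordinates borel_measurable_const)

lemma eball_borel: "eball d c r \<in> sets borel"
proof -
 have "eball d c r = (\<Inter>i\<in>{d..}. (%x. x i) -` {0} \<inter> space borel) \<inter> ((%x. edist d x c) -` {..<r} \<inter> space borel)"
  by (auto simp: eball_iff)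
 also have "... \<in> sets borel"
  by (intro sets.Int sets.countable_INT'' measurable_sets[OF edist_meas] measurable_sets[OF measurable_product_coordinates]) auto
 finally show ?thesis .
qed

text \<open>The derivative is the limit of difference quotients with steps 1 / (n + 1), which are
  jointly measurable in (z, x). Setting them to 0 off U avoids points where the limit may not
  exist.\<close>

lemma partial_meas:
 fixes F :: "'z => point => real"
 assumes F: "(%(z, x). F z x) \<in> borel_measurable (P \<Otimes>\<^sub>M borel)" and U: "U \<in> sets borel"
  and der: "!!z x. z \<in> space P ==> x \<in> U ==> ((%t. F z (x(i := t))) has_real_derivative F' z x) (at (x i))"
 shows "(%(z, x). if x \<in> U then F' z x else 0) \<in> borel_measurable (P \<Otimes>\<^sub>M borel)"
proof (rule borel_measurable_LIMSEQ_real)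
 let ?u = "%n p. if snd p \<in> U then (F (fst p) ((snd p)(i := snd p i + 1 / real (Suc n))) - F (fst p) (snd p)) / (1 / real (Suc n)) else 0"
 fix p assume "p \<in> space (P \<Otimes>\<^sub>M (borel :: point measure))"
 then have z: "fst p \<in> space P" by (auto simp: space_pair_measure)
 have f: "filterlim (%n. 1 / real (Suc n)) (at 0) sequentially"
  unfolding filterlim_at using LIMSEQ_Suc[OF lim_inverse_n'] by auto
 show "(%n. ?u n p) \<longlonglongrightarrow> (case p of (z, x) => if x \<in> U then F' z x else 0)"
 proof (cases "snd p \<in> U")
  case True
  have "((%h. (F (fst p) ((snd p)(i := snd p i + h)) - F (fst p) ((snd p)(i := snd p i))) / h) \<longlongrightarrow> F' (fst p) (snd p)) (at 0)"
   using der[OF z True] unfolding DERIV_def .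
  from filterlim_compose[OF this f] show ?thesis using True by (simp add: case_prod_beta' del: fun_upd_apply of_nat_Suc)
 qed (simp add: case_prod_beta')
next
 fix n :: nat
 have "(%p :: 'z \<times> point. (snd p)(i := snd p i + 1 / real (Suc n))) \<in> borel_measurable (P \<Otimes>\<^sub>M borel)"
 proof (rule measurable_coordinatewise_then_product)
  have c: "(%p :: 'z \<times> point. snd p j) \<in> borel_measurable (P \<Otimes>\<^sub>M borel)" for j
   by (rule measurable_compose[OF measurable_snd measurable_product_coordinates])
  show "(%p :: 'z \<times> point. ((snd p)(i := snd p i + 1 / real (Suc n))) j) \<in> borel_measurable (P \<Otimes>\<^sub>M borel)" for j
   using c[of j] c[of i] by (cases "j = i") auto
 qed
 then have "(%p. (fst p, (snd p)(i := snd p i + 1 / real (Suc n)))) \<in> P \<Otimes>\<^sub>M borel \<rightarrow>\<^sub>M P \<Otimes>\<^sub>M borel" by (intro measurable_Pair measurable_fst)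
 from measurable_compose[OF this F]
 have 1: "(%p. F (fst p) ((snd p)(i := snd p i + 1 / real (Suc n)))) \<in> borel_measurable (P \<Otimes>\<^sub>M borel)" by simp
 have 2: "(%p. F (fst p) (snd p)) \<in> borel_measurable (P \<Otimes>\<^sub>M borel)" using F by (simp add: case_prod_beta')
 have "snd -` U \<inter> space (P \<Otimes>\<^sub>M borel) \<in> sets (P \<Otimes>\<^sub>M borel)" by (rule measurable_sets[OF measurable_snd U])
 then show "(%p. if snd p \<in> U then (F (fst p) ((snd p)(i := snd p i + 1 / real (Suc n))) - F (fst p) (snd p)) / (1 / real (Suc n)) else 0) \<in> borel_measurable (P \<Otimes>\<^sub>M borel)"
  by (intro measurable_If borel_measurable_divide borel_measurable_diff 1 2) (auto simp: vimage_def Int_def conj_commute)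
qed

text \<open>Instantiated twice: with \<open>zeta\<close>, whose Hessian has exponential moments, and
  with its deterministic companion \<open>G\<close>, regarded as a constant random function.\<close>

locale second_order = prob_space P for P :: "'z measure" +
 fixes d :: nat and \<theta>0 :: point and r :: real and g :: "'z => point => real" and C :: real
 assumes r: "r > 0" and \<theta>0: "!!i. i >= d ==> \<theta>0 i = 0" and C0: "C >= 0"
  and g_meas: "(%(z, x). if x \<in> eball d \<theta>0 r then g z x else 0) \<in> borel_measurable (P \<Otimes>\<^sub>M borel)"
  and g2: "!!z x. z \<in> space P ==> x \<in> eball d \<theta>0 r ==> second_partials_exist d (g z) x"
  and H_bound: "!!x i j. x \<in> eball d \<theta>0 r ==> i < d ==> j < d ==> (\<integral>\<^sup>+z. ennreal \<bar>partial i (partial j (g z)) x\<bar> \<partial>P) <= ennreal C"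
begin

abbreviation "U \<equiv> eball d \<theta>0 r"

text \<open>Extension by 0 makes these functions jointly measurable on the whole space; derivatives
  at points of the ball are unaffected, because the ball is open along coordinate lines.\<close>

definition "gU z x = (if x \<in> U then g z x else 0)"
definition "h j z x = (if x \<in> U then partial j (g z) x else 0)"
definition "H i j z x = (if x \<in> U then partial i (partial j (g z)) x else 0)"

lemma cong_U:
 assumes x: "x \<in> U" and i: "i < d" and eq: "!!x. x \<in> U ==> F x = G x" and D: "((%t. G (x(i := t))) has_real_derivative D) (at (x i))"
 shows "((%t. F (x(i := t))) has_real_derivative D) (at (x i))"
proof -
 have "\<forall>\<^sub>F t in nhds (x i). F (x(i := t)) = G (x(i := t))" using eball_coord[OF x i] by eventually_elim (rule eq)
 then show ?thesis using D by (subst DERIV_cong_ev[OF refl _ refl])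
qed

lemma deriv1: "z \<in> space P ==> x \<in> U ==> j < d ==> ((%t. g z (x(j := t))) has_real_derivative partial j (g z) x) (at (x j))"
proof -
 assume a: "z \<in> space P" "x \<in> U" "j < d"
 have "\<forall>\<^sub>F t in nhds (x j). partial_exists j (g z) (x(j := t))" using g2[OF a(1,2)] a(3) unfolding second_partials_exist_def by blast
 then have "partial_exists j (g z) (x(j := x j))" by (rule eventually_nhds_x_imp_x)
 then show ?thesis unfolding partial_exists_def partial_def by (simp add: DERIV_deriv_iff_field_differentiable)
qed

lemma deriv2: "z \<in> space P ==> x \<in> U ==> i < d ==> j < d ==>
 ((%t. partial j (g z) (x(i := t))) has_real_derivative partial i (partial j (g z)) x) (at (x i))"
 using g2[of z x] unfolding second_partials_exist_def partial_exists_def partial_def[of i]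
 by (simp add: DERIV_deriv_iff_field_differentiable)

lemma gU_deriv: "z \<in> space P ==> x \<in> U ==> j < d ==> ((%t. gU z (x(j := t))) has_real_derivative partial j (g z) x) (at (x j))"
 by (rule cong_U[OF _ _ _ deriv1]) (auto simp: gU_def)

lemma h_deriv: "z \<in> space P ==> x \<in> U ==> i < d ==> j < d ==> ((%t. h j z (x(i := t))) has_real_derivative partial i (partial j (g z)) x) (at (x i))"
 by (rule cong_U[OF _ _ _ deriv2]) (auto simp: h_def)

lemma gU_meas: "(%(z, x). gU z x) \<in> borel_measurable (P \<Otimes>\<^sub>M borel)" unfolding gU_def by (rule g_meas)

lemma h_meas: "j < d ==> (%(z, x). h j z x) \<in> borel_measurable (P \<Otimes>\<^sub>M borel)"
 unfolding h_def by (rule partial_meas[OF gU_meas eball_borel gU_deriv])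

lemma H_meas: "i < d ==> j < d ==> (%(z, x). H i j z x) \<in> borel_measurable (P \<Otimes>\<^sub>M borel)"
 unfolding H_def by (rule partial_meas[OF h_meas eball_borel h_deriv])

lemma slice_meas:
 fixes F :: "'z => point => real"
 shows "(%(z, x). F z x) \<in> borel_measurable (P \<Otimes>\<^sub>M borel) ==> (%z. F z x) \<in> borel_measurable P"
 using measurable_compose[OF measurable_Pair2'[of x borel P], of "%(z, x). F z x" borel] by simp

lemma partial_slice_meas:
 assumes "x \<in> U" "j < d"
 shows "(%z. partial j (g z) x) \<in> borel_measurable P"
 using slice_meas[OF h_meas[OF assms(2)], of x] assms(1) by (simp add: h_def)

text \<open>The gradient contracted with a fixed direction w is again a process with partial
  derivatives bounded in L1, namely the entries of the Hessian applied to w.\<close>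

lemma grad_l1: "l1_calculus P d U (%z x. \<Sum>j<d. w j * h j z x) (%i z x. \<Sum>j<d. w j * H i j z x) (C * (\<Sum>j<d. \<bar>w j\<bar>))"
proof unfold_locales
 show "(%(z, x). \<Sum>j<d. w j * h j z x) \<in> borel_measurable (P \<Otimes>\<^sub>M borel)"
  using h_meas by (simp add: case_prod_beta')
 show "(%(z, x). \<Sum>j<d. w j * H i j z x) \<in> borel_measurable (P \<Otimes>\<^sub>M borel)" if "i < d" for i
  using H_meas[OF that] by (simp add: case_prod_beta')
 show "((%t. \<Sum>j<d. w j * h j z (x(i := t))) has_real_derivative (\<Sum>j<d. w j * H i j z x)) (at (x i))"
  if "z \<in> space P" "x \<in> U" "i < d" for z x i
  using h_deriv[OF that] that(2) by (intro DERIV_sum DERIV_cmult) (simp add: H_def del: fun_upd_apply)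
 show "(\<integral>\<^sup>+z. ennreal \<bar>\<Sum>j<d. w j * H i j z x\<bar> \<partial>P) <= ennreal (C * (\<Sum>j<d. \<bar>w j\<bar>))" if "x \<in> U" "i < d" for x i
 proof -
  have m: "(%z. ennreal \<bar>H i j z x\<bar>) \<in> borel_measurable P" if "j < d" for j
   using slice_meas[OF H_meas[OF \<open>i < d\<close> that]] by (intro measurable_compose[OF _ measurable_ennreal] borel_measurable_abs)
  have "(\<integral>\<^sup>+z. ennreal \<bar>\<Sum>j<d. w j * H i j z x\<bar> \<partial>P) <= (\<integral>\<^sup>+z. (\<Sum>j<d. ennreal \<bar>w j\<bar> * ennreal \<bar>H i j z x\<bar>) \<partial>P)"
  proof (rule nn_integral_mono)
   fix z
   have "\<bar>\<Sum>j<d. w j * H i j z x\<bar> <= (\<Sum>j<d. \<bar>w j\<bar> * \<bar>H i j z x\<bar>)" using sum_abs[of "%j. w j * H i j z x" "{..<d}"] by (simp add: abs_mult)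
   then show "ennreal \<bar>\<Sum>j<d. w j * H i j z x\<bar> <= (\<Sum>j<d. ennreal \<bar>w j\<bar> * ennreal \<bar>H i j z x\<bar>)"
   by (simp add: ennreal_mult[symmetric] sum_ennreal ennreal_leI)
  qed
  also have "... = (\<Sum>j<d. ennreal \<bar>w j\<bar> * (\<integral>\<^sup>+z. ennreal \<bar>H i j z x\<bar> \<partial>P))"
   using m by (subst nn_integral_sum) (auto intro!: sum.cong nn_integral_cmult)
  also have "... <= (\<Sum>j<d. ennreal \<bar>w j\<bar> * ennreal C)" using that H_bound by (intro sum_mono mult_left_mono) (auto simp: H_def)
  also have "... = ennreal (C * (\<Sum>j<d. \<bar>w j\<bar>))" using C0 by (simp add: ennreal_mult[symmetric] sum_ennreal sum_distrib_left mult.commute)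
  finally show ?thesis .
 qed
qed (use C0 eball_borel in \<open>auto intro!: mult_nonneg_nonneg sum_nonneg\<close>)

lemma between_in_U:
 assumes x: "x \<in> U" and w: "!!i. i < d ==> w i \<in> closed_segment (\<theta>0 i) (x i)" "!!i. i >= d ==> w i = \<theta>0 i"
 shows "w \<in> U"
proof -
 have "edist d w \<theta>0 <= edist d x \<theta>0"
  by (rule edist_mono) (use w(1) in \<open>fastforce simp: closed_segment_eq_real_ivl split: if_splits\<close>)
 then show ?thesis using x w(2) \<theta>0 by (auto simp: eball_iff)
qed

lemma theta0_in_U: "\<theta>0 \<in> U" using r \<theta>0 by (simp add: eball_iff)

lemma eball_component: "x \<in> U ==> i < d ==> \<bar>x i - \<theta>0 i\<bar> <= r"
 using component_le_edist[of i d x \<theta>0] by (simp add: eball_iff)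

lemma grad_L1_from_center:
 assumes x: "x \<in> U"
 shows "(\<integral>\<^sup>+z. ennreal \<bar>(\<Sum>j<d. w j * h j z x) - (\<Sum>j<d. w j * h j z \<theta>0)\<bar> \<partial>P) <= ennreal (C * (\<Sum>j<d. \<bar>w j\<bar>) * (real d * r))"
proof -
 have "(\<integral>\<^sup>+z. ennreal \<bar>(\<Sum>j<d. w j * h j z x) - (\<Sum>j<d. w j * h j z \<theta>0)\<bar> \<partial>P) <= ennreal (C * (\<Sum>j<d. \<bar>w j\<bar>) * (\<Sum>i<d. \<bar>x i - \<theta>0 i\<bar>))"
  using x \<theta>0 by (intro l1_calculus.L1_staircase[OF grad_l1] between_in_U[OF x]) (auto simp: eball_iff)
 also have "... <= ennreal (C * (\<Sum>j<d. \<bar>w j\<bar>) * (real d * r))"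
  using C0 sum_bounded_above[of "{..<d}" "%i. \<bar>x i - \<theta>0 i\<bar>" r] eball_component[OF x]
  by (intro ennreal_leI mult_left_mono) (auto intro!: mult_nonneg_nonneg sum_nonneg)
 finally show ?thesis .
qed

text \<open>First integration: exponential moments of the Hessian form in the directions Dl and w
  pass to the increment of the gradient along Dl, tested against w.\<close>

lemma grad_increment:
 assumes \<theta>: "\<theta> \<in> U" and \<theta>': "(%i. \<theta> i + Dl i) \<in> U" and c: "c > 0"
  and mgf: "!!x. x \<in> U ==> (\<integral>\<^sup>+z. ennreal (exp (\<Sum>i<d. Dl i * (\<Sum>j<d. w j * partial i (partial j (g z)) x))) \<partial>P) <= ennreal c"
 shows "(\<integral>\<^sup>+z. ennreal (exp (\<Sum>j<d. w j * (partial j (g z) (%i. \<theta> i + Dl i) - partial j (g z) \<theta>))) \<partial>P) <= ennreal c"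
proof -
 interpret L: l1_calculus P d U "%z x. \<Sum>j<d. w j * h j z x" "%i z x. \<Sum>j<d. w j * H i j z x" "C * (\<Sum>j<d. \<bar>w j\<bar>)" by (rule grad_l1)
 obtain \<eta> where e: "\<eta> > 0" "!!x u. 0 <= u ==> u <= 1 ==> (!!i. i < d ==> \<bar>x i - (\<theta> i + u * Dl i)\<bar> < \<eta>) ==>
   (!!i. i >= d ==> x i = 0) ==> x \<in> U"
  using eball_nbhd[OF \<theta> \<theta>'] by blast
 let ?D = "%z x. \<Sum>j<d. w j * h j z x"
 let ?B = "C * (\<Sum>j<d. \<bar>w j\<bar>) * (real d * r)"
 have B0: "?B >= 0" using C0 r by (auto intro!: mult_nonneg_nonneg sum_nonneg)
 have "(\<integral>\<^sup>+z. ennreal (exp (?D z (%i. \<theta> i + Dl i) - ?D z \<theta> + 0)) \<partial>P) <= ennreal c"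
 proof (rule L.exp_increment_le[where ?Y0.0 = "%_. 0" and ?C2.0 = "?B + ?B", OF _ _ _ e(1)])
  show "x \<in> U" if "0 <= u" "u <= 1" "!!i. i < d ==> \<bar>x i - (\<theta> i + u * Dl i)\<bar> < \<eta>" "!!i. i >= d ==> x i = 0" for x u
   using that by (rule e(2))
  show "(\<integral>\<^sup>+z. ennreal \<bar>?D z x - ?D z \<theta>\<bar> \<partial>P) <= ennreal (?B + ?B)" if x: "x \<in> U" for x
  proof -
   have "(\<integral>\<^sup>+z. ennreal \<bar>?D z x - ?D z \<theta>\<bar> \<partial>P) <= (\<integral>\<^sup>+z. ennreal \<bar>?D z x - ?D z \<theta>0\<bar> + ennreal \<bar>?D z \<theta> - ?D z \<theta>0\<bar> \<partial>P)"
   by (intro nn_integral_mono) (auto simp: ennreal_plus[symmetric] simp del: ennreal_plus intro!: ennreal_leI)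
   also have "... = (\<integral>\<^sup>+z. ennreal \<bar>?D z x - ?D z \<theta>0\<bar> \<partial>P) + (\<integral>\<^sup>+z. ennreal \<bar>?D z \<theta> - ?D z \<theta>0\<bar> \<partial>P)"
   by (intro nn_integral_add measurable_compose[OF _ measurable_ennreal] borel_measurable_abs borel_measurable_diff L.D_meas1[OF refl])
   also have "... <= ennreal ?B + ennreal ?B" by (intro add_mono grad_L1_from_center x \<theta>)
   also have "... = ennreal (?B + ?B)" using B0 by (intro ennreal_plus[symmetric])
   finally show ?thesis .
  qed
  show "(\<integral>\<^sup>+z. ennreal (exp ((\<Sum>i<d. Dl i * (\<Sum>j<d. w j * H i j z x)) + 0)) \<partial>P) <= ennreal c" if x: "x \<in> U" for x
   using mgf[OF x] x by (simp add: H_def)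
  show "\<theta> i = 0" "Dl i = 0" if "i >= d" for i
  proof -
   show *: "\<theta> i = 0" using \<theta> that by (simp add: eball_iff)
   have "\<theta> i + Dl i = 0" using \<theta>' that by (simp add: eball_iff)
   then show "Dl i = 0" using * by simp
  qed
 qed (use c in auto)
 then show ?thesis using \<theta> \<theta>' by (simp add: h_def right_diff_distrib sum_subtractf)
qed

lemma grad_L1_bound:
 assumes x: "x \<in> U" and j: "j < d" and c0: "(\<integral>\<^sup>+z. ennreal \<bar>partial j (g z) \<theta>0\<bar> \<partial>P) <= ennreal c0" "c0 >= 0"
 shows "(\<integral>\<^sup>+z. ennreal \<bar>partial j (g z) x\<bar> \<partial>P) <= ennreal (c0 + C * (real d * r))"
proof -
 let ?w = "%i. if i = j then 1 else 0 :: real"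
 have s: "(\<Sum>i<d. ?w i * F i) = F j" "(\<Sum>i<d. \<bar>?w i\<bar>) = 1" for F :: "nat => real"
  using j by (simp_all add: if_distrib if_distribR cong: if_cong)
 have "(\<integral>\<^sup>+z. ennreal \<bar>partial j (g z) x\<bar> \<partial>P) <= (\<integral>\<^sup>+z. ennreal \<bar>partial j (g z) \<theta>0\<bar> + ennreal \<bar>h j z x - h j z \<theta>0\<bar> \<partial>P)"
  using x theta0_in_U by (intro nn_integral_mono) (auto simp: h_def ennreal_plus[symmetric] simp del: ennreal_plus intro!: ennreal_leI)
 also have "... = (\<integral>\<^sup>+z. ennreal \<bar>partial j (g z) \<theta>0\<bar> \<partial>P) + (\<integral>\<^sup>+z. ennreal \<bar>h j z x - h j z \<theta>0\<bar> \<partial>P)"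
  by (intro nn_integral_add measurable_compose[OF _ measurable_ennreal] borel_measurable_abs borel_measurable_diff slice_meas[OF h_meas] partial_slice_meas theta0_in_U j)
 also have "... <= ennreal c0 + ennreal (C * (real d * r))"
  using grad_L1_from_center[OF x, of ?w] unfolding s by (intro add_mono c0) simp
 also have "... = ennreal (c0 + C * (real d * r))" using c0(2) C0 r by (intro ennreal_plus[symmetric]) auto
 finally show ?thesis .
qed

text \<open>Second integration. The ball has its own radius \<rho>, because the gradient is within
  order \<rho> of its value at \<theta>0 only there, and \<open>Y0\<close> carries the gradient at
  \<theta>0 that the linearization subtracts.\<close>

lemma value_increment:
 assumes \<rho>: "\<rho> <= r" and \<theta>: "\<theta> \<in> eball d \<theta>0 \<rho>" and \<theta>': "(%i. \<theta> i + Dl i) \<in> eball d \<theta>0 \<rho>" and c: "c > 0"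
  and b: "!!z x. z \<in> space P ==> x \<in> U ==> \<bar>g z x\<bar> <= b" and b0: "b >= 0"
  and grad_b: "!!j. j < d ==> (\<integral>\<^sup>+z. ennreal \<bar>partial j (g z) \<theta>0\<bar> \<partial>P) <= ennreal c0" "c0 >= 0"
  and Y0: "Y0 \<in> borel_measurable P"
  and mgf: "!!x. x \<in> eball d \<theta>0 \<rho> ==> (\<integral>\<^sup>+z. ennreal (exp ((\<Sum>j<d. Dl j * (s * partial j (g z) x)) + Y0 z)) \<partial>P) <= ennreal c"
 shows "(\<integral>\<^sup>+z. ennreal (exp (s * g z (%i. \<theta> i + Dl i) - s * g z \<theta> + Y0 z)) \<partial>P) <= ennreal c"
proof -
 have sub: "x \<in> U" if "x \<in> eball d \<theta>0 \<rho>" for x using that \<rho> by (auto simp: eball_iff)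
 define C1 where "C1 = c0 + C * (real d * r)"
 have C1: "C1 >= 0" using C0 r grad_b(2) by (simp add: C1_def)
 interpret L: l1_calculus P d "eball d \<theta>0 \<rho>" "%z x. s * gU z x" "%i z x. s * h i z x" "\<bar>s\<bar> * C1"
 proof unfold_locales
  show "(%(z, x). s * gU z x) \<in> borel_measurable (P \<Otimes>\<^sub>M borel)" using gU_meas by (simp add: case_prod_beta')
  show "(%(z, x). s * h i z x) \<in> borel_measurable (P \<Otimes>\<^sub>M borel)" if "i < d" for i using h_meas[OF that] by (simp add: case_prod_beta')
  show "((%t. s * gU z (x(i := t))) has_real_derivative s * h i z x) (at (x i))" if "z \<in> space P" "x \<in> eball d \<theta>0 \<rho>" "i < d" for z x i
   using gU_deriv[OF that(1) sub[OF that(2)] that(3)] sub[OF that(2)] by (intro DERIV_cmult) (simp add: h_def del: fun_upd_apply)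
  show "(\<integral>\<^sup>+z. ennreal \<bar>s * h i z x\<bar> \<partial>P) <= ennreal (\<bar>s\<bar> * C1)" if "x \<in> eball d \<theta>0 \<rho>" "i < d" for x i
  proof -
   have "(\<integral>\<^sup>+z. ennreal \<bar>s * h i z x\<bar> \<partial>P) = (\<integral>\<^sup>+z. ennreal \<bar>s\<bar> * ennreal \<bar>partial i (g z) x\<bar> \<partial>P)"
   using sub[OF that(1)] by (simp add: h_def abs_mult ennreal_mult)
   also have "... = ennreal \<bar>s\<bar> * (\<integral>\<^sup>+z. ennreal \<bar>partial i (g z) x\<bar> \<partial>P)"
   by (intro nn_integral_cmult measurable_compose[OF _ measurable_ennreal] borel_measurable_abs partial_slice_meas sub that)
   also have "... <= ennreal \<bar>s\<bar> * ennreal C1" unfolding C1_def using sub[OF that(1)] that(2) grad_b by (intro mult_left_mono grad_L1_bound) auto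
   finally show ?thesis using C1 by (simp add: ennreal_mult)
  qed
 qed (use C1 eball_borel in auto)
 obtain \<eta> where e: "\<eta> > 0" "!!x u. 0 <= u ==> u <= 1 ==> (!!i. i < d ==> \<bar>x i - (\<theta> i + u * Dl i)\<bar> < \<eta>) ==>
   (!!i. i >= d ==> x i = 0) ==> x \<in> eball d \<theta>0 \<rho>"
  using eball_nbhd[OF \<theta> \<theta>'] by blast
 have "(\<integral>\<^sup>+z. ennreal (exp (s * gU z (%i. \<theta> i + Dl i) - s * gU z \<theta> + Y0 z)) \<partial>P) <= ennreal c"
 proof (rule L.exp_increment_le[where ?Y0.0 = Y0 and ?C2.0 = "\<bar>s\<bar> * (2 * b)", OF Y0 _ _ e(1)])
  show "x \<in> eball d \<theta>0 \<rho>" if "0 <= u" "u <= 1" "!!i. i < d ==> \<bar>x i - (\<theta> i + u * Dl i)\<bar> < \<eta>" "!!i. i >= d ==> x i = 0" for x u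
   using that by (rule e(2))
  show "(\<integral>\<^sup>+z. ennreal \<bar>s * gU z x - s * gU z \<theta>\<bar> \<partial>P) <= ennreal (\<bar>s\<bar> * (2 * b))" if x: "x \<in> eball d \<theta>0 \<rho>" for x
  proof -
   have "\<bar>s * gU z x - s * gU z \<theta>\<bar> <= \<bar>s\<bar> * (2 * b)" if z: "z \<in> space P" for z
   proof -
   have "\<bar>gU z x - gU z \<theta>\<bar> <= 2 * b" using b[OF z sub[OF x]] b[OF z sub[OF \<theta>]] sub[OF x] sub[OF \<theta>] by (simp add: gU_def)
   then show ?thesis by (simp add: right_diff_distrib[symmetric] abs_mult mult_left_mono)
   qed
   then have "(\<integral>\<^sup>+z. ennreal \<bar>s * gU z x - s * gU z \<theta>\<bar> \<partial>P) <= (\<integral>\<^sup>+z. ennreal (\<bar>s\<bar> * (2 * b)) \<partial>P)" by (intro nn_integral_mono ennreal_leI)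
   then show ?thesis by (simp add: emeasure_space_1)
  qed
  show "(\<integral>\<^sup>+z. ennreal (exp ((\<Sum>i<d. Dl i * (s * h i z x)) + Y0 z)) \<partial>P) <= ennreal c" if x: "x \<in> eball d \<theta>0 \<rho>" for x
   using mgf[OF x] sub[OF x] by (simp add: h_def)
  show "\<theta> i = 0" "Dl i = 0" if "i >= d" for i
  proof -
   show *: "\<theta> i = 0" using \<theta> that by (simp add: eball_iff)
   have "\<theta> i + Dl i = 0" using \<theta>' that by (simp add: eball_iff)
   then show "Dl i = 0" using * by simp
  qed
 qed (use c in auto)
 then show ?thesis using sub[OF \<theta>] sub[OF \<theta>'] by (simp add: gU_def)
qed

end

context second_order begin

text \<open>No constant term is subtracted: increments do not see it, and \<open>zeta\<close>
  vanishes at \<theta>0.\<close>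

definition "R z x = g z x - (\<Sum>j<d. (x j - \<theta>0 j) * partial j (g z) \<theta>0)"

text \<open>The increments of the second order remainder \<open>R\<close> inherit the subgaussian bound on the Hessian
 by integrating twice: first the gradient along the segment from \<open>\<theta>0\<close>, then the values.\<close>

theorem remainder_mgf:
 assumes mgf: "!!x a b s. x \<in> U ==> \<bar>s\<bar> * (sqrt (ip d a a) * sqrt (ip d b b)) <= l0 ==>
   (\<integral>\<^sup>+z. ennreal (exp (s * (\<Sum>i<d. a i * (\<Sum>j<d. b j * partial i (partial j (g z)) x)))) \<partial>P)
   <= ennreal (exp (v\<^sup>2 * (s * (sqrt (ip d a a) * sqrt (ip d b b)))\<^sup>2 / 2))"
  and b: "!!z x. z \<in> space P ==> x \<in> U ==> \<bar>g z x\<bar> <= b" "b >= 0"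
  and grad_b: "!!j. j < d ==> (\<integral>\<^sup>+z. ennreal \<bar>partial j (g z) \<theta>0\<bar> \<partial>P) <= ennreal c0" "c0 >= 0"
  and \<rho>: "\<rho> <= r" and \<theta>: "\<theta> \<in> eball d \<theta>0 \<rho>" "\<theta>' \<in> eball d \<theta>0 \<rho>" and s: "\<bar>s\<bar> * (\<rho> * edist d \<theta>' \<theta>) <= l0"
 shows "(\<integral>\<^sup>+z. ennreal (exp (s * (R z \<theta>' - R z \<theta>))) \<partial>P) <= ennreal (exp (v\<^sup>2 * (s * (\<rho> * edist d \<theta>' \<theta>))\<^sup>2 / 2))"
proof -
 define Dl where "Dl i = \<theta>' i - \<theta> i" for i
 define Y0 where "Y0 z = - s * (\<Sum>j<d. Dl j * partial j (g z) \<theta>0)" for z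
 let ?e = "edist d \<theta>' \<theta>"
 let ?c = "exp (v\<^sup>2 * (s * (\<rho> * ?e))\<^sup>2 / 2)"
 have e: "sqrt (ip d Dl Dl) = ?e" by (simp add: edist_ip Dl_def[abs_def])
 have \<theta>'e: "(%i. \<theta> i + Dl i) = \<theta>'" by (simp add: Dl_def)
 have \<rho>0: "\<rho> > 0" using \<theta>(1) edist_pos[of d \<theta> \<theta>0] by (simp add: eball_iff)
 have Y0m: "Y0 \<in> borel_measurable P" unfolding Y0_def[abs_def]
  by (intro borel_measurable_times borel_measurable_const borel_measurable_sum partial_slice_meas theta0_in_U) auto
 have "(\<integral>\<^sup>+z. ennreal (exp (s * g z (%i. \<theta> i + Dl i) - s * g z \<theta> + Y0 z)) \<partial>P) <= ennreal ?c"
 proof (rule value_increment[OF \<rho> \<theta>(1) _ _ b grad_b Y0m])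
  show "(%i. \<theta> i + Dl i) \<in> eball d \<theta>0 \<rho>" unfolding \<theta>'e by (rule \<theta>)
  fix x assume x: "x \<in> eball d \<theta>0 \<rho>"
  then have xU: "x \<in> U" using \<rho> by (auto simp: eball_iff)
  have xe: "(%i. \<theta>0 i + (x i - \<theta>0 i)) = x" by simp
  have e2: "sqrt (ip d (%i. x i - \<theta>0 i) (%i. x i - \<theta>0 i)) <= \<rho>" using x by (simp add: edist_ip[symmetric] eball_iff)
  have "(\<integral>\<^sup>+z. ennreal (exp (\<Sum>j<d. s * Dl j * (partial j (g z) (%i. \<theta>0 i + (x i - \<theta>0 i)) - partial j (g z) \<theta>0))) \<partial>P) <= ennreal ?c"
  proof (rule grad_increment[OF theta0_in_U])
   show "(%i. \<theta>0 i + (x i - \<theta>0 i)) \<in> U" unfolding xe by (rule xU)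
   fix y assume y: "y \<in> U"
   let ?a = "%i. x i - \<theta>0 i"
   let ?p = "sqrt (ip d ?a ?a) * sqrt (ip d Dl Dl)"
   have p: "0 <= ?p" "?p <= \<rho> * ?e" using e2 \<rho>0 unfolding e by (auto simp: ip_pos edist_pos intro!: mult_nonneg_nonneg mult_right_mono)
   have "\<bar>s\<bar> * ?p <= \<bar>s\<bar> * (\<rho> * ?e)" by (intro mult_left_mono p) simp
   then have "\<bar>s\<bar> * ?p <= l0" using s by linarith
   from mgf[OF y this]
   have "(\<integral>\<^sup>+z. ennreal (exp (s * (\<Sum>i<d. ?a i * (\<Sum>j<d. Dl j * partial i (partial j (g z)) y)))) \<partial>P) <= ennreal (exp (v\<^sup>2 * (s * ?p)\<^sup>2 / 2))" .
   also have "... <= ennreal ?c"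
   proof -
   have "(s * ?p)\<^sup>2 <= (s * (\<rho> * ?e))\<^sup>2" unfolding power_mult_distrib[of s] by (intro mult_left_mono power_mono p) auto
   then show ?thesis by (intro ennreal_leI iffD2[OF exp_le_cancel_iff] divide_right_mono mult_left_mono) auto
   qed
   finally show "(\<integral>\<^sup>+z. ennreal (exp (\<Sum>i<d. ?a i * (\<Sum>j<d. s * Dl j * partial i (partial j (g z)) y))) \<partial>P) <= ennreal ?c"
   by (simp add: sum_distrib_left mult_ac)
  qed simp
  then show "(\<integral>\<^sup>+z. ennreal (exp ((\<Sum>j<d. Dl j * (s * partial j (g z) x)) + Y0 z)) \<partial>P) <= ennreal ?c"
   unfolding xe by (simp add: Y0_def sum_distrib_left sum_negf[symmetric] sum.distrib[symmetric] right_diff_distrib mult_ac)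
 qed simp
 moreover have "s * g z (%i. \<theta> i + Dl i) - s * g z \<theta> + Y0 z = s * (R z \<theta>' - R z \<theta>)" for z
 proof -
  have a: "s * A - s * B + - s * (X - Y) = s * ((A - X) - (B - Y))" for A B X Y :: real by (simp add: algebra_simps)
  have b: "(\<Sum>j<d. Dl j * partial j (g z) \<theta>0) = (\<Sum>j<d. (\<theta>' j - \<theta>0 j) * partial j (g z) \<theta>0) - (\<Sum>j<d. (\<theta> j - \<theta>0 j) * partial j (g z) \<theta>0)"
   unfolding sum_subtractf[symmetric] by (intro sum.cong) (auto simp: Dl_def algebra_simps)
  show ?thesis unfolding \<theta>'e Y0_def R_def b by (rule a)
 qed
 ultimately show ?thesis by simp
qed

lemma grad_lipschitz_near:
 assumes x: "!!w. (!!i. i < d ==> w i \<in> closed_segment (y i) (x i)) ==> (!!i. i >= d ==> w i = y i) ==> w \<in> U"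
  and hi: "!!i. i >= d ==> x i = y i" and j: "j < d"
 shows "(\<integral>\<^sup>+z. ennreal \<bar>partial j (g z) x - partial j (g z) y\<bar> \<partial>P) <= ennreal (C * (\<Sum>i<d. \<bar>x i - y i\<bar>))"
proof -
 let ?w = "%i. if i = j then 1 else 0 :: real"
 have s: "(\<Sum>i<d. ?w i * F i) = F j" "(\<Sum>i<d. \<bar>?w i\<bar>) = 1" for F :: "nat => real"
  using j by (simp_all add: if_distrib if_distribR cong: if_cong)
 have "x \<in> U" by (rule assms(1)) (use hi in auto)
 moreover have "y \<in> U" by (rule assms(1)) auto
 ultimately have U: "x \<in> U" "y \<in> U" by auto
 have "(\<integral>\<^sup>+z. ennreal \<bar>(\<Sum>i<d. ?w i * h i z x) - (\<Sum>i<d. ?w i * h i z y)\<bar> \<partial>P) <= ennreal (C * (\<Sum>i<d. \<bar>?w i\<bar>) * (\<Sum>i<d. \<bar>x i - y i\<bar>))"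
  by (rule l1_calculus.L1_staircase[OF grad_l1]) (fact x hi)+
 then show ?thesis using U unfolding s by (simp add: h_def)
qed

end

text \<open>Taking G as a constant random function turns the exponential inequalities into plain
  ones by monotonicity of exp, so the gradient is controlled without continuity of the Hessian.
  Along the segment from \<theta>0, the function G plus \<kappa>/2 times the squared distance is
  then nonincreasing.\<close>

theorem quadratic_decrease:
 assumes "second_order P d \<theta>0 r (%_. G) C" and grad0: "!!j. j < d ==> partial j G \<theta>0 = 0"
  and curv: "!!x a. x \<in> eball d \<theta>0 r ==> (\<Sum>i<d. a i * (\<Sum>j<d. a j * partial i (partial j G) x)) <= - \<kappa> * ip d a a"
  and \<theta>: "\<theta> \<in> eball d \<theta>0 r"
 shows "G \<theta> <= G \<theta>0 - \<kappa> / 2 * (edist d \<theta> \<theta>0)\<^sup>2"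
proof -
 interpret second_order P d \<theta>0 r "%_. G" C by fact
 define Dl where "Dl i = \<theta> i - \<theta>0 i" for i
 let ?p = "%u i. \<theta>0 i + u * Dl i"
 have e: "ip d Dl Dl = (edist d \<theta> \<theta>0)\<^sup>2" by (simp add: edist_ip Dl_def[abs_def] ip_pos)
 have p1: "(%i. \<theta>0 i + Dl i) = \<theta>" by (simp add: Dl_def)
 have Dl0: "Dl i = 0" if "i >= d" for i using \<theta> \<theta>0 that by (simp add: Dl_def eball_iff)
 have pU: "?p u \<in> U" if u: "0 <= u" "u <= 1" for u
 proof -
  have "u * edist d \<theta> \<theta>0 <= edist d \<theta> \<theta>0" using u edist_pos[of d \<theta> \<theta>0] by (simp add: mult_left_le_one_le)
  then have "edist d (?p u) \<theta>0 <= edist d \<theta> \<theta>0" using edist_scale[OF u(1), of d \<theta>0 Dl] unfolding p1 by linarith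
  then show ?thesis using \<theta> \<theta>0 Dl0 by (auto simp: eball_iff)
 qed
 have grad: "(\<Sum>j<d. Dl j * partial j G (?p u)) <= - \<kappa> * (u * ip d Dl Dl)" if u: "0 <= u" "u <= 1" for u
 proof -
  have "(\<integral>\<^sup>+z. ennreal (exp (\<Sum>j<d. Dl j * (partial j G (?p u) - partial j G \<theta>0))) \<partial>P) <= ennreal (exp (- \<kappa> * (u * ip d Dl Dl)))"
  proof (rule grad_increment[OF theta0_in_U pU[OF u]])
   fix x assume x: "x \<in> U"
   have "(\<Sum>i<d. u * Dl i * (\<Sum>j<d. Dl j * partial i (partial j G) x)) = u * (\<Sum>i<d. Dl i * (\<Sum>j<d. Dl j * partial i (partial j G) x))"
   by (simp add: sum_distrib_left mult_ac)
   also have "... <= u * (- \<kappa> * ip d Dl Dl)" by (intro mult_left_mono curv x u)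
   also have "... = - \<kappa> * (u * ip d Dl Dl)" by simp
   finally show "(\<integral>\<^sup>+z. ennreal (exp (\<Sum>i<d. u * Dl i * (\<Sum>j<d. Dl j * partial i (partial j G) x))) \<partial>P) <= ennreal (exp (- \<kappa> * (u * ip d Dl Dl)))"
   by (simp add: emeasure_space_1 ennreal_leI)
  qed simp
  then show ?thesis using grad0 by (simp add: emeasure_space_1)
 qed
 have D: "((%u. G (?p u)) has_real_derivative (\<Sum>j<d. Dl j * partial j G (?p u))) (at u)" if u: "0 <= u" "u <= 1" for u
 proof -
  obtain \<eta> where \<eta>: "\<eta> > 0" "!!y s. 0 <= s ==> s <= 1 ==> (!!i. i < d ==> \<bar>y i - (?p u i + s * 0)\<bar> < \<eta>) ==> (!!i. i >= d ==> y i = 0) ==> y \<in> U"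
   using eball_nbhd[of "?p u" d \<theta>0 r "%_. 0"] pU[OF u] by auto
  have box: "w \<in> U" if "!!i. i < d ==> \<bar>w i - ?p u i\<bar> < \<eta>" "!!i. i >= d ==> w i = ?p u i" for w
   by (rule \<eta>(2)[of 0]) (use that \<theta>0 Dl0 in auto)
  have "((%s. G (%i. ?p u i + s * Dl i)) has_real_derivative (\<Sum>i<d. Dl i * partial i G (?p u))) (at 0)"
  proof (rule partials_imp_directional[where \<eta> = \<eta> and L = C, OF \<eta>(1) Dl0 _ _ C0])
   fix x :: point and i assume x: "i < d" "!!j. \<bar>x j - ?p u j\<bar> < \<eta>" "!!j. j >= d ==> x j = ?p u j"
   obtain z where "z \<in> space P" using not_empty by blast
   then show "((%t. G (x(i := t))) has_real_derivative partial i G x) (at (x i))" using box[OF x(2,3)] x(1) by (rule deriv1)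
   have "(\<integral>\<^sup>+z. ennreal \<bar>partial i G x - partial i G (?p u)\<bar> \<partial>P) <= ennreal (C * (\<Sum>j<d. \<bar>x j - ?p u j\<bar>))"
   proof (rule grad_lipschitz_near[OF _ x(3,1)])
   fix w assume w: "!!i. i < d ==> w i \<in> closed_segment (?p u i) (x i)" "!!i. i >= d ==> w i = ?p u i"
   show "w \<in> U"
   proof (rule box[OF _ w(2)])
   fix j assume "j < d"
   from w(1)[OF this] show "\<bar>w j - ?p u j\<bar> < \<eta>" using x(2)[of j]
   unfolding closed_segment_eq_real_ivl abs_less_iff by (auto split: if_splits)
   qed
   qed
   then show "\<bar>partial i G x - partial i G (?p u)\<bar> <= C * (\<Sum>j<d. \<bar>x j - ?p u j\<bar>)"
   using C0 by (simp add: emeasure_space_1 ennreal_le_iff sum_nonneg)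
  qed
  moreover have "(%s. G (%i. ?p u i + s * Dl i)) = (%s. G (?p (s + u)))" by (simp add: algebra_simps)
  ultimately show ?thesis using DERIV_shift[of "%u. G (?p u)" "(\<Sum>i<d. Dl i * partial i G (?p u))" 0 u] by simp
 qed
 let ?q = "ip d Dl Dl"
 have "G (?p 1) + \<kappa> / 2 * ?q * 1\<^sup>2 <= G (?p 0) + \<kappa> / 2 * ?q * 0\<^sup>2"
 proof (rule DERIV_nonpos_imp_nonincreasing[of 0 1 "%u. G (?p u) + \<kappa> / 2 * ?q * u\<^sup>2"])
  fix u :: real assume u: "0 <= u" "u <= 1"
  have "((%u. G (?p u) + \<kappa> / 2 * ?q * u\<^sup>2) has_real_derivative (\<Sum>j<d. Dl j * partial j G (?p u)) + \<kappa> * ?q * u) (at u)"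
   by (rule DERIV_add[OF D[OF u]]) (auto intro!: derivative_eq_intros)
  then show "\<exists>y. ((%u. G (?p u) + \<kappa> / 2 * ?q * u\<^sup>2) has_real_derivative y) (at u) \<and> y <= 0"
   using grad[OF u] by (intro exI conjI) (auto simp: mult_ac)
 qed simp
 then show ?thesis unfolding e by (simp add: p1)
qed

section \<open>Chaining over a ball\<close>

text \<open>Exponential weights again: each counted vector has weight at least exp (- a L), and the
  total weight factorizes into d two-sided geometric sums, each at most 4 / a.\<close>

lemma card_int_vectors:
 assumes a: "0 < a" "a <= 1"
 shows "real (card {z \<in> PiE {..<d} (%_. {- int L..int L}). (\<Sum>i<d. \<bar>z i\<bar>) <= int L}) <= exp (a * real L) * (4 / a) ^ d"
proof -
 let ?E = "PiE {..<d} (%_. {- int L..int L})"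
 let ?S = "{z \<in> ?E. (\<Sum>i<d. \<bar>z i\<bar>) <= int L}"
 let ?f = "%m. exp (- a * real_of_int \<bar>m\<bar>)"
 have fin: "finite ?E" by (rule finite_PiE) auto
 have one: "(\<Sum>m\<in>{- int L..int L}. ?f m) <= 4 / a"
 proof -
  have "{- int L..int L} \<subseteq> int ` {..<Suc L} \<union> (%n. - int n) ` {..<Suc L}"
  proof
   fix m :: int assume "m \<in> {- int L..int L}"
   then show "m \<in> int ` {..<Suc L} \<union> (%n. - int n) ` {..<Suc L}"
   by (cases m rule: int_cases2) (auto simp: image_iff less_Suc_eq_le)
  qed
  then have "(\<Sum>m\<in>{- int L..int L}. ?f m) <= (\<Sum>m\<in>int ` {..<Suc L} \<union> (%n. - int n) ` {..<Suc L}. ?f m)" by (intro sum_mono2) auto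
  also have "... <= (\<Sum>m\<in>int ` {..<Suc L}. ?f m) + (\<Sum>m\<in>(%n. - int n) ` {..<Suc L}. ?f m)"
   by (subst sum.union_inter[symmetric]) (auto intro!: sum_nonneg)
  also have "... = 2 * (\<Sum>n<Suc L. exp (- a) ^ n)"
   by (subst (1 2) sum.reindex) (auto simp: inj_on_def exp_of_nat_mult[symmetric] mult.commute)
  also have "(\<Sum>n<Suc L. exp (- a) ^ n) <= 1 / (1 - exp (- a))"
  proof -
   have "(\<Sum>n<Suc L. exp (- a) ^ n) = (1 - exp (- a) ^ Suc L) / (1 - exp (- a))"
   using a by (subst sum_gp_strict) auto
   also have "... <= 1 / (1 - exp (- a))" using a by (intro divide_right_mono) auto
   finally show ?thesis .
  qed
  also have "1 / (1 - exp (- a)) <= 1 / (a / 2)"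
  proof (rule divide_left_mono)
   \<comment> \<open>Together with 1 + a <= exp a this gives exp (- a) <= 1 - a / 2 for a <=
     1.\<close>
   have "1 * 1 <= (1 + a) * (1 - a / 2)" using a by (simp add: algebra_simps power2_eq_square[symmetric] power_le_one)  (use a in \<open>simp add: power2_eq_square mult_left_le\<close>)
   also have "... <= exp a * (1 - a / 2)" using a exp_ge_add_one_self[of a] by (intro mult_right_mono) auto
   finally have "exp (- a) <= 1 - a / 2" by (simp add: exp_minus field_simps)
   then show "a / 2 <= 1 - exp (- a)" by simp
  qed (use a in auto)
  finally show ?thesis by simp
 qed
 have "real (card ?S) = (\<Sum>z\<in>?S. 1)" by simp
 also have "... <= (\<Sum>z\<in>?S. exp (a * real L) * (\<Prod>i<d. ?f (z i)))"
 proof (rule sum_mono)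
  fix z assume "z \<in> ?S"
  then have "real_of_int (\<Sum>i<d. \<bar>z i\<bar>) <= real_of_int (int L)" by (intro of_int_le_iff[THEN iffD2]) simp
  then have "a * real_of_int (\<Sum>i<d. \<bar>z i\<bar>) <= a * real L" using a by (intro mult_left_mono) auto
  moreover have "(\<Prod>i<d. ?f (z i)) = exp (- (a * real_of_int (\<Sum>i<d. \<bar>z i\<bar>)))"
   by (simp add: exp_sum[symmetric] sum_negf sum_distrib_left)
  ultimately show "1 <= exp (a * real L) * (\<Prod>i<d. ?f (z i))" by (simp add: exp_add[symmetric])
 qed
 also have "... <= (\<Sum>z\<in>?E. exp (a * real L) * (\<Prod>i<d. ?f (z i)))" 
 proof (rule sum_mono2[OF fin])
  show "0 <= exp (a * real L) * (\<Prod>i<d. ?f (z i))" for z by (intro mult_nonneg_nonneg prod_nonneg) auto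
 qed blast
 also have "... = exp (a * real L) * (\<Prod>i<d. \<Sum>m\<in>{- int L..int L}. ?f m)"
  unfolding sum_distrib_left[symmetric] by (subst prod_sum_PiE) auto
 also have "... <= exp (a * real L) * (4 / a) ^ d"
  using one by (intro mult_left_mono) (auto intro!: power_mono sum_nonneg)
 finally show ?thesis .
qed

locale dyadic_grid =
 fixes d :: nat and \<theta>0 :: point and \<rho> :: real
 assumes d: "d >= 1" and \<rho>: "\<rho> > 0" and \<theta>0: "!!i. i >= d ==> \<theta>0 i = 0"
begin

text \<open>The mesh for which an error of sp k in every coordinate is a Euclidean error of \<rho> /
  2^k.\<close>

definition "sp k = \<rho> / (sqrt (real d) * 2 ^ k)"
text \<open>Rounding is towards 0, that is towards the centre, so that projection never leaves the
  ball.\<close>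

definition "zt k x = (if x >= 0 then \<lfloor>x / sp k\<rfloor> else - \<lfloor>- x / sp k\<rfloor>)"
definition "tr k x = sp k * real_of_int (zt k x)"
definition "proj k \<theta> = (%i. if i < d then \<theta>0 i + tr k (\<theta> i - \<theta>0 i) else 0)"
definition "grid k = {\<theta> \<in> eball d \<theta>0 \<rho>. \<forall>i<d. \<exists>z::int. \<theta> i - \<theta>0 i = sp k * real_of_int z}"

lemma sp: "sp k > 0" "sp k = 2 * sp (Suc k)" using d \<rho> by (auto simp: sp_def)

lemma sp_d: "sqrt (real d) * sp k = \<rho> / 2 ^ k" using d by (simp add: sp_def)

lemma floor_bounds: "sp k * real_of_int \<lfloor>x / sp k\<rfloor> <= x" "x <= sp k * real_of_int \<lfloor>x / sp k\<rfloor> + sp k"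
proof -
 have "sp k * real_of_int \<lfloor>x / sp k\<rfloor> <= sp k * (x / sp k)" using sp(1)[of k] by (intro mult_left_mono of_int_floor_le) auto
 then show "sp k * real_of_int \<lfloor>x / sp k\<rfloor> <= x" using sp(1)[of k] by simp
 have "sp k * (x / sp k) <= sp k * (real_of_int \<lfloor>x / sp k\<rfloor> + 1)" using sp(1)[of k] by (intro mult_left_mono real_of_int_floor_add_one_ge) auto
 then show "x <= sp k * real_of_int \<lfloor>x / sp k\<rfloor> + sp k" using sp(1)[of k] by (simp add: distrib_left)
qed

lemma floor_nonneg: "x >= 0 ==> 0 <= sp k * real_of_int \<lfloor>x / sp k\<rfloor>" using sp(1)[of k] by simp

lemma floor_Suc: "sp k * real_of_int \<lfloor>x / sp k\<rfloor> <= sp (Suc k) * real_of_int \<lfloor>x / sp (Suc k)\<rfloor>"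
proof -
 have "sp (Suc k) * (2 * real_of_int \<lfloor>x / sp k\<rfloor>) <= x" using floor_bounds(1)[of k x] unfolding sp(2)[of k] by (simp add: mult_ac)
 then have "real_of_int (2 * \<lfloor>x / sp k\<rfloor>) <= x / sp (Suc k)" using sp(1)[of "Suc k"] by (simp add: pos_le_divide_eq mult.commute)
 then have "2 * \<lfloor>x / sp k\<rfloor> <= \<lfloor>x / sp (Suc k)\<rfloor>" by (simp only: le_floor_iff)
 then have "real_of_int (2 * \<lfloor>x / sp k\<rfloor>) <= real_of_int \<lfloor>x / sp (Suc k)\<rfloor>" by (simp only: of_int_le_iff)
 then have "sp (Suc k) * real_of_int (2 * \<lfloor>x / sp k\<rfloor>) <= sp (Suc k) * real_of_int \<lfloor>x / sp (Suc k)\<rfloor>" using sp(1)[of "Suc k"] by (intro mult_left_mono) auto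
 then show ?thesis unfolding sp(2)[of k] by (simp add: mult_ac)
qed

lemma tr: "\<bar>tr k x\<bar> <= \<bar>x\<bar>" "\<bar>x - tr k x\<bar> <= sp k" "\<bar>tr (Suc k) x - tr k x\<bar> <= sp k"
proof -
 note fb = floor_bounds[where k = k and x = x] floor_bounds[where k = k and x = "- x"] floor_Suc[where k = k and x = x]
  floor_Suc[where k = k and x = "- x"] floor_bounds[where k = "Suc k" and x = x] floor_bounds[where k = "Suc k" and x = "- x"]
 have e: "tr k x = (if x >= 0 then sp k * real_of_int \<lfloor>x / sp k\<rfloor> else - (sp k * real_of_int \<lfloor>- x / sp k\<rfloor>))" for k by (simp add: tr_def zt_def)
 show "\<bar>tr k x\<bar> <= \<bar>x\<bar>" unfolding e using fb floor_nonneg[of x k] floor_nonneg[of "- x" k] by auto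
 show "\<bar>x - tr k x\<bar> <= sp k" unfolding e using fb by auto
 show "\<bar>tr (Suc k) x - tr k x\<bar> <= sp k" unfolding e using fb by auto
qed

lemma tr_grid: "tr k (sp k * real_of_int z) = sp k * real_of_int z"
proof -
 have "sp k * real_of_int z / sp k = real_of_int z" "- (sp k * real_of_int z) / sp k = real_of_int (- z)" using sp(1)[of k] by auto
 then show ?thesis unfolding tr_def zt_def by (simp only: floor_of_int) simp
qed

lemma proj_ball: "\<theta> \<in> eball d \<theta>0 \<rho> ==> proj k \<theta> \<in> eball d \<theta>0 \<rho>"
proof -
 assume \<theta>: "\<theta> \<in> eball d \<theta>0 \<rho>"
 have "edist d (proj k \<theta>) \<theta>0 <= edist d \<theta> \<theta>0" by (rule edist_mono) (simp add: proj_def tr)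
 then show ?thesis using \<theta> by (auto simp: eball_iff proj_def)
qed

lemma proj_grid: "\<theta> \<in> eball d \<theta>0 \<rho> ==> proj k \<theta> \<in> grid k"
 using proj_ball[of \<theta> k] unfolding grid_def by (auto simp: proj_def tr_def)

lemma proj_top: "\<theta> \<in> grid k ==> proj k \<theta> = \<theta>"
proof
 fix i assume \<theta>: "\<theta> \<in> grid k"
 show "proj k \<theta> i = \<theta> i"
 proof (cases "i < d")
  case True
  then obtain z :: int where z: "\<theta> i - \<theta>0 i = sp k * real_of_int z" using \<theta> by (auto simp: grid_def)
  have "proj k \<theta> i = \<theta>0 i + tr k (\<theta> i - \<theta>0 i)" using True by (simp add: proj_def)
  also have "tr k (\<theta> i - \<theta>0 i) = \<theta> i - \<theta>0 i" unfolding z by (rule tr_grid)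
  finally show ?thesis by simp
 qed (use \<theta> in \<open>auto simp: grid_def eball_iff proj_def\<close>)
qed

lemma proj_step: "edist d (proj (Suc k) \<theta>) (proj k \<theta>) <= \<rho> / 2 ^ k"
proof -
 have "edist d (proj (Suc k) \<theta>) (proj k \<theta>) <= edist d (%_. sp k) (%_. 0)"
  by (rule edist_mono) (use tr(3) sp(1)[of k] in \<open>simp add: proj_def\<close>)
 also have "... = sqrt (real d) * sp k" using sp(1)[of k] by (simp add: edist_def L2_set_def real_sqrt_mult)
 finally show ?thesis unfolding sp_d .
qed

lemma grid_mono: "grid k \<subseteq> grid (Suc k)"
proof
 fix \<theta> assume \<theta>: "\<theta> \<in> grid k"
 have "\<exists>z::int. \<theta> i - \<theta>0 i = sp (Suc k) * real_of_int z" if i: "i < d" for i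
 proof -
  obtain z :: int where "\<theta> i - \<theta>0 i = sp k * real_of_int z" using \<theta> i by (auto simp: grid_def)
  then have "\<theta> i - \<theta>0 i = sp (Suc k) * real_of_int (2 * z)" unfolding sp(2)[of k] by simp
  then show ?thesis ..
 qed
 then show "\<theta> \<in> grid (Suc k)" using \<theta> by (simp add: grid_def)
qed

text \<open>By Cauchy-Schwarz a point of the ball is within sqrt d * \<rho> of the centre in l1, so
  its integer code has l1 norm at most L = d 2^k. The weight a = 2^(-k) then makes a L = d.\<close>

lemma grid_card: "finite (grid k)" "real (card (grid k)) <= exp (real d) * (4 * 2 ^ k) ^ d"
proof -
 define L where "L = d * 2 ^ k"
 let ?S = "{z \<in> PiE {..<d} (%_. {- int L..int L}). (\<Sum>i<d. \<bar>z i\<bar>) <= int L}"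
 define cd where "cd \<theta> = (\<lambda>i\<in>{..<d}. \<lfloor>(\<theta> i - \<theta>0 i) / sp k\<rfloor>)" for \<theta>
 have cd: "\<theta> i - \<theta>0 i = sp k * real_of_int (cd \<theta> i)" if a: "\<theta> \<in> grid k" "i < d" for \<theta> i
 proof -
  obtain z :: int where z: "\<theta> i - \<theta>0 i = sp k * real_of_int z" using a by (auto simp: grid_def)
  have "(\<theta> i - \<theta>0 i) / sp k = real_of_int z" using sp(1)[of k] z by simp
  then have "cd \<theta> i = z" using a(2) by (simp add: cd_def)
  then show ?thesis using z by simp
 qed
 have inj: "inj_on cd (grid k)"
 proof (rule inj_onI)
  fix x y assume xy: "x \<in> grid k" "y \<in> grid k" "cd x = cd y"
  show "x = y"
  proof
   fix i show "x i = y i"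
   proof (cases "i < d")
   case True
   then show ?thesis using cd[OF xy(1) True] cd[OF xy(2) True] xy(3) by simp
   qed (use xy in \<open>auto simp: grid_def eball_iff\<close>)
  qed
 qed
 have into: "cd ` grid k \<subseteq> ?S"
 proof
  fix z assume "z \<in> cd ` grid k"
  then obtain \<theta> where \<theta>: "\<theta> \<in> grid k" "z = cd \<theta>" by blast
  let ?x = "%i. \<bar>\<theta> i - \<theta>0 i\<bar>"
  have "\<bar>ip d (%_. 1) ?x\<bar> <= sqrt (ip d (%_. 1) (%_. 1)) * sqrt (ip d ?x ?x)" by (rule ip_CS)
  then have "(\<Sum>i<d. ?x i) <= sqrt (real d) * edist d \<theta> \<theta>0" by (simp add: edist_ip ip_def sum_nonneg)
  also have "... <= sqrt (real d) * \<rho>" using \<theta>(1) by (intro mult_left_mono) (auto simp: grid_def eball_iff)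
  finally have "(\<Sum>i<d. sp k * \<bar>real_of_int (cd \<theta> i)\<bar>) <= sqrt (real d) * \<rho>" using cd[OF \<theta>(1)] sp(1)[of k] by (simp add: abs_mult)
  then have "sp k * real_of_int (\<Sum>i<d. \<bar>cd \<theta> i\<bar>) <= sqrt (real d) * \<rho>" by (simp add: sum_distrib_left)
  also have "... = sp k * real L"
  proof -
   have "sp k * real L = \<rho> * (real d / sqrt (real d))" by (simp add: sp_def L_def)
   then show ?thesis by (simp add: real_div_sqrt mult.commute)
  qed
  finally have "real_of_int (\<Sum>i<d. \<bar>cd \<theta> i\<bar>) <= real_of_int (int L)" using sp(1)[of k] by simp
  then have s: "(\<Sum>i<d. \<bar>cd \<theta> i\<bar>) <= int L" by (simp only: of_int_le_iff)
  have "\<bar>cd \<theta> i\<bar> <= int L" if "i < d" for i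
   using member_le_sum[of i "{..<d}" "%i. \<bar>cd \<theta> i\<bar>"] that s by simp
  then have "- int L <= cd \<theta> i \<and> cd \<theta> i <= int L" if "i < d" for i using that by (simp add: abs_le_iff) (metis minus_le_iff)
  then have "cd \<theta> \<in> PiE {..<d} (%_. {- int L..int L})" by (auto simp: PiE_iff cd_def extensional_def)
  then show "z \<in> ?S" using s \<theta>(2) by simp
 qed
 have finS: "finite ?S" by (rule finite_subset[OF _ finite_PiE[of "{..<d}" "%_. {- int L..int L}"]]) auto
 show "finite (grid k)" by (rule inj_on_finite[OF inj into finS])
 have "real (card (grid k)) <= real (card ?S)" using card_inj_on_le[OF inj into finS] by simp
 also have "... <= exp (1 / 2 ^ k * real L) * (4 / (1 / 2 ^ k)) ^ d" by (rule card_int_vectors) auto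
 also have "1 / 2 ^ k * real L = real d" by (simp add: L_def)
 finally show "real (card (grid k)) <= exp (real d) * (4 * 2 ^ k) ^ d" by simp
qed

lemma center_grid: "\<theta>0 \<in> grid k" using \<rho> \<theta>0 by (auto simp: grid_def eball_iff intro: exI[of _ 0])

lemma ln_card_proj: "ln (real (card (proj k ` grid K))) <= 3 * real d * (real k + 1)"
proof -
 have sub: "proj k ` grid K \<subseteq> grid k" by (rule image_subsetI, rule proj_grid) (simp add: grid_def)
 have ne: "proj k ` grid K ~= {}" using center_grid by auto
 have fin: "finite (proj k ` grid K)" by (intro finite_imageI grid_card)
 have "card (proj k ` grid K) > 0" using ne fin by (simp add: card_gt_0_iff)
 moreover have "real (card (proj k ` grid K)) <= real (card (grid k))" using card_mono[OF grid_card(1) sub] by simp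
 ultimately have "ln (real (card (proj k ` grid K))) <= ln (exp (real d) * (4 * 2 ^ k) ^ d)" using grid_card(2)[of k] by simp
 also have "... = real d + real d * ln (2 ^ (k + 2))" by (simp add: ln_mult ln_realpow power_add mult.commute) (simp add: algebra_simps)
 also have "ln (2 ^ (k + 2) :: real) = real (k + 2) * ln 2" by (rule ln_realpow)
 also have "... <= real (k + 2) * 1" using ln_2_less_1 by (intro mult_left_mono) auto
 finally have "ln (real (card (proj k ` grid K))) <= real d + real d * (real k + 2)" by (simp add: mult_left_mono add.commute)
 also have "... <= 3 * real d * (real k + 1)" by (simp add: algebra_simps)
 finally show ?thesis .
qed

text \<open>Truncating one coordinate at a time, a separately continuous function is controlled by its values
 on the grids.\<close>

lemma grid_sup:
 assumes cont: "!!\<theta> i. \<theta> \<in> eball d \<theta>0 \<rho> ==> i < d ==> isCont (%t. F (\<theta>(i := t))) (\<theta> i)"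
  and le: "!!K \<theta>. \<theta> \<in> grid K ==> ennreal \<bar>F \<theta>\<bar> <= S" and \<theta>: "\<theta> \<in> eball d \<theta>0 \<rho>"
 shows "ennreal \<bar>F \<theta>\<bar> <= S"
proof -
 \<comment> \<open>Induction on the number of leading coordinates that need not be dyadic; the
   others may lie on grids of different depths.\<close>
 have "ennreal \<bar>F \<theta>\<bar> <= S" if "m <= d" "\<theta> \<in> eball d \<theta>0 \<rho>" "!!i. m <= i ==> i < d ==> \<exists>K. \<exists>z::int. \<theta> i - \<theta>0 i = sp K * real_of_int z" for m \<theta>
  using that
 proof (induction m arbitrary: \<theta>)
  case 0
  have "\<forall>i<d. \<exists>K. \<exists>z::int. \<theta> i - \<theta>0 i = sp K * real_of_int z" using 0(3) by blast
  then obtain Kf where Kf: "!!i. i < d ==> \<exists>z::int. \<theta> i - \<theta>0 i = sp (Kf i) * real_of_int z" by metis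
  define K where "K = Max (Kf ` {..<d})"
  have "\<exists>z::int. \<theta> i - \<theta>0 i = sp K * real_of_int z" if i: "i < d" for i
  proof -
   obtain z :: int where z: "\<theta> i - \<theta>0 i = sp (Kf i) * real_of_int z" using Kf[OF i] by blast
   have "Kf i <= K" unfolding K_def using i by (intro Max_ge) auto
   then obtain m where K: "K = Kf i + m" using le_Suc_ex by blast
   have "sp (Kf i) = sp K * 2 ^ m" using d \<rho> by (simp add: sp_def K power_add)
   then have "\<theta> i - \<theta>0 i = sp K * real_of_int (2 ^ m * z)" using z by simp
   then show ?thesis ..
  qed
  then have "\<theta> \<in> grid K" using 0(2) by (simp add: grid_def)
  then show ?case by (rule le)
 next
  case (Suc m)
  have m: "m < d" using Suc.prems by simp
  let ?t = "%k. \<theta>0 m + tr k (\<theta> m - \<theta>0 m)"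
  have "ennreal \<bar>F (\<theta>(m := ?t k))\<bar> <= S" for k
  proof (rule Suc.IH)
   have "edist d (\<theta>(m := ?t k)) \<theta>0 <= edist d \<theta> \<theta>0" by (rule edist_mono) (simp add: tr)
   then show "\<theta>(m := ?t k) \<in> eball d \<theta>0 \<rho>" using Suc.prems m by (auto simp: eball_iff)
   show "\<exists>K. \<exists>z::int. (\<theta>(m := ?t k)) i - \<theta>0 i = sp K * real_of_int z" if "m <= i" "i < d" for i
   proof (cases "i = m")
   case True
   then show ?thesis by (auto simp: tr_def)
   next
   case False
   then show ?thesis using Suc.prems(3)[of i] that by simp
   qed
  qed (use m in simp)
  moreover have "(%k. F (\<theta>(m := ?t k))) \<longlonglongrightarrow> F (\<theta>(m := \<theta> m))"
  proof (rule isCont_tendsto_compose[OF cont[OF Suc.prems(2) m]])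
   have "(%k. \<theta> m - ?t k) \<longlonglongrightarrow> 0"
   proof (rule Lim_null_comparison)
   show "\<forall>\<^sub>F k in sequentially. norm (\<theta> m - ?t k) <= \<rho> / sqrt (real d) * (1 / 2) ^ k"
   using tr(2)[of "\<theta> m - \<theta>0 m"] by (intro always_eventually allI) (simp add: sp_def power_one_over algebra_simps)
   show "(%k. \<rho> / sqrt (real d) * (1 / 2) ^ k) \<longlonglongrightarrow> 0" by (intro tendsto_mult_right_zero LIMSEQ_power_zero) auto
   qed
   then have "(%k. \<theta> m - (\<theta> m - ?t k)) \<longlonglongrightarrow> \<theta> m - 0" by (intro tendsto_diff tendsto_const)
   then show "?t \<longlonglongrightarrow> \<theta> m" by simp
  qed
  then have "(%k. ennreal \<bar>F (\<theta>(m := ?t k))\<bar>) \<longlonglongrightarrow> ennreal \<bar>F \<theta>\<bar>" by (intro tendsto_ennrealI tendsto_rabs) simp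
  from LIMSEQ_le_const2[OF this, of S] calculation show ?case by blast
 qed
 from this[of d \<theta>] \<theta> show ?thesis by simp
qed

end

text \<open>With \<beta> = sqrt (d n) a link has exponent v^2 \<beta>^2 / (2n) = d v^2 / 2, of the
  same order as the entropy 3 d (k + 1), and the hypothesis on l0 keeps all links in the range where
  exponential moments exist. The scale is D = \<rho>^2: one factor from the radius in the increment
  condition, one from the length of the increment. The grids are nested, so monotone convergence
  covers all of them at once, and continuity in each coordinate covers the ball.\<close>

theorem (in prob_space) chaining_ball:
 assumes d: "d >= 1" and \<rho>: "\<rho> > 0" and \<theta>0: "!!i. i >= d ==> \<theta>0 i = 0" and n: "n > 0" and l0: "sqrt (real d * n) <= n * l0"
  and W_meas: "!!\<theta>. \<theta> \<in> eball d \<theta>0 \<rho> ==> (%om. W om \<theta>) \<in> borel_measurable M"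
  and inc: "!!\<theta> \<theta>' s. \<theta> \<in> eball d \<theta>0 \<rho> ==> \<theta>' \<in> eball d \<theta>0 \<rho> ==> \<bar>s\<bar> * (\<rho> * edist d \<theta>' \<theta>) <= n * l0 ==>
   (\<integral>\<^sup>+om. ennreal (exp (s * (W om \<theta>' - W om \<theta>))) \<partial>M) <= ennreal (exp (v\<^sup>2 * (s * (\<rho> * edist d \<theta>' \<theta>))\<^sup>2 / (2 * n)))"
  and W0: "!!om. om \<in> space M ==> W om \<theta>0 = 0"
  and cont: "!!om \<theta> i. om \<in> space M ==> \<theta> \<in> eball d \<theta>0 \<rho> ==> i < d ==> isCont (%t. W om (\<theta>(i := t))) (\<theta> i)"
 obtains S where "S \<in> borel_measurable M" "!!om \<theta>. om \<in> space M ==> \<theta> \<in> eball d \<theta>0 \<rho> ==> ennreal \<bar>W om \<theta>\<bar> <= S om"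
  "(\<integral>\<^sup>+om. S om \<partial>M) <= ennreal (17 * (3 + v\<^sup>2 / 2) * \<rho>\<^sup>2 * sqrt (real d / n))"
proof -
 interpret dyadic_grid d \<theta>0 \<rho> by standard (use d \<rho> \<theta>0 in auto)
 define \<beta> where "\<beta> = sqrt (real d * n)"
 define A where "A = real d * (3 + v\<^sup>2 / 2)"
 have \<beta>: "\<beta> > 0" "\<beta>\<^sup>2 = real d * n" using d n by (auto simp: \<beta>_def)
 have A3: "3 * real d <= A" unfolding A_def by (simp add: algebra_simps)
 have A1: "A >= 1" using A3 d by linarith
 let ?B = "17 * A * \<rho>\<^sup>2 / \<beta>"
 have mgf: "(\<integral>\<^sup>+om. ennreal (exp (s * \<bar>W om \<theta>' - W om \<theta>\<bar>)) \<partial>M) <= ennreal (exp A)"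
  if \<theta>: "\<theta> \<in> eball d \<theta>0 \<rho>" "\<theta>' \<in> eball d \<theta>0 \<rho>" and s: "s >= 0" "s * (\<rho> * edist d \<theta>' \<theta>) <= \<beta>" for s \<theta> \<theta>'
 proof -
  let ?p = "\<rho> * edist d \<theta>' \<theta>"
  have p0: "0 <= s * ?p" using s \<rho> by (simp add: edist_pos)
  have c: "\<bar>s\<bar> * ?p <= n * l0" "\<bar>- s\<bar> * ?p <= n * l0" using s l0 by (auto simp: \<beta>_def)
  have "(s * ?p)\<^sup>2 <= \<beta>\<^sup>2" using p0 s(2) by (intro power_mono)
  then have "v\<^sup>2 * (s * ?p)\<^sup>2 / (2 * n) <= v\<^sup>2 * \<beta>\<^sup>2 / (2 * n)" using n by (intro divide_right_mono mult_left_mono) auto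
  also have "... = real d * (v\<^sup>2 / 2)" using n by (simp add: \<beta>(2) field_simps)
  finally have b: "v\<^sup>2 * (s * ?p)\<^sup>2 / (2 * n) <= real d * (v\<^sup>2 / 2)" .
  have Wm: "(%om. ennreal (exp (t * (W om \<theta>' - W om \<theta>)))) \<in> borel_measurable M" for t
   using W_meas[OF \<theta>(1)] W_meas[OF \<theta>(2)] by measurable
  have "(\<integral>\<^sup>+om. ennreal (exp (s * \<bar>W om \<theta>' - W om \<theta>\<bar>)) \<partial>M)
   <= (\<integral>\<^sup>+om. ennreal (exp (s * (W om \<theta>' - W om \<theta>))) + ennreal (exp (- s * (W om \<theta>' - W om \<theta>))) \<partial>M)"
  proof (rule nn_integral_mono)
   fix om
   have "exp (s * \<bar>x\<bar>) <= exp (s * x) + exp (- s * x)" for x :: real by (cases "x >= 0") (simp_all add: add_nonneg_pos less_imp_le)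
   then show "ennreal (exp (s * \<bar>W om \<theta>' - W om \<theta>\<bar>)) <= ennreal (exp (s * (W om \<theta>' - W om \<theta>))) + ennreal (exp (- s * (W om \<theta>' - W om \<theta>)))"
   by (simp add: ennreal_plus[symmetric] ennreal_leI del: ennreal_plus)
  qed
  also have "... = (\<integral>\<^sup>+om. ennreal (exp (s * (W om \<theta>' - W om \<theta>))) \<partial>M) + (\<integral>\<^sup>+om. ennreal (exp (- s * (W om \<theta>' - W om \<theta>))) \<partial>M)"
   by (intro nn_integral_add Wm)
  also have "... <= ennreal (exp (real d * (v\<^sup>2 / 2))) + ennreal (exp (real d * (v\<^sup>2 / 2)))"
  proof (intro add_mono)
   show "(\<integral>\<^sup>+om. ennreal (exp (s * (W om \<theta>' - W om \<theta>))) \<partial>M) <= ennreal (exp (real d * (v\<^sup>2 / 2)))"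
   using b by (intro order_trans[OF inc[OF \<theta> c(1)]] ennreal_leI) simp
   show "(\<integral>\<^sup>+om. ennreal (exp (- s * (W om \<theta>' - W om \<theta>))) \<partial>M) <= ennreal (exp (real d * (v\<^sup>2 / 2)))"
   using b by (intro order_trans[OF inc[OF \<theta> c(2)]] ennreal_leI) simp
  qed
  also have "... = ennreal (2 * exp (real d * (v\<^sup>2 / 2)))" by (simp add: ennreal_plus[symmetric] del: ennreal_plus)
  also have "... <= ennreal (exp A)"
  proof (rule ennreal_leI)
   \<comment> \<open>The part 3 d of A also pays for the two signs of the absolute value.\<close>
   have "2 <= exp (3 * real d)" using exp_ge_add_one_self[of "3 * real d"] d by linarith
   then have "2 * exp (real d * (v\<^sup>2 / 2)) <= exp (3 * real d) * exp (real d * (v\<^sup>2 / 2))" by (intro mult_right_mono) auto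
   then show "2 * exp (real d * (v\<^sup>2 / 2)) <= exp A" by (simp add: A_def exp_add[symmetric] distrib_left mult.commute)
  qed
  finally show ?thesis .
 qed
 have gb: "t \<in> grid K ==> t \<in> eball d \<theta>0 \<rho>" for t K by (simp add: grid_def)
 define F where "F K om = ennreal (Max ((%t. \<bar>W om t\<bar>) ` grid K))" for K om
 have level: "(\<integral>\<^sup>+om. F K om \<partial>M) <= ennreal ?B" for K
  unfolding F_def
 proof (rule nn_integral_chaining[where \<pi> = proj and K = K and X = "%t om. W om t"])
  show "grid K ~= {}" using center_grid by auto
  show "\<rho>\<^sup>2 > 0" using \<rho> by simp
  show "(\<integral>\<^sup>+om. ennreal (exp (\<beta> / \<rho>\<^sup>2 * \<bar>W om (proj 0 t)\<bar>)) \<partial>M) <= ennreal (exp A)" if t: "t \<in> grid K" for t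
  proof -
   have pb: "proj 0 t \<in> eball d \<theta>0 \<rho>" by (rule proj_ball[OF gb[OF t]])
   then have "\<rho> * edist d (proj 0 t) \<theta>0 <= \<rho> * \<rho>" using \<rho> by (intro mult_left_mono) (auto simp: eball_iff)
   then have "\<beta> / \<rho>\<^sup>2 * (\<rho> * edist d (proj 0 t) \<theta>0) <= \<beta> / \<rho>\<^sup>2 * (\<rho> * \<rho>)" by (rule mult_left_mono) (use \<beta> in auto)
   also have "... = \<beta>" using \<rho> by (simp add: power2_eq_square)
   finally have "(\<integral>\<^sup>+om. ennreal (exp (\<beta> / \<rho>\<^sup>2 * \<bar>W om (proj 0 t) - W om \<theta>0\<bar>)) \<partial>M) <= ennreal (exp A)"
   using \<beta> by (intro mgf gb[OF center_grid] pb) auto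
   then show ?thesis using W0 by (simp cong: nn_integral_cong)
  qed
  show "(\<integral>\<^sup>+om. ennreal (exp (\<beta> * 2 ^ k / \<rho>\<^sup>2 * \<bar>W om (proj (Suc k) t) - W om (proj k t)\<bar>)) \<partial>M) <= ennreal (exp A)" if t: "t \<in> grid K" for k t
  proof (rule mgf)
   have "\<beta> * 2 ^ k / \<rho>\<^sup>2 * (\<rho> * edist d (proj (Suc k) t) (proj k t)) <= \<beta> * 2 ^ k / \<rho>\<^sup>2 * (\<rho> * (\<rho> / 2 ^ k))"
   using \<beta> \<rho> by (intro mult_left_mono proj_step) auto
   also have "... = \<beta>" using \<rho> by (simp add: power2_eq_square)
   finally show "\<beta> * 2 ^ k / \<rho>\<^sup>2 * (\<rho> * edist d (proj (Suc k) t) (proj k t)) <= \<beta>" .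
  qed (use \<beta> proj_ball[OF gb[OF t]] in auto)
  show "ln (real (card (proj k ` grid K))) <= A * (real k + 1)" for k
   using mult_right_mono[OF A3, of "real k + 1"] by (intro order_trans[OF ln_card_proj]) simp
 qed (auto simp: grid_card A1 \<beta> intro: proj_top W_meas proj_ball gb)
 have ne: "grid K ~= {}" for K using center_grid by auto
 have Fm: "F K \<in> borel_measurable M" for K
  unfolding F_def[abs_def] using ne grid_card(1) W_meas[OF gb] by (intro measurable_compose[OF _ measurable_ennreal] borel_measurable_Max) auto
 have Fmono: "incseq F"
 proof (rule incseq_SucI, rule le_funI)
  fix K om show "F K om <= F (Suc K) om"
   unfolding F_def using ne grid_card(1) by (intro ennreal_leI Max_mono image_mono grid_mono) auto
 qed
 show thesis
 proof (rule that[of "%om. SUP K. F K om"])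
  show "(%om. SUP K. F K om) \<in> borel_measurable M" using Fm by (intro borel_measurable_SUP) auto
  have "(\<integral>\<^sup>+om. (SUP K. F K om) \<partial>M) = (SUP K. \<integral>\<^sup>+om. F K om \<partial>M)" by (rule nn_integral_monotone_convergence_SUP[OF Fmono Fm])
  also have "... <= ennreal ?B" by (rule SUP_least) (rule level)
  also have "?B = 17 * (3 + v\<^sup>2 / 2) * \<rho>\<^sup>2 * sqrt (real d / n)"
  proof -
   have "real d / \<beta> = sqrt (real d / n)"
   proof -
   have "real d / \<beta> = sqrt (real d) * sqrt (real d) / (sqrt (real d) * sqrt n)" by (simp add: \<beta>_def real_sqrt_mult)
   also have "... = sqrt (real d / n)" using d by (simp add: real_sqrt_divide del: real_sqrt_mult_self)
   finally show ?thesis .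
   qed
   moreover have "?B = 17 * (3 + v\<^sup>2 / 2) * \<rho>\<^sup>2 * (real d / \<beta>)" by (simp add: A_def)
   ultimately show ?thesis by simp
  qed
  finally show "(\<integral>\<^sup>+om. (SUP K. F K om) \<partial>M) <= ennreal (17 * (3 + v\<^sup>2 / 2) * \<rho>\<^sup>2 * sqrt (real d / n))" .
  fix om \<theta> assume w: "om \<in> space M" and \<theta>: "\<theta> \<in> eball d \<theta>0 \<rho>"
  show "ennreal \<bar>W om \<theta>\<bar> <= (SUP K. F K om)"
  proof (rule grid_sup[OF _ _ \<theta>])
   show "isCont (%t. W om (\<theta>(i := t))) (\<theta> i)" if "\<theta> \<in> eball d \<theta>0 \<rho>" "i < d" for \<theta> i by (rule cont[OF w that])
   fix K t assume t: "t \<in> grid K"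
   have "ennreal \<bar>W om t\<bar> <= F K om" unfolding F_def using t grid_card(1) by (intro ennreal_leI Max_ge) auto
   also have "... <= (SUP K. F K om)" by (rule SUP_upper) simp
   finally show "ennreal \<bar>W om t\<bar> <= (SUP K. F K om)" .
  qed
 qed
qed

section \<open>Independent samples\<close>

context prob_space begin

lemma mgf_imp_abs_bound:
 assumes X: "X \<in> borel_measurable M" and a: "a > 0"
  and mgf: "(\<integral>\<^sup>+z. ennreal (exp (a * X z)) \<partial>M) <= ennreal b" "(\<integral>\<^sup>+z. ennreal (exp (- a * X z)) \<partial>M) <= ennreal b" and b: "b >= 0"
 shows "(\<integral>\<^sup>+z. ennreal \<bar>X z\<bar> \<partial>M) <= ennreal (2 * b / a)"
proof -
 have "(\<integral>\<^sup>+z. ennreal \<bar>X z\<bar> \<partial>M) <= (\<integral>\<^sup>+z. ennreal (1 / a) * (ennreal (exp (a * X z)) + ennreal (exp (- a * X z))) \<partial>M)"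
 proof (rule nn_integral_mono)
  fix z
  have "\<bar>y\<bar> <= exp y + exp (- y)" for y :: real
   using exp_ge_add_one_self[of y] exp_ge_add_one_self[of "- y"] exp_ge_zero[of y] exp_ge_zero[of "- y"] by linarith
  from this[of "a * X z"] have "a * \<bar>X z\<bar> <= exp (a * X z) + exp (- a * X z)" using a by (simp add: abs_mult)
  then have "\<bar>X z\<bar> <= 1 / a * (exp (a * X z) + exp (- a * X z))" using a by (simp add: field_simps)
  then have "ennreal \<bar>X z\<bar> <= ennreal (1 / a * (exp (a * X z) + exp (- a * X z)))" by (rule ennreal_leI)
  also have "... = ennreal (1 / a) * (ennreal (exp (a * X z)) + ennreal (exp (- a * X z)))"
   using a by (subst ennreal_mult) (auto simp: add_nonneg_nonneg)
  finally show "ennreal \<bar>X z\<bar> <= ennreal (1 / a) * (ennreal (exp (a * X z)) + ennreal (exp (- a * X z)))" .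
 qed
 also have "... = ennreal (1 / a) * ((\<integral>\<^sup>+z. ennreal (exp (a * X z)) \<partial>M) + (\<integral>\<^sup>+z. ennreal (exp (- a * X z)) \<partial>M))"
  using X by (subst nn_integral_cmult) (auto intro!: arg_cong2[where f = "(*)"] nn_integral_add)
 also have "... <= ennreal (1 / a) * (ennreal b + ennreal b)" by (intro mult_left_mono add_mono mgf) simp
 also have "... = ennreal (2 * b / a)" using a b by (simp add: ennreal_plus[symmetric] ennreal_mult[symmetric] del: ennreal_plus)
 finally show ?thesis .
qed

text \<open>Jensen gives s E X <= exp (b s^2) - 1 for small s of either sign; dividing by s and
  letting s tend to 0 leaves E X = 0.\<close>

lemma mgf_imp_mean_zero:
 assumes X: "X \<in> borel_measurable M" and a: "a > 0" and b: "b >= 0"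
  and mgf: "!!s. \<bar>s\<bar> <= a ==> (\<integral>\<^sup>+z. ennreal (exp (s * X z)) \<partial>M) <= ennreal (exp (b * s\<^sup>2))"
 shows "integrable M X" "expectation X = 0"
proof -
 have "(\<integral>\<^sup>+z. ennreal \<bar>X z\<bar> \<partial>M) <= ennreal (2 * exp (b * a\<^sup>2) / a)"
  using mgf[of a] mgf[of "- a"] a by (intro mgf_imp_abs_bound[OF X a]) auto
 then show int: "integrable M X" using X by (intro integrableI_bounded) (auto intro: le_less_trans)
 have le: "s * expectation X <= exp (b * s\<^sup>2) - 1" if s: "\<bar>s\<bar> <= a" for s
 proof -
  have i: "integrable M (%z. exp (s * X z))" using X le_less_trans[OF mgf[OF s] ennreal_less_top] by (intro integrableI_nonneg) auto
  have j: "exp (expectation (%z. s * X z)) <= expectation (%z. exp (s * X z))"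
   using int i by (intro jensens_inequality[where I = UNIV] exp_convex) auto
  have "ennreal (expectation (%z. exp (s * X z))) <= ennreal (exp (b * s\<^sup>2))"
   using mgf[OF s] nn_integral_eq_integral[OF i] by simp
  then have "expectation (%z. exp (s * X z)) <= exp (b * s\<^sup>2)" by (simp add: ennreal_le_iff)
  moreover have "exp (s * expectation X) <= expectation (%z. exp (s * X z))" using j by simp
  ultimately have "exp (s * expectation X) <= exp (b * s\<^sup>2)" by linarith
  then show ?thesis using exp_ge_add_one_self[of "s * expectation X"] by linarith
 qed
 have small: "\<bar>expectation X\<bar> <= (exp (b * s\<^sup>2) - 1) / s" if s: "0 < s" "s <= a" for s
 proof -
  have "s * \<bar>expectation X\<bar> <= exp (b * s\<^sup>2) - 1" using le[of s] le[of "- s"] s by (auto simp: abs_if)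
  then show ?thesis using s by (simp add: pos_le_divide_eq mult.commute)
 qed
 have "((%s. (exp (b * s\<^sup>2) - 1) / s) \<longlongrightarrow> 0) (at_right 0)"
 proof -
  have "((%s. exp (b * s\<^sup>2)) has_real_derivative 0) (at 0)" by (auto intro!: derivative_eq_intros)
  then have "((%s. (exp (b * s\<^sup>2) - 1) / s) \<longlongrightarrow> 0) (at 0)" unfolding DERIV_def by simp
  then show ?thesis by (rule tendsto_mono[rotated]) (simp add: at_le)
 qed
 then have "\<bar>expectation X\<bar> <= 0"
 proof (rule tendsto_lowerbound)
  show "\<forall>\<^sub>F s in at_right 0. \<bar>expectation X\<bar> <= (exp (b * s\<^sup>2) - 1) / s"
   unfolding eventually_at_right_field using small a by (intro exI[of _ a]) auto
 qed simp
 then show "expectation X = 0" by simp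
qed

lemma iid_exp_sum:
 assumes I: "finite I" and ind: "indep_vars (%_. N) Z I" and dis: "!!i. i \<in> I ==> distr M N (Z i) = P"
  and \<phi>: "\<phi> \<in> borel_measurable N"
 shows "(\<integral>\<^sup>+om. ennreal (exp (\<Sum>i\<in>I. \<phi> (Z i om))) \<partial>M) = (\<integral>\<^sup>+z. ennreal (exp (\<phi> z)) \<partial>P) ^ card I"
proof -
 have rv: "i \<in> I ==> Z i \<in> M \<rightarrow>\<^sub>M N" for i using ind by (auto simp: indep_vars_def)
 have "indep_vars (%_. borel) (%i om. ennreal (exp (\<phi> (Z i om)))) I"
  by (rule indep_vars_compose2[OF ind]) (use \<phi> in measurable)
 then have "(\<integral>\<^sup>+om. (\<Prod>i\<in>I. ennreal (exp (\<phi> (Z i om)))) \<partial>M) = (\<Prod>i\<in>I. \<integral>\<^sup>+om. ennreal (exp (\<phi> (Z i om))) \<partial>M)"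
  by (intro indep_vars_nn_integral I) auto
 also have "... = (\<Prod>i\<in>I. \<integral>\<^sup>+z. ennreal (exp (\<phi> z)) \<partial>P)"
 proof (rule prod.cong[OF refl])
  fix i assume i: "i \<in> I"
  have "(\<integral>\<^sup>+z. ennreal (exp (\<phi> z)) \<partial>distr M N (Z i)) = (\<integral>\<^sup>+om. ennreal (exp (\<phi> (Z i om))) \<partial>M)"
   using \<phi> by (intro nn_integral_distr rv i) auto
  then show "(\<integral>\<^sup>+om. ennreal (exp (\<phi> (Z i om))) \<partial>M) = (\<integral>\<^sup>+z. ennreal (exp (\<phi> z)) \<partial>P)" using dis[OF i] by simp
 qed
 also have "(\<integral>\<^sup>+om. (\<Prod>i\<in>I. ennreal (exp (\<phi> (Z i om)))) \<partial>M) = (\<integral>\<^sup>+om. ennreal (exp (\<Sum>i\<in>I. \<phi> (Z i om))) \<partial>M)"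
  using I by (simp add: prod_ennreal exp_sum)
 finally show ?thesis by simp
qed

lemma iid_sum_square:
 fixes \<phi> :: "'z => real"
 assumes I: "finite I" and ind: "indep_vars (%_. N) Z I" and dis: "!!i. i \<in> I ==> distr M N (Z i) = P"
  and \<phi>: "\<phi> \<in> borel_measurable N" "integrable P \<phi>" "integrable P (%z. (\<phi> z)\<^sup>2)" "(\<integral>z. \<phi> z \<partial>P) = 0"
 shows "integrable M (%om. (\<Sum>i\<in>I. \<phi> (Z i om))\<^sup>2)" "expectation (%om. (\<Sum>i\<in>I. \<phi> (Z i om))\<^sup>2) = real (card I) * (\<integral>z. (\<phi> z)\<^sup>2 \<partial>P)"
proof -
 have rv: "i \<in> I ==> Z i \<in> M \<rightarrow>\<^sub>M N" for i using ind by (auto simp: indep_vars_def)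
 have tr: "expectation (%om. F (Z i om)) = (\<integral>z. F z \<partial>P)" "integrable M (%om. F (Z i om)) \<longleftrightarrow> integrable P F"
  if "i \<in> I" "F \<in> borel_measurable N" for F :: "'z => real" and i
  using integral_distr[OF rv[OF that(1)] that(2)] integrable_distr_eq[OF rv[OF that(1)] that(2)] dis[OF that(1)] by auto
 have p: "integrable M (%om. \<phi> (Z i om) * \<phi> (Z j om)) \<and> expectation (%om. \<phi> (Z i om) * \<phi> (Z j om)) = (if i = j then \<integral>z. (\<phi> z)\<^sup>2 \<partial>P else 0)"
  if ij: "i \<in> I" "j \<in> I" for i j
 proof (cases "i = j")
  case True
  have "(%z. (\<phi> z)\<^sup>2) \<in> borel_measurable N" using \<phi>(1) by measurable
  from tr[OF ij(1) this] show ?thesis using True \<phi>(3) by (simp add: power2_eq_square)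
 next
  case False
  have "indep_vars (%_. borel) (%i om. \<phi> (Z i om)) I" by (rule indep_vars_compose2[OF ind]) (use \<phi> in measurable)
  then have "indep_vars (%_. borel) (%i om. \<phi> (Z i om)) {i, j}" by (rule indep_vars_subset) (use ij in auto)
  then have iv: "indep_vars (%_. borel) (%i om. \<phi> (Z i om)) {i, j}" .
  have int: "integrable M (%om. \<phi> (Z k om))" if "k \<in> {i, j}" for k using tr(2)[OF _ \<phi>(1), of k] that ij \<phi>(2) by auto
  show ?thesis using indep_vars_integrable[OF _ iv int] indep_vars_lebesgue_integral[OF _ iv int] tr(1)[OF _ \<phi>(1)] ij \<phi>(4) False by simp
 qed
 have e: "(\<Sum>i\<in>I. \<phi> (Z i om))\<^sup>2 = (\<Sum>i\<in>I. \<Sum>j\<in>I. \<phi> (Z i om) * \<phi> (Z j om))" for om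
  by (simp add: power2_eq_square sum_product)
 show "integrable M (%om. (\<Sum>i\<in>I. \<phi> (Z i om))\<^sup>2)" unfolding e using p by (intro Bochner_Integration.integrable_sum) auto
 have "expectation (%om. (\<Sum>i\<in>I. \<phi> (Z i om))\<^sup>2) = (\<Sum>i\<in>I. \<Sum>j\<in>I. expectation (%om. \<phi> (Z i om) * \<phi> (Z j om)))"
  unfolding e using p by (subst Bochner_Integration.integral_sum) (auto intro!: sum.cong Bochner_Integration.integral_sum Bochner_Integration.integrable_sum)
 also have "... = (\<Sum>i\<in>I. \<Sum>j\<in>I. if i = j then \<integral>z. (\<phi> z)\<^sup>2 \<partial>P else 0)" using p by (intro sum.cong refl) auto
 also have "... = (\<Sum>i\<in>I. \<integral>z. (\<phi> z)\<^sup>2 \<partial>P)" using I by (intro sum.cong refl) (simp add: sum.delta)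
 finally show "expectation (%om. (\<Sum>i\<in>I. \<phi> (Z i om))\<^sup>2) = real (card I) * (\<integral>z. (\<phi> z)\<^sup>2 \<partial>P)" by simp
qed

end

lemma partial_deriv:
 assumes "partial_exists i g x"
 shows "((%t. g (x(i := t))) has_real_derivative partial i g x) (at (x i))"
 using assms unfolding partial_exists_def partial_def by (simp add: DERIV_deriv_iff_field_differentiable)

lemma partial_diff:
 assumes "partial_exists i g x" "partial_exists i k x"
 shows "partial_exists i (%x. g x - k x) x" "partial i (%x. g x - k x) x = partial i g x - partial i k x"
proof -
 have D: "((%t. g (x(i := t)) - k (x(i := t))) has_real_derivative partial i g x - partial i k x) (at (x i))"
  by (intro DERIV_diff partial_deriv assms)
 show "partial i (%x. g x - k x) x = partial i g x - partial i k x" unfolding partial_def[of i "%x. g x - k x"] by (rule DERIV_imp_deriv[OF D])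
 show "partial_exists i (%x. g x - k x) x" using D unfolding partial_exists_def by (auto simp: field_differentiable_def)
qed

lemma second_partials_diff:
 assumes g: "second_partials_exist d g x" and k: "second_partials_exist d k x"
 shows "second_partials_exist d (%x. g x - k x) x"
  and "!!j. j < d ==> partial j (%x. g x - k x) x = partial j g x - partial j k x"
  and "!!i j. i < d ==> j < d ==> partial i (partial j (%x. g x - k x)) x = partial i (partial j g) x - partial i (partial j k) x"
proof -
 let ?h = "%x. g x - k x"
 have ev: "\<forall>\<^sub>F t in nhds (x i). partial_exists j g (x(i := t)) \<and> partial_exists j k (x(i := t))" if "i < d" "j < d" for i j
  using g k that unfolding second_partials_exist_def by (auto intro: eventually_conj)
 have pe: "partial_exists j g x \<and> partial_exists j k x" if "j < d" for j
  using eventually_nhds_x_imp_x[OF ev[OF that that]] by simp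
 show "!!j. j < d ==> partial j ?h x = partial j g x - partial j k x" using pe by (intro partial_diff) auto
 have D: "((%t. partial j ?h (x(i := t))) has_real_derivative partial i (partial j g) x - partial i (partial j k) x) (at (x i))" if ij: "i < d" "j < d" for i j
 proof -
  have D1: "((%t. partial j g (x(i := t)) - partial j k (x(i := t))) has_real_derivative partial i (partial j g) x - partial i (partial j k) x) (at (x i))"
   using g k ij unfolding second_partials_exist_def by (intro DERIV_diff partial_deriv) auto
  have "\<forall>\<^sub>F t in nhds (x i). partial j ?h (x(i := t)) = partial j g (x(i := t)) - partial j k (x(i := t))"
   using ev[OF ij] by eventually_elim (rule partial_diff, auto)
  then show ?thesis using D1 by (subst DERIV_cong_ev[OF refl _ refl])
 qed
 show "!!i j. i < d ==> j < d ==> partial i (partial j ?h) x = partial i (partial j g) x - partial i (partial j k) x"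
  unfolding partial_def[of _ "partial _ ?h"] by (rule DERIV_imp_deriv[OF D])
 show "second_partials_exist d ?h x"
  unfolding second_partials_exist_def
 proof (intro allI impI conjI)
  fix i j assume ij: "i < d" "j < d"
  show "\<forall>\<^sub>F t in nhds (x i). partial_exists j ?h (x(i := t))" using ev[OF ij] by eventually_elim (rule partial_diff, auto)
  show "partial_exists i (partial j ?h) x" using D[OF ij] unfolding partial_exists_def by (auto simp: field_differentiable_def)
 qed
qed

lemma Rd_subset_compact_borel:
 assumes "compactin (Euclidean_space d) \<Theta>"
 shows "\<Theta> \<subseteq> Rd d" "\<Theta> \<in> sets borel"
proof -
 show "\<Theta> \<subseteq> Rd d" using assms by (rule compactin_subset_topspace)
 have "compactin (product_topology (%i::nat. euclidean :: real topology) UNIV) \<Theta>"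
  using assms unfolding Euclidean_space_def by (simp add: compactin_subtopology)
 then have "compact \<Theta>" by (simp add: euclidean_product_topology)
 then show "\<Theta> \<in> sets borel" by (intro borel_closed compact_imp_closed)
qed

lemma Rd_borel_set: "Rd d \<in> sets borel"
proof -
 have "Rd d = (\<Inter>i\<in>{d..}. (%x. x i) -` {0} \<inter> space borel)" by (auto simp: Rd_iff)
 also have "... \<in> sets borel"
  by (intro sets.countable_INT'' measurable_sets[OF measurable_product_coordinates]) auto
 finally show ?thesis .
qed

section \<open>The estimator at a fixed sample size\<close>

text \<open>One sample size, with all absolute constants fixed and (A3) taken at the single radius
  r0.\<close>

locale m_estimation = prob_space M for M :: "'w measure" +
 fixes n m d \<nu> :: nat and Z :: "nat => 'w => point" and P :: "point measure" and f :: kernel and \<Theta> :: "point set"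
  and \<theta>0 :: point and \<theta>hat :: "'w => point" and r0 C cmin cmax c dmin dmax \<nu>0 l0 :: real
 assumes n: "n >= 2" and d: "d >= 1" and P: "prob_space P" and P_sets: "sets P = sets (Rd_borel m)"
  and Z_indep: "indep_vars (%_. Rd_borel m) Z {1..n}"
  and Z_distr: "!!i. i \<in> {1..n} ==> distr M (Rd_borel m) (Z i) = P"
  and f_meas: "(%(z1, z2, \<theta>). f z1 z2 \<theta>) \<in> borel_measurable (Rd_borel m \<Otimes>\<^sub>M Rd_borel m \<Otimes>\<^sub>M restrict_space borel \<Theta>)"
  and f_VC: "subgraph_VC_dim m f \<Theta> = enat \<nu>"
  and fC: "!!z1 z2 \<theta>. z1 \<in> Rd m ==> z2 \<in> Rd m ==> \<theta> \<in> \<Theta> ==> \<bar>f z1 z2 \<theta>\<bar> <= C" and C: "C > 0"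
  and theta0: "is_arg_max (pop_crit n f M Z) (%\<theta>. \<theta> \<in> \<Theta>) \<theta>0"
  and f_theta0: "!!z1 z2. z1 \<in> Rd m ==> z2 \<in> Rd m ==> f z1 z2 \<theta>0 = 0"
  and thetahat_meas: "\<theta>hat \<in> measurable M (Rd_borel d)"
  and thetahat: "!!om. om \<in> space M ==> is_arg_max (sample_crit n f (%i. Z i om)) (%\<theta>. \<theta> \<in> \<Theta>) (\<theta>hat om)"
  and compact: "compactin (Euclidean_space d) \<Theta>" and r0: "r0 > 0" and ball: "eball d \<theta>0 r0 \<subseteq> \<Theta>"
  and pos_const: "cmin > 0" "\<nu>0 > 0" "l0 > 0"
  and A3: "A3_at m d \<Theta> \<theta>0 P f cmin cmax c dmin dmax \<nu>0 l0 r0"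
begin

lemma in_\<Theta>: "\<theta>0 \<in> \<Theta>" "om \<in> space M ==> \<theta>hat om \<in> \<Theta>"
 using theta0 thetahat by (auto simp: is_arg_max_def)

lemma \<Theta>: "\<Theta> \<subseteq> Rd d" "\<Theta> \<in> sets borel" using Rd_subset_compact_borel[OF compact] by auto

text \<open>Retractions onto \<open>Rd m\<close> and \<Theta> make the kernel total and Borel on the
  whole sequence space without changing it on its domain; \<open>Pt\<close> is P seen as a Borel
  measure on that space.\<close>

definition "rx x = (if x \<in> Rd m then x else (%_. 0))"
definition "rt t = (if t \<in> \<Theta> then t else \<theta>0)"
definition "ft x y t = f (rx x) (rx y) (rt t)"
definition "Pt = distr P borel (%x. x)"

lemma rx: "rx x \<in> Rd m" "x \<in> Rd m ==> rx x = x" by (auto simp: rx_def Rd_iff)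
lemma rt: "rt t \<in> \<Theta>" "t \<in> \<Theta> ==> rt t = t" using in_\<Theta> by (auto simp: rt_def)

lemma rx_meas: "rx \<in> borel \<rightarrow>\<^sub>M Rd_borel m"
proof (rule measurable_restrict_space2)
 show "rx \<in> borel_measurable borel" unfolding rx_def[abs_def] using Rd_borel_set by (intro measurable_If_set) auto
qed (use rx in auto)

lemma rt_meas: "rt \<in> borel \<rightarrow>\<^sub>M restrict_space borel \<Theta>"
proof (rule measurable_restrict_space2)
 show "rt \<in> borel_measurable borel" unfolding rt_def[abs_def] using \<Theta> by (intro measurable_If_set) auto
qed (use rt in auto)

lemma ft_meas: "(%(x, y, t). ft x y t) \<in> borel_measurable borel"
proof -
 have 1: "fst \<in> borel_measurable (borel :: (point \<times> point \<times> point) measure)" "snd \<in> borel_measurable (borel :: (point \<times> point \<times> point) measure)"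
  "fst \<in> borel_measurable (borel :: (point \<times> point) measure)" "snd \<in> borel_measurable (borel :: (point \<times> point) measure)"
  by (intro borel_measurable_continuous_onI continuous_on_fst continuous_on_snd continuous_on_id)+
 have "(%p :: point \<times> point \<times> point. (rx (fst p), rx (fst (snd p)), rt (snd (snd p)))) \<in> borel \<rightarrow>\<^sub>M Rd_borel m \<Otimes>\<^sub>M Rd_borel m \<Otimes>\<^sub>M restrict_space borel \<Theta>"
  by (intro measurable_Pair measurable_compose[OF 1(1) rx_meas] measurable_compose[OF measurable_compose[OF 1(2) 1(3)] rx_meas]
   measurable_compose[OF measurable_compose[OF 1(2) 1(4)] rt_meas])
 from measurable_compose[OF this f_meas] show ?thesis by (simp add: ft_def case_prod_beta')
qed

lemma id_meas: "(%x. x) \<in> Rd_borel k \<rightarrow>\<^sub>M borel" by (rule measurable_restrict_space1) simp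

lemma P_id: "(%x. x) \<in> borel_measurable P" using id_meas measurable_cong_sets[OF P_sets refl] by blast

lemma space_P: "space P = Rd m" using sets_eq_imp_space_eq[OF P_sets] by (simp add: space_restrict_space)

lemma Z_rv: "i \<in> {1..n} ==> Z i \<in> M \<rightarrow>\<^sub>M Rd_borel m" using Z_indep by (auto simp: indep_vars_def)

lemma Z_Rd: "i \<in> {1..n} ==> om \<in> space M ==> Z i om \<in> Rd m"
 using measurable_space[OF Z_rv] by (simp add: space_restrict_space)

sublocale PP: prob_space P by (rule P)

lemma prob_Pt: "prob_space Pt" unfolding Pt_def by (rule PP.prob_space_distr[OF P_id])

interpretation Pt: prob_space Pt by (rule prob_Pt)

sublocale I: iid_sample M n Z Pt ft C \<nu> \<theta>hat
proof (rule iid_sample.intro[OF prob_space_axioms], rule iid_sample_axioms.intro)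
 show "2 <= n" by (rule n)
 show "prob_space Pt" by (rule prob_Pt)
 show "sets Pt = sets borel" by (simp add: Pt_def)
 show "indep_vars (%_. borel) Z {1..n}" using indep_vars_compose2[OF Z_indep, of "%_ x. x" "%_. borel"] id_meas by simp
 show "distr M borel (Z i) = Pt" if "i \<in> {1..n}" for i
  using distr_distr[OF id_meas Z_rv[OF that]] unfolding Z_distr[OF that] Pt_def by (simp add: o_def)
 show "(%(x, y, t). ft x y t) \<in> borel_measurable borel" by (rule ft_meas)
 show "0 < C" by (rule C)
 show "\<bar>ft x y t\<bar> <= C" for x y t unfolding ft_def by (intro fC rx rt)
 show "\<theta>hat \<in> borel_measurable M" using measurable_compose[OF thetahat_meas id_meas] by simp
 show "card B <= \<nu>" if B: "finite B" and sh: "!!D. D \<subseteq> B ==> \<exists>\<theta>. {q\<in>B. t < ft (fst q) (snd q) \<theta>} = D" for t and B :: "(point \<times> point) set"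
 proof -
  \<comment> \<open>All points are lifted to the common height t, where membership in the subgraph
    means t < f. Points that the retraction would identify are excluded by shattering.\<close>
  define e where "e q = ((rx (fst q), rx (snd q)), t)" for q
  let ?CC = "(%\<theta>. subgraph (Rd m \<times> Rd m) (%(z1, z2). f z1 z2 \<theta>)) ` \<Theta>"
  have mem: "e q \<in> subgraph (Rd m \<times> Rd m) (%(z1, z2). f z1 z2 (rt \<theta>)) \<longleftrightarrow> t < ft (fst q) (snd q) \<theta>" for q \<theta>
   using rx by (simp add: e_def subgraph_def ft_def)
  have inj: "inj_on e B"
  proof (rule inj_onI, rule ccontr)
   fix p q assume pq: "p \<in> B" "q \<in> B" "e p = e q" "p ~= q"
   obtain \<theta> where \<theta>: "{q\<in>B. t < ft (fst q) (snd q) \<theta>} = {p}" using sh[of "{p}"] pq(1) by auto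
   have "p \<in> {q\<in>B. t < ft (fst q) (snd q) \<theta>}" "q \<notin> {q\<in>B. t < ft (fst q) (snd q) \<theta>}" unfolding \<theta> using pq(4) by auto
   then have "t < ft (fst p) (snd p) \<theta>" "\<not> t < ft (fst q) (snd q) \<theta>" using pq(2) by simp_all
   then show False using pq(3) by (simp add: mem[symmetric])
  qed
  have "shatters ?CC (e ` B)"
   unfolding shatters_def
  proof (intro equalityI subsetI)
   fix X assume "X \<in> Pow (e ` B)"
   then obtain D where D: "D \<subseteq> B" "X = e ` D" by (auto simp: subset_image_iff)
   obtain \<theta> where \<theta>: "{q\<in>B. t < ft (fst q) (snd q) \<theta>} = D" using sh[OF D(1)] by blast
   have "X = subgraph (Rd m \<times> Rd m) (%(z1, z2). f z1 z2 (rt \<theta>)) \<inter> e ` B"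
   unfolding D(2) using mem[of _ \<theta>] \<theta> by blast
   then show "X \<in> (%C. C \<inter> e ` B) ` ?CC" using rt(1)[of \<theta>] by blast
  qed blast
  then have "enat (card (e ` B)) <= VC_dim ?CC" unfolding VC_dim_def using B by (intro Sup_upper) blast
  then have "enat (card (e ` B)) <= enat \<nu>" using f_VC by (simp add: subgraph_VC_dim_def)
  then show ?thesis by (simp add: card_image[OF inj])
 qed
qed

lemma Pt_int: "F \<in> borel_measurable borel ==> (\<integral>z. F z \<partial>Pt) = (\<integral>z. F z \<partial>P)" for F :: "point => real"
 unfolding Pt_def by (rule integral_distr[OF P_id])

lemma ft_meas1: "(%w. ft z w t) \<in> borel_measurable borel" "(%w. ft w z t) \<in> borel_measurable borel"
 by (rule I.f_meas'; simp)+

lemma tau_ft: "z \<in> Rd m ==> t \<in> \<Theta> ==> tau P f z t = (\<integral>w. ft z w t \<partial>Pt) + (\<integral>w. ft w z t \<partial>Pt)"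
 unfolding tau_def Pt_int[OF ft_meas1(1)] Pt_int[OF ft_meas1(2)]
 by (intro arg_cong2[where f = "(+)"] Bochner_Integration.integral_cong refl) (auto simp: ft_def rx rt space_P)

definition "G x = (\<integral>w. tau P f w x \<partial>P)"

lemma inner_meas':
 assumes u: "u \<in> borel_measurable N" and v: "v \<in> borel_measurable N"
 shows "(%p. \<integral>w. ft (u p) w (v p) \<partial>Pt) \<in> borel_measurable N" "(%p. \<integral>w. ft w (u p) (v p) \<partial>Pt) \<in> borel_measurable N"
proof -
 have a: "(%q. u (fst q)) \<in> borel_measurable (N \<Otimes>\<^sub>M Pt)" "(%q. v (fst q)) \<in> borel_measurable (N \<Otimes>\<^sub>M Pt)"
  by (intro measurable_compose[OF measurable_fst] u v)+
 have c: "(%q. snd q) \<in> N \<Otimes>\<^sub>M Pt \<rightarrow>\<^sub>M (borel :: point measure)"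
  using measurable_snd[of N Pt] measurable_cong_sets[OF refl I.sets_P] by auto
 have "(%(p, w). ft (u p) w (v p)) \<in> borel_measurable (N \<Otimes>\<^sub>M Pt)" unfolding case_prod_beta' by (rule I.f_meas'[OF a(1) c a(2)])
 from Pt.borel_measurable_lebesgue_integral[OF this] show "(%p. \<integral>w. ft (u p) w (v p) \<partial>Pt) \<in> borel_measurable N" .
 have "(%(p, w). ft w (u p) (v p)) \<in> borel_measurable (N \<Otimes>\<^sub>M Pt)" unfolding case_prod_beta' by (rule I.f_meas'[OF c a])
 from Pt.borel_measurable_lebesgue_integral[OF this] show "(%p. \<integral>w. ft w (u p) (v p) \<partial>Pt) \<in> borel_measurable N" .
qed

lemma Gamma_meas: "I.\<Gamma> \<in> borel_measurable borel"
proof -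
 interpret PtPt: prob_space "Pt \<Otimes>\<^sub>M Pt" by (intro prob_space_pair Pt.prob_space_axioms)
 have s: "sets (borel \<Otimes>\<^sub>M (Pt \<Otimes>\<^sub>M Pt)) = sets (borel \<Otimes>\<^sub>M (borel \<Otimes>\<^sub>M borel))" by (intro sets_pair_measure_cong refl I.sets_P)
 have "(%p :: point \<times> point \<times> point. ft (fst (snd p)) (snd (snd p)) (fst p)) \<in> borel_measurable (borel \<Otimes>\<^sub>M (borel \<Otimes>\<^sub>M borel))"
  by (rule I.f_meas'; measurable)
 then have "(%(x, z). ft (fst z) (snd z) x) \<in> borel_measurable (borel \<Otimes>\<^sub>M (Pt \<Otimes>\<^sub>M Pt))"
  unfolding measurable_cong_sets[OF s refl] case_prod_beta' .
 from PtPt.borel_measurable_lebesgue_integral[OF this] show ?thesis by (simp add: I.f_P_iterated)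
qed

lemma inner_bound: "\<bar>\<integral>w. ft z w t \<partial>Pt\<bar> <= C" "\<bar>\<integral>w. ft w z t \<partial>Pt\<bar> <= C"
 using I.fC C by (auto intro!: Pt.abs_expectation_le)

lemma inner_int: "integrable Pt (%z. \<integral>w. ft z w t \<partial>Pt)" "integrable Pt (%z. \<integral>w. ft w z t \<partial>Pt)"
proof -
 have "(%z. \<integral>w. ft z w t \<partial>Pt) \<in> borel_measurable Pt" "(%z. \<integral>w. ft w z t \<partial>Pt) \<in> borel_measurable Pt"
  using inner_meas'[OF measurable_ident measurable_const, of t] measurable_cong_sets[OF I.sets_P refl] by auto
 then show "integrable Pt (%z. \<integral>w. ft z w t \<partial>Pt)" "integrable Pt (%z. \<integral>w. ft w z t \<partial>Pt)"
  using inner_bound by (auto intro!: Pt.integrable_const_bound[of _ C])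
qed

lemma G_Gamma: "t \<in> \<Theta> ==> G t = 2 * I.\<Gamma> t"
proof -
 assume t: "t \<in> \<Theta>"
 interpret PtPt: pair_sigma_finite Pt Pt by standard
 have "G t = (\<integral>z. (\<integral>w. ft z w t \<partial>Pt) + (\<integral>w. ft w z t \<partial>Pt) \<partial>P)"
  unfolding G_def using tau_ft[OF _ t] by (intro Bochner_Integration.integral_cong) (auto simp: space_P)
 also have "... = (\<integral>z. (\<integral>w. ft z w t \<partial>Pt) + (\<integral>w. ft w z t \<partial>Pt) \<partial>Pt)"
  by (intro Pt_int[symmetric] borel_measurable_add inner_meas' measurable_const) auto
 also have "... = (\<integral>z. \<integral>w. ft z w t \<partial>Pt \<partial>Pt) + (\<integral>z. \<integral>w. ft w z t \<partial>Pt \<partial>Pt)" by (rule Bochner_Integration.integral_add[OF inner_int])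
 also have "(\<integral>z. \<integral>w. ft w z t \<partial>Pt \<partial>Pt) = (\<integral>w. \<integral>z. ft w z t \<partial>Pt \<partial>Pt)"
 proof (rule PtPt.Fubini_integral)
  interpret PtP: prob_space "Pt \<Otimes>\<^sub>M Pt" by (intro prob_space_pair Pt.prob_space_axioms)
  show "integrable (Pt \<Otimes>\<^sub>M Pt) (%(w, z). ft w z t)"
   using I.f_P[of t] I.fC by (intro PtP.integrable_const_bound[of _ C]) (auto simp: case_prod_beta')
 qed
 finally show ?thesis by (simp add: I.\<Gamma>_def)
qed

lemma zeta_eq: "zeta P f z = (%x. tau P f z x - G x)" by (simp add: zeta_def G_def fun_eq_iff)

lemma Gamma_bound: "\<bar>I.\<Gamma> t\<bar> <= C"
 unfolding I.\<Gamma>_def by (rule Pt.abs_expectation_le[OF inner_bound(1)]) (use C in simp)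

lemma tau_bound: "z \<in> Rd m ==> t \<in> \<Theta> ==> \<bar>tau P f z t\<bar> <= 2 * C"
 unfolding tau_ft using inner_bound(1)[of z t] inner_bound(2)[of z t] by linarith

lemma zeta_bound: "z \<in> Rd m ==> t \<in> \<Theta> ==> \<bar>zeta P f z t\<bar> <= 4 * C"
 unfolding zeta_eq using tau_bound[of z t] Gamma_bound[of t] G_Gamma[of t] by auto

lemma pop_crit_eq: "t \<in> \<Theta> ==> pop_crit n f M Z t = I.\<Gamma> t"
proof -
 assume t: "t \<in> \<Theta>"
 have int: "integrable M (%om. ft (Z i om) (Z j om) t)" if "i \<in> {1..n}" "j \<in> {1..n}" for i j
  using I.fC by (intro integrable_const_bound[of _ C] I.f_meas' I.Z_meas that) auto
 have "pop_crit n f M Z t = (\<integral>om. 1 / (real n * (real n - 1)) * I.pairsum (%i j. ft (Z i om) (Z j om) t) \<partial>M)"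
  unfolding pop_crit_def sample_crit_def
  by (intro Bochner_Integration.integral_cong refl arg_cong2[where f = "(*)"] sum.cong) (auto simp: ft_def Z_Rd rx rt t)
 also have "... = 1 / (real n * (real n - 1)) * (\<integral>om. I.pairsum (%i j. ft (Z i om) (Z j om) t) \<partial>M)" by simp
 also have "(\<integral>om. I.pairsum (%i j. ft (Z i om) (Z j om) t) \<partial>M) = I.pairsum (%i j. \<integral>om. ft (Z i om) (Z j om) t \<partial>M)"
  using int by (subst Bochner_Integration.integral_sum) (auto intro!: sum.cong Bochner_Integration.integral_sum Bochner_Integration.integrable_sum)
 also have "... = I.pairsum (%i j. I.\<Gamma> t)"
  by (intro sum.cong refl I.integral_pair[OF prob_space_axioms I.indep _ _ _ I.distr_Z]) auto
 also have "... = real n * (real n - 1) * I.\<Gamma> t" using n by (simp add: of_nat_diff)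
 finally show ?thesis using n by simp
qed

lemma Gamma_theta0: "I.\<Gamma> \<theta>0 = 0"
 using f_theta0 rx rt in_\<Theta> by (simp add: I.\<Gamma>_def ft_def)

lemma Gamma_max: "t \<in> \<Theta> ==> I.\<Gamma> t <= 0"
 using theta0 pop_crit_eq[of t] pop_crit_eq[of \<theta>0] in_\<Theta> Gamma_theta0 by (auto simp: is_arg_max_def not_less)

abbreviation "U \<equiv> eball d \<theta>0 r0"

lemma U_closed: "x \<in> U ==> x \<in> closed_ball d \<Theta> \<theta>0 r0"
 using ball by (auto simp: closed_ball_def eball_iff)

lemma theta0_U: "\<theta>0 \<in> U" using in_\<Theta> \<Theta> r0 by (auto simp: eball_iff Rd_iff subset_iff)

lemma tau2: "z \<in> Rd m ==> x \<in> U ==> second_partials_exist d (tau P f z) x"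
 and zeta2: "z \<in> Rd m ==> x \<in> U ==> second_partials_exist d (zeta P f z) x"
 using A3 U_closed[of x] unfolding A3_at_def Let_def by blast+

text \<open>G is the difference of \<open>tau\<close> and \<open>zeta\<close> at any fixed z, and
  both are twice differentiable by (A3); no derivative is taken under an integral.\<close>

lemma G2: "x \<in> U ==> second_partials_exist d G x"
proof -
 assume x: "x \<in> U"
 have z: "(%_. 0) \<in> Rd m" by (simp add: Rd_iff)
 have "(%x. tau P f (%_. 0) x - zeta P f (%_. 0) x) = G" by (simp add: zeta_eq)
 then show ?thesis using second_partials_diff(1)[OF tau2[OF z x] zeta2[OF z x]] by simp
qed

lemma zeta_partial:
 assumes "z \<in> Rd m" "x \<in> U"
 shows "j < d ==> partial j (zeta P f z) x = partial j (tau P f z) x - partial j G x"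
  "i < d ==> j < d ==> partial i (partial j (zeta P f z)) x = partial i (partial j (tau P f z)) x - partial i (partial j G) x"
 unfolding zeta_eq using second_partials_diff[OF tau2[OF assms] G2[OF assms(2)]] by auto

text \<open>(A3)(v) rescaled from unit vectors to arbitrary ones; if one of them has norm 0, so does
  the form.\<close>

lemma zeta_mgf:
 assumes x: "x \<in> U" and s: "\<bar>s\<bar> * (sqrt (ip d a a) * sqrt (ip d b b)) <= l0"
 shows "(\<integral>\<^sup>+z. ennreal (exp (s * (\<Sum>i<d. a i * (\<Sum>j<d. b j * partial i (partial j (zeta P f z)) x)))) \<partial>P)
   <= ennreal (exp (\<nu>0\<^sup>2 * (s * (sqrt (ip d a a) * sqrt (ip d b b)))\<^sup>2 / 2))"
  and "(%z. exp (s * (\<Sum>i<d. a i * (\<Sum>j<d. b j * partial i (partial j (zeta P f z)) x)))) \<in> borel_measurable P"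
proof -
 let ?q = "%z. \<Sum>i<d. a i * (\<Sum>j<d. b j * partial i (partial j (zeta P f z)) x)"
 define na where "na = sqrt (ip d a a)"
 define nb where "nb = sqrt (ip d b b)"
 have n0: "na >= 0" "nb >= 0" by (simp_all add: na_def nb_def ip_pos)
 have "(%z. exp (s * ?q z)) \<in> borel_measurable P \<and> (\<integral>\<^sup>+z. ennreal (exp (s * ?q z)) \<partial>P) <= ennreal (exp (\<nu>0\<^sup>2 * (s * (na * nb))\<^sup>2 / 2))"
 proof (cases "na = 0 \<or> nb = 0")
  case True
  then have "(\<forall>i<d. a i = 0) \<or> (\<forall>i<d. b i = 0)" using ip_eq_0 by (auto simp: na_def nb_def)
  then have "?q z = 0" for z by auto
  then show ?thesis using True by (auto simp: PP.emeasure_space_1)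
 next
  case False
  then have pos: "na > 0" "nb > 0" using n0 by auto
  define g1 where "g1 = Matrix.vec d (%i. 1 / na * a i)"
  define g2 where "g2 = Matrix.vec d (%i. 1 / nb * b i)"
  have unit: "Matrix.vec d (%i. 1 / sqrt (ip d a a) * a i) \<in> unit_sphere d" if "sqrt (ip d a a) > 0" for a
  proof -
   define k where "k = sqrt (ip d a a)"
   have k: "k > 0" "k * k = ip d a a" using that ip_pos[of d a] by (auto simp: k_def)
   have "scalar_prod (Matrix.vec d (%i. 1 / k * a i)) (Matrix.vec d (%i. 1 / k * a i)) = ip d (%i. 1 / k * a i) (%i. 1 / k * a i)"
   unfolding scalar_prod_ip[OF vec_carrier vec_carrier] by (simp add: ip_def)
   also have "... = 1 / k * (1 / k * ip d a a)" by (simp add: ip_def sum_distrib_left mult_ac)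
   also have "... = 1" unfolding k(2)[symmetric] using k(1) by simp
   finally show ?thesis unfolding unit_sphere_def k_def[symmetric] by simp
  qed
  have u: "g1 \<in> unit_sphere d" "g2 \<in> unit_sphere d" using unit[of a] unit[of b] pos unfolding g1_def g2_def na_def nb_def by blast+
  let ?s = "s * (na * nb)"
  have "\<bar>?s\<bar> <= l0" using s n0 by (simp add: abs_mult na_def nb_def)
  then have A: "integrable P (%z. exp (?s * scalar_prod g1 (hess d (zeta P f z) x *\<^sub>v g2)))"
   "ln (\<integral>z. exp (?s * scalar_prod g1 (hess d (zeta P f z) x *\<^sub>v g2)) \<partial>P) <= \<nu>0\<^sup>2 * ?s\<^sup>2 / 2"
   using A3 U_closed[OF x] u unfolding A3_at_def Let_def by blast+
  have e: "?s * scalar_prod g1 (hess d (zeta P f z) x *\<^sub>v g2) = s * ?q z" for z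
  proof -
   have hc: "hess d (zeta P f z) x \<in> carrier_mat d d" by (simp add: hess_def)
   have "scalar_prod g1 (hess d (zeta P f z) x *\<^sub>v g2) = (\<Sum>i<d. 1 / na * a i * (\<Sum>j<d. partial i (partial j (zeta P f z)) x * (1 / nb * b j)))"
   unfolding scalar_prod_mult_mat_vec(1)[OF hc, of g1 g2, unfolded g1_def g2_def, OF vec_carrier vec_carrier, folded g1_def g2_def] ip_def mv_def
   by (intro sum.cong refl arg_cong2[where f = "(*)"]) (auto simp: g1_def g2_def hess_def)
   also have "... = 1 / na * (1 / nb) * ?q z" by (simp add: sum_distrib_left mult_ac)
   finally show ?thesis using pos by simp
  qed
  have m: "(%z. exp (s * ?q z)) \<in> borel_measurable P" using A(1) unfolding e by (rule borel_measurable_integrable)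
  \<comment> \<open>\<open>ln\<close> carries information at positive arguments only; otherwise the
    bound is trivial.\<close>
  have "(\<integral>z. exp (s * ?q z) \<partial>P) <= exp (\<nu>0\<^sup>2 * ?s\<^sup>2 / 2)"
  proof (cases "(\<integral>z. exp (s * ?q z) \<partial>P) > 0")
   case True
   have "ln (\<integral>z. exp (s * ?q z) \<partial>P) <= \<nu>0\<^sup>2 * ?s\<^sup>2 / 2" using A(2) unfolding e .
   then have "exp (ln (\<integral>z. exp (s * ?q z) \<partial>P)) <= exp (\<nu>0\<^sup>2 * ?s\<^sup>2 / 2)" by (simp only: exp_le_cancel_iff)
   then show ?thesis using True by simp
  next
   case False
   then show ?thesis by (meson exp_ge_zero not_less order_trans)
  qed
  then show ?thesis using A(1) m unfolding e by (subst nn_integral_eq_integral) (auto intro: ennreal_leI)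
 qed
 then show "(\<integral>\<^sup>+z. ennreal (exp (s * ?q z)) \<partial>P) <= ennreal (exp (\<nu>0\<^sup>2 * (s * (sqrt (ip d a a) * sqrt (ip d b b)))\<^sup>2 / 2))"
  "(%z. exp (s * ?q z)) \<in> borel_measurable P" by (auto simp: na_def nb_def)
qed

lemma basis_sum: "i < d ==> (\<Sum>k<d. (if k = i then 1 else 0) * F k) = F i" "i < d ==> ip d (%k. if k = i then 1 else 0) F = F i" for F :: "nat => real"
 by (simp_all add: ip_def if_distrib if_distribR cong: if_cong)

text \<open>Unit coordinate vectors pick out single entries. Measurability is recovered from that of
  the exponential by taking the logarithm.\<close>

lemma hess_mgf:
 assumes x: "x \<in> U" and ij: "i < d" "j < d"
 shows "(%z. partial i (partial j (zeta P f z)) x) \<in> borel_measurable P"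
  and "!!s. \<bar>s\<bar> <= l0 ==> (\<integral>\<^sup>+z. ennreal (exp (s * partial i (partial j (zeta P f z)) x)) \<partial>P) <= ennreal (exp (\<nu>0\<^sup>2 / 2 * s\<^sup>2))"
proof -
 let ?e = "%i k. if k = i then 1 else 0 :: real"
 have q: "(\<Sum>k<d. ?e i k * (\<Sum>l<d. ?e j l * partial k (partial l (zeta P f z)) x)) = partial i (partial j (zeta P f z)) x" for z
  unfolding basis_sum(1)[OF ij(1)] basis_sum(1)[OF ij(2)] ..
 have e1: "sqrt (ip d (?e i) (?e i)) * sqrt (ip d (?e j) (?e j)) = 1" using ij by (simp add: basis_sum)
 show "(\<integral>\<^sup>+z. ennreal (exp (s * partial i (partial j (zeta P f z)) x)) \<partial>P) <= ennreal (exp (\<nu>0\<^sup>2 / 2 * s\<^sup>2))" if "\<bar>s\<bar> <= l0" for s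
  using zeta_mgf(1)[OF x, of s "?e i" "?e j"] that unfolding q e1 by simp
 have "(%z. exp (l0 * partial i (partial j (zeta P f z)) x)) \<in> borel_measurable P"
  using zeta_mgf(2)[OF x, of l0 "?e i" "?e j"] pos_const unfolding q e1 by simp
 then have "(%z. ln (exp (l0 * partial i (partial j (zeta P f z)) x)) / l0) \<in> borel_measurable P" by measurable
 then show "(%z. partial i (partial j (zeta P f z)) x) \<in> borel_measurable P" using pos_const by simp
qed

lemma zeta_joint_meas: "(%(z, x). if x \<in> U then zeta P f z x else 0) \<in> borel_measurable (P \<Otimes>\<^sub>M borel)"
proof -
 define T where "T z x = (\<integral>w. ft z w x \<partial>Pt) + (\<integral>w. ft w z x \<partial>Pt)" for z x
 have a: "(%p. fst (fst p)) \<in> (P \<Otimes>\<^sub>M borel) \<Otimes>\<^sub>M Pt \<rightarrow>\<^sub>M (borel :: point measure)"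
  by (rule measurable_compose[OF measurable_fst, OF measurable_compose[OF measurable_fst P_id]])
 have b: "(%p. snd (fst p)) \<in> (P \<Otimes>\<^sub>M borel) \<Otimes>\<^sub>M Pt \<rightarrow>\<^sub>M (borel :: point measure)"
  by (rule measurable_compose[OF measurable_fst measurable_snd])
 have c: "(%p. snd p) \<in> (P \<Otimes>\<^sub>M borel) \<Otimes>\<^sub>M Pt \<rightarrow>\<^sub>M (borel :: point measure)"
  using measurable_snd[of "P \<Otimes>\<^sub>M (borel :: point measure)" Pt] measurable_cong_sets[OF refl I.sets_P] by auto
 have "(%(p, w). ft (fst p) w (snd p)) \<in> borel_measurable ((P \<Otimes>\<^sub>M borel) \<Otimes>\<^sub>M Pt)"
  unfolding case_prod_beta' by (rule I.f_meas'[OF a c b])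
 from Pt.borel_measurable_lebesgue_integral[OF this]
 have 1: "(%p. \<integral>w. ft (fst p) w (snd p) \<partial>Pt) \<in> borel_measurable (P \<Otimes>\<^sub>M borel)" .
 have "(%(p, w). ft w (fst p) (snd p)) \<in> borel_measurable ((P \<Otimes>\<^sub>M borel) \<Otimes>\<^sub>M Pt)"
  unfolding case_prod_beta' by (rule I.f_meas'[OF c a b])
 from Pt.borel_measurable_lebesgue_integral[OF this]
 have 2: "(%p. \<integral>w. ft w (fst p) (snd p) \<partial>Pt) \<in> borel_measurable (P \<Otimes>\<^sub>M borel)" .
 have Tm: "(%p. T (fst p) (snd p)) \<in> borel_measurable (P \<Otimes>\<^sub>M borel)" unfolding T_def by (rule borel_measurable_add[OF 1 2])
 have "(%(x, z). T z x) \<in> borel_measurable (borel \<Otimes>\<^sub>M P)"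
  using measurable_compose[OF measurable_pair_swap'[of borel P] Tm] by (simp add: case_prod_beta')
 from PP.borel_measurable_lebesgue_integral[OF this] have Gm: "(%x. \<integral>z. T z x \<partial>P) \<in> borel_measurable borel" .
 have "snd -` U \<inter> space (P \<Otimes>\<^sub>M borel) \<in> sets (P \<Otimes>\<^sub>M borel)" by (rule measurable_sets[OF measurable_snd eball_borel])
 then have m: "(%p. if snd p \<in> U then T (fst p) (snd p) - (\<integral>z. T z (snd p) \<partial>P) else 0) \<in> borel_measurable (P \<Otimes>\<^sub>M borel)"
  by (intro measurable_If borel_measurable_diff Tm measurable_compose[OF measurable_snd Gm]) (auto simp: vimage_def Int_def conj_commute)
 have G: "G x = (\<integral>z. T z x \<partial>P)" if "x \<in> \<Theta>" for x
  unfolding G_def using that by (intro Bochner_Integration.integral_cong) (auto simp: tau_ft T_def space_P)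
 have "(%(z, x). if x \<in> U then zeta P f z x else 0) \<in> borel_measurable (P \<Otimes>\<^sub>M borel) \<longleftrightarrow> (%p. if snd p \<in> U then T (fst p) (snd p) - (\<integral>z. T z (snd p) \<partial>P) else 0) \<in> borel_measurable (P \<Otimes>\<^sub>M borel)"
  by (rule measurable_cong) (use ball in \<open>auto simp: space_pair_measure space_P zeta_eq G tau_ft T_def\<close>)
 then show ?thesis using m by simp
qed

definition "CH = 2 * exp (\<nu>0\<^sup>2 / 2 * l0\<^sup>2) / l0"

sublocale S: second_order P d \<theta>0 r0 "zeta P f" CH
proof (rule second_order.intro[OF P], rule second_order_axioms.intro)
 show "0 < r0" by (rule r0)
 show "\<theta>0 i = 0" if "i >= d" for i using that theta0_U by (simp add: eball_iff)
 show "0 <= CH" using pos_const by (simp add: CH_def)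
 show "(%(z, x). if x \<in> U then zeta P f z x else 0) \<in> borel_measurable (P \<Otimes>\<^sub>M borel)" by (rule zeta_joint_meas)
 show "second_partials_exist d (zeta P f z) x" if "z \<in> space P" "x \<in> U" for z x using zeta2 that by (simp add: space_P)
 show "(\<integral>\<^sup>+z. ennreal \<bar>partial i (partial j (zeta P f z)) x\<bar> \<partial>P) <= ennreal CH" if "x \<in> U" "i < d" "j < d" for x i j
  unfolding CH_def using hess_mgf(2)[OF that, of l0] hess_mgf(2)[OF that, of "- l0"] pos_const
  by (intro PP.mgf_imp_abs_bound[OF hess_mgf(1)[OF that]]) auto
qed

text \<open>The entries of the Hessian of \<open>zeta\<close> have mean zero by (A3)(v), so the
  Hessian of G is the mean Hessian of \<open>tau\<close>: expectation and differentiation are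
  interchanged without domination.\<close>

lemma hess_mean:
 assumes x: "x \<in> U" and ij: "i < d" "j < d"
 shows "partial i (partial j G) x = 2 * V_mat d P f x $$ (i, j)"
proof -
 have Z: "integrable P (%z. partial i (partial j (zeta P f z)) x)" "(\<integral>z. partial i (partial j (zeta P f z)) x \<partial>P) = 0"
  using PP.mgf_imp_mean_zero[OF hess_mgf(1)[OF x ij] pos_const(3) _ hess_mgf(2)[OF x ij]] by auto
 have "integrable P (%z. hess d (tau P f z) x $$ (i, j))"
  using A3 U_closed[OF x] ij unfolding A3_at_def Let_def integrable_mat_def by blast
 then have T: "integrable P (%z. partial i (partial j (tau P f z)) x)" using ij by (simp add: hess_def)
 have "(\<integral>z. partial i (partial j (zeta P f z)) x \<partial>P) = (\<integral>z. partial i (partial j (tau P f z)) x - partial i (partial j G) x \<partial>P)"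
  using zeta_partial(2)[OF _ x ij] by (intro Bochner_Integration.integral_cong) (auto simp: space_P)
 also have "... = (\<integral>z. partial i (partial j (tau P f z)) x \<partial>P) - partial i (partial j G) x"
  using T by (simp add: PP.prob_space)
 finally show ?thesis using Z(2) ij by (simp add: V_mat_def mean_mat_def hess_def)
qed

definition "A = - V_mat d P f \<theta>0"

lemma A_mat: "A \<in> carrier_mat d d" "symmetric_mat A" "cmin <= lambda_min A" "lambda_max A <= cmax" "lambda_min A <= lambda_max A"
proof -
 show "A \<in> carrier_mat d d" by (simp add: A_def V_mat_def mean_mat_def)
 show "symmetric_mat A" "cmin <= lambda_min A" "lambda_max A <= cmax" "lambda_min A <= lambda_max A"
  using A3 unfolding A3_at_def Let_def A_def by auto
qed

lemma lmax: "0 < lambda_max A" "0 < cmax" using A_mat pos_const by linarith+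

text \<open>The relative bound \<rho> < cmin / (11 cmax) becomes absolute after multiplication by
  \<open>lambda_max A\<close>, which is at most cmax.\<close>

lemma V_perturb:
 assumes x: "x \<in> U"
 shows "\<bar>ip d a (mv d (%i j. V_mat d P f x $$ (i, j) - V_mat d P f \<theta>0 $$ (i, j)) b)\<bar> <= cmin / 11 * (sqrt (ip d a a) * sqrt (ip d b b))"
proof -
 obtain v \<mu> where sm: "sym_mat d A v \<mu>" using sym_mat_exists[OF A_mat(1,2)] .
 interpret sym_mat d A v \<mu> by (rule sm)
 interpret pd_mat d A v \<mu>
 proof unfold_locales
  show "\<mu> k > 0" if "k < d" for k using \<mu>_bounds(1)[OF that] A_mat(3) pos_const by linarith
 qed
 let ?C = "- V_mat d P f x"
 obtain \<rho> where \<rho>: "\<rho> > 0" "\<rho> < cmin / (11 * cmax)" "spectral_norm (1\<^sub>m d - inv_sqrt_mat A * ?C * inv_sqrt_mat A) <= \<rho>"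
  using A3 U_closed[OF x] unfolding A3_at_def Let_def A_def by auto
 have Cc: "?C \<in> carrier_mat d d" and Vc: "V_mat d P f \<theta>0 \<in> carrier_mat d d" by (simp_all add: V_mat_def mean_mat_def)
 have e: "mv d (%i j. A $$ (i, j) - ?C $$ (i, j)) b i = mv d (%i j. V_mat d P f x $$ (i, j) - V_mat d P f \<theta>0 $$ (i, j)) b i" if "i < d" for i
  unfolding mv_def using that Cc Vc by (intro sum.cong) (auto simp: A_def)
 have "\<bar>ip d a (mv d (%i j. A $$ (i, j) - ?C $$ (i, j)) b)\<bar> <= \<rho> * lambda_max A * (sqrt (ip d a a) * sqrt (ip d b b))"
  by (rule inv_sqrt_perturbation[OF Cc \<rho>(3)]) (use \<rho> lmax in auto)
 also have "... <= cmin / 11 * (sqrt (ip d a a) * sqrt (ip d b b))"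
 proof (rule mult_right_mono)
  have "\<rho> * lambda_max A <= cmin / (11 * cmax) * cmax" using \<rho> A_mat(4) lmax pos_const by (intro mult_mono) auto
  also have "... = cmin / 11" using lmax by simp
  finally show "\<rho> * lambda_max A <= cmin / 11" .
 qed (simp add: ip_pos)
 finally show ?thesis using e by (simp add: ip_def)
qed

lemma V_curv:
 assumes x: "x \<in> U"
 shows "ip d a (mv d (%i j. V_mat d P f x $$ (i, j)) a) <= - (10 / 11) * cmin * ip d a a"
proof -
 obtain v \<mu> where sm: "sym_mat d A v \<mu>" using sym_mat_exists[OF A_mat(1,2)] .
 interpret sym_mat d A v \<mu> by (rule sm)
 have "sqrt (ip d a a) * sqrt (ip d a a) = ip d a a" by (simp add: ip_pos)
 then have 1: "ip d a (mv d (%i j. V_mat d P f x $$ (i, j) - V_mat d P f \<theta>0 $$ (i, j)) a) <= cmin / 11 * ip d a a"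
  using V_perturb[OF x, of a a] by simp
 have 2: "cmin * ip d a a <= ip d a (mv d (%i j. A $$ (i, j)) a)"
  by (rule order_trans[OF mult_right_mono[OF A_mat(3) ip_pos] rayleigh(1)])
 have Vc: "V_mat d P f \<theta>0 \<in> carrier_mat d d" by (simp add: V_mat_def mean_mat_def)
 have 3: "mv d (%i j. A $$ (i, j)) a i = - mv d (%i j. V_mat d P f \<theta>0 $$ (i, j)) a i" if "i < d" for i
  unfolding mv_def sum_negf[symmetric] using that Vc by (intro sum.cong) (auto simp: A_def)
 have 4: "ip d a (mv d (%i j. A $$ (i, j)) a) = - ip d a (mv d (%i j. V_mat d P f \<theta>0 $$ (i, j)) a)"
  using 3 by (simp add: ip_def sum_negf)
 have 5: "ip d a (mv d (%i j. V_mat d P f x $$ (i, j) - V_mat d P f \<theta>0 $$ (i, j)) a)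
   = ip d a (mv d (%i j. V_mat d P f x $$ (i, j)) a) - ip d a (mv d (%i j. V_mat d P f \<theta>0 $$ (i, j)) a)"
  by (simp add: ip_def mv_def left_diff_distrib right_diff_distrib sum_subtractf)
 show ?thesis using 1 2 4 5 by (simp add: field_simps)
qed

text \<open>Any finite bound on the Hessian of G serves. It may grow with n, since
  \<open>quadratic_decrease\<close> does not pass it on.\<close>

definition "CG = 2 * ((\<Sum>i<d. \<Sum>j<d. \<bar>V_mat d P f \<theta>0 $$ (i, j)\<bar>) + cmin / 11)"

lemma G_second_order: "second_order P d \<theta>0 r0 (%_. G) CG"
proof (rule second_order.intro[OF P], rule second_order_axioms.intro)
 show "0 < r0" by (rule r0)
 show "\<theta>0 i = 0" if "i >= d" for i using that theta0_U by (simp add: eball_iff)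
 show "0 <= CG" using pos_const by (auto simp: CG_def intro!: add_nonneg_nonneg sum_nonneg)
 show "second_partials_exist d G x" if "x \<in> U" for x by (rule G2[OF that])
 show "(%(z, x). if x \<in> U then G x else 0) \<in> borel_measurable (P \<Otimes>\<^sub>M borel)"
 proof -
  have *: "(if x \<in> U then G x else 0) = (if x \<in> U then 2 * I.\<Gamma> x else 0)" for x
   using G_Gamma[of x] ball by auto
  have "(%x. if x \<in> U then 2 * I.\<Gamma> x else 0) \<in> borel_measurable borel"
   using eball_borel Gamma_meas by (intro measurable_If_set) auto
  from measurable_compose[OF measurable_snd this] show ?thesis by (simp only: case_prod_beta' *)
 qed
 show "(\<integral>\<^sup>+z. ennreal \<bar>partial i (partial j G) x\<bar> \<partial>P) <= ennreal CG" if x: "x \<in> U" and ij: "i < d" "j < d" for x i j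
 proof -
  let ?e = "%i k. if k = i then 1 else 0 :: real"
  have "mv d a (?e j) k = a k j" for a k
   using basis_sum(1)[OF ij(2), of "%l. a k l"] by (simp add: mv_def mult.commute)
  then have "ip d (?e i) (mv d (%i j. V_mat d P f x $$ (i, j) - V_mat d P f \<theta>0 $$ (i, j)) (?e j)) = V_mat d P f x $$ (i, j) - V_mat d P f \<theta>0 $$ (i, j)"
   unfolding basis_sum(2)[OF ij(1)] by simp
  moreover have "sqrt (ip d (?e i) (?e i)) * sqrt (ip d (?e j) (?e j)) = 1" using ij by (simp add: basis_sum)
  ultimately have 1: "\<bar>V_mat d P f x $$ (i, j) - V_mat d P f \<theta>0 $$ (i, j)\<bar> <= cmin / 11" using V_perturb[OF x, of "?e i" "?e j"] by simp
  have "\<bar>V_mat d P f \<theta>0 $$ (i, j)\<bar> <= (\<Sum>j<d. \<bar>V_mat d P f \<theta>0 $$ (i, j)\<bar>)" using ij by (intro member_le_sum[of j "{..<d}" "%j. \<bar>V_mat d P f \<theta>0 $$ (i, j)\<bar>"]) auto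
  also have "... <= (\<Sum>i<d. \<Sum>j<d. \<bar>V_mat d P f \<theta>0 $$ (i, j)\<bar>)" using ij by (intro member_le_sum[of i "{..<d}" "%i. \<Sum>j<d. \<bar>V_mat d P f \<theta>0 $$ (i, j)\<bar>"]) (auto intro: sum_nonneg)
  finally have 2: "\<bar>V_mat d P f \<theta>0 $$ (i, j)\<bar> <= (\<Sum>i<d. \<Sum>j<d. \<bar>V_mat d P f \<theta>0 $$ (i, j)\<bar>)" .
  have "\<bar>2 * a\<bar> <= 2 * (s + t)" if "\<bar>b\<bar> <= s" "\<bar>a - b\<bar> <= t" for a b s t :: real
   using abs_triangle_ineq[of "a - b" b] that by (simp add: abs_mult)
  from this[OF 2 1] have le: "\<bar>partial i (partial j G) x\<bar> <= CG" unfolding hess_mean[OF x ij] CG_def .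
  have "(\<integral>\<^sup>+z. ennreal \<bar>partial i (partial j G) x\<bar> \<partial>P) = ennreal \<bar>partial i (partial j G) x\<bar> * emeasure P (space P)" by (rule nn_integral_const)
  then show "(\<integral>\<^sup>+z. ennreal \<bar>partial i (partial j G) x\<bar> \<partial>P) <= ennreal CG"
   unfolding PP.emeasure_space_1 mult_1_right by (simp only: ennreal_leI[OF le])
 qed
qed

text \<open>The ball puts \<theta>0 in the interior of \<Theta>, where \<Gamma> is maximal, so
  Fermat's criterion applies on each coordinate line.\<close>

lemma G_grad0: "j < d ==> partial j G \<theta>0 = 0"
proof -
 assume j: "j < d"
 interpret G: second_order P d \<theta>0 r0 "%_. G" CG by (rule G_second_order)
 obtain z where z: "z \<in> space P" using PP.not_empty by blast
 have D: "((%t. G (\<theta>0(j := t))) has_real_derivative partial j G \<theta>0) (at (\<theta>0 j))" by (rule G.deriv1[OF z theta0_U j])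
 obtain \<eta> where \<eta>: "\<eta> > 0" "!!t. dist t (\<theta>0 j) < \<eta> ==> \<theta>0(j := t) \<in> U" using eball_coord[OF theta0_U j] unfolding eventually_nhds_metric by blast
 show ?thesis
 proof (rule DERIV_local_max[OF D \<eta>(1)], intro allI impI)
  fix t assume "\<bar>\<theta>0 j - t\<bar> < \<eta>"
  then have "\<theta>0(j := t) \<in> \<Theta>" using \<eta>(2)[of t] ball by (auto simp: dist_real_def abs_minus_commute)
  from G_Gamma[OF this] Gamma_max[OF this] G_Gamma[OF in_\<Theta>(1)] Gamma_theta0
  show "G (\<theta>0(j := t)) <= G (\<theta>0(j := \<theta>0 j))" by simp
 qed
qed

text \<open>The curvature of G is 2 * 10/11 cmin; one factor 1/2 from the parabola and another from
  G = 2 \<Gamma> leave 5/11.\<close>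

lemma Gamma_decrease:
 assumes "\<theta> \<in> U"
 shows "I.\<Gamma> \<theta> <= - (5 / 11) * cmin * (edist d \<theta> \<theta>0)\<^sup>2"
proof -
 have "G \<theta> <= G \<theta>0 - (20 / 11 * cmin) / 2 * (edist d \<theta> \<theta>0)\<^sup>2"
 proof (rule quadratic_decrease[OF G_second_order G_grad0 _ assms])
  fix x a assume x: "x \<in> U"
  have "(\<Sum>i<d. a i * (\<Sum>j<d. a j * partial i (partial j G) x)) = 2 * ip d a (mv d (%i j. V_mat d P f x $$ (i, j)) a)"
   unfolding ip_def mv_def sum_distrib_left using hess_mean[OF x] by (intro sum.cong refl) auto
  then show "(\<Sum>i<d. a i * (\<Sum>j<d. a j * partial i (partial j G) x)) <= - (20 / 11 * cmin) * ip d a a"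
   using V_curv[OF x, of a] by simp
 qed
 then show ?thesis using G_Gamma[of \<theta>] G_Gamma[OF in_\<Theta>(1)] Gamma_theta0 assms ball by auto
qed

end

section \<open>Linear term, remainder and basic inequality\<close>

lemma (in prob_space) markov_prob:
 assumes u: "u \<in> borel_measurable M" and le: "(\<integral>\<^sup>+om. u om \<partial>M) <= ennreal b" and t: "t > 0" and b: "b >= 0"
 shows "prob {om \<in> space M. ennreal t <= u om} <= b / t" "{om \<in> space M. ennreal t <= u om} \<in> events"
proof -
 let ?A = "{om \<in> space M. ennreal t <= u om}"
 show A: "?A \<in> events" using u by measurable
 have "ennreal t * emeasure M ?A = (\<integral>\<^sup>+om. ennreal t * indicator ?A om \<partial>M)" using A by (simp add: nn_integral_cmult_indicator)
 also have "... <= (\<integral>\<^sup>+om. u om \<partial>M)" by (intro nn_integral_mono) (auto simp: indicator_def)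
 finally have "ennreal t * emeasure M ?A <= ennreal b" using le by (rule order_trans)
 then have "ennreal (t * prob ?A) <= ennreal b" using t by (simp add: emeasure_eq_measure ennreal_mult)
 then have "t * prob ?A <= b" using b by (simp add: ennreal_le_iff)
 then show "prob ?A <= b / t" using t by (simp add: pos_le_divide_eq mult.commute)
qed

lemma ennreal_power_mono: "a <= b ==> a ^ k <= b ^ k" for a b :: ennreal
 by (induction k) (auto intro: mult_mono)

context m_estimation
begin

interpretation Pt: prob_space Pt by (rule prob_Pt)

definition "dz j z = partial j (zeta P f z) \<theta>0"

lemma dz_meas: "j < d ==> dz j \<in> borel_measurable P"
 unfolding dz_def[abs_def] by (rule S.partial_slice_meas[OF theta0_U])

lemma to_Rd_borel: "F \<in> borel_measurable P ==> F \<in> borel_measurable (Rd_borel m)" for F :: "point => real"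
 using measurable_cong_sets[OF P_sets refl] by blast

lemma dz_tau: "z \<in> space P ==> j < d ==> dz j z = partial j (tau P f z) \<theta>0"
 using zeta_partial(1)[OF _ theta0_U] G_grad0 by (simp add: dz_def space_P)

text \<open>The gradients of \<open>zeta\<close> and \<open>tau\<close> agree at the critical point
  \<theta>0, so the diagonal of \<Delta> holds these second moments; each is a Rayleigh quotient at
  a unit vector, hence at most dmax.\<close>

lemma dz_L2: "j < d ==> integrable P (%z. (dz j z)\<^sup>2)" "(\<Sum>j<d. \<integral>z. (dz j z)\<^sup>2 \<partial>P) <= real d * dmax"
proof -
 have D: "integrable_mat d P (grad_outer d P f \<theta>0)" "lambda_max (Delta_mat d P f \<theta>0) <= dmax"
  using A3 unfolding A3_at_def Let_def by blast+
 have go: "grad_outer d P f \<theta>0 z $$ (i, j) = partial i (tau P f z) \<theta>0 * partial j (tau P f z) \<theta>0" if "i < d" "j < d" for i j z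
  using that by (simp add: grad_outer_def grad_def)
 have e: "(dz j z)\<^sup>2 = grad_outer d P f \<theta>0 z $$ (j, j)" if "j < d" "z \<in> space P" for j z
  using go[OF that(1,1)] dz_tau[OF that(2,1)] by (simp add: power2_eq_square)
 show "integrable P (%z. (dz j z)\<^sup>2)" if "j < d"
  using D(1) that e[OF that] unfolding integrable_mat_def by (subst Bochner_Integration.integrable_cong[OF refl]) auto
 let ?D = "Delta_mat d P f \<theta>0"
 have Dc: "?D \<in> carrier_mat d d" by (simp add: Delta_mat_def mean_mat_def)
 have "transpose_mat ?D = ?D" by (rule eq_matI) (auto simp: Delta_mat_def mean_mat_def go mult.commute)
 then have "symmetric_mat ?D" using Dc by (simp add: symmetric_mat_def)
 from sym_mat_exists[OF Dc this] obtain v \<mu> where "sym_mat d ?D v \<mu>" .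
 then interpret sym_mat d ?D v \<mu> .
 have "(\<integral>z. (dz j z)\<^sup>2 \<partial>P) <= dmax" if j: "j < d" for j
 proof -
  let ?e = "%k. if k = j then 1 else 0 :: real"
  have "(\<integral>z. (dz j z)\<^sup>2 \<partial>P) = ?D $$ (j, j)" using j e[OF j] by (simp add: Delta_mat_def mean_mat_def cong: Bochner_Integration.integral_cong)
  also have "... = ip d ?e (mv d (%i j. ?D $$ (i, j)) ?e)"
   using basis_sum(1)[OF j, of "%l. ?D $$ (j, l)"] unfolding basis_sum(2)[OF j] by (simp add: mv_def mult.commute)
  also have "... <= lambda_max ?D * ip d ?e ?e" by (rule rayleigh(2))
  finally show ?thesis using D(2) by (simp add: basis_sum(2)[OF j])
 qed
 then have "(\<Sum>j<d. \<integral>z. (dz j z)\<^sup>2 \<partial>P) <= (\<Sum>j<d. dmax)" by (intro sum_mono) auto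
 then show "(\<Sum>j<d. \<integral>z. (dz j z)\<^sup>2 \<partial>P) <= real d * dmax" by simp
qed

text \<open>A finite L1 bound for the gradient at \<theta>0, from |x| <= 1 + x^2. Like
  \<open>CG\<close> it may grow with n, as the moment bound for the remainder does not contain
  it.\<close>

definition "c0 = 1 + (\<Sum>j<d. \<integral>z. (dz j z)\<^sup>2 \<partial>P)"

lemma c0: "c0 >= 0" by (auto simp: c0_def intro!: add_nonneg_nonneg sum_nonneg)

lemma dz_L1: assumes j: "j < d" shows "(\<integral>\<^sup>+z. ennreal \<bar>partial j (zeta P f z) \<theta>0\<bar> \<partial>P) <= ennreal c0"
proof -
 have "\<bar>x\<bar> <= 1 + x\<^sup>2" for x :: real
  using zero_le_power2[of "\<bar>x\<bar> - 1"] by (simp add: power2_diff)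
 then have "(\<integral>\<^sup>+z. ennreal \<bar>dz j z\<bar> \<partial>P) <= (\<integral>\<^sup>+z. ennreal (1 + (dz j z)\<^sup>2) \<partial>P)" by (intro nn_integral_mono ennreal_leI)
 also have "... = ennreal (\<integral>z. 1 + (dz j z)\<^sup>2 \<partial>P)" using dz_L2(1)[OF j] by (intro nn_integral_eq_integral) auto
 also have "(\<integral>z. 1 + (dz j z)\<^sup>2 \<partial>P) = 1 + (\<integral>z. (dz j z)\<^sup>2 \<partial>P)" using dz_L2(1)[OF j] by (simp add: PP.prob_space)
 also have "ennreal ... <= ennreal c0"
  unfolding c0_def using j by (intro ennreal_leI add_left_mono member_le_sum[of j "{..<d}" "%j. \<integral>z. (dz j z)\<^sup>2 \<partial>P"]) auto
 finally show ?thesis by (simp add: dz_def)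
qed

lemma R_meas: "\<theta> \<in> U ==> (%z. S.R z \<theta>) \<in> borel_measurable P"
proof -
 assume \<theta>: "\<theta> \<in> U"
 have "(%z. zeta P f z \<theta>) \<in> borel_measurable P" using S.slice_meas[OF S.gU_meas, of \<theta>] \<theta> by (simp add: S.gU_def)
 then show ?thesis unfolding S.R_def
  by (intro borel_measurable_diff borel_measurable_sum borel_measurable_times borel_measurable_const S.partial_slice_meas theta0_U) auto
qed

lemma ft_theta0: "ft x y \<theta>0 = 0" using f_theta0 rx rt in_\<Theta> by (simp add: ft_def)

lemma zeta_theta0: "z \<in> Rd m ==> zeta P f z \<theta>0 = 0"
 using tau_ft[OF _ in_\<Theta>(1)] G_Gamma[OF in_\<Theta>(1)] Gamma_theta0 by (simp add: zeta_eq ft_theta0)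

lemma R_theta0: "z \<in> Rd m ==> S.R z \<theta>0 = 0" by (simp add: S.R_def zeta_theta0)

lemma R_mgf:
 assumes "\<rho> <= r0" "\<theta> \<in> eball d \<theta>0 \<rho>" "\<theta>' \<in> eball d \<theta>0 \<rho>" "\<bar>s\<bar> * (\<rho> * edist d \<theta>' \<theta>) <= l0"
 shows "(\<integral>\<^sup>+z. ennreal (exp (s * (S.R z \<theta>' - S.R z \<theta>))) \<partial>P) <= ennreal (exp (\<nu>0\<^sup>2 * (s * (\<rho> * edist d \<theta>' \<theta>))\<^sup>2 / 2))"
proof (rule S.remainder_mgf[where ?l0.0 = l0 and b = "4 * C" and ?c0.0 = c0])
 show "\<bar>zeta P f z x\<bar> <= 4 * C" if "z \<in> space P" "x \<in> U" for z x using zeta_bound[of z x] that ball by (auto simp: space_P)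
qed (use assms zeta_mgf(1) dz_L1 c0 C in auto)

text \<open>\<open>E \<nabla>\<zeta>(\<cdot>; \<theta>\<^sub>0) = 0\<close>, since both \<open>\<zeta>\<close> and its remainder have mean zero.\<close>

lemma dz_mean: assumes j: "j < d" shows "integrable P (dz j)" "(\<integral>z. dz j z \<partial>P) = 0"
proof -
 define h where "h = r0 / 2"
 define \<theta> where "\<theta> = \<theta>0(j := \<theta>0 j + h)"
 have h: "h > 0" "h < r0" using r0 by (auto simp: h_def)
 have "edist d \<theta> \<theta>0 = sqrt (\<Sum>i<d. (if i = j then h else 0)\<^sup>2)" unfolding edist_def L2_set_def
  by (intro arg_cong[where f = sqrt] sum.cong) (auto simp: \<theta>_def)
 also have "(\<Sum>i<d. (if i = j then h else 0)\<^sup>2) = (\<Sum>i<d. if i = j then h\<^sup>2 else 0)" by (intro sum.cong) auto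
 finally have e: "edist d \<theta> \<theta>0 = h" using j h by simp
 have \<theta>U: "\<theta> \<in> U" using e h theta0_U j by (auto simp: eball_iff \<theta>_def)
 have \<theta>\<Theta>: "\<theta> \<in> \<Theta>" using \<theta>U ball by blast
 have Re: "S.R z \<theta> = zeta P f z \<theta> - h * dz j z" for z
 proof -
  have "(\<Sum>i<d. (\<theta> i - \<theta>0 i) * partial i (zeta P f z) \<theta>0) = (\<Sum>i<d. if i = j then h * dz j z else 0)"
   by (intro sum.cong) (auto simp: \<theta>_def dz_def)
  then show ?thesis using j by (simp add: S.R_def)
 qed
 have R: "integrable P (%z. S.R z \<theta>)" "(\<integral>z. S.R z \<theta> \<partial>P) = 0"
 proof -
  have a: "l0 / (r0 * h) > 0" using pos_const r0 h by simp
  have "(\<integral>\<^sup>+z. ennreal (exp (s * S.R z \<theta>)) \<partial>P) <= ennreal (exp (\<nu>0\<^sup>2 * (r0 * h)\<^sup>2 / 2 * s\<^sup>2))" if s: "\<bar>s\<bar> <= l0 / (r0 * h)" for s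
  proof -
   have "\<bar>s\<bar> * (r0 * edist d \<theta> \<theta>0) <= l0" using s r0 h unfolding e by (simp add: pos_le_divide_eq)
   from R_mgf[OF order_refl theta0_U \<theta>U this]
   have "(\<integral>\<^sup>+z. ennreal (exp (s * (S.R z \<theta> - S.R z \<theta>0))) \<partial>P) <= ennreal (exp (\<nu>0\<^sup>2 * (s * (r0 * h))\<^sup>2 / 2))" unfolding e .
   moreover have "(\<integral>\<^sup>+z. ennreal (exp (s * (S.R z \<theta> - S.R z \<theta>0))) \<partial>P) = (\<integral>\<^sup>+z. ennreal (exp (s * S.R z \<theta>)) \<partial>P)"
   by (intro nn_integral_cong) (simp add: R_theta0 space_P)
   ultimately show ?thesis by (simp add: power_mult_distrib mult_ac)
  qed
  from PP.mgf_imp_mean_zero[OF R_meas[OF \<theta>U] a _ this] show "integrable P (%z. S.R z \<theta>)" "(\<integral>z. S.R z \<theta> \<partial>P) = 0" by auto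
 qed
 have z: "integrable P (%z. zeta P f z \<theta>)"
 proof (rule PP.integrable_const_bound[of _ "4 * C"])
  show "(%z. zeta P f z \<theta>) \<in> borel_measurable P" using S.slice_meas[OF S.gU_meas, of \<theta>] \<theta>U by (simp add: S.gU_def)
 qed (use zeta_bound[OF _ \<theta>\<Theta>] in \<open>auto simp: space_P\<close>)
 have t: "integrable P (%z. tau P f z \<theta>)"
 proof -
  have "integrable P (%z. zeta P f z \<theta> + G \<theta>)" using z by simp
  then show ?thesis by (simp add: zeta_eq)
 qed
 have zm: "(\<integral>z. zeta P f z \<theta> \<partial>P) = 0"
  using t unfolding zeta_eq by (simp add: PP.prob_space G_def)
 have dze: "dz j z = (zeta P f z \<theta> - S.R z \<theta>) / h" for z using h by (simp add: Re)
 show "integrable P (dz j)" unfolding dze[abs_def] using z R(1) by auto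
 show "(\<integral>z. dz j z \<partial>P) = 0" unfolding dze using z R zm by simp
qed

definition "W om \<theta> = 1 / real n * (\<Sum>i\<in>{1..n}. S.R (Z i om) \<theta>)"

text \<open>Averaging n independent copies reduces the subgaussian variance from \<nu>0^2 to
  \<nu>0^2 / n and widens the admissible range of s from l0 to n l0, which is the form that
  \<open>chaining_ball\<close> expects.\<close>

lemma remainder_sup:
 assumes \<rho>: "0 < \<rho>" "\<rho> <= r0" and rate: "sqrt (real d * real n) <= real n * l0"
 shows "\<exists>X \<in> borel_measurable M. (\<forall>om\<in>space M. \<forall>\<theta>\<in>eball d \<theta>0 \<rho>. ennreal \<bar>W om \<theta>\<bar> <= X om) \<and>
  (\<integral>\<^sup>+om. X om \<partial>M) <= ennreal (17 * (3 + \<nu>0\<^sup>2 / 2) * \<rho>\<^sup>2 * sqrt (real d / real n))"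
proof -
 have sub: "\<theta> \<in> U" if "\<theta> \<in> eball d \<theta>0 \<rho>" for \<theta> using that \<rho> by (auto simp: eball_iff)
 have n0: "real n > 0" using n by simp
 have Rm: "(%om. S.R (Z i om) \<theta>) \<in> borel_measurable M" if "i \<in> {1..n}" "\<theta> \<in> U" for i \<theta>
  by (rule measurable_compose[OF Z_rv[OF that(1)] to_Rd_borel[OF R_meas[OF that(2)]]])
 obtain X where X: "X \<in> borel_measurable M" "!!om \<theta>. om \<in> space M ==> \<theta> \<in> eball d \<theta>0 \<rho> ==> ennreal \<bar>W om \<theta>\<bar> <= X om"
  "(\<integral>\<^sup>+om. X om \<partial>M) <= ennreal (17 * (3 + \<nu>0\<^sup>2 / 2) * \<rho>\<^sup>2 * sqrt (real d / real n))"
 proof (rule chaining_ball[where d = d and \<rho> = \<rho> and n = "real n" and ?l0.0 = l0 and W = W and v = \<nu>0 and ?\<theta>0.0 = \<theta>0])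
  show "\<theta>0 i = 0" if "d <= i" for i using that theta0_U by (simp add: eball_iff)
  show "(%om. W om \<theta>) \<in> borel_measurable M" if "\<theta> \<in> eball d \<theta>0 \<rho>" for \<theta>
   unfolding W_def using Rm[OF _ sub[OF that]] by (intro borel_measurable_times borel_measurable_const borel_measurable_sum) auto
  show "W om \<theta>0 = 0" if "om \<in> space M" for om using R_theta0 Z_Rd[OF _ that] by (simp add: W_def)
  show "isCont (%t. W om (\<theta>(i := t))) (\<theta> i)" if w: "om \<in> space M" and \<theta>: "\<theta> \<in> eball d \<theta>0 \<rho>" and i: "i < d" for om \<theta> i
  proof -
   have "isCont (%t. S.R z (\<theta>(i := t))) (\<theta> i)" if z: "z \<in> space P" for z
   proof -
   have c: "isCont (%t. (\<theta>(i := t)) j) (\<theta> i)" for j by (cases "j = i") auto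
   have g: "isCont (%t. zeta P f z (\<theta>(i := t))) (\<theta> i)" by (rule DERIV_isCont[OF S.deriv1[OF z sub[OF \<theta>] i]])
   show ?thesis unfolding S.R_def
   by (intro continuous_diff g continuous_sum continuous_mult c continuous_const)
   qed
   then show ?thesis unfolding W_def using Z_Rd[OF _ w] by (intro continuous_mult continuous_const continuous_sum) (auto simp: space_P)
  qed
  fix \<theta> \<theta>' s assume \<theta>: "\<theta> \<in> eball d \<theta>0 \<rho>" "\<theta>' \<in> eball d \<theta>0 \<rho>" and s: "\<bar>s\<bar> * (\<rho> * edist d \<theta>' \<theta>) <= real n * l0"
  let ?\<phi> = "%z. s / real n * (S.R z \<theta>' - S.R z \<theta>)"
  let ?e = "\<rho> * edist d \<theta>' \<theta>"
  have \<phi>: "?\<phi> \<in> borel_measurable (Rd_borel m)"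
   by (intro to_Rd_borel borel_measurable_times borel_measurable_const borel_measurable_diff R_meas sub \<theta>)
  have sn: "\<bar>s / real n\<bar> * ?e <= l0" using s n0 by (simp add: pos_divide_le_eq mult.commute)
  have "(\<integral>\<^sup>+om. ennreal (exp (s * (W om \<theta>' - W om \<theta>))) \<partial>M) = (\<integral>\<^sup>+om. ennreal (exp (\<Sum>i\<in>{1..n}. ?\<phi> (Z i om))) \<partial>M)"
   by (simp only: W_def right_diff_distrib sum_distrib_left sum_subtractf) simp
  also have "... = (\<integral>\<^sup>+z. ennreal (exp (?\<phi> z)) \<partial>P) ^ card {1..n}"
   by (rule iid_exp_sum[OF _ Z_indep Z_distr \<phi>]) auto
  also have "... <= ennreal (exp (\<nu>0\<^sup>2 * (s / real n * ?e)\<^sup>2 / 2)) ^ card {1..n}"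
   by (intro ennreal_power_mono R_mgf \<rho> \<theta> sn)
  also have "... = ennreal (exp (\<nu>0\<^sup>2 * (s * ?e)\<^sup>2 / (2 * real n)))"
   using n0 by (simp add: ennreal_power exp_of_nat_mult[symmetric] power2_eq_square)
  finally show "(\<integral>\<^sup>+om. ennreal (exp (s * (W om \<theta>' - W om \<theta>))) \<partial>M) <= ennreal (exp (\<nu>0\<^sup>2 * (s * ?e)\<^sup>2 / (2 * real n)))" .
 qed (use d \<rho> n0 rate in auto)
 then show ?thesis by blast
qed

definition "q j om = 1 / real n * (\<Sum>i\<in>{1..n}. dz j (Z i om))"

lemma q_sq:
 shows "integrable M (%om. \<Sum>j<d. (q j om)\<^sup>2)" "(\<integral>om. (\<Sum>j<d. (q j om)\<^sup>2) \<partial>M) <= dmax * real d / real n"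
proof -
 have n0: "real n > 0" using n by simp
 have e: "(q j om)\<^sup>2 = 1 / (real n)\<^sup>2 * (\<Sum>i\<in>{1..n}. dz j (Z i om))\<^sup>2" for j om by (simp add: q_def power_mult_distrib power_one_over power_divide)
 have i: "integrable M (%om. (\<Sum>i\<in>{1..n}. dz j (Z i om))\<^sup>2)" "expectation (%om. (\<Sum>i\<in>{1..n}. dz j (Z i om))\<^sup>2) = real n * (\<integral>z. (dz j z)\<^sup>2 \<partial>P)"
  if j: "j < d" for j
  using iid_sum_square[OF finite_atLeastAtMost Z_indep Z_distr to_Rd_borel[OF dz_meas[OF j]] dz_mean(1)[OF j] dz_L2(1)[OF j] dz_mean(2)[OF j]] by auto
 show int: "integrable M (%om. \<Sum>j<d. (q j om)\<^sup>2)" unfolding e using i by (intro Bochner_Integration.integrable_sum integrable_mult_right) auto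
 have "(\<integral>om. (\<Sum>j<d. (q j om)\<^sup>2) \<partial>M) = (\<Sum>j<d. 1 / (real n)\<^sup>2 * (real n * (\<integral>z. (dz j z)\<^sup>2 \<partial>P)))"
  unfolding e using i by (subst Bochner_Integration.integral_sum) auto
 also have "... = 1 / real n * (\<Sum>j<d. \<integral>z. (dz j z)\<^sup>2 \<partial>P)" using n0 by (simp add: sum_distrib_left power2_eq_square)
 also have "... <= 1 / real n * (real d * dmax)" using n0 by (intro mult_left_mono dz_L2) auto
 finally show "(\<integral>om. (\<Sum>j<d. (q j om)\<^sup>2) \<partial>M) <= dmax * real d / real n" by (simp add: mult.commute)
qed

abbreviation "N2 \<equiv> real n * (real n - 1)"

definition "hU om = I.pairsum (%i j. I.hoeff (Z i om) (Z j om) (\<theta>hat om)) / N2"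

lemma N2: "N2 > 0" using n by simp

lemma pairsum_const: "I.pairsum (%i j. u i) = (real n - 1) * (\<Sum>i\<in>{1..n}. u i)" "I.pairsum (%i j. u j) = (real n - 1) * (\<Sum>i\<in>{1..n}. u i)"
proof -
 show "I.pairsum (%i j. u i) = (real n - 1) * (\<Sum>i\<in>{1..n}. u i)" using n by (simp add: of_nat_diff sum_distrib_left)
 have "I.pairsum (%i j. u j) = (\<Sum>i\<in>{1..n}. (\<Sum>j\<in>{1..n}. u j) - u i)" by (intro sum.cong refl) (simp add: sum_diff1)
 then show "I.pairsum (%i j. u j) = (real n - 1) * (\<Sum>i\<in>{1..n}. u i)" by (simp add: sum_subtractf left_diff_distrib)
qed

lemma crit_ft: "om \<in> space M ==> t \<in> \<Theta> ==> sample_crit n f (%i. Z i om) t = I.pairsum (%i j. ft (Z i om) (Z j om) t) / N2"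
 unfolding sample_crit_def by (simp add: ft_def Z_Rd rx rt)

lemma crit_nonneg: assumes w: "om \<in> space M" shows "0 <= I.pairsum (%i j. ft (Z i om) (Z j om) (\<theta>hat om)) / N2"
 using thetahat[OF w] in_\<Theta>(1) crit_ft[OF w in_\<Theta>(1)] crit_ft[OF w in_\<Theta>(2)[OF w]]
 by (auto simp: is_arg_max_def not_less ft_theta0)

text \<open>Maximality enters as nonnegativity of the criterion at the estimator, its value at
  \<theta>0 being 0. Cauchy-Schwarz isolates the distance in the linear term.\<close>

lemma basic_inequality:
 assumes w: "om \<in> space M" and U: "\<theta>hat om \<in> U"
 shows "5 / 11 * cmin * (edist d (\<theta>hat om) \<theta>0)\<^sup>2 <= edist d (\<theta>hat om) \<theta>0 * sqrt (\<Sum>j<d. (q j om)\<^sup>2) + \<bar>W om (\<theta>hat om)\<bar> + \<bar>hU om\<bar>"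
proof -
 let ?t = "\<theta>hat om"
 have t\<Theta>: "?t \<in> \<Theta>" by (rule in_\<Theta>(2)[OF w])
 let ?a = "%i. \<integral>w. ft (Z i om) w ?t \<partial>Pt" and ?b = "%i. \<integral>w. ft w (Z i om) ?t \<partial>Pt"
 have n1: "real n > 0" "real n - 1 > 0" using n by auto
 have "I.pairsum (%i j. I.hoeff (Z i om) (Z j om) ?t) = I.pairsum (%i j. ft (Z i om) (Z j om) ?t) - I.pairsum (%i j. ?a i) - I.pairsum (%i j. ?b j) + I.pairsum (%i j. I.\<Gamma> ?t)"
  unfolding I.hoeff_def sum.distrib sum_subtractf ..
 also have "I.pairsum (%i j. I.\<Gamma> ?t) = N2 * I.\<Gamma> ?t" unfolding pairsum_const(1) by simp
 finally have h: "I.pairsum (%i j. I.hoeff (Z i om) (Z j om) ?t) = I.pairsum (%i j. ft (Z i om) (Z j om) ?t)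
   - (real n - 1) * (\<Sum>i\<in>{1..n}. ?a i + ?b i) + N2 * I.\<Gamma> ?t"
  unfolding pairsum_const by (simp only: sum.distrib distrib_left)
 have "?a i + ?b i = zeta P f (Z i om) ?t + 2 * I.\<Gamma> ?t" if "i \<in> {1..n}" for i
  using tau_ft[OF Z_Rd[OF that w] t\<Theta>] G_Gamma[OF t\<Theta>] by (simp add: zeta_eq)
 then have ab: "(\<Sum>i\<in>{1..n}. ?a i + ?b i) = (\<Sum>i\<in>{1..n}. zeta P f (Z i om) ?t) + real n * (2 * I.\<Gamma> ?t)"
  by (simp add: sum.distrib)
 have zR: "zeta P f z ?t = S.R z ?t + (\<Sum>j<d. (?t j - \<theta>0 j) * dz j z)" for z by (simp add: S.R_def dz_def)
 have "(\<Sum>i\<in>{1..n}. zeta P f (Z i om) ?t) = (\<Sum>i\<in>{1..n}. S.R (Z i om) ?t) + (\<Sum>j<d. (?t j - \<theta>0 j) * (\<Sum>i\<in>{1..n}. dz j (Z i om)))"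
  unfolding zR sum.distrib sum_distrib_left by (subst sum.swap) simp
 also have "... = real n * W om ?t + real n * ip d (%j. ?t j - \<theta>0 j) (%j. q j om)"
  using n1 by (simp add: W_def q_def ip_def sum_distrib_left)
 finally have z: "(\<Sum>i\<in>{1..n}. zeta P f (Z i om) ?t) = real n * (W om ?t + ip d (%j. ?t j - \<theta>0 j) (%j. q j om))" by (simp add: distrib_left)
 \<comment> \<open>The algebra of the decomposition: 2 \<Gamma> from the one-variable terms and -
   \<Gamma> from the kernel leave one \<Gamma>.\<close>
 have alg: "F = N * (H / N + (w + i) + g)" if "H = F - n1 * (n0 * (w + i) + n0 * (2 * g)) + N * g" "N = n0 * n1" "N > 0" for F H w i g n0 n1 N :: real
 proof -
  have "N * (H / N + (w + i) + g) = H + N * (w + i) + N * g" using that(3) by (simp add: distrib_left)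
  then show ?thesis unfolding that(1,2) by (simp add: algebra_simps)
 qed
 have sgn: "0 <= Y" if "0 <= F / N" "F = N * Y" "N > 0" for F N Y :: real using that by simp
 have "I.pairsum (%i j. ft (Z i om) (Z j om) ?t) = N2 * (hU om + (W om ?t + ip d (%j. ?t j - \<theta>0 j) (%j. q j om)) + I.\<Gamma> ?t)"
  unfolding hU_def by (rule alg[OF h[unfolded ab z] refl N2])
 from sgn[OF crit_nonneg[OF w] this N2] have "0 <= hU om + (W om ?t + ip d (%j. ?t j - \<theta>0 j) (%j. q j om)) + I.\<Gamma> ?t" .
 moreover have "\<bar>ip d (%j. ?t j - \<theta>0 j) (%j. q j om)\<bar> <= edist d ?t \<theta>0 * sqrt (\<Sum>j<d. (q j om)\<^sup>2)"
  using ip_CS[of d "%j. ?t j - \<theta>0 j" "%j. q j om"] by (simp add: edist_ip ip_def power2_eq_square)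
 ultimately show ?thesis using Gamma_decrease[OF U] by linarith
qed

end

section \<open>Peeling, the deviation bound and the rate\<close>

lemma sqrt_mult_eq:
 assumes "a > 0"
 shows "sqrt (t * a) = a * sqrt (t / a)"
proof -
 have "sqrt (t * a) = sqrt (a\<^sup>2 * (t / a))" using assms by (intro arg_cong[where f = sqrt]) (simp add: power2_eq_square)
 also have "... = a * sqrt (t / a)" unfolding real_sqrt_mult[of "a\<^sup>2"] using assms by simp
 finally show ?thesis .
qed

context m_estimation
begin

interpretation Pt: prob_space Pt by (rule prob_Pt)

lemma dmax_nonneg: "dmax >= 0"
proof -
 have "0 <= (\<integral>om. (\<Sum>j<d. (q j om)\<^sup>2) \<partial>M)" by (intro integral_nonneg_AE AE_I2 sum_nonneg) auto
 then have "0 <= dmax * real d / real n" using q_sq(2) by linarith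
 then show ?thesis using d n by (simp add: zero_le_divide_iff zero_le_mult_iff)
qed

lemma pairsum_meas:
 "(%om. I.pairsum (%i j. ft (Z i om) (Z j om) (\<theta>hat om) - I.\<Gamma> (\<theta>hat om))) \<in> borel_measurable M"
 "(%om. I.pairsum (%i j. I.hoeff (Z i om) (Z j om) (\<theta>hat om))) \<in> borel_measurable M"
proof -
 have g: "(%om. I.\<Gamma> (\<theta>hat om)) \<in> borel_measurable M" by (rule measurable_compose[OF I.\<theta>_meas Gamma_meas])
 show "(%om. I.pairsum (%i j. ft (Z i om) (Z j om) (\<theta>hat om) - I.\<Gamma> (\<theta>hat om))) \<in> borel_measurable M"
  by (intro borel_measurable_sum borel_measurable_diff g I.f_meas' I.Z_meas I.\<theta>_meas) auto
 show "(%om. I.pairsum (%i j. I.hoeff (Z i om) (Z j om) (\<theta>hat om))) \<in> borel_measurable M"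
  unfolding I.hoeff_def
  by (intro borel_measurable_sum borel_measurable_add borel_measurable_diff g I.f_meas' inner_meas' I.Z_meas I.\<theta>_meas) auto
qed

definition "Kc = 17 * (3 + \<nu>0\<^sup>2 / 2)"
text \<open>The Markov constant of the local error \<open>B\<close>: dmax comes from the linear term
  and 45696 = 4 * 11424 from the degenerate one, where 4 covers \<nu> + 1 <= 2 y n and n <= 2 (n -
  1).\<close>

definition "KB = 11 / (3 * cmin) * (11 / (4 * cmin) * dmax + 45696 * C)"

text \<open>Three kinds of bad events: \<open>A1\<close>, where the uniform deviation could carry
  the estimator beyond r0/2; \<open>A2 j\<close>, where the remainder is large on the ball of radius
  r0 / 2^j; and \<open>A3\<close>, where the linear and degenerate terms together reach L y. The
  first two become rare as y tends to 0; the third is made rare by L.\<close>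

lemma deviation_bound:
 assumes \<xi>: "\<xi> > 0" and sep: "!!\<theta>. \<theta> \<in> \<Theta> ==> r0 / 2 <= edist d \<theta> \<theta>0 ==> I.\<Gamma> \<theta> <= - \<xi>"
  and y: "y = real (max \<nu> d) / real n" and rate: "sqrt y <= l0" and L: "L >= 1"
 shows "prob {om \<in> space M. L * y < (edist d (\<theta>hat om) \<theta>0)\<^sup>2}
  <= 3264 * C * sqrt (2 * y) / \<xi> + (2 * sqrt (r0 * sqrt y) + 2 * sqrt y) * Kc / (cmin / 44) + KB / L"
proof -
 define x where "x = sqrt (real d / real n)"
 have n0: "real n > 0" "real n - 1 > 0" "real n <= 2 * (real n - 1)" using n by auto
 have d0: "real d > 0" using d by simp
 have x: "x > 0" "x\<^sup>2 = real d / real n" using n0 d0 by (auto simp: x_def)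
 have dy: "real d / real n <= y" unfolding y using n0 by (intro divide_right_mono) auto
 have xy: "x <= sqrt y" unfolding x_def using dy by simp
 have y0: "y > 0" using dy n0 d0 by (meson divide_pos_pos less_le_trans)
 have rate': "sqrt (real d * real n) <= real n * l0"
 proof -
  have "sqrt (real d * real n) = real n * x" unfolding x_def by (rule sqrt_mult_eq[OF n0(1)])
  also have "... <= real n * l0" using xy rate n0 by (intro mult_left_mono) auto
  finally show ?thesis .
 qed
 have nu: "(real \<nu> + 1) / real n <= 2 * y"
 proof -
  have "real \<nu> + 1 <= 2 * real (max \<nu> d)" using d by auto
  then show ?thesis unfolding y times_divide_eq_right by (rule divide_right_mono) simp
 qed
 let ?ps1 = "%om. I.pairsum (%i j. ft (Z i om) (Z j om) (\<theta>hat om) - I.\<Gamma> (\<theta>hat om))"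
 let ?ps2 = "%om. I.pairsum (%i j. I.hoeff (Z i om) (Z j om) (\<theta>hat om))"
 let ?T = "%om. edist d (\<theta>hat om) \<theta>0"
 define A1 where "A1 = {om \<in> space M. ennreal (\<xi> * N2) <= ennreal \<bar>?ps1 om\<bar>}"
 have A1: "prob A1 <= 3264 * C * sqrt (2 * y) / \<xi>" "A1 \<in> events"
 proof -
  let ?b = "1632 * C * real n * sqrt ((real \<nu> + 1) * real n)"
  have um: "(%om. ennreal \<bar>?ps1 om\<bar>) \<in> borel_measurable M" by (intro measurable_compose[OF _ measurable_ennreal] borel_measurable_abs pairsum_meas)
  have t0: "\<xi> * N2 > 0" using \<xi> N2 by simp
  have b0: "?b >= 0" using C by simp
  have "prob A1 <= ?b / (\<xi> * N2)" unfolding A1_def by (rule markov_prob[OF um I.uniform_bound t0 b0])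
  also have "... <= 3264 * C * sqrt (2 * y) / \<xi>"
  proof -
   have "sqrt ((real \<nu> + 1) * real n) = real n * sqrt ((real \<nu> + 1) / real n)" by (rule sqrt_mult_eq[OF n0(1)])
   also have "... <= real n * sqrt (2 * y)" using nu n0 by (intro mult_left_mono real_sqrt_le_mono) auto
   finally have "?b <= 1632 * C * real n * (real n * sqrt (2 * y))" using C by (intro mult_left_mono) auto
   \<comment> \<open>n <= 2 (n - 1) replaces n^2 by N2 up to a factor 2, whence 3264.\<close>
   also have "... <= 1632 * C * real n * ((2 * (real n - 1)) * sqrt (2 * y))"
   using C n0 y0 by (intro mult_left_mono mult_right_mono) auto
   also have "... = 3264 * C * sqrt (2 * y) / \<xi> * (\<xi> * N2)" using \<xi> by simp
   finally show ?thesis using t0 by (simp only: pos_divide_le_eq)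
  qed
  finally show "prob A1 <= 3264 * C * sqrt (2 * y) / \<xi>" .
  show "A1 \<in> events" unfolding A1_def by (rule markov_prob[OF um I.uniform_bound t0 b0])
 qed
 define \<rho> where "\<rho> j = r0 / 2 ^ j" for j :: nat
 have \<rho>: "\<rho> j > 0" "\<rho> j <= r0" for j using r0 by (auto simp: \<rho>_def divide_le_eq)
 have "\<forall>j. \<exists>X. X \<in> borel_measurable M \<and> (\<forall>om\<in>space M. \<forall>\<theta>\<in>eball d \<theta>0 (\<rho> j). ennreal \<bar>W om \<theta>\<bar> <= X om) \<and>
  (\<integral>\<^sup>+om. X om \<partial>M) <= ennreal (Kc * (\<rho> j)\<^sup>2 * x)"
  using remainder_sup[OF \<rho> rate'] unfolding Kc_def x_def by blast
 from choice[OF this] obtain X where X: "!!j. X j \<in> borel_measurable M"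
  "!!j om \<theta>. om \<in> space M ==> \<theta> \<in> eball d \<theta>0 (\<rho> j) ==> ennreal \<bar>W om \<theta>\<bar> <= X j om"
  "!!j. (\<integral>\<^sup>+om. X j om \<partial>M) <= ennreal (Kc * (\<rho> j)\<^sup>2 * x)" by blast
 have Kc0: "Kc >= 0" by (simp add: Kc_def)
 \<comment> \<open>Threshold and mean both scale with \<rho>^2, so every shell has the same failure
   probability. The factor 1/44 is 1/11 divided by 4, because a shell radius may be twice the
   distance of the estimator.\<close>
 define A2 where "A2 j = {om \<in> space M. ennreal (cmin / 44 * (\<rho> j)\<^sup>2) <= X j om}" for j
 have A2: "prob (A2 j) <= Kc * x / (cmin / 44)" "A2 j \<in> events" for j
 proof -
  have t0: "cmin / 44 * (\<rho> j)\<^sup>2 > 0" using pos_const \<rho>(1)[of j] by simp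
  have b0: "Kc * (\<rho> j)\<^sup>2 * x >= 0" using Kc0 x by simp
  have "prob (A2 j) <= Kc * (\<rho> j)\<^sup>2 * x / (cmin / 44 * (\<rho> j)\<^sup>2)" unfolding A2_def by (rule markov_prob[OF X(1,3) t0 b0])
  also have "... = Kc * x / (cmin / 44)" using \<rho>(1)[of j] by simp
  finally show "prob (A2 j) <= Kc * x / (cmin / 44)" .
  show "A2 j \<in> events" unfolding A2_def by (rule markov_prob[OF X(1,3) t0 b0])
 qed
 \<comment> \<open>2k halvings bring r0 below x, because 4^k >= k^2 >= r0 / x. A logarithmic number
   would do, but order sqrt (r0 / x) is harmless: multiplied by x it still tends to 0.\<close>
 define k where "k = nat \<lceil>sqrt (r0 / x)\<rceil>"
 have k: "sqrt (r0 / x) <= real k" "real k <= sqrt (r0 / x) + 1"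
 proof -
  have "0 <= sqrt (r0 / x)" using r0 x by simp
  then have "real k = real_of_int \<lceil>sqrt (r0 / x)\<rceil>" by (simp add: k_def)
  then show "sqrt (r0 / x) <= real k" "real k <= sqrt (r0 / x) + 1" by (auto intro: less_imp_le)
 qed
 let ?J = "2 * k"
 have J1: "\<rho> ?J <= x"
 proof -
  have "r0 / x = (sqrt (r0 / x))\<^sup>2" using r0 x by simp
  also have "... <= (real k)\<^sup>2" using k r0 x by (intro power_mono) auto
  also have "... <= (2 ^ k)\<^sup>2" using of_nat_less_two_power[of k, where 'a = real] by (intro power_mono) auto
  also have "... = 2 ^ ?J" by (simp add: power_mult mult.commute[of 2 k])
  finally show ?thesis using x by (simp add: \<rho>_def field_simps)
 qed
 have J2: "real ?J * x <= 2 * sqrt (r0 * sqrt y) + 2 * sqrt y"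
 proof -
  have "real ?J * x <= 2 * (sqrt (r0 / x) + 1) * x" using k x by (intro mult_right_mono) auto
  also have "... = 2 * sqrt (r0 * x) + 2 * x"
   unfolding sqrt_mult_eq[OF x(1)] by (simp only: algebra_simps)
  also have "... <= 2 * sqrt (r0 * sqrt y) + 2 * sqrt y" using xy r0 by (intro add_mono mult_left_mono real_sqrt_le_mono) auto
  finally show ?thesis .
 qed
 define B where "B om = 11 / (3 * cmin) * (11 / (4 * cmin) * (\<Sum>j<d. (q j om)\<^sup>2) + \<bar>hU om\<bar>)" for om
 define A3 where "A3 = {om \<in> space M. ennreal (L * y) <= ennreal (B om)}"
 have A3: "prob A3 <= KB / L" "A3 \<in> events"
 proof -
  let ?a = "11 / (3 * cmin)" and ?b = "11 / (4 * cmin)" and ?s = "%om. \<Sum>j<d. (q j om)\<^sup>2"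
  have ab: "?a > 0" "?b > 0" using pos_const by auto
  have s0: "?s om >= 0" for om by (intro sum_nonneg) auto
  have sm: "?s \<in> borel_measurable M" using q_sq(1) by (rule borel_measurable_integrable)
  have en: "ennreal (u * v + u' * v') = ennreal u * ennreal v + ennreal u' * ennreal v'"
   if "0 <= u" "0 <= v" "0 <= u'" "0 <= v'" for u v u' v' using that by (simp add: ennreal_mult)
  have Bm: "(%om. ennreal (B om)) \<in> borel_measurable M" unfolding B_def hU_def
   by (intro measurable_compose[OF _ measurable_ennreal] borel_measurable_times borel_measurable_add borel_measurable_const borel_measurable_abs borel_measurable_divide sm pairsum_meas)
  have "(\<integral>\<^sup>+om. ennreal (B om) \<partial>M) = (\<integral>\<^sup>+om. ennreal (?a * ?b) * ennreal (?s om) + ennreal (?a / N2) * ennreal \<bar>?ps2 om\<bar> \<partial>M)"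
  proof (rule nn_integral_cong)
   fix om
   have Be: "B om = ?a * ?b * ?s om + ?a / N2 * \<bar>?ps2 om\<bar>" using N2 unfolding B_def hU_def abs_divide by (simp add: distrib_left)
   show "ennreal (B om) = ennreal (?a * ?b) * ennreal (?s om) + ennreal (?a / N2) * ennreal \<bar>?ps2 om\<bar>"
   unfolding Be by (intro en) (use ab s0[of om] N2 in auto)
  qed
  also have "... = ennreal (?a * ?b) * (\<integral>\<^sup>+om. ennreal (?s om) \<partial>M) + ennreal (?a / N2) * (\<integral>\<^sup>+om. ennreal \<bar>?ps2 om\<bar> \<partial>M)"
  proof -
   have m: "(%om. ennreal (?s om)) \<in> borel_measurable M" "(%om. ennreal \<bar>?ps2 om\<bar>) \<in> borel_measurable M"
   by (intro measurable_compose[OF _ measurable_ennreal] borel_measurable_abs sm pairsum_meas)+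
   show ?thesis unfolding nn_integral_cmult[OF m(1), symmetric] nn_integral_cmult[OF m(2), symmetric]
   by (intro nn_integral_add borel_measurable_times_ennreal m borel_measurable_const)
  qed
  also have "... <= ennreal (?a * ?b) * ennreal (dmax * real d / real n) + ennreal (?a / N2) * ennreal (11424 * C * (real \<nu> + 1) * real n)"
  proof (intro add_mono mult_left_mono I.degenerate_bound)
   show "(\<integral>\<^sup>+om. ennreal (?s om) \<partial>M) <= ennreal (dmax * real d / real n)"
   using q_sq s0 by (subst nn_integral_eq_integral) (auto intro: ennreal_leI)
  qed auto
  also have "... = ennreal (?a * ?b * (dmax * real d / real n) + ?a / N2 * (11424 * C * (real \<nu> + 1) * real n))"
  proof -
   have p: "0 <= ?a * ?b" "0 <= dmax * real d / real n" "0 <= ?a / N2" "0 <= 11424 * C * (real \<nu> + 1) * real n"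
   using ab dmax_nonneg N2 C by auto
   show ?thesis unfolding ennreal_mult[OF p(1,2), symmetric] ennreal_mult[OF p(3,4), symmetric]
   by (rule ennreal_plus[symmetric]) (intro mult_nonneg_nonneg p)+
  qed
  also have "... <= ennreal (KB * y)"
  proof (rule ennreal_leI)
   have "?a * ?b * (dmax * real d / real n) <= ?a * ?b * (dmax * y)"
   using ab dmax_nonneg dy by (intro mult_left_mono) (auto simp: times_divide_eq_right[symmetric] simp del: times_divide_eq_right intro!: mult_left_mono)
   moreover have "?a / N2 * (11424 * C * (real \<nu> + 1) * real n) <= ?a * (45696 * C * y)"
   proof -
   have "(real \<nu> + 1) <= 2 * y * real n" using nu n0 by (simp add: pos_divide_le_eq)
   then have "11424 * C * (real \<nu> + 1) * real n <= 11424 * C * (2 * y * real n) * (2 * (real n - 1))"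
   using C n0 y0 by (intro mult_mono mult_left_mono) auto
   also have "... = 45696 * C * y * N2" by simp
   finally have "?a / N2 * (11424 * C * (real \<nu> + 1) * real n) <= ?a / N2 * (45696 * C * y * N2)"
   using ab N2 by (intro mult_left_mono) auto
   also have "... = ?a * (45696 * C * y)" 
   proof -
   have "u / N * (v * N) = u * v" if "N > 0" for u v N :: real using that by simp
   then show ?thesis using N2 by blast
   qed
   finally show ?thesis .
   qed
   ultimately show "?a * ?b * (dmax * real d / real n) + ?a / N2 * (11424 * C * (real \<nu> + 1) * real n) <= KB * y"
   unfolding KB_def by (simp add: distrib_left distrib_right mult.assoc)
  qed
  finally have le: "(\<integral>\<^sup>+om. ennreal (B om) \<partial>M) <= ennreal (KB * y)" .
  have t0: "L * y > 0" using L y0 by simp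
  have b0: "KB * y >= 0" using y0 dmax_nonneg C pos_const by (auto simp: KB_def intro!: mult_nonneg_nonneg add_nonneg_nonneg)
  have "prob A3 <= KB * y / (L * y)" unfolding A3_def by (rule markov_prob[OF Bm le t0 b0])
  then show "prob A3 <= KB / L" using y0 by simp
  show "A3 \<in> events" unfolding A3_def by (rule markov_prob[OF Bm le t0 b0])
 qed
 have incl: "{om \<in> space M. L * y < (?T om)\<^sup>2} \<subseteq> A1 \<union> ((\<Union>j<?J. A2 j) \<union> A3)"
 proof (rule subsetI, rule ccontr)
  fix om assume "om \<in> {om \<in> space M. L * y < (?T om)\<^sup>2}" and no: "om \<notin> A1 \<union> ((\<Union>j<?J. A2 j) \<union> A3)"
  then have w: "om \<in> space M" and big: "L * y < (?T om)\<^sup>2" by auto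
  have n1: "\<bar>?ps1 om\<bar> < \<xi> * N2" using no w ennreal_leI by (force simp: A1_def not_le)
  have n2: "\<not> ennreal (cmin / 44 * (\<rho> j)\<^sup>2) <= X j om" if "j < ?J" for j using no w that by (auto simp: A2_def)
  have n3: "B om < L * y" using no w ennreal_leI by (force simp: A3_def not_le)
  have T0: "?T om >= 0" by (rule edist_pos)
  have "?ps1 om = I.pairsum (%i j. ft (Z i om) (Z j om) (\<theta>hat om)) - I.pairsum (%i j. I.\<Gamma> (\<theta>hat om))" unfolding sum_subtractf ..
  also have "I.pairsum (%i j. I.\<Gamma> (\<theta>hat om)) = N2 * I.\<Gamma> (\<theta>hat om)" unfolding pairsum_const(1) by simp
  finally have "- (\<xi> * N2) < N2 * I.\<Gamma> (\<theta>hat om)" using n1 crit_nonneg[OF w] N2 by (auto simp: zero_le_divide_iff)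
  then have "N2 * (- \<xi>) < N2 * I.\<Gamma> (\<theta>hat om)" by (simp add: mult.commute)
  then have "- \<xi> < I.\<Gamma> (\<theta>hat om)" using N2 by (simp only: mult_less_cancel_left_pos)
  then have Tr: "?T om < r0 / 2" using sep[OF in_\<Theta>(2)[OF w]] by (meson not_le)
  have hi: "\<theta>hat om i = 0" if "i >= d" for i using in_\<Theta>(2)[OF w] \<Theta> that by (auto simp: Rd_iff subset_iff)
  have tU: "\<theta>hat om \<in> U" using Tr hi T0 by (simp add: eball_iff)
  \<comment> \<open>An estimator closer than x would contradict \<open>big\<close>, since x^2 <= y
    <= L y.\<close>
  have xT: "x <= ?T om"
  proof (rule ccontr)
   assume "\<not> x <= ?T om"
   then have "(?T om)\<^sup>2 <= x\<^sup>2" using T0 by (intro power_mono) auto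
   also have "... <= 1 * y" using x dy by simp
   also have "... <= L * y" using L y0 by (intro mult_right_mono) auto
   finally show False using big by simp
  qed
  have ex: "\<rho> ?J <= ?T om" using J1 xT by linarith
  \<comment> \<open>The first radius not exceeding the distance: the preceding ball contains the
    estimator, and its radius is at most twice the distance. Index 0 is excluded by the bound
    r0/2.\<close>
  define j where "j = (LEAST j. \<rho> j <= ?T om)"
  have j1: "\<rho> j <= ?T om" "j <= ?J" unfolding j_def by (rule LeastI[of "%j. \<rho> j <= ?T om", OF ex], rule Least_le[of "%j. \<rho> j <= ?T om", OF ex])
  have "j ~= 0"
  proof
   assume "j = 0"
   then have "r0 <= ?T om" using j1(1) by (simp add: \<rho>_def)
   then show False using Tr r0 by linarith
  qed
  then obtain i where i: "j = Suc i" using not0_implies_Suc by blast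
  have "?T om < \<rho> i" using not_less_Least[of i "%j. \<rho> j <= ?T om"] i by (simp add: j_def[symmetric])
  then have tb: "\<theta>hat om \<in> eball d \<theta>0 (\<rho> i)" using hi by (simp add: eball_iff)
  have \<rho>i: "\<rho> i <= 2 * ?T om" using j1(1) by (simp add: i \<rho>_def)
  have "ennreal \<bar>W om (\<theta>hat om)\<bar> < ennreal (cmin / 44 * (\<rho> i)\<^sup>2)"
   using X(2)[OF w tb] n2[of i] j1(2) i by (meson Suc_le_eq le_less_trans not_le)
  then have "\<bar>W om (\<theta>hat om)\<bar> <= cmin / 44 * (\<rho> i)\<^sup>2" by (simp add: ennreal_less_iff less_imp_le)
  also have "... <= cmin / 44 * (2 * ?T om)\<^sup>2" using pos_const \<rho>i \<rho>(1)[of i] by (intro mult_left_mono power_mono) auto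
  finally have Wb: "\<bar>W om (\<theta>hat om)\<bar> <= cmin / 11 * (?T om)\<^sup>2" by (simp add: power_mult_distrib)
  define Qv where "Qv = sqrt (\<Sum>j<d. (q j om)\<^sup>2)"
  have Q2: "Qv\<^sup>2 = (\<Sum>j<d. (q j om)\<^sup>2)" unfolding Qv_def by (simp add: sum_nonneg)
  \<comment> \<open>Weighted arithmetic-geometric mean inequality with weight cmin/11. Together with
    the remainder it uses 2/11 of the available 5/11, leaving 3/11.\<close>
  have am: "?T om * Qv <= cmin / 11 * (?T om)\<^sup>2 + 11 / (4 * cmin) * Qv\<^sup>2"
  proof -
   have "0 <= cmin / 11 * (?T om - 11 / (2 * cmin) * Qv)\<^sup>2" using pos_const by simp
   also have "... = cmin / 11 * (?T om)\<^sup>2 - ?T om * Qv + 11 / (4 * cmin) * Qv\<^sup>2"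
   using pos_const by (simp add: power2_diff power_mult_distrib power_divide) (simp add: field_simps power2_eq_square)
   finally show ?thesis by linarith
  qed
  have "3 / 11 * cmin * (?T om)\<^sup>2 <= 11 / (4 * cmin) * Qv\<^sup>2 + \<bar>hU om\<bar>"
   using basic_inequality[OF w tU] Wb am unfolding Qv_def[symmetric] by (simp add: field_simps)
  then have "11 / (3 * cmin) * (3 / 11 * cmin * (?T om)\<^sup>2) <= B om"
   unfolding B_def Q2[symmetric] using pos_const by (intro mult_left_mono) auto
  then have "(?T om)\<^sup>2 <= B om" using pos_const by simp
  then show False using n3 big by linarith
 qed
 have Au: "(\<Union>j<?J. A2 j) \<in> events" using A2(2) by auto
 have "prob {om \<in> space M. L * y < (?T om)\<^sup>2} <= prob (A1 \<union> ((\<Union>j<?J. A2 j) \<union> A3))"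
  using A1 A3 Au by (intro finite_measure_mono incl) auto
 also have "... <= prob A1 + prob ((\<Union>j<?J. A2 j) \<union> A3)" using A1 A3 Au by (intro measure_Un_le) auto
 also have "prob ((\<Union>j<?J. A2 j) \<union> A3) <= prob (\<Union>j<?J. A2 j) + prob A3" using A3 Au by (intro measure_Un_le) auto
 also have "prob (\<Union>j<?J. A2 j) <= (\<Sum>j<?J. prob (A2 j))" using A2(2) by (intro finite_measure_subadditive_finite) auto
 also have "... <= (\<Sum>j<?J. Kc * x / (cmin / 44))" by (intro sum_mono A2)
 also have "... = (real ?J * x) * Kc / (cmin / 44)" by simp
 also have "... <= (2 * sqrt (r0 * sqrt y) + 2 * sqrt y) * Kc / (cmin / 44)"
  using J2 Kc0 pos_const by (intro divide_right_mono mult_right_mono) auto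
 finally show ?thesis using A1(1) A3(1) by linarith
qed

end

theorem theorem2p3:
  fixes m p \<nu> :: "nat \<Rightarrow> nat"
    and M :: "nat \<Rightarrow> 'w measure"
    and Z :: "nat \<Rightarrow> nat \<Rightarrow> 'w \<Rightarrow> point"
    and P :: "nat \<Rightarrow> point measure"
    and f :: "nat \<Rightarrow> kernel"
    and \<Theta> :: "nat \<Rightarrow> point set"
    and \<theta>0 :: "nat \<Rightarrow> point"
    and \<theta>hat :: "nat \<Rightarrow> 'w \<Rightarrow> point"
    and r0 :: real
  assumes dim: "\<And>n. n \<ge> 2 \<Longrightarrow> p n \<ge> 1"
    and M: "\<And>n. n \<ge> 2 \<Longrightarrow> prob_space (M n)"
    and P: "\<And>n. n \<ge> 2 \<Longrightarrow> prob_space (P n)"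
    and P_sets: "\<And>n. n \<ge> 2 \<Longrightarrow> sets (P n) = sets (Rd_borel (m n))"
    and Z_indep: "\<And>n. n \<ge> 2 \<Longrightarrow>
          prob_space.indep_vars (M n) (\<lambda>_. Rd_borel (m n)) (Z n) {1..n}"
    and Z_distr: "\<And>n i. n \<ge> 2 \<Longrightarrow> i \<in> {1..n} \<Longrightarrow> distr (M n) (Rd_borel (m n)) (Z n i) = P n"
    and f_meas: "\<And>n. n \<ge> 2 \<Longrightarrow> (\<lambda>(z1, z2, \<theta>). f n z1 z2 \<theta>) \<in>
          borel_measurable (Rd_borel (m n) \<Otimes>\<^sub>M Rd_borel (m n) \<Otimes>\<^sub>M restrict_space borel (\<Theta> n))"
    and f_VC: "\<And>n. n \<ge> 2 \<Longrightarrow> subgraph_VC_dim (m n) (f n) (\<Theta> n) = enat (\<nu> n)"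
    and f_bounded: "\<exists>C. \<forall>n\<ge>2. \<forall>z1\<in>Rd (m n). \<forall>z2\<in>Rd (m n). \<forall>\<theta>\<in>\<Theta> n. \<bar>f n z1 z2 \<theta>\<bar> \<le> C"
    and theta0: "\<And>n. n \<ge> 2 \<Longrightarrow> is_arg_max (pop_crit n (f n) (M n) (Z n)) (\<lambda>\<theta>. \<theta> \<in> \<Theta> n) (\<theta>0 n)"
    and f_theta0: "\<And>n z1 z2. n \<ge> 2 \<Longrightarrow> z1 \<in> Rd (m n) \<Longrightarrow> z2 \<in> Rd (m n) \<Longrightarrow> f n z1 z2 (\<theta>0 n) = 0"
    and thetahat_meas: "\<And>n. n \<ge> 2 \<Longrightarrow> \<theta>hat n \<in> measurable (M n) (Rd_borel (p n))"
    and thetahat: "\<And>n \<omega>. n \<ge> 2 \<Longrightarrow> \<omega> \<in> space (M n) \<Longrightarrow>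
          is_arg_max (sample_crit n (f n) (\<lambda>i. Z n i \<omega>)) (\<lambda>\<theta>. \<theta> \<in> \<Theta> n) (\<theta>hat n \<omega>)"
    and A1: "A1 p \<Theta> \<theta>0 (\<lambda>n. pop_crit n (f n) (M n) (Z n)) r0"
    and A2: "A2 \<Theta> \<theta>0 (\<lambda>n. pop_crit n (f n) (M n) (Z n)) P f"
    and A3: "A3 m p \<Theta> \<theta>0 P f r0"
    and rate: "(\<lambda>n. real (max (\<nu> n) (p n)) / real n) \<longlonglongrightarrow> 0"
  shows "O_prob M (\<lambda>n \<omega>. (edist (p n) (\<theta>hat n \<omega>) (\<theta>0 n))\<^sup>2)
           (\<lambda>n. real (max (\<nu> n) (p n)) / real n)"
proof -
 obtain C' where C': "!!n z1 z2 \<theta>. n >= 2 ==> z1 \<in> Rd (m n) ==> z2 \<in> Rd (m n) ==> \<theta> \<in> \<Theta> n ==> \<bar>f n z1 z2 \<theta>\<bar> <= C'"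
  using f_bounded by blast
 \<comment> \<open>The maximum with 1 supplies the positivity that the locale demands.\<close>
 define C where "C = max C' 1"
 have r0: "r0 > 0" and compact: "!!n. n >= 2 ==> compactin (Euclidean_space (p n)) (\<Theta> n)"
  and ball: "!!n. n >= 2 ==> eball (p n) (\<theta>0 n) r0 \<subseteq> \<Theta> n"
  using A1 unfolding A1_def by blast+
 have "0 < r0 / 2 \<and> r0 / 2 < r0" using r0 by simp
 then obtain \<xi> where \<xi>: "\<xi> > 0" "!!n. n >= 2 ==> pop_crit n (f n) (M n) (Z n) (\<theta>0 n)
   - (SUP \<theta> \<in> \<Theta> n - open_ball (p n) (\<Theta> n) (\<theta>0 n) (r0 / 2). pop_crit n (f n) (M n) (Z n) \<theta>) >= \<xi>"
  using A1 unfolding A1_def by blast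
 obtain cmin cmax c dmin dmax \<nu>0 l0 where k: "cmin > 0" "\<nu>0 > 0" "l0 > 0"
  and a3: "\<forall>r. 0 < r \<and> r <= r0 --> (\<forall>n\<ge>2. A3_at (m n) (p n) (\<Theta> n) (\<theta>0 n) (P n) (f n) cmin cmax c dmin dmax \<nu>0 l0 r)"
  using A3 unfolding A3_def by blast
 have loc: "m_estimation (M n) n (m n) (p n) (\<nu> n) (Z n) (P n) (f n) (\<Theta> n) (\<theta>0 n) (\<theta>hat n) r0 C cmin cmax c dmin dmax \<nu>0 l0"
  if n: "n >= 2" for n
 proof (rule m_estimation.intro[OF M[OF n]], rule m_estimation_axioms.intro)
  show "\<bar>f n z1 z2 \<theta>\<bar> <= C" if "z1 \<in> Rd (m n)" "z2 \<in> Rd (m n)" "\<theta> \<in> \<Theta> n" for z1 z2 \<theta>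
   using C'[OF n that] by (simp add: C_def)
  show "C > 0" by (simp add: C_def)
  show "A3_at (m n) (p n) (\<Theta> n) (\<theta>0 n) (P n) (f n) cmin cmax c dmin dmax \<nu>0 l0 r0" using a3 r0 n by blast
 qed (fact n dim[OF n] P[OF n] P_sets[OF n] Z_indep[OF n] Z_distr[OF n] f_meas[OF n] f_VC[OF n] theta0[OF n] f_theta0[OF n]
   thetahat_meas[OF n] thetahat[OF n] compact[OF n] r0 ball[OF n] k)+
 define y where "y n = real (max (\<nu> n) (p n)) / real n" for n
 define Kc' where "Kc' = 17 * (3 + \<nu>0\<^sup>2 / 2)"
 define KB' where "KB' = 11 / (3 * cmin) * (11 / (4 * cmin) * dmax + 45696 * C)"
 \<comment> \<open>The part of the deviation bound free of L; it is continuous at 0 and vanishes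
   there.\<close>
 define b where "b t = 3264 * C * sqrt (2 * t) / \<xi> + (2 * sqrt (r0 * sqrt t) + 2 * sqrt t) * Kc' / (cmin / 44)" for t
 have bound: "measure (M n) {om \<in> space (M n). L * y n < (edist (p n) (\<theta>hat n om) (\<theta>0 n))\<^sup>2} <= b (y n) + KB' / L"
  if n: "n >= 2" and small: "sqrt (y n) <= l0" and L: "L >= 1" for n L
 proof -
  interpret m_estimation "M n" n "m n" "p n" "\<nu> n" "Z n" "P n" "f n" "\<Theta> n" "\<theta>0 n" "\<theta>hat n" r0 C cmin cmax c dmin dmax \<nu>0 l0
   by (rule loc[OF n])
  have "I.\<Gamma> \<theta> <= - \<xi>" if \<theta>: "\<theta> \<in> \<Theta> n" "r0 / 2 <= edist (p n) \<theta> (\<theta>0 n)" for \<theta>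
  proof -
   let ?S = "\<Theta> n - open_ball (p n) (\<Theta> n) (\<theta>0 n) (r0 / 2)"
   have "\<theta> \<in> ?S" using \<theta> by (auto simp: open_ball_def)
   \<comment> \<open>Boundedness lets the supremum in (A1) dominate its members.\<close>
   moreover have "bdd_above (pop_crit n (f n) (M n) (Z n) ` ?S)"
   using Gamma_bound pop_crit_eq by (intro bdd_aboveI2[of _ _ C]) (auto simp: abs_le_iff)
   ultimately have "pop_crit n (f n) (M n) (Z n) \<theta> <= (SUP \<theta> \<in> ?S. pop_crit n (f n) (M n) (Z n) \<theta>)" by (rule cSUP_upper)
   then show ?thesis using \<xi>(2)[OF n] pop_crit_eq[OF \<theta>(1)] pop_crit_eq[OF in_\<Theta>(1)] Gamma_theta0 by linarith
  qed
  from deviation_bound[OF \<xi>(1) this y_def small L] show ?thesis by (simp add: b_def Kc_def KB_def Kc'_def KB'_def)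
 qed
 have y: "y \<longlonglongrightarrow> 0" using rate by (simp add: y_def[abs_def])
 have "isCont b 0" unfolding b_def[abs_def] using k \<xi> by (intro continuous_intros) auto
 from isCont_tendsto_compose[OF this y] have b0: "(%n. b (y n)) \<longlonglongrightarrow> 0" by (simp add: b_def)
 have s0: "(%n. sqrt (y n)) \<longlonglongrightarrow> 0" using tendsto_real_sqrt[OF y] by simp
 show ?thesis unfolding O_prob_def y_def[symmetric]
 proof (intro allI impI)
  fix \<epsilon> :: real assume \<epsilon>: "\<epsilon> > 0"
  \<comment> \<open>Half of \<epsilon> is spent on KB' / L, which does not shrink with n; the other
    half is left for b.\<close>
  define L where "L = max 1 (2 * KB' / \<epsilon>)"
  have L: "L >= 1" "KB' / L <= \<epsilon> / 2"
  proof -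
   show 1: "L >= 1" by (simp add: L_def)
   have "2 * KB' / \<epsilon> <= L" by (simp add: L_def)
   then have "KB' <= \<epsilon> / 2 * L" using \<epsilon> by (simp add: field_simps)
   then show "KB' / L <= \<epsilon> / 2" using 1 by (simp add: pos_divide_le_eq)
  qed
  have "\<forall>\<^sub>F n in sequentially. b (y n) < \<epsilon> / 2" using b0 \<epsilon> by (intro order_tendstoD(2)) auto
  moreover have "\<forall>\<^sub>F n in sequentially. sqrt (y n) < l0" using s0 k by (intro order_tendstoD(2)) auto
  ultimately have "\<forall>\<^sub>F n in sequentially. measure (M n) {om \<in> space (M n). \<bar>(edist (p n) (\<theta>hat n om) (\<theta>0 n))\<^sup>2\<bar> > L * y n} <= \<epsilon>"
   using eventually_ge_at_top[of 2]
  proof eventually_elim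
   case (elim n)
   have "measure (M n) {om \<in> space (M n). L * y n < (edist (p n) (\<theta>hat n om) (\<theta>0 n))\<^sup>2} <= b (y n) + KB' / L"
   using elim by (intro bound L) auto
   then have "measure (M n) {om \<in> space (M n). L * y n < (edist (p n) (\<theta>hat n om) (\<theta>0 n))\<^sup>2} <= \<epsilon>" using elim(1) L(2) by linarith
   then show ?case by simp
  qed
  then show "\<exists>L>0. \<exists>N. \<forall>n\<ge>N. measure (M n) {om \<in> space (M n). \<bar>(edist (p n) (\<theta>hat n om) (\<theta>0 n))\<^sup>2\<bar> > L * y n} <= \<epsilon>"
   unfolding eventually_sequentially using L(1) by (intro exI[of _ L]) auto
 qed
qed

end
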